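(* Let $0\to E_1\xrightarrow{\alpha}E_2\xrightarrow{\beta}E_3\to0$ be an admissible triple of complete $C_2$-spaces over a finite field $\mathbb F_q$, $E_m=(I_m,F_m,V_m)$, with associated order-preserving maps $\gamma:I_2\to I_3$, $\beta(F_2(i))=F_3(\gamma(i))$, and $\varepsilon:I_2\to I_1$, $F_2(i)\cap V_1=F_1(\varepsilon(i))$. Let $E_1$ be a $cC_2$-space and $E_3$ a $dC_2$-space. Let $o\in I_2$. Then for any $\mu\in\mu(F_1(\varepsilon(o))\mid V_1)$ and $\nu\in\mu(F_3(\gamma(o))\mid\{0\})$ we have, in $\mathcal D'_{F_2^0(o)}(\check E_2)$, $$\mathbf F(\delta_{E_1,\mu\otimes\nu})=\delta_{\check E_3,\nu\otimes\mu}.$$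
   Context: Fix a finite field $\mathbb F_q$ and a nontrivial character $\psi:\mathbb F_q\to\mathbb C^*$. Vector spaces on which filtrations are considered are over $\mathbb F_q$. **$C_1$-spaces.** A filtered vector space $(I,F,V)$: a vector space $V$, a partially ordered set $I$ such that for all $i,j\in I$ there are $k,l\in I$ with $k\le i\le l$, $k\le j\le l$, and a map $F$ from $I$ to subspaces of $V$ with $F(i)\subset F(j)$ for $i\le j$, $\bigcap F(i)=0$, $\bigcup F(i)=V$. It is a $C_1$-space if all $F(j)/F(i)$, $i\le j$, are finite-dimensional; complete if $V\to\varinjlim_i\varprojlim_{j\le i}F(i)/F(j)$ is an isomorphism. $(I_1,F_1,V)$ dominates $(I_2,F_2,V)$ if there is an order-preserving $\phi:I_2\to I_1$ with $F_1(\phi(i))=F_2(i)$ and for each $j\in I_1$ there are $i_1,i_2\in I_2$ with $\phi(i_1)\le j\le\phi(i_2)$. An admissible triple $0\to E_1\xrightarrow{\alpha}E_2\xrightarrow{\beta}E_3\to0$ of $C_1$-spaces is an exact sequence of the underlying vector spaces such that $(I_1,F_1,V_1)$ dominates $(I_2,F_1',V_1)$ with $F_1'(i)=F_2(i)\cap V_1$, $(I_3,F_3,V_3)$ dominates $(I_2,F_3',V_3)$ with $F_3'(i)=\beta(F_2(i))$, and the induced sequences of quotients $F_1'(j)/F_1'(i)$, $F_2(j)/F_2(i)$, $F_3'(j)/F_3'(i)$ are exact. Dual: $\check E=(I^0,F^0,\check V)$, $\check V=\bigcup F(i)^\perp\subset V^*$, $F^0(i)=F(i)^\perp$, $I^0$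 = $I$ with reversed order. For a $C_1$-space $E=(I,F,V)$: $\mathcal D(E)$ = functions $V\to\mathbb C$ supported in some $F(j)$ and invariant under translations by some $F(i)$; $\mathcal D'(E)=\mathcal D(E)^*$; $\mu(E)\subset\mathcal D'(E)$ = one-dimensional space of translation-invariant elements; $\mu(F(i)):=\mu(\mathbf 1_{F(i)})$. Canonically $\mu(E)\otimes\mu(\check E)=\mathbb C$ for $E$ complete, where $\mu^{-1}(F(i)^\perp)=\mu(F(i))^{-1}$. For an admissible triple $\mu(E_1)\otimes\mu(E_3)=\mu(E_2)$ via $(\mu_1\otimes\mu_3)(F_2(j))=\mu_1(F_2(j)\cap V_1)\mu_3(\beta(F_2(j)))$; $\alpha^*:\mathcal D(E_2)\to\mathcal D(E_1)$ is $f\mapsto f\circ\alpha$; $\beta_*:\mathcal D(E_2)\otimes\mu(E_1)\to\mathcal D(E_3)$ is $\beta_*(f\otimes\mu_1)(w)=\mu_1(v_1\mapsto f(w'+\alpha(v_1)))$, $w'\in\beta^{-1}(w)$; $\alpha_*:\mathcal D'(E_1)\to\mathcal D'(E_2)$ and $\beta^*:\mathcal D'(E_3)\otimes\mu(E_1)\to\mathcal D'(E_2)$ are the conjugate maps. For complete $E$: $\mathbf F_\mu:\mathcal D(E)\to\mathcal D(\check E)$, $\mathbf F_\mu(f)(w)=\mu(v\mapsto f(v)\overline{\psi(w(v))})$; for $\mu\neq0$, $\mathbf F_{\mu^{-1}}:\mathcal D'(E)\to\mathcal D'(\check E)$, $\mathbf F_{\mu^{-1}}(G)(f)=G(\mathbf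 F_{\mu^{-1}}f)$. **$C_2$-spaces.** A $C_2$-space is a filtered vector space $E=(I,F,V)$ together with, for all $i\le j$, a $C_1$-space structure $E_{i,j}$ on $F(j)/F(i)$ such that $0\to E_{i,j}\to E_{i,k}\to E_{j,k}\to0$ is an admissible triple of $C_1$-spaces for all $i\le j\le k$. It is complete if all $E_{i,j}$ are complete and $V=\varinjlim_i\varprojlim_{j\le i}F(i)/F(j)$; a $cC_2$-space if $F(i)=V$ for some $i$; a $dC_2$-space if $F(j)=0$ for some $j$. An admissible triple of $C_2$-spaces $0\to E_1\xrightarrow{\alpha}E_2\xrightarrow{\beta}E_3\to 0$ is an exact sequence of vector spaces such that $(I_1,F_1,V_1)$ dominates $(I_2,F_2(i)\cap V_1,V_1)$, $(I_3,F_3,V_3)$ dominates $(I_2,\beta(F_2(i)),V_3)$ (as filtered spaces), giving order-preserving $\varepsilon:I_2\to I_1$ with $F_2(i)\cap V_1=F_1(\varepsilon(i))$ and $\gamma:I_2\to I_3$ with $\beta(F_2(i))=F_3(\gamma(i))$, and such that $0\to F_1(\varepsilon(j))/F_1(\varepsilon(i))\to F_2(j)/F_2(i)\to F_3(\gamma(j))/F_3(\gamma(i))\to0$ is an admissible triple of $C_1$-spaces for $i\le j\in I_2$. Dual: $\check E=(I^0,F^0,\check V)$ with $\check V=\varinjlim_{j\in I}\varprojlim_{i\ge j}\check E_{j,i}\subset V^*$, $F^0(j)=\varprojlim_{i\ge j}\check E_{j,i}$ (the elements of $\check V$ vanishing on $F(j)$), and for $j\le i$ in $I$ the $C_1$-space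 $F^0(j)/F^0(i)$ is $\check E_{j,i}$. An admissible triple induces an admissible triple $0\to\check E_3\xrightarrow{\check\beta}\check E_2\xrightarrow{\check\alpha}\check E_1\to 0$ with $\check\alpha(F_2^0(i))=F_1^0(\varepsilon(i))$, $F_2^0(i)\cap\check V_3=F_3^0(\gamma(i))$. The dual of a $cC_2$-space is a $dC_2$-space and conversely. **Virtual measures.** $\mu(F(i)\mid F(j))=\varinjlim_{l\le i,\,l\le j}\mathrm{Hom}_{\mathbb C}(\mu(F(i)/F(l)),\mu(F(j)/F(l)))$, a one-dimensional $\mathbb C$-space; for $l'\le l$ the (iso) transition map sends $f$ to $f'(a\otimes c)=f(a)\otimes c$ using $\mu(F(i)/F(l'))=\mu(F(i)/F(l))\otimes\mu(F(l)/F(l'))$ and likewise for $j$. Composition gives canonical isomorphisms $\mu(F(i)\mid F(j))\otimes\mu(F(j)\mid F(l))=\mu(F(i)\mid F(l))$; also $\mu(F(i)\mid F(i))=\mathbb C$, $\mu(F(j)\mid F(i))=\mu(F(i)\mid F(j))^*$ and $\mu(F(i)\mid F(j))=\mu(F(j)/F(i))$ for $i\le j$. Canonically $\mu(F(i)\mid F(j))=\mu(F^0(i)\mid F^0(j))$ (from $\mu(E_{i,j})^*=\mu(\check E_{i,j})$). For an admissible triple, $\mu(F_2(i)\mid F_2(j))=\mu(F_1(\varepsilon(i))\mid F_1(\varepsilon(j)))\otimes\mu(F_3(\gamma(i))\mid F_3(\gamma(j)))$. If $V_1$ (or $\{0\}\subset V_3$) is a member of the filtration, it is used as an argument of $\mu(\cdot\mid\cdot)$.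 **Spaces.** For $o\in I$: $\mathcal D_{F(o)}(E)=\varprojlim_i\varprojlim_l\mathcal D(F(i)/F(l))\otimes\mu(F(l)\mid F(o))$ over $i\ge l$, with transition maps, for $i\ge j\ge l$, the restriction $\mathcal D(F(i)/F(l))\otimes\mu(F(l)\mid F(o))\to\mathcal D(F(j)/F(l))\otimes\mu(F(l)\mid F(o))$ and the pushforward to $\mathcal D(F(i)/F(j))\otimes\mu(F(j)\mid F(o))$ (using $\mu(F(l)\mid F(o))=\mu(F(j)/F(l))\otimes\mu(F(j)\mid F(o))$). $\mathcal D'_{F(o)}(E)=\varinjlim_i\varinjlim_l\mathcal D'(F(i)/F(l))\otimes\mu(F(o)\mid F(l))$ with the conjugate transition maps. The level-wise pairings induce a nondegenerate pairing $\langle\cdot,\cdot\rangle$ between $\mathcal D_{F(o)}(E)$ and $\mathcal D'_{F(o)}(E)$. **Fourier transform** ($E$ complete). $\mathbf F:\mathcal D'_{F(o)}(E)\to\mathcal D'_{F^0(o)}(\check E)$ is the inductive limit of the maps $\mathcal D'(F(i)/F(j))\otimes\mu(F(o)\mid F(j))\to\mathcal D'(F^0(j)/F^0(i))\otimes\mu(F^0(o)\mid F^0(i))$, $G\otimes(\lambda\otimes\rho^{-1})\mapsto\mathbf F_{\rho^{-1}}(G)\otimes\lambda$, where $\lambda\in\mu(F(o)\mid F(i))=\mu(F^0(o)\mid F^0(i))$, $0\ne\rho\in\mu(F(i)/F(j))$, $\rho^{-1}\in\mu(F(i)/F(j))^*=\mu(F(i)\mid F(j))$. **Image map.** If $E_3$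 is a $dC_2$-space, $\alpha^*:\mathcal D_{F_2(o)}(E_2)\otimes\mu(F_3(\gamma(o))\mid\{0\})\to\mathcal D_{F_1(\varepsilon(o))}(E_1)$ is the projective limit, over $i\ge k\ge j$ in $I_2$ where $F_3(\gamma(k))=\{0\}$, of the restriction maps $\mathcal D(F_2(i)/F_2(j))\to\mathcal D(F_1(\varepsilon(i))/F_1(\varepsilon(j)))$ tensored with $\mu(F_1(\varepsilon(j))\mid F_1(\varepsilon(o)))=\mu(F_2(j)\mid F_2(o))\otimes\mu(F_3(\gamma(o))\mid\{0\})$. Its conjugate is $\alpha_*:\mathcal D'_{F_1(\varepsilon(o))}(E_1)\otimes\mu(F_3(\gamma(o))\mid\{0\})\to\mathcal D'_{F_2(o)}(E_2)$, $\langle f,\alpha_*(G\otimes\nu)\rangle=\langle\alpha^*(f\otimes\nu),G\rangle$. **Characteristic functions.** If $E_1$ is a $cC_2$-space and $\mu\in\mu(F_1(\varepsilon(o))\mid V_1)=\mu(V_1/F_1(\varepsilon(o)))\subset\mathcal D'(V_1/F_1(\varepsilon(o)))$, then $\mathbf 1_\mu\in\mathcal D'_{F_1(\varepsilon(o))}(E_1)$ is the class of $\mu\otimes1\in\mathcal D'(V_1/F_1(\varepsilon(o)))\otimes\mu(F_1(\varepsilon(o))\mid F_1(\varepsilon(o)))$. If $E_1$ is a $cC_2$-space and $E_3$ a $dC_2$-space, $\delta_{E_1,\mu\otimes\nu}:=\alpha_*(\mathbf 1_\mu\otimes\nu)\in\mathcal D'_{F_2(o)}(E_2)$ for $\nu\in\mu(F_3(\gamma(o))\mid\{0\})$.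 The element $\delta_{\check E_3,\nu\otimes\mu}=\check\beta_*(\mathbf 1_\nu\otimes\mu)\in\mathcal D'_{F_2^0(o)}(\check E_2)$ is the same construction for the dual triple, where $\nu\in\mu(F_3(\gamma(o))\mid\{0\})=\mu(F_3^0(\gamma(o))\mid\check V_3)$ and $\mu\in\mu(F_1(\varepsilon(o))\mid V_1)=\mu(F_1^0(\varepsilon(o))\mid\{0\})$. *)

theory Defs
  imports Complex_Main "HOL-Library.FuncSet" "HOL-Library.Function_Algebras"
begin

text \<open>
  Every vector space is a subspace \<open>spc\<close> of an ambient type. A function on a subset \<open>V\<close>
  of a type (a linear functional, a test function, a distribution, a map between spaces of
  measures) is always extended by \<open>0\<close> outside \<open>V\<close>, so that equality of functions on \<open>V\<close>
  is equality of terms.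
\<close>

definition cut :: "'a set \<Rightarrow> ('a \<Rightarrow> 'b::zero) \<Rightarrow> 'a \<Rightarrow> 'b" where
  "cut V f = (\<lambda>x. if x \<in> V then f x else 0)"

definition fscale :: "'c::times \<Rightarrow> ('a \<Rightarrow> 'c) \<Rightarrow> 'a \<Rightarrow> 'c" where
  "fscale c f = (\<lambda>x. c * f x)"

definition lin_on ::
  "('k \<Rightarrow> 'a::plus \<Rightarrow> 'a) \<Rightarrow> ('k \<Rightarrow> 'b::plus \<Rightarrow> 'b) \<Rightarrow> 'a set \<Rightarrow> ('a \<Rightarrow> 'b) \<Rightarrow> bool" where
  "lin_on s t V f \<longleftrightarrow>
     (\<forall>x\<in>V. \<forall>y\<in>V. f (x + y) = f x + f y) \<and> (\<forall>c. \<forall>x\<in>V. f (s c x) = t c (f x))"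

definition nontrivial_character :: "('k::field \<Rightarrow> complex) \<Rightarrow> bool" where
  "nontrivial_character \<psi> \<longleftrightarrow>
     (\<forall>x. \<psi> x \<noteq> 0) \<and> (\<forall>x y. \<psi> (x + y) = \<psi> x * \<psi> y) \<and> (\<exists>x. \<psi> x \<noteq> 1)"

text \<open>
  A direct limit is the disjoint union of the terms (tagged by their index) modulo the
  equivalence relation generated by \<open>x \<sim> t x\<close> for the transition maps \<open>t\<close>. In each case
  below \<open>r\<close> is the generating relation and \<open>cls r x\<close> the class of \<open>x\<close>. A map out of a direct
  limit is written as the union of the classes of the images of all representatives.
\<close>

definition cls :: "('a \<Rightarrow> 'a \<Rightarrow> bool) \<Rightarrow> 'a \<Rightarrow> 'a set" where
  "cls r x = {y. equivclp r x y}"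


section \<open>Filtered vector spaces\<close>

record ('k, 'i, 'v) filt =
  idx :: "'i set"
  leq :: "('i \<times> 'i) set"
  fil :: "'i \<Rightarrow> 'v set"
  spc :: "'v set"
  scl :: "'k \<Rightarrow> 'v \<Rightarrow> 'v"

definition filtered_space :: "('k::field, 'i, 'v::ab_group_add, 'z) filt_scheme \<Rightarrow> bool" where
  "filtered_space E \<longleftrightarrow>
     vector_space (scl E) \<and> module.subspace (scl E) (spc E) \<and>
     partial_order_on (idx E) (leq E) \<and>
     (\<forall>i\<in>idx E. \<forall>j\<in>idx E. \<exists>k\<in>idx E. \<exists>l\<in>idx E.
        (k, i) \<in> leq E \<and> (i, l) \<in> leq E \<and> (k, j) \<in> leq E \<and> (j, l) \<in> leq E) \<and>
     (\<forall>i\<in>idx E. module.subspace (scl E) (fil E i)) \<and>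
     (\<forall>i j. (i, j) \<in> leq E \<longrightarrow> fil E i \<subseteq> fil E j) \<and>
     (\<Inter>i\<in>idx E. fil E i) = {0} \<and>
     (\<Union>i\<in>idx E. fil E i) = spc E"

text \<open>
  \<open>fil_lim E i\<close> is the projective limit of the quotients \<open>F(i)/F(j)\<close> (sets of cosets) over
  \<open>j \<le> i\<close>. For \<open>i \<le> i'\<close> the transition map \<open>fil_lim E i \<rightarrow> fil_lim E i'\<close> sends \<open>x\<close> to the
  family \<open>x'\<close> for which \<open>x' j\<close> is the image of \<open>x l\<close> in \<open>F(i')/F(j)\<close> whenever
  \<open>l \<le> i\<close> and \<open>l \<le> j\<close>.
\<close>

definition coset :: "'v::plus set \<Rightarrow> 'v \<Rightarrow> 'v set" where
  "coset S v = (\<lambda>u. v + u) ` S"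

definition fil_lim :: "('k, 'i, 'v::ab_group_add, 'z) filt_scheme \<Rightarrow> 'i \<Rightarrow> ('i \<Rightarrow> 'v set) set" where
  "fil_lim E i =
     {x \<in> \<Pi>\<^sub>E j\<in>{j. (j, i) \<in> leq E}. coset (fil E j) ` fil E i.
        \<forall>j k. (j, k) \<in> leq E \<and> (k, i) \<in> leq E \<longrightarrow> x j \<subseteq> x k}"

inductive compl_rel ::
  "('k, 'i, 'v::ab_group_add, 'z) filt_scheme \<Rightarrow> 'i \<times> ('i \<Rightarrow> 'v set) \<Rightarrow> 'i \<times> ('i \<Rightarrow> 'v set) \<Rightarrow> bool"
  for E where
  "(i, i') \<in> leq E \<Longrightarrow> x \<in> fil_lim E i \<Longrightarrow> x' \<in> fil_lim E i' \<Longrightarrow>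
   \<forall>l j. (l, i) \<in> leq E \<and> (l, j) \<in> leq E \<and> (j, i') \<in> leq E \<longrightarrow> x l \<subseteq> x' j \<Longrightarrow>
   compl_rel E (i, x) (i', x')"

definition completion ::
  "('k, 'i, 'v::ab_group_add, 'z) filt_scheme \<Rightarrow> ('i \<times> ('i \<Rightarrow> 'v set)) set set" where
  "completion E = {cls (compl_rel E) (i, x) | i x. i \<in> idx E \<and> x \<in> fil_lim E i}"

definition to_completion ::
  "('k, 'i, 'v::ab_group_add, 'z) filt_scheme \<Rightarrow> 'v \<Rightarrow> ('i \<times> ('i \<Rightarrow> 'v set)) set" where
  "to_completion E v =
     (\<Union>i\<in>{i \<in> idx E. v \<in> fil E i}.
        cls (compl_rel E) (i, \<lambda>j\<in>{j. (j, i) \<in> leq E}. coset (fil E j) v))"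

definition fil_complete :: "('k, 'i, 'v::ab_group_add, 'z) filt_scheme \<Rightarrow> bool" where
  "fil_complete E \<longleftrightarrow> bij_betw (to_completion E) (spc E) (completion E)"

text \<open>
  \<open>E1\<close> dominates the filtration \<open>(I, F)\<close>, with partial order \<open>r\<close> on \<open>I\<close>, through \<open>\<phi>\<close>.
\<close>

definition dominates_via ::
  "('k, 'i, 'v, 'z) filt_scheme \<Rightarrow> 'j set \<Rightarrow> ('j \<times> 'j) set \<Rightarrow> ('j \<Rightarrow> 'v set) \<Rightarrow> ('j \<Rightarrow> 'i) \<Rightarrow> bool" where
  "dominates_via E1 I r F \<phi> \<longleftrightarrow>
     (\<forall>i\<in>I. \<phi> i \<in> idx E1) \<and>
     (\<forall>i j. (i, j) \<in> r \<longrightarrow> (\<phi> i, \<phi> j) \<in> leq E1) \<and>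
     (\<forall>i\<in>I. fil E1 (\<phi> i) = F i) \<and>
     (\<forall>j\<in>idx E1. \<exists>i1\<in>I. \<exists>i2\<in>I. (\<phi> i1, j) \<in> leq E1 \<and> (j, \<phi> i2) \<in> leq E1)"

definition exact_seq ::
  "('k, 'i1, 'a::ab_group_add, 'z1) filt_scheme \<Rightarrow> ('a \<Rightarrow> 'b) \<Rightarrow>
   ('k, 'i2, 'b::ab_group_add, 'z2) filt_scheme \<Rightarrow> ('b \<Rightarrow> 'c) \<Rightarrow>
   ('k, 'i3, 'c::ab_group_add, 'z3) filt_scheme \<Rightarrow> bool" where
  "exact_seq E1 \<alpha> E2 \<beta> E3 \<longleftrightarrow>
     lin_on (scl E1) (scl E2) (spc E1) \<alpha> \<and> lin_on (scl E2) (scl E3) (spc E2) \<beta> \<and>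
     inj_on \<alpha> (spc E1) \<and> \<alpha> ` spc E1 = {v \<in> spc E2. \<beta> v = 0} \<and> \<beta> ` spc E2 = spc E3"

text \<open>The filtration \<open>F\<^sub>2(i) \<inter> V\<^sub>1\<close>, as subspaces of \<open>V\<^sub>1\<close>.\<close>

definition fil_sub ::
  "('k, 'i1, 'a, 'z1) filt_scheme \<Rightarrow> ('a \<Rightarrow> 'b) \<Rightarrow> ('k, 'i2, 'b, 'z2) filt_scheme \<Rightarrow> 'i2 \<Rightarrow> 'a set" where
  "fil_sub E1 \<alpha> E2 i = {v \<in> spc E1. \<alpha> v \<in> fil E2 i}"


section \<open>\<open>C\<^sub>1\<close>-spaces\<close>

definition c1_space :: "('k::field, 'i, 'v::ab_group_add, 'z) filt_scheme \<Rightarrow> bool" where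
  "c1_space E \<longleftrightarrow> filtered_space E \<and>
     (\<forall>i j. (i, j) \<in> leq E \<longrightarrow>
        (\<exists>B. finite B \<and> B \<subseteq> fil E j \<and> fil E j = module.span (scl E) (fil E i \<union> B)))"

text \<open>
  The last conjunct is exactness of
  \<open>0 \<rightarrow> F\<^sub>1'(j)/F\<^sub>1'(i) \<rightarrow> F\<^sub>2(j)/F\<^sub>2(i) \<rightarrow> F\<^sub>3'(j)/F\<^sub>3'(i) \<rightarrow> 0\<close>, in terms of representatives.
\<close>

definition c1_admissible ::
  "('k::field, 'i1, 'a::ab_group_add) filt \<Rightarrow> ('a \<Rightarrow> 'b) \<Rightarrow>
   ('k, 'i2, 'b::ab_group_add) filt \<Rightarrow> ('b \<Rightarrow> 'c) \<Rightarrow>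
   ('k, 'i3, 'c::ab_group_add) filt \<Rightarrow> bool" where
  "c1_admissible E1 \<alpha> E2 \<beta> E3 \<longleftrightarrow>
     c1_space E1 \<and> c1_space E2 \<and> c1_space E3 \<and> exact_seq E1 \<alpha> E2 \<beta> E3 \<and>
     (\<exists>\<phi>. dominates_via E1 (idx E2) (leq E2) (fil_sub E1 \<alpha> E2) \<phi>) \<and>
     (\<exists>\<phi>. dominates_via E3 (idx E2) (leq E2) (\<lambda>i. \<beta> ` fil E2 i) \<phi>) \<and>
     (\<forall>i j. (i, j) \<in> leq E2 \<longrightarrow>
        (\<forall>v\<in>fil_sub E1 \<alpha> E2 j. \<alpha> v \<in> fil E2 i \<longrightarrow> v \<in> fil_sub E1 \<alpha> E2 i) \<and>
        (\<forall>v\<in>fil E2 j. \<beta> v \<in> \<beta> ` fil E2 i \<longleftrightarrow> (\<exists>u\<in>fil_sub E1 \<alpha> E2 j. v - \<alpha> u \<in> fil E2 i)))"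

definition functionals :: "('k::field, 'i, 'v::ab_group_add, 'z) filt_scheme \<Rightarrow> ('v \<Rightarrow> 'k) set" where
  "functionals E = {w. lin_on (scl E) (*) (spc E) w \<and> (\<forall>x. x \<notin> spc E \<longrightarrow> w x = 0)}"

definition ann :: "('k::field, 'i, 'v::ab_group_add, 'z) filt_scheme \<Rightarrow> 'v set \<Rightarrow> ('v \<Rightarrow> 'k) set" where
  "ann E S = {w \<in> functionals E. \<forall>x\<in>S. w x = 0}"

definition c1_dual :: "('k::field, 'i, 'v::ab_group_add) filt \<Rightarrow> ('k, 'i, 'v \<Rightarrow> 'k) filt" where
  "c1_dual E =
     \<lparr>idx = idx E, leq = (leq E)\<inverse>, fil = (\<lambda>i. ann E (fil E i)),
      spc = (\<Union>i\<in>idx E. ann E (fil E i)), scl = fscale\<rparr>"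

text \<open>
  Composition with \<open>\<alpha>\<close>, as a function on \<open>E1\<close>: the restriction \<open>\<alpha>\<^sup>*\<close> of test functions as
  well as the transpose on linear functionals.
\<close>

definition pull ::
  "('k, 'i, 'a) filt \<Rightarrow> ('a \<Rightarrow> 'b) \<Rightarrow> ('b \<Rightarrow> 'c::zero) \<Rightarrow> 'a \<Rightarrow> 'c" where
  "pull E1 \<alpha> f = cut (spc E1) (\<lambda>x. f (\<alpha> x))"


section \<open>Functions, distributions and measures on \<open>C\<^sub>1\<close>-spaces\<close>

type_synonym 'v dist = "('v \<Rightarrow> complex) \<Rightarrow> complex"

definition test_fun :: "('k, 'i, 'v::ab_group_add) filt \<Rightarrow> ('v \<Rightarrow> complex) set" where
  "test_fun E =
     {f. (\<forall>x. x \<notin> spc E \<longrightarrow> f x = 0) \<and> (\<exists>j\<in>idx E. \<forall>x. x \<notin> fil E j \<longrightarrow> f x = 0) \<and>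
         (\<exists>i\<in>idx E. \<forall>x\<in>spc E. \<forall>u\<in>fil E i. f (x + u) = f x)}"

definition dists :: "('k, 'i, 'v::ab_group_add) filt \<Rightarrow> 'v dist set" where
  "dists E = {G. lin_on fscale (*) (test_fun E) G \<and> (\<forall>f. f \<notin> test_fun E \<longrightarrow> G f = 0)}"

definition meas :: "('k, 'i, 'v::ab_group_add) filt \<Rightarrow> 'v dist set" where
  "meas E = {m \<in> dists E. \<forall>f\<in>test_fun E. \<forall>u\<in>spc E. m (\<lambda>x. f (x + u)) = m f}"

definition ind :: "'v set \<Rightarrow> 'v \<Rightarrow> complex" where
  "ind S = (\<lambda>x. if x \<in> S then 1 else 0)"

text \<open>The measure \<open>1\<close> on a zero space.\<close>

definition unit_meas :: "('k, 'i, 'v::ab_group_add) filt \<Rightarrow> 'v dist" where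
  "unit_meas E = cut (test_fun E) (\<lambda>f. f 0)"

text \<open>The canonical pairing \<open>\<mu>(E) \<otimes> \<mu>(E\<^sup>\<or>) = \<complex>\<close>, and the inverse of a measure with respect to it.\<close>

definition meas_pairing ::
  "('k::field, 'i, 'v::ab_group_add) filt \<Rightarrow> 'v dist \<Rightarrow> ('v \<Rightarrow> 'k) dist \<Rightarrow> complex" where
  "meas_pairing E m n = (THE c. \<forall>i\<in>idx E. c = m (ind (fil E i)) * n (ind (ann E (fil E i))))"

definition meas_inv ::
  "('k::field, 'i, 'v::ab_group_add) filt \<Rightarrow> 'v dist \<Rightarrow> ('v \<Rightarrow> 'k) dist" where
  "meas_inv E m =
     (THE n. n \<in> meas (c1_dual E) \<and>
        (\<forall>i\<in>idx E. n (ind (ann E (fil E i))) = inverse (m (ind (fil E i)))))"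

text \<open>\<open>\<mu>(E\<^sub>1) \<otimes> \<mu>(E\<^sub>3) = \<mu>(E\<^sub>2)\<close>\<close>

definition meas_tensor ::
  "('k, 'i1, 'a::ab_group_add) filt \<Rightarrow> ('a \<Rightarrow> 'b) \<Rightarrow> ('k, 'i2, 'b::ab_group_add) filt \<Rightarrow>
   ('b \<Rightarrow> 'c) \<Rightarrow> ('k, 'i3, 'c::ab_group_add) filt \<Rightarrow> 'a dist \<Rightarrow> 'c dist \<Rightarrow> 'b dist" where
  "meas_tensor E1 \<alpha> E2 \<beta> E3 m1 m3 =
     (THE m. m \<in> meas E2 \<and>
        (\<forall>j\<in>idx E2. m (ind (fil E2 j)) = m1 (ind (fil_sub E1 \<alpha> E2 j)) * m3 (ind (\<beta> ` fil E2 j))))"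

text \<open>\<open>\<alpha>\<^sub>*\<close> on distributions\<close>

definition push_dist ::
  "('k, 'i1, 'a) filt \<Rightarrow> ('a \<Rightarrow> 'b) \<Rightarrow> ('k, 'i2, 'b::ab_group_add) filt \<Rightarrow> 'a dist \<Rightarrow> 'b dist" where
  "push_dist E1 \<alpha> E2 G = cut (test_fun E2) (\<lambda>f. G (pull E1 \<alpha> f))"

text \<open>\<open>\<beta>\<^sub>*\<close> on functions and the conjugate map \<open>\<beta>\<^sup>*\<close> on distributions\<close>

definition fibre_integral ::
  "('k, 'i1, 'a::ab_group_add) filt \<Rightarrow> ('a \<Rightarrow> 'b) \<Rightarrow> ('k, 'i2, 'b::ab_group_add) filt \<Rightarrow>
   ('b \<Rightarrow> 'c) \<Rightarrow> ('k, 'i3, 'c::ab_group_add) filt \<Rightarrow> 'a dist \<Rightarrow> ('b \<Rightarrow> complex) \<Rightarrow> 'c \<Rightarrow> complex" where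
  "fibre_integral E1 \<alpha> E2 \<beta> E3 m f =
     cut (spc E3) (\<lambda>w. m (cut (spc E1) (\<lambda>v. f ((SOME w'. w' \<in> spc E2 \<and> \<beta> w' = w) + \<alpha> v))))"

definition pull_dist ::
  "('k, 'i1, 'a::ab_group_add) filt \<Rightarrow> ('a \<Rightarrow> 'b) \<Rightarrow> ('k, 'i2, 'b::ab_group_add) filt \<Rightarrow>
   ('b \<Rightarrow> 'c) \<Rightarrow> ('k, 'i3, 'c::ab_group_add) filt \<Rightarrow> 'a dist \<Rightarrow> 'c dist \<Rightarrow> 'b dist" where
  "pull_dist E1 \<alpha> E2 \<beta> E3 m G = cut (test_fun E2) (\<lambda>f. G (fibre_integral E1 \<alpha> E2 \<beta> E3 m f))"

definition fourier_fun ::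
  "('k::field \<Rightarrow> complex) \<Rightarrow> ('k, 'i, 'v::ab_group_add) filt \<Rightarrow> 'v dist \<Rightarrow>
   ('v \<Rightarrow> complex) \<Rightarrow> ('v \<Rightarrow> 'k) \<Rightarrow> complex" where
  "fourier_fun \<psi> E m f = cut (spc (c1_dual E)) (\<lambda>w. m (cut (spc E) (\<lambda>v. f v * cnj (\<psi> (w v)))))"

text \<open>The canonical map from \<open>E\<close> to its double dual.\<close>

definition bidual :: "('k::field, 'i, 'v::ab_group_add) filt \<Rightarrow> 'v \<Rightarrow> ('v \<Rightarrow> 'k) \<Rightarrow> 'k" where
  "bidual E v = cut (spc (c1_dual E)) (\<lambda>w. w v)"

text \<open>
  \<open>\<^bold>F\<^bsub>m\<^sup>-\<^sup>1\<^esub> : \<D>'(E) \<rightarrow> \<D>'(E\<^sup>\<or>)\<close> for a nonzero measure \<open>m\<close> on \<open>E\<close>. The Fourier transform of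
  \<open>f \<in> \<D>(E\<^sup>\<or>)\<close> is a function on the double dual and is transported to \<open>E\<close> by \<open>bidual\<close>.
\<close>

definition fourier_dist ::
  "('k::field \<Rightarrow> complex) \<Rightarrow> ('k, 'i, 'v::ab_group_add) filt \<Rightarrow> 'v dist \<Rightarrow> 'v dist \<Rightarrow> ('v \<Rightarrow> 'k) dist" where
  "fourier_dist \<psi> E m G =
     cut (test_fun (c1_dual E))
       (\<lambda>f. G (pull E (bidual E) (fourier_fun \<psi> (c1_dual E) (meas_inv E m) f)))"


section \<open>\<open>C\<^sub>2\<close>-spaces\<close>

text \<open>
  The quotient \<open>F(j)/F(i)\<close>, for \<open>i \<le> j\<close>, is given by a \<open>C\<^sub>1\<close>-space \<open>quo i j\<close> together with a
  linear surjection \<open>qmap i j : F(j) \<rightarrow> quo i j\<close> with kernel \<open>F(i)\<close>. The maps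
  \<open>inc i j k : F(j)/F(i) \<rightarrow> F(k)/F(i)\<close> and \<open>prj i j k : F(k)/F(i) \<rightarrow> F(k)/F(j)\<close>, for
  \<open>i \<le> j \<le> k\<close>, are those induced by the identity, hence determined by \<open>qmap\<close>. They are
  part of the record because \<open>qmap\<close> of a dual space (below) need not be surjective when the
  index set has no countable cofinal subset; there \<open>F\<^sup>0(j)/F\<^sup>0(i)\<close> is by definition the dual of
  \<open>F(i)/F(j)\<close>, and \<open>inc\<close>, \<open>prj\<close> are the transposes of \<open>prj\<close>, \<open>inc\<close>.
\<close>

record ('k, 'i, 'v, 'x, 'w) c2 = "('k, 'i, 'v) filt" +
  quo :: "'i \<Rightarrow> 'i \<Rightarrow> ('k, 'x, 'w) filt"
  qmap :: "'i \<Rightarrow> 'i \<Rightarrow> 'v \<Rightarrow> 'w"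
  inc :: "'i \<Rightarrow> 'i \<Rightarrow> 'i \<Rightarrow> 'w \<Rightarrow> 'w"
  prj :: "'i \<Rightarrow> 'i \<Rightarrow> 'i \<Rightarrow> 'w \<Rightarrow> 'w"

definition c2_space :: "('k::field, 'i, 'v::ab_group_add, 'x, 'w::ab_group_add) c2 \<Rightarrow> bool" where
  "c2_space E \<longleftrightarrow> filtered_space E \<and>
     (\<forall>i j. (i, j) \<in> leq E \<longrightarrow>
        c1_space (quo E i j) \<and>
        lin_on (scl E) (scl (quo E i j)) (fil E j) (qmap E i j) \<and>
        qmap E i j ` fil E j = spc (quo E i j) \<and>
        {v \<in> fil E j. qmap E i j v = 0} = fil E i) \<and>
     (\<forall>i j k. (i, j) \<in> leq E \<and> (j, k) \<in> leq E \<longrightarrow>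
        (\<forall>v\<in>fil E j. inc E i j k (qmap E i j v) = qmap E i k v) \<and>
        (\<forall>v\<in>fil E k. prj E i j k (qmap E i k v) = qmap E j k v) \<and>
        c1_admissible (quo E i j) (inc E i j k) (quo E i k) (prj E i j k) (quo E j k))"

definition c2_complete :: "('k::field, 'i, 'v::ab_group_add, 'x, 'w::ab_group_add) c2 \<Rightarrow> bool" where
  "c2_complete E \<longleftrightarrow>
     (\<forall>i j. (i, j) \<in> leq E \<longrightarrow> fil_complete (quo E i j)) \<and> fil_complete E"

definition cC2_space :: "('k::field, 'i, 'v::ab_group_add, 'x, 'w::ab_group_add) c2 \<Rightarrow> bool" where
  "cC2_space E \<longleftrightarrow> c2_space E \<and> (\<exists>i\<in>idx E. fil E i = spc E)"

definition dC2_space :: "('k::field, 'i, 'v::ab_group_add, 'x, 'w::ab_group_add) c2 \<Rightarrow> bool" where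
  "dC2_space E \<longleftrightarrow> c2_space E \<and> (\<exists>j\<in>idx E. fil E j = {0})"

text \<open>
  \<open>fil_dual E j\<close> is the projective limit over \<open>i \<ge> j\<close> of the duals of \<open>F(i)/F(j)\<close>, each
  compatible family being glued to a functional on \<open>V\<close>.
\<close>

definition fil_dual ::
  "('k::field, 'i, 'v::ab_group_add, 'x, 'w::ab_group_add) c2 \<Rightarrow> 'i \<Rightarrow> ('v \<Rightarrow> 'k) set" where
  "fil_dual E j =
     {w \<in> functionals E. \<forall>i. (j, i) \<in> leq E \<longrightarrow>
        (\<exists>u\<in>spc (c1_dual (quo E j i)). \<forall>v\<in>fil E i. w v = u (qmap E j i v))}"

definition c2_dual ::
  "('k::field, 'i, 'v::ab_group_add, 'x, 'w::ab_group_add) c2 \<Rightarrow> ('k, 'i, 'v \<Rightarrow> 'k, 'x, 'w \<Rightarrow> 'k) c2" where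
  "c2_dual E =
     \<lparr>idx = idx E, leq = (leq E)\<inverse>, fil = fil_dual E, spc = (\<Union>j\<in>idx E. fil_dual E j), scl = fscale,
      quo = (\<lambda>i j. c1_dual (quo E j i)),
      qmap = (\<lambda>i j w. THE u. u \<in> spc (c1_dual (quo E j i)) \<and> (\<forall>v\<in>fil E i. w v = u (qmap E j i v))),
      inc = (\<lambda>i j k. pull (quo E k i) (prj E k j i)),
      prj = (\<lambda>i j k. pull (quo E k j) (inc E k j i))\<rparr>"

text \<open>
  A triple \<open>0 \<rightarrow> E\<^sub>1 \<rightarrow> E\<^sub>2 \<rightarrow> E\<^sub>3 \<rightarrow> 0\<close>. For \<open>i \<le> j\<close> in \<open>I\<^sub>2\<close>, \<open>tri_aq i j\<close> and \<open>tri_bq i j\<close> are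
  the maps \<open>F\<^sub>1(\<epsilon> j)/F\<^sub>1(\<epsilon> i) \<rightarrow> F\<^sub>2(j)/F\<^sub>2(i) \<rightarrow> F\<^sub>3(\<gamma> j)/F\<^sub>3(\<gamma> i)\<close> induced by \<open>\<alpha>\<close> and \<open>\<beta>\<close>.
\<close>

record ('k, 'i1, 'a, 'x1, 'r, 'i2, 'b, 'x2, 's, 'i3, 'c, 'x3, 't) triple =
  tri1 :: "('k, 'i1, 'a, 'x1, 'r) c2"
  tri2 :: "('k, 'i2, 'b, 'x2, 's) c2"
  tri3 :: "('k, 'i3, 'c, 'x3, 't) c2"
  tri_a :: "'a \<Rightarrow> 'b"
  tri_b :: "'b \<Rightarrow> 'c"
  eps :: "'i2 \<Rightarrow> 'i1"
  gam :: "'i2 \<Rightarrow> 'i3"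
  tri_aq :: "'i2 \<Rightarrow> 'i2 \<Rightarrow> 'r \<Rightarrow> 's"
  tri_bq :: "'i2 \<Rightarrow> 'i2 \<Rightarrow> 's \<Rightarrow> 't"

definition c2_admissible ::
  "('k::field, 'i1, 'a::ab_group_add, 'x1, 'r::ab_group_add,
    'i2, 'b::ab_group_add, 'x2, 's::ab_group_add,
    'i3, 'c::ab_group_add, 'x3, 't::ab_group_add) triple \<Rightarrow> bool" where
  "c2_admissible T \<longleftrightarrow>
     c2_space (tri1 T) \<and> c2_space (tri2 T) \<and> c2_space (tri3 T) \<and>
     exact_seq (tri1 T) (tri_a T) (tri2 T) (tri_b T) (tri3 T) \<and>
     dominates_via (tri1 T) (idx (tri2 T)) (leq (tri2 T)) (fil_sub (tri1 T) (tri_a T) (tri2 T)) (eps T) \<and>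
     dominates_via (tri3 T) (idx (tri2 T)) (leq (tri2 T)) (\<lambda>i. tri_b T ` fil (tri2 T) i) (gam T) \<and>
     (\<forall>i j. (i, j) \<in> leq (tri2 T) \<longrightarrow>
        (\<forall>v\<in>fil (tri1 T) (eps T j).
           tri_aq T i j (qmap (tri1 T) (eps T i) (eps T j) v) = qmap (tri2 T) i j (tri_a T v)) \<and>
        (\<forall>v\<in>fil (tri2 T) j.
           tri_bq T i j (qmap (tri2 T) i j v) = qmap (tri3 T) (gam T i) (gam T j) (tri_b T v)) \<and>
        c1_admissible (quo (tri1 T) (eps T i) (eps T j)) (tri_aq T i j) (quo (tri2 T) i j)
          (tri_bq T i j) (quo (tri3 T) (gam T i) (gam T j)))"

definition dual_triple ::
  "('k::field, 'i1, 'a::ab_group_add, 'x1, 'r::ab_group_add,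
    'i2, 'b::ab_group_add, 'x2, 's::ab_group_add,
    'i3, 'c::ab_group_add, 'x3, 't::ab_group_add) triple \<Rightarrow>
   ('k, 'i3, 'c \<Rightarrow> 'k, 'x3, 't \<Rightarrow> 'k,
    'i2, 'b \<Rightarrow> 'k, 'x2, 's \<Rightarrow> 'k,
    'i1, 'a \<Rightarrow> 'k, 'x1, 'r \<Rightarrow> 'k) triple" where
  "dual_triple T =
     \<lparr>tri1 = c2_dual (tri3 T), tri2 = c2_dual (tri2 T), tri3 = c2_dual (tri1 T),
      tri_a = (\<lambda>w. cut (spc (tri2 T)) (\<lambda>v. w (tri_b T v))),
      tri_b = (\<lambda>w. cut (spc (tri1 T)) (\<lambda>v. w (tri_a T v))),
      eps = gam T, gam = eps T,
      tri_aq = (\<lambda>i j. pull (quo (tri2 T) j i) (tri_bq T j i)),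
      tri_bq = (\<lambda>i j. pull (quo (tri1 T) (eps T j) (eps T i)) (tri_aq T j i))\<rparr>"


section \<open>Virtual measures\<close>

text \<open>
  For \<open>a \<in> \<mu>(F(j)/F(i))\<close> and \<open>c \<in> \<mu>(F(k)/F(j))\<close>, \<open>quo_tensor E i j k a c\<close> is their product
  in \<open>\<mu>(F(k)/F(i))\<close>.
\<close>

definition quo_tensor ::
  "('k, 'i, 'v, 'x, 'w::ab_group_add) c2 \<Rightarrow> 'i \<Rightarrow> 'i \<Rightarrow> 'i \<Rightarrow> 'w dist \<Rightarrow> 'w dist \<Rightarrow> 'w dist" where
  "quo_tensor E i j k =
     meas_tensor (quo E i j) (inc E i j k) (quo E i k) (prj E i j k) (quo E j k)"

definition chom :: "'v dist set \<Rightarrow> 'w dist set \<Rightarrow> ('v dist \<Rightarrow> 'w dist) set" where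
  "chom X Y =
     {f. (\<forall>x\<in>X. f x \<in> Y) \<and> lin_on fscale fscale X f \<and> (\<forall>x. x \<notin> X \<longrightarrow> f x = 0)}"

type_synonym ('i, 'w) vmeas = "('i \<times> ('w dist \<Rightarrow> 'w dist)) set"

text \<open>
  \<open>vmeas E i j\<close> is \<open>\<mu>(F(i) | F(j))\<close>, the direct limit of
  \<open>vlevel E i j l = Hom(\<mu>(F(i)/F(l)), \<mu>(F(j)/F(l)))\<close>.
\<close>

definition vlevel ::
  "('k, 'i, 'v, 'x, 'w::ab_group_add) c2 \<Rightarrow> 'i \<Rightarrow> 'i \<Rightarrow> 'i \<Rightarrow> ('w dist \<Rightarrow> 'w dist) set" where
  "vlevel E i j l = chom (meas (quo E l i)) (meas (quo E l j))"

inductive vrel ::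
  "('k, 'i, 'v, 'x, 'w::ab_group_add) c2 \<Rightarrow> 'i \<Rightarrow> 'i \<Rightarrow>
   'i \<times> ('w dist \<Rightarrow> 'w dist) \<Rightarrow> 'i \<times> ('w dist \<Rightarrow> 'w dist) \<Rightarrow> bool"
  for E i j where
  "(l', l) \<in> leq E \<Longrightarrow> (l, i) \<in> leq E \<Longrightarrow> (l, j) \<in> leq E \<Longrightarrow>
   f \<in> vlevel E i j l \<Longrightarrow> f' \<in> vlevel E i j l' \<Longrightarrow>
   \<forall>c\<in>meas (quo E l' l). \<forall>a\<in>meas (quo E l i).
     f' (quo_tensor E l' l i c a) = quo_tensor E l' l j c (f a) \<Longrightarrow>
   vrel E i j (l, f) (l', f')"

definition vmeas ::
  "('k, 'i, 'v, 'x, 'w::ab_group_add) c2 \<Rightarrow> 'i \<Rightarrow> 'i \<Rightarrow> ('i, 'w) vmeas set" where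
  "vmeas E i j =
     {cls (vrel E i j) (l, f) | l f. (l, i) \<in> leq E \<and> (l, j) \<in> leq E \<and> f \<in> vlevel E i j l}"

definition vscale ::
  "('k, 'i, 'v, 'x, 'w::ab_group_add) c2 \<Rightarrow> 'i \<Rightarrow> 'i \<Rightarrow> complex \<Rightarrow> ('i, 'w) vmeas \<Rightarrow> ('i, 'w) vmeas" where
  "vscale E i j c A = (\<Union>(l, f)\<in>A. cls (vrel E i j) (l, \<lambda>a. fscale c (f a)))"

text \<open>\<open>\<mu>(F(i) | F(j)) \<otimes> \<mu>(F(j) | F(k)) = \<mu>(F(i) | F(k))\<close>\<close>

definition vcomp ::
  "('k, 'i, 'v, 'x, 'w::ab_group_add) c2 \<Rightarrow> 'i \<Rightarrow> 'i \<Rightarrow> 'i \<Rightarrow>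
   ('i, 'w) vmeas \<Rightarrow> ('i, 'w) vmeas \<Rightarrow> ('i, 'w) vmeas" where
  "vcomp E i j k A B = \<Union>{cls (vrel E i k) (l, g \<circ> f) | l f g. (l, f) \<in> A \<and> (l, g) \<in> B}"

text \<open>\<open>1 \<in> \<complex> = \<mu>(F(i) | F(i))\<close>\<close>

definition vone :: "('k, 'i, 'v, 'x, 'w::ab_group_add) c2 \<Rightarrow> 'i \<Rightarrow> ('i, 'w) vmeas" where
  "vone E i = cls (vrel E i i) (i, cut (meas (quo E i i)) id)"

text \<open>For \<open>i \<le> j\<close>: the image of \<open>m \<in> \<mu>(F(j)/F(i))\<close> in \<open>\<mu>(F(i) | F(j))\<close>.\<close>

definition vof ::
  "('k, 'i, 'v, 'x, 'w::ab_group_add) c2 \<Rightarrow> 'i \<Rightarrow> 'i \<Rightarrow> 'w dist \<Rightarrow> ('i, 'w) vmeas" where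
  "vof E i j m =
     cls (vrel E i j) (i, THE f. f \<in> vlevel E i j i \<and> f (unit_meas (quo E i i)) = m)"

text \<open>
  For \<open>i \<le> j\<close>: the element \<open>m\<^sup>-\<^sup>1\<close> of \<open>\<mu>(F(j)/F(i))\<^sup>* = \<mu>(F(j) | F(i))\<close>, for
  \<open>0 \<noteq> m \<in> \<mu>(F(j)/F(i))\<close>; more generally, \<open>vfunctional E i j p\<close> is the element given by the
  linear form \<open>p\<close> on \<open>\<mu>(F(j)/F(i))\<close>.
\<close>

definition vinv ::
  "('k, 'i, 'v, 'x, 'w::ab_group_add) c2 \<Rightarrow> 'i \<Rightarrow> 'i \<Rightarrow> 'w dist \<Rightarrow> ('i, 'w) vmeas" where
  "vinv E i j m =
     cls (vrel E j i) (i, THE f. f \<in> vlevel E j i i \<and> f m = unit_meas (quo E i i))"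

definition vfunctional ::
  "('k, 'i, 'v, 'x, 'w::ab_group_add) c2 \<Rightarrow> 'i \<Rightarrow> 'i \<Rightarrow> ('w dist \<Rightarrow> complex) \<Rightarrow> ('i, 'w) vmeas" where
  "vfunctional E i j p =
     cls (vrel E j i) (i, cut (meas (quo E i j)) (\<lambda>n. fscale (p n) (unit_meas (quo E i i))))"

text \<open>
  If \<open>F(d) = F(d') = {0}\<close>, the arguments \<open>F(d)\<close> and \<open>F(d')\<close> of \<open>\<mu>(\<cdot> | \<cdot>)\<close> are identified by
  the canonical generator of \<open>\<mu>(F(d) | F(d'))\<close>.
\<close>

definition vzero ::
  "('k, 'i, 'v, 'x, 'w::ab_group_add) c2 \<Rightarrow> 'i \<Rightarrow> 'i \<Rightarrow> ('i, 'w) vmeas" where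
  "vzero E d d' =
     \<Union>{cls (vrel E d d') (l, f) | l f. (l, d) \<in> leq E \<and> (l, d') \<in> leq E \<and> f \<in> vlevel E d d' l \<and>
         f (unit_meas (quo E l d)) = unit_meas (quo E l d')}"

text \<open>
  \<open>\<mu>(F(i) | F(j)) = \<mu>(F\<^sup>0(i) | F\<^sup>0(j))\<close>. For \<open>l \<le> i, j\<close>, an element \<open>a\<^sup>-\<^sup>1 \<otimes> b\<close> of
  \<open>\<mu>(F(i)/F(l))\<^sup>* \<otimes> \<mu>(F(j)/F(l))\<close> goes to the product of \<open>a\<^sup>-\<^sup>1\<close>, a measure on the dual
  \<open>F\<^sup>0(l)/F\<^sup>0(i)\<close> of \<open>F(i)/F(l)\<close>, and \<open>b\<close>, a linear form on the measures of the dual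
  \<open>F\<^sup>0(l)/F\<^sup>0(j)\<close> of \<open>F(j)/F(l)\<close>.
\<close>

definition vdual ::
  "('k::field, 'i, 'v::ab_group_add, 'x, 'w::ab_group_add) c2 \<Rightarrow> 'i \<Rightarrow> 'i \<Rightarrow>
   ('i, 'w) vmeas \<Rightarrow> ('i, 'w \<Rightarrow> 'k) vmeas" where
  "vdual E i j A =
     \<Union>{vcomp (c2_dual E) i l j
          (vof (c2_dual E) i l (meas_inv (quo E l i) a))
          (vfunctional (c2_dual E) j l (meas_pairing (quo E l j) (f a)))
        | l f a. (l, f) \<in> A \<and> a \<in> meas (quo E l i) \<and> a \<noteq> 0}"

text \<open>
  \<open>\<mu>(F\<^sub>1(\<epsilon> i) | F\<^sub>1(\<epsilon> j)) \<otimes> \<mu>(F\<^sub>3(\<gamma> i) | F\<^sub>3(\<gamma> j)) = \<mu>(F\<^sub>2(i) | F\<^sub>2(j))\<close>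
\<close>

definition tri_tensor ::
  "('k, 'i1, 'a, 'x1, 'r::ab_group_add, 'i2, 'b, 'x2, 's::ab_group_add,
    'i3, 'c, 'x3, 't::ab_group_add) triple \<Rightarrow> 'i2 \<Rightarrow> 'i2 \<Rightarrow> 'r dist \<Rightarrow> 't dist \<Rightarrow> 's dist" where
  "tri_tensor T i j =
     meas_tensor (quo (tri1 T) (eps T i) (eps T j)) (tri_aq T i j) (quo (tri2 T) i j)
       (tri_bq T i j) (quo (tri3 T) (gam T i) (gam T j))"

definition vtensor ::
  "('k, 'i1, 'a, 'x1, 'r::ab_group_add, 'i2, 'b, 'x2, 's::ab_group_add,
    'i3, 'c, 'x3, 't::ab_group_add) triple \<Rightarrow> 'i2 \<Rightarrow> 'i2 \<Rightarrow>
   ('i1, 'r) vmeas \<Rightarrow> ('i3, 't) vmeas \<Rightarrow> ('i2, 's) vmeas" where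
  "vtensor T i j A C =
     \<Union>{cls (vrel (tri2 T) i j) (l, g) | l g f h.
         (l, i) \<in> leq (tri2 T) \<and> (l, j) \<in> leq (tri2 T) \<and> g \<in> vlevel (tri2 T) i j l \<and>
         (eps T l, f) \<in> A \<and> (gam T l, h) \<in> C \<and>
         (\<forall>a\<in>meas (quo (tri1 T) (eps T l) (eps T i)). \<forall>c\<in>meas (quo (tri3 T) (gam T l) (gam T i)).
            g (tri_tensor T l i a c) = tri_tensor T l j (f a) (h c))}"


section \<open>Distributions on \<open>C\<^sub>2\<close>-spaces\<close>

text \<open>
  \<open>dist_space E b\<close> is \<open>\<D>'\<^bsub>F(b)\<^esub>(E)\<close>. The quadruple \<open>(i, l, G, \<theta>)\<close>, \<open>l \<le> i\<close>, stands for
  \<open>G \<otimes> \<theta> \<in> \<D>'(F(i)/F(l)) \<otimes> \<mu>(F(b) | F(l))\<close>; since the second factor is one-dimensional, every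
  tensor has this form, and equality of tensors is generated by \<open>c G \<otimes> \<theta> = G \<otimes> c \<theta>\<close>.
  The other two rules are the transition maps conjugate to the restriction from \<open>F(i)/F(l)\<close>
  to \<open>F(j)/F(l)\<close> and to the pushforward from \<open>F(i)/F(l)\<close> to \<open>F(i)/F(j)\<close>; in the latter
  \<open>\<theta> = (\<theta> \<otimes> \<rho>\<^sup>-\<^sup>1) \<otimes> \<rho>\<close> for any \<open>0 \<noteq> \<rho> \<in> \<mu>(F(j)/F(l))\<close>.
\<close>

type_synonym ('i, 'w) dlevel = "'i \<times> 'i \<times> 'w dist \<times> ('i, 'w) vmeas"

inductive drel ::
  "('k, 'i, 'v, 'x, 'w::ab_group_add) c2 \<Rightarrow> 'i \<Rightarrow> ('i, 'w) dlevel \<Rightarrow> ('i, 'w) dlevel \<Rightarrow> bool"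
  for E b where
  scale: "(l, i) \<in> leq E \<Longrightarrow> G \<in> dists (quo E l i) \<Longrightarrow> \<theta> \<in> vmeas E b l \<Longrightarrow>
     drel E b (i, l, fscale c G, \<theta>) (i, l, G, vscale E b l c \<theta>)"
| push: "(l, j) \<in> leq E \<Longrightarrow> (j, i) \<in> leq E \<Longrightarrow> G \<in> dists (quo E l j) \<Longrightarrow> \<theta> \<in> vmeas E b l \<Longrightarrow>
     drel E b (j, l, G, \<theta>) (i, l, push_dist (quo E l j) (inc E l j i) (quo E l i) G, \<theta>)"
| pull: "(l, j) \<in> leq E \<Longrightarrow> (j, i) \<in> leq E \<Longrightarrow> G \<in> dists (quo E j i) \<Longrightarrow> \<theta> \<in> vmeas E b j \<Longrightarrow>
     \<rho> \<in> meas (quo E l j) \<Longrightarrow> \<rho> \<noteq> 0 \<Longrightarrow>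
     drel E b (i, j, G, \<theta>)
       (i, l, pull_dist (quo E l j) (inc E l j i) (quo E l i) (prj E l j i) (quo E j i) \<rho> G,
        vcomp E b j l \<theta> (vinv E l j \<rho>))"

definition dist_space ::
  "('k, 'i, 'v, 'x, 'w::ab_group_add) c2 \<Rightarrow> 'i \<Rightarrow> ('i, 'w) dlevel set set" where
  "dist_space E b =
     {cls (drel E b) (i, l, G, \<theta>) | i l G \<theta>.
        (l, i) \<in> leq E \<and> G \<in> dists (quo E l i) \<and> \<theta> \<in> vmeas E b l}"

definition fourier ::
  "('k::field \<Rightarrow> complex) \<Rightarrow> ('k, 'i, 'v::ab_group_add, 'x, 'w::ab_group_add) c2 \<Rightarrow> 'i \<Rightarrow>
   ('i, 'w) dlevel set \<Rightarrow> ('i, 'w \<Rightarrow> 'k) dlevel set" where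
  "fourier \<psi> E b X =
     \<Union>{cls (drel (c2_dual E) b) (j, i, fourier_dist \<psi> (quo E j i) \<rho> G, vdual E b i \<theta>)
        | i j G \<kappa> \<rho> \<theta>. (i, j, G, \<kappa>) \<in> X \<and> \<rho> \<in> meas (quo E j i) \<and> \<rho> \<noteq> 0 \<and>
            \<theta> \<in> vmeas E b i \<and> \<kappa> = vcomp E b i j \<theta> (vinv E j i \<rho>)}"

text \<open>
  The map \<open>\<alpha>\<^sub>*\<close>, \<open>X \<otimes> \<nu> \<mapsto> \<alpha>\<^sub>*(X \<otimes> \<nu>)\<close>, for \<open>\<nu> \<in> \<mu>(F\<^sub>3(\<gamma> b) | F\<^sub>3(d))\<close> with \<open>F\<^sub>3(d) = {0}\<close>: the
  direct limit of the maps conjugate to the restrictions of functions from \<open>F\<^sub>2(i)/F\<^sub>2(j)\<close> to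
  \<open>F\<^sub>1(\<epsilon> i)/F\<^sub>1(\<epsilon> j)\<close>, where \<open>j \<le> k \<le> i\<close> and \<open>F\<^sub>3(\<gamma> k) = {0}\<close>.
\<close>

definition image_map ::
  "('k, 'i1, 'a, 'x1, 'r::ab_group_add, 'i2, 'b, 'x2, 's::ab_group_add,
    'i3, 'c::zero, 'x3, 't::ab_group_add) triple \<Rightarrow> 'i2 \<Rightarrow> 'i3 \<Rightarrow>
   ('i1, 'r) dlevel set \<Rightarrow> ('i3, 't) vmeas \<Rightarrow> ('i2, 's) dlevel set" where
  "image_map T b d X \<nu> =
     \<Union>{cls (drel (tri2 T) b)
          (i, j, push_dist (quo (tri1 T) (eps T j) (eps T i)) (tri_aq T j i) (quo (tri2 T) j i) G,
           vtensor T b j \<theta> (vcomp (tri3 T) (gam T b) d (gam T j) \<nu> (vzero (tri3 T) d (gam T j))))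
        | i j k G \<theta>. (j, k) \<in> leq (tri2 T) \<and> (k, i) \<in> leq (tri2 T) \<and>
            fil (tri3 T) (gam T k) = {0} \<and> (eps T i, eps T j, G, \<theta>) \<in> X}"

text \<open>
  \<open>\<^bold>1\<^sub>\<mu>\<close> in \<open>\<D>'\<^bsub>F(b)\<^esub>(E)\<close> for \<open>\<mu> \<in> \<mu>(F(b) | F(c))\<close>, \<open>F(c) = V\<close>, \<open>b \<le> c\<close>. The representative of
  \<open>\<mu>\<close> at level \<open>b\<close> is a map \<open>\<complex> = \<mu>(F(b)/F(b)) \<rightarrow> \<mu>(F(c)/F(b))\<close>, whose value at \<open>1\<close> is \<open>\<mu>\<close> as a
  measure on \<open>F(c)/F(b)\<close>.
\<close>

definition char_dist ::
  "('k, 'i, 'v, 'x, 'w::ab_group_add) c2 \<Rightarrow> 'i \<Rightarrow> 'i \<Rightarrow> ('i, 'w) vmeas \<Rightarrow> ('i, 'w) dlevel set" where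
  "char_dist E b c \<mu> =
     \<Union>{cls (drel E b) (c, b, f (unit_meas (quo E b b)), vone E b) | f. (b, f) \<in> \<mu>}"

definition delta ::
  "('k, 'i1, 'a, 'x1, 'r::ab_group_add, 'i2, 'b, 'x2, 's::ab_group_add,
    'i3, 'c::zero, 'x3, 't::ab_group_add) triple \<Rightarrow> 'i2 \<Rightarrow> 'i1 \<Rightarrow> 'i3 \<Rightarrow>
   ('i1, 'r) vmeas \<Rightarrow> ('i3, 't) vmeas \<Rightarrow> ('i2, 's) dlevel set" where
  "delta T b c d \<mu> \<nu> = image_map T b d (char_dist (tri1 T) (eps T b) c \<mu>) \<nu>"

end

theory Submission
  imports Defs
begin

text \<open>
  At a level \<open>j \<le> b \<le> i\<close> with \<open>F\<^sub>3(\<gamma> j) = {0}\<close> and \<open>F\<^sub>1(\<epsilon> i) = V\<^sub>1\<close>, the distribution \<open>\<delta>\<close> is the direct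
  image \<open>\<alpha>\<^sub>* m\<^sub>1\<close> of an invariant measure on \<open>F\<^sub>1(\<epsilon> i)/F\<^sub>1(\<epsilon> j)\<close>, and its Fourier transform with respect to
  \<open>(m\<^sub>1 \<otimes> m\<^sub>3)\<^sup>-\<^sup>1\<close> is the direct image of \<open>m\<^sub>3\<^sup>-\<^sup>1\<close> under the transpose of \<open>\<beta>\<close>: this is the Poisson formula for an
  admissible triple of \<open>C\<^sub>1\<close>-spaces, which follows from Fubini and Fourier inversion at \<open>0\<close>.

  To compare the virtual measures on both sides, choose bases \<open>e(i,j)\<close> of all lines \<open>\<mu>(F(j)/F(i))\<close> with
  \<open>e(i,j) \<otimes> e(j,k) = e(i,k)\<close>. In these coordinates composition, duality and the tensor product of virtual
  measures become multiplication of numbers. That products of such bases of \<open>E\<^sub>1\<close> and \<open>E\<^sub>3\<close> are again such a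
  basis of \<open>E\<^sub>2\<close> is the three-by-three lemma for measures.
\<close>

text \<open>A map out of a direct limit is written as a union over all representatives, so it is not
  clear beforehand that \<open>fourier\<close>, \<open>image_map\<close> or \<open>vtensor\<close>
  yields a single class. Coordinates settle this: that of a virtual measure does not depend on the
  level, and a class in \<open>dist_space\<close> becomes a distribution with a number, compared at
  a common further level. A second obstacle is that the dual of a \<open>c2_space\<close> may fail
  to be one, since a functional on a quotient may fail to extend to V. Hence the arguments run over
  \<open>c2sys\<close> and \<open>tsys\<close>, which mention only quotients and are closed under
  duality, so that both sides of the theorem are instances of \<open>delta_dc\<close>. There the
  freedom in \<open>c\<close>, \<open>d\<close> and the level appears as ratios between e and the
  unit measure of a zero quotient. Dualising inverts these ratios and exchanges numerator and
  denominator, so the two numbers agree. The nontrivial character enters through orthogonality,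
  which also shows that F(j)/F(i) and its dual have equally many elements, as the existence of the
  inverse measure requires.\<close>

lemma cut_in [simp]: "x \<in> V \<Longrightarrow> cut V f x = f x"
  by (simp add: cut_def)

lemma cut_out [simp]: "x \<notin> V \<Longrightarrow> cut V f x = 0"
  by (simp add: cut_def)

lemma fscale_apply [simp]: "fscale c f x = c * f x"
  by (simp add: fscale_def)

lemma fscale_fscale [simp]: "fscale c (fscale d f) = fscale (c * d) (f :: 'a \<Rightarrow> 'b::semigroup_mult)"
  by (simp add: fscale_def mult.assoc)

lemma fscale_one [simp]: "fscale 1 f = (f :: 'a \<Rightarrow> 'b::monoid_mult)"
  by (simp add: fscale_def)

lemma fscale_zero [simp]: "fscale 0 f = (0 :: 'a \<Rightarrow> 'b::mult_zero)"
  by (simp add: fscale_def zero_fun_def)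

lemma fscale_cancel:
  fixes f :: "'a \<Rightarrow> complex"
  assumes "fscale s f = fscale t f" "f \<noteq> 0"
  shows "s = t"
proof -
  obtain x where "f x \<noteq> 0"
    using assms(2) by (auto simp: fun_eq_iff)
  then show ?thesis
    using fun_cong[OF assms(1), of x] by simp
qed

lemma fscale_eq_0: "fscale s f = 0 \<longleftrightarrow> s = 0 \<or> (f :: 'a \<Rightarrow> complex) = 0"
  by (auto simp: fun_eq_iff)

section \<open>Filtered spaces\<close>

lemma filtered_vs: "filtered_space E \<Longrightarrow> vector_space (scl E)"
  by (simp add: filtered_space_def)

lemma filtered_module: "filtered_space E \<Longrightarrow> module (scl E)"
  by (simp add: filtered_space_def module_iff_vector_space)

lemma
  assumes "filtered_space E"
  shows spc_subspace: "module.subspace (scl E) (spc E)"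
    and fil_subspace: "i \<in> idx E \<Longrightarrow> module.subspace (scl E) (fil E i)"
    and fil_mono: "(i, j) \<in> leq E \<Longrightarrow> fil E i \<subseteq> fil E j"
    and fil_Union: "(\<Union>i\<in>idx E. fil E i) = spc E"
    and leq_order: "partial_order_on (idx E) (leq E)"
  using assms by (simp_all add: filtered_space_def)

lemma
  assumes "filtered_space E"
  shows leq_idx: "(i, j) \<in> leq E \<Longrightarrow> i \<in> idx E \<and> j \<in> idx E"
    and leq_refl: "i \<in> idx E \<Longrightarrow> (i, i) \<in> leq E"
    and leq_trans: "(i, j) \<in> leq E \<Longrightarrow> (j, k) \<in> leq E \<Longrightarrow> (i, k) \<in> leq E"
  using leq_order[OF assms] unfolding partial_order_on_def preorder_on_def refl_on_def
  by (auto elim: transD)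

lemma fil_directed:
  assumes "filtered_space E" "i \<in> idx E" "j \<in> idx E"
  shows "\<exists>k\<in>idx E. \<exists>l\<in>idx E. (k, i) \<in> leq E \<and> (i, l) \<in> leq E \<and> (k, j) \<in> leq E \<and> (j, l) \<in> leq E"
  using assms by (simp add: filtered_space_def)

lemma
  assumes "filtered_space E" "i \<in> idx E" "j \<in> idx E"
  shows fil_below: "\<exists>k\<in>idx E. (k, i) \<in> leq E \<and> (k, j) \<in> leq E"
    and fil_above: "\<exists>l\<in>idx E. (i, l) \<in> leq E \<and> (j, l) \<in> leq E"
  using fil_directed[OF assms] by blast+

lemma
  assumes "filtered_space E"
  shows spc_0: "0 \<in> spc E"
    and spc_add: "x \<in> spc E \<Longrightarrow> y \<in> spc E \<Longrightarrow> x + y \<in> spc E"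
    and spc_diff: "x \<in> spc E \<Longrightarrow> y \<in> spc E \<Longrightarrow> x - y \<in> spc E"
    and spc_scl: "x \<in> spc E \<Longrightarrow> scl E c x \<in> spc E"
proof -
  interpret module "scl E" by (rule filtered_module[OF assms])
  note s = spc_subspace[OF assms]
  show "0 \<in> spc E" by (rule subspace_0[OF s])
  show "x \<in> spc E \<Longrightarrow> y \<in> spc E \<Longrightarrow> x + y \<in> spc E" by (rule subspace_add[OF s])
  show "x \<in> spc E \<Longrightarrow> y \<in> spc E \<Longrightarrow> x - y \<in> spc E" by (rule subspace_diff[OF s])
  show "x \<in> spc E \<Longrightarrow> scl E c x \<in> spc E" by (rule subspace_scale[OF s])
qed

lemma
  assumes "filtered_space E" "i \<in> idx E"
  shows fil_0: "0 \<in> fil E i"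
    and fil_add: "x \<in> fil E i \<Longrightarrow> y \<in> fil E i \<Longrightarrow> x + y \<in> fil E i"
    and fil_diff: "x \<in> fil E i \<Longrightarrow> y \<in> fil E i \<Longrightarrow> x - y \<in> fil E i"
    and fil_neg: "x \<in> fil E i \<Longrightarrow> - x \<in> fil E i"
    and fil_scl: "x \<in> fil E i \<Longrightarrow> scl E c x \<in> fil E i"
    and fil_spc: "x \<in> fil E i \<Longrightarrow> x \<in> spc E"
proof -
  interpret module "scl E" by (rule filtered_module[OF assms(1)])
  note s = fil_subspace[OF assms]
  show "0 \<in> fil E i" by (rule subspace_0[OF s])
  show "x \<in> fil E i \<Longrightarrow> y \<in> fil E i \<Longrightarrow> x + y \<in> fil E i" by (rule subspace_add[OF s])
  show "x \<in> fil E i \<Longrightarrow> y \<in> fil E i \<Longrightarrow> x - y \<in> fil E i" by (rule subspace_diff[OF s])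
  show "x \<in> fil E i \<Longrightarrow> - x \<in> fil E i" by (rule subspace_neg[OF s])
  show "x \<in> fil E i \<Longrightarrow> scl E c x \<in> fil E i" by (rule subspace_scale[OF s])
  show "x \<in> fil E i \<Longrightarrow> x \<in> spc E" using fil_Union[OF assms(1)] assms(2) by blast
qed

lemma spc_fil: "filtered_space E \<Longrightarrow> x \<in> spc E \<Longrightarrow> \<exists>i\<in>idx E. x \<in> fil E i"
  using fil_Union by blast

lemma spc_add_iff:
  assumes "filtered_space E" "u \<in> spc E"
  shows "x + u \<in> spc E \<longleftrightarrow> x \<in> spc E"
  using spc_add[OF assms(1), of x u] spc_diff[OF assms(1), of "x + u" u] assms(2) by auto

lemma idx_nonempty: "filtered_space E \<Longrightarrow> \<exists>i. i \<in> idx E"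
  using spc_fil spc_0 by blast

lemma c1_fs: "c1_space E \<Longrightarrow> filtered_space E"
  by (simp add: c1_space_def)

section \<open>Transversals\<close>

text \<open>Counting cosets uses only the additive group, so scalars are dropped.\<close>

definition additive_subgroup :: "'v::ab_group_add set \<Rightarrow> bool" where
  "additive_subgroup A \<longleftrightarrow> 0 \<in> A \<and> (\<forall>x\<in>A. \<forall>y\<in>A. x - y \<in> A)"

lemma
  assumes "additive_subgroup A"
  shows sg_0: "0 \<in> A"
    and sg_diff: "x \<in> A \<Longrightarrow> y \<in> A \<Longrightarrow> x - y \<in> A"
    and sg_add: "x \<in> A \<Longrightarrow> y \<in> A \<Longrightarrow> x + y \<in> A"
proof -
  show *: "0 \<in> A" and **: "x \<in> A \<Longrightarrow> y \<in> A \<Longrightarrow> x - y \<in> A" for x y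
    using assms by (auto simp: additive_subgroup_def)
  show "x \<in> A \<Longrightarrow> y \<in> A \<Longrightarrow> x + y \<in> A" for x y
    using **[of x "- y"] **[of 0 y] * by simp
qed

lemma fil_subgroup: "filtered_space E \<Longrightarrow> i \<in> idx E \<Longrightarrow> additive_subgroup (fil E i)"
  by (simp add: additive_subgroup_def fil_0 fil_diff)

text \<open>The finite quotient A/B is represented by a set of coset representatives, so that
  integrals become finite sums and the index [A:B] becomes a cardinality.\<close>

definition transv :: "'v::ab_group_add set \<Rightarrow> 'v set \<Rightarrow> 'v set \<Rightarrow> bool" where
  "transv R A B \<longleftrightarrow> finite R \<and> R \<subseteq> A \<and> (\<forall>x\<in>A. \<exists>!r. r \<in> R \<and> x - r \<in> B)"

lemma
  assumes "transv R A B"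
  shows transv_finite: "finite R"
    and transv_in: "r \<in> R \<Longrightarrow> r \<in> A"
    and transv_ex: "x \<in> A \<Longrightarrow> \<exists>r\<in>R. x - r \<in> B"
    and transv_unique: "x \<in> A \<Longrightarrow> r \<in> R \<Longrightarrow> s \<in> R \<Longrightarrow> x - r \<in> B \<Longrightarrow> x - s \<in> B \<Longrightarrow> r = s"
  using assms unfolding transv_def by blast+

lemma transvI:
  assumes "finite R" "R \<subseteq> A" "\<And>x. x \<in> A \<Longrightarrow> \<exists>r\<in>R. x - r \<in> B"
    and "\<And>r s. r \<in> R \<Longrightarrow> s \<in> R \<Longrightarrow> r - s \<in> B \<Longrightarrow> r = s" "additive_subgroup B"
  shows "transv R A B"
proof -
  have "r = s" if "r \<in> R" "s \<in> R" "x - r \<in> B" "x - s \<in> B" for x r s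
    using assms(4)[of r s] sg_diff[OF assms(5), of "x - s" "x - r"] that by simp
  then show ?thesis
    using assms(1-3) unfolding transv_def by blast
qed

lemma transv_eq:
  assumes "transv R A B" "r \<in> R" "s \<in> R" "r - s \<in> B" "additive_subgroup B"
  shows "r = s"
  using transv_unique[OF assms(1), of r r s] transv_in[OF assms(1)] assms sg_0 by force

lemma transv_card_pos:
  assumes "transv R A B" "additive_subgroup A"
  shows "card R > 0"
  using transv_ex[OF assms(1) sg_0[OF assms(2)]] transv_finite[OF assms(1)] by (auto simp: card_gt_0_iff)

text \<open>A covering set may hit a coset several times. The choice \<open>g s\<close> depends only
  on the coset of \<open>s\<close>, because the condition that defines it does; its image therefore
  meets each coset exactly once.\<close>

lemma transv_from_cover:
  assumes "finite S" "\<And>x. x \<in> A \<Longrightarrow> \<exists>s\<in>S. x - s \<in> B"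
    and "additive_subgroup A" "additive_subgroup B" "B \<subseteq> A"
  shows "\<exists>R. transv R A B"
proof -
  define S' where "S' = S \<inter> A"
  have cover: "\<exists>s\<in>S'. x - s \<in> B" if x: "x \<in> A" for x
  proof -
    obtain s where s: "s \<in> S" "x - s \<in> B" using assms(2)[OF x] by blast
    then have "s \<in> A" using sg_diff[OF assms(3) x, of "x - s"] assms(5) by auto
    then show ?thesis using s S'_def by blast
  qed
  define g where "g s = (SOME t. t \<in> S' \<and> s - t \<in> B)" for s
  have g: "g s \<in> S' \<and> s - g s \<in> B" if "s \<in> A" for s
    unfolding g_def by (rule someI_ex) (use cover[OF that] in blast)
  have g_cong: "g s = g t" if "s - t \<in> B" for s t
  proof -
    have "s - u \<in> B \<longleftrightarrow> t - u \<in> B" for u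
      using sg_diff[OF assms(4), of "s - u" "s - t"] sg_add[OF assms(4), of "t - u" "s - t"] that
      by auto
    then show ?thesis by (simp add: g_def)
  qed
  have "transv (g ` S') A B"
  proof (rule transvI)
    show "finite (g ` S')" using assms(1) by (simp add: S'_def)
    show "g ` S' \<subseteq> A" using g S'_def by blast
    show "\<exists>r\<in>g ` S'. x - r \<in> B" if x: "x \<in> A" for x
    proof -
      obtain s where s: "s \<in> S'" "x - s \<in> B" using cover[OF x] by blast
      then have "x - g s \<in> B" using g[of s] S'_def sg_add[OF assms(4), of "x - s" "s - g s"] by auto
      then show ?thesis using s by blast
    qed
    show "r = s" if rs: "r \<in> g ` S'" "s \<in> g ` S'" "r - s \<in> B" for r s
    proof -
      obtain a b where ab: "a \<in> S'" "r = g a" "b \<in> S'" "s = g b" using rs by blast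
      have "a - b = (a - g a) + (g a - g b) - (b - g b)" by simp
      moreover have "(a - g a) + (g a - g b) - (b - g b) \<in> B"
        by (rule sg_diff[OF assms(4) sg_add[OF assms(4)]]) (use g[of a] g[of b] ab rs S'_def in auto)
      ultimately have "a - b \<in> B" by simp
      then show ?thesis using g_cong ab by blast
    qed
    show "additive_subgroup B" by fact
  qed
  then show ?thesis by blast
qed

text \<open>Finiteness of the field enters here: each new generator \<open>a\<close> multiplies the
  number of representatives by at most the number of scalars.\<close>

lemma span_cover:
  fixes s :: "'k::{field,finite} \<Rightarrow> 'v::ab_group_add \<Rightarrow> 'v"
  assumes "vector_space s" "module.subspace s W" "finite B"
  shows "\<exists>S. finite S \<and> (\<forall>x\<in>module.span s (W \<union> B). \<exists>t\<in>S. x - t \<in> W)"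
  using assms(3)
proof (induction B rule: finite_induct)
  interpret vector_space s by fact
  case empty
  have "\<forall>x\<in>span (W \<union> {}). \<exists>t\<in>{0}. x - t \<in> W"
    using assms(2) span_minimal[of W W] by auto
  then show ?case by blast
next
  interpret vector_space s by fact
  case (insert a B)
  then obtain S where S: "finite S" "\<And>x. x \<in> span (W \<union> B) \<Longrightarrow> \<exists>t\<in>S. x - t \<in> W" by blast
  define S' where "S' = (\<lambda>(k, t). s k a + t) ` (UNIV \<times> S)"
  have "finite S'" using S(1) by (simp add: S'_def)
  moreover have "\<exists>t\<in>S'. x - t \<in> W" if x: "x \<in> span (W \<union> insert a B)" for x
  proof -
    obtain k where "x - s k a \<in> span (W \<union> B)"
      using x span_breakdown_eq[of x a "W \<union> B"] by auto
    then obtain t where "t \<in> S" "x - s k a - t \<in> W" using S(2) by blast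
    then show ?thesis unfolding S'_def
      by (intro bexI[of _ "s k a + t"]) (simp add: diff_diff_eq[symmetric], rule rev_image_eqI[of "(k, t)"], auto)
  qed
  ultimately show ?case by blast
qed

lemma transv_exists:
  fixes E :: "('k::{field,finite}, 'i, 'v::ab_group_add, 'z) filt_scheme"
  assumes "c1_space E" "(i, j) \<in> leq E"
  shows "\<exists>R. transv R (fil E j) (fil E i)"
proof -
  have fs: "filtered_space E" using assms by (simp add: c1_fs)
  have ij: "i \<in> idx E" "j \<in> idx E" using leq_idx[OF fs assms(2)] by auto
  obtain B where "finite B" "fil E j = module.span (scl E) (fil E i \<union> B)"
    using assms unfolding c1_space_def by blast
  then obtain S where "finite S" "\<And>x. x \<in> fil E j \<Longrightarrow> \<exists>t\<in>S. x - t \<in> fil E i"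
    using span_cover[OF filtered_vs[OF fs] fil_subspace[OF fs ij(1)], of B] by auto
  then show ?thesis
    by (rule transv_from_cover) (use fil_subgroup[OF fs] ij fil_mono[OF fs assms(2)] in auto)
qed

text \<open>Multiplicativity of the index, [A:C] = [A:B] [B:C]; injectivity is what turns the
  statement on representatives into one on cardinalities.\<close>

lemma transv_mult:
  assumes R: "transv R A B" and Q: "transv Q B C"
    and sg: "additive_subgroup A" "additive_subgroup B" "additive_subgroup C" and sub: "C \<subseteq> B" "B \<subseteq> A"
  shows "inj_on (\<lambda>(r, q). r + q) (R \<times> Q)" "transv ((\<lambda>(r, q). r + q) ` (R \<times> Q)) A C"
proof -
  have key: "r = r' \<and> q = q'"
    if "r \<in> R" "r' \<in> R" "q \<in> Q" "q' \<in> Q" "(r + q) - (r' + q') \<in> C" for r r' q q'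
  proof -
    have q: "q \<in> B" "q' \<in> B" using transv_in[OF Q] that by auto
    have "r - r' = ((r + q) - (r' + q')) - (q - q')" by simp
    then have "r - r' \<in> B" using that(5) sub(1) q sg_diff[OF sg(2)] by (metis subsetD)
    then have "r = r'" using transv_eq[OF R] that sg by blast
    then show ?thesis using transv_eq[OF Q, of q q'] that sg by simp
  qed
  show "inj_on (\<lambda>(r, q). r + q) (R \<times> Q)"
    using key sg_0[OF sg(3)] by (fastforce simp: inj_on_def)
  show "transv ((\<lambda>(r, q). r + q) ` (R \<times> Q)) A C"
  proof (rule transvI)
    show "finite ((\<lambda>(r, q). r + q) ` (R \<times> Q))" using transv_finite R Q by blast
    show "(\<lambda>(r, q). r + q) ` (R \<times> Q) \<subseteq> A"
      using sub by (auto intro!: sg_add[OF sg(1)] intro: transv_in[OF R] dest: transv_in[OF Q])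
    show "\<exists>t\<in>(\<lambda>(r, q). r + q) ` (R \<times> Q). x - t \<in> C" if x: "x \<in> A" for x
    proof -
      obtain r where r: "r \<in> R" "x - r \<in> B" using transv_ex[OF R x] by blast
      obtain q where q: "q \<in> Q" "x - r - q \<in> C" using transv_ex[OF Q r(2)] by blast
      show ?thesis
        by (rule bexI[of _ "r + q"], simp add: diff_diff_eq[symmetric] q, rule rev_image_eqI[of "(r, q)"])
          (use r q in auto)
    qed
    show "t = t'" if "t \<in> (\<lambda>(r, q). r + q) ` (R \<times> Q)" "t' \<in> (\<lambda>(r, q). r + q) ` (R \<times> Q)"
      "t - t' \<in> C" for t t' using key that by auto
  qed (fact sg)
qed

text \<open>Only representatives with nonzero value count. They lie in both \<open>A\<close> and
  \<open>A'\<close>, and passing to the representative of the same coset of \<open>B\<close> matches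
  them. Allowing two groups covers a change of the bound on the support together with a change of
  representatives.\<close>

lemma transv_sum:
  fixes f :: "'v::ab_group_add \<Rightarrow> complex"
  assumes R: "transv R A B" and R': "transv R' A' B" and sg: "additive_subgroup B"
    and per: "\<And>x u. x \<in> A \<union> A' \<Longrightarrow> u \<in> B \<Longrightarrow> f (x + u) = f x"
    and supp: "\<And>x. x \<notin> A \<inter> A' \<Longrightarrow> f x = 0"
  shows "(\<Sum>r\<in>R. f r) = (\<Sum>r\<in>R'. f r)"
proof -
  define P where "P = {r \<in> R. f r \<noteq> 0}"
  define P' where "P' = {r \<in> R'. f r \<noteq> 0}"
  define g where "g r = (THE s. s \<in> R' \<and> r - s \<in> B)" for r
  define h where "h r = (THE s. s \<in> R \<and> r - s \<in> B)" for r
  have g: "g r \<in> R' \<and> r - g r \<in> B" if "r \<in> A'" for r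
    unfolding g_def using R' that by - (rule theI', simp add: transv_def)
  have h: "h r \<in> R \<and> r - h r \<in> B" if "r \<in> A" for r
    unfolding h_def using R that by - (rule theI', simp add: transv_def)
  have fg: "f (g r) = f r" if "r \<in> A'" for r
    using per[of "g r" "r - g r"] g[OF that] transv_in[OF R'] by simp
  have fh: "f (h r) = f r" if "r \<in> A" for r
    using per[of "h r" "r - h r"] h[OF that] transv_in[OF R] by simp
  have "(\<Sum>r\<in>R. f r) = (\<Sum>r\<in>P. f r)"
    unfolding P_def by (rule sum.mono_neutral_right) (auto simp: transv_finite[OF R])
  also have "\<dots> = (\<Sum>r\<in>P'. f r)"
  proof (rule sum.reindex_bij_witness[of _ h g])
    fix r assume r: "r \<in> P"
    then have "r \<in> A \<inter> A'" using supp[of r] by (auto simp: P_def)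
    then have *: "g r \<in> R'" "r - g r \<in> B" "f (g r) = f r" using g[of r] fg[of r] by auto
    then show "g r \<in> P'" using r by (auto simp: P_def P'_def)
    then have "g r \<in> A" using supp[of "g r"] by (auto simp: P'_def)
    then have "h (g r) \<in> R" "g r - h (g r) \<in> B" using h by auto
    then have "r - h (g r) \<in> B" using sg_add[OF sg *(2)] by force
    then show "h (g r) = r" using transv_eq[OF R] r sg \<open>h (g r) \<in> R\<close> by (metis (lifting) P_def mem_Collect_eq)
    show "f (g r) = f r" by fact
  next
    fix r assume r: "r \<in> P'"
    then have "r \<in> A \<inter> A'" using supp[of r] by (auto simp: P'_def)
    then have *: "h r \<in> R" "r - h r \<in> B" "f (h r) = f r" using h[of r] fh[of r] by auto
    then show "h r \<in> P" using r by (auto simp: P_def P'_def)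
    then have "h r \<in> A'" using supp[of "h r"] by (auto simp: P_def)
    then have "g (h r) \<in> R'" "h r - g (h r) \<in> B" using g by auto
    then have "r - g (h r) \<in> B" using sg_add[OF sg *(2)] by force
    then show "g (h r) = r" using transv_eq[OF R'] r sg \<open>g (h r) \<in> R'\<close> by (metis (lifting) P'_def mem_Collect_eq)
  qed
  also have "\<dots> = (\<Sum>r\<in>R'. f r)"
    unfolding P'_def by (rule sum.mono_neutral_left) (auto simp: transv_finite[OF R'])
  finally show ?thesis .
qed

lemma transv_card: 
  assumes "transv R A B" "transv R' A B" "additive_subgroup A" "additive_subgroup B" "B \<subseteq> A"
  shows "card R = card R'"
proof -
  have in_A: "x + u \<in> A \<longleftrightarrow> x \<in> A" if "u \<in> B" for x u
    using sg_add[OF assms(3), of x u] sg_diff[OF assms(3), of "x + u" u] that assms(5) by auto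
  have "(\<Sum>r\<in>R. ind A r) = (\<Sum>r\<in>R'. ind A r)"
    by (rule transv_sum[OF assms(1,2,4)]) (auto simp: ind_def in_A)
  moreover have "(\<Sum>r\<in>Q. ind A r) = of_nat (card Q)" if "transv Q A B" for Q
    using transv_in[OF that] by (simp add: ind_def)
  ultimately show ?thesis using assms by simp
qed

text \<open>Each coset of \<open>B\<close> consists of [B:C] cosets of \<open>C\<close>, and
  \<open>f\<close> takes its value on all of them.\<close>

lemma transv_sum_refine:
  fixes f :: "'v::ab_group_add \<Rightarrow> complex"
  assumes R: "transv R A B" and Q: "transv Q B C" and R': "transv R' A C"
    and sg: "additive_subgroup A" "additive_subgroup B" "additive_subgroup C" and sub: "C \<subseteq> B" "B \<subseteq> A"
    and per: "\<And>x u. x \<in> A \<Longrightarrow> u \<in> B \<Longrightarrow> f (x + u) = f x"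
    and supp: "\<And>x. x \<notin> A \<Longrightarrow> f x = 0"
  shows "(\<Sum>r\<in>R'. f r) = of_nat (card Q) * (\<Sum>r\<in>R. f r)"
proof -
  let ?T = "(\<lambda>(r, q). r + q) ` (R \<times> Q)"
  note T = transv_mult[OF R Q sg sub]
  have "(\<Sum>r\<in>R'. f r) = (\<Sum>r\<in>?T. f r)"
    by (rule transv_sum[OF R' T(2) sg(3)]) (use sub in \<open>simp_all add: per supp subset_iff\<close>)
  also have "\<dots> = (\<Sum>(r, q)\<in>R \<times> Q. f (r + q))"
    by (subst sum.reindex[OF T(1)]) (simp add: case_prod_unfold o_def)
  also have "\<dots> = (\<Sum>(r, q)\<in>R \<times> Q. f r)"
    by (rule sum.cong) (auto simp: per transv_in[OF R] transv_in[OF Q])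
  also have "\<dots> = of_nat (card Q) * (\<Sum>r\<in>R. f r)"
    by (simp add: sum.cartesian_product[symmetric] sum_distrib_left)
  finally show ?thesis .
qed

section \<open>Test functions\<close>

text \<open>A function on the finite quotient F(j)/F(i). Periodicity is asked at every
  \<open>x\<close> of the type; outside \<open>spc E\<close> this is automatic, since
  \<open>f\<close> vanishes there and translation by F(i) preserves the complement.\<close>

definition tf :: "('k, 'i, 'v::ab_group_add) filt \<Rightarrow> 'i \<Rightarrow> 'i \<Rightarrow> ('v \<Rightarrow> complex) \<Rightarrow> bool" where
  "tf E i j f \<longleftrightarrow> (i, j) \<in> leq E \<and> (\<forall>x. x \<notin> fil E j \<longrightarrow> f x = 0) \<and> (\<forall>x. \<forall>u\<in>fil E i. f (x + u) = f x)"

lemma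
  assumes "tf E i j f"
  shows tf_leq: "(i, j) \<in> leq E"
    and tf_supp: "x \<notin> fil E j \<Longrightarrow> f x = 0"
    and tf_per: "u \<in> fil E i \<Longrightarrow> f (x + u) = f x"
  using assms by (auto simp: tf_def)

lemma tf_refine:
  assumes "filtered_space E" "tf E i j f" "(i', i) \<in> leq E" "(j, j') \<in> leq E"
  shows "tf E i' j' f"
  unfolding tf_def
proof (intro conjI allI ballI impI)
  show "(i', j') \<in> leq E" using assms leq_trans[OF assms(1)] tf_leq by metis
  show "f x = 0" if "x \<notin> fil E j'" for x
    using that tf_supp[OF assms(2)] fil_mono[OF assms(1,4)] by blast
  show "f (x + u) = f x" if "u \<in> fil E i'" for x u
    using that tf_per[OF assms(2)] fil_mono[OF assms(1,3)] by blast
qed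

lemma tf_test_fun:
  assumes "filtered_space E" "tf E i j f"
  shows "f \<in> test_fun E"
proof -
  have "i \<in> idx E" "j \<in> idx E" using leq_idx[OF assms(1) tf_leq[OF assms(2)]] by auto
  then show ?thesis
    using tf_supp[OF assms(2)] tf_per[OF assms(2)] fil_spc[OF assms(1)] unfolding test_fun_def by blast
qed

lemma test_fun_tf:
  assumes fs: "filtered_space E" and f: "f \<in> test_fun E"
  shows "\<exists>i j. tf E i j f"
proof -
  obtain j i where j: "j \<in> idx E" "\<And>x. x \<notin> fil E j \<Longrightarrow> f x = 0"
    and i: "i \<in> idx E" "\<And>x u. x \<in> spc E \<Longrightarrow> u \<in> fil E i \<Longrightarrow> f (x + u) = f x"
    and out: "\<And>x. x \<notin> spc E \<Longrightarrow> f x = 0"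
    using f unfolding test_fun_def by blast
  \<comment> \<open>The indices bounding the period and the support need not be comparable, so the
    support bound is raised above the period.\<close>
  obtain j' where j': "j' \<in> idx E" "(i, j') \<in> leq E" "(j, j') \<in> leq E"
    using fil_above[OF fs i(1) j(1)] by blast
  have "f (x + u) = f x" if "u \<in> fil E i" for x u
    using i(2)[of x u] out[of x] out[of "x + u"] spc_add_iff[OF fs fil_spc[OF fs i(1) that], of x] that
    by (cases "x \<in> spc E") auto
  then have "tf E i j' f"
    unfolding tf_def using j' j(2) fil_mono[OF fs j'(3)] by blast
  then show ?thesis by blast
qed

lemma tf_below:
  assumes fs: "filtered_space E" and f: "f \<in> test_fun E" and i0: "i0 \<in> idx E"
  shows "\<exists>i j. tf E i j f \<and> (i, i0) \<in> leq E \<and> (i0, j) \<in> leq E"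
proof -
  obtain i j where ij: "tf E i j f" using test_fun_tf[OF fs f] by blast
  then have idx: "i \<in> idx E" "j \<in> idx E" using leq_idx[OF fs tf_leq] by blast+
  obtain i' where i': "(i', i) \<in> leq E" "(i', i0) \<in> leq E" using fil_below[OF fs idx(1) i0] by blast
  obtain j' where j': "(j, j') \<in> leq E" "(i0, j') \<in> leq E" using fil_above[OF fs idx(2) i0] by blast
  show ?thesis using tf_refine[OF fs ij i'(1) j'(1)] i' j' by blast
qed

lemma tf_common:
  assumes fs: "filtered_space E" and f: "f \<in> test_fun E" and g: "g \<in> test_fun E" and i0: "i0 \<in> idx E"
  shows "\<exists>i j. tf E i j f \<and> tf E i j g \<and> (i, i0) \<in> leq E \<and> (i0, j) \<in> leq E"
proof -
  obtain i j where ij: "tf E i j f" "(i, i0) \<in> leq E" "(i0, j) \<in> leq E"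
    using tf_below[OF fs f i0] by blast
  have idx: "i \<in> idx E" "j \<in> idx E" using leq_idx[OF fs tf_leq[OF ij(1)]] by blast+
  obtain i1 j1 where 1: "tf E i1 j1 g" "(i1, i) \<in> leq E" "(i, j1) \<in> leq E"
    using tf_below[OF fs g idx(1)] by blast
  have "j1 \<in> idx E" using leq_idx[OF fs 1(3)] by blast
  then obtain j' where j': "(j, j') \<in> leq E" "(j1, j') \<in> leq E" using fil_above[OF fs idx(2)] by blast
  have "(i1, i1) \<in> leq E" using leq_refl[OF fs] leq_idx[OF fs 1(2)] by blast
  then show ?thesis
    using tf_refine[OF fs ij(1) 1(2) j'(1)] tf_refine[OF fs 1(1) _ j'(2)]
      leq_trans[OF fs 1(2) ij(2)] leq_trans[OF fs ij(3) j'(1)] by blast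
qed

lemma test_fun_out: "f \<in> test_fun E \<Longrightarrow> x \<notin> spc E \<Longrightarrow> f x = 0"
  by (auto simp: test_fun_def)

lemma test_fun_lin:
  assumes fs: "filtered_space E" and f: "f \<in> test_fun E" and g: "g \<in> test_fun E"
  shows "fscale c f + g \<in> test_fun E"
proof -
  obtain i0 where "i0 \<in> idx E" using idx_nonempty[OF fs] by blast
  then obtain i j where "tf E i j f" "tf E i j g" using tf_common[OF fs f g] by blast
  then have "tf E i j (fscale c f + g)" by (auto simp: tf_def)
  then show ?thesis by (rule tf_test_fun[OF fs])
qed

lemma test_fun_0: "filtered_space E \<Longrightarrow> 0 \<in> test_fun E"
  using idx_nonempty[of E] by (auto simp: test_fun_def)

lemma test_fun_scale: "filtered_space E \<Longrightarrow> f \<in> test_fun E \<Longrightarrow> fscale c f \<in> test_fun E"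
  using test_fun_lin[of E f 0 c] test_fun_0[of E] by simp

lemma test_fun_add: "filtered_space E \<Longrightarrow> f \<in> test_fun E \<Longrightarrow> g \<in> test_fun E \<Longrightarrow> f + g \<in> test_fun E"
  using test_fun_lin[of E f g 1] by simp

lemma test_fun_sum: "filtered_space E \<Longrightarrow> (\<And>i. i \<in> I \<Longrightarrow> f i \<in> test_fun E) \<Longrightarrow> (\<Sum>i\<in>I. f i) \<in> test_fun E"
  by (induction I rule: infinite_finite_induct) (auto intro: test_fun_0 test_fun_add)

lemma tf_coset:
  assumes fs: "filtered_space E" and ij: "(i, j) \<in> leq E" and r: "r \<in> fil E j"
  shows "tf E i j (ind (coset (fil E i) r))"
proof -
  have idx: "i \<in> idx E" "j \<in> idx E" using leq_idx[OF fs ij] by auto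
  have *: "x \<in> coset (fil E i) r \<longleftrightarrow> x - r \<in> fil E i" for x
    by (auto simp: coset_def image_iff intro: bexI[of _ "x - r"])
  have "x \<in> fil E j" if "x - r \<in> fil E i" for x
    using fil_add[OF fs idx(2), of "x - r" r] fil_mono[OF fs ij] r that by auto
  moreover have "x + u - r \<in> fil E i \<longleftrightarrow> x - r \<in> fil E i" if "u \<in> fil E i" for x u
    using fil_add[OF fs idx(1), of "x - r" u] fil_diff[OF fs idx(1), of "x + u - r" u] that
    by (auto simp: algebra_simps)
  ultimately show ?thesis using ij by (auto simp: tf_def ind_def *)
qed

lemma coset_0 [simp]: "coset S (0::'v::monoid_add) = S"
  by (simp add: coset_def)

lemma tf_ind: "filtered_space E \<Longrightarrow> (i, j) \<in> leq E \<Longrightarrow> tf E i j (ind (fil E i))"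
  using tf_coset[of E i j 0] fil_0[of E j] leq_idx[of E i j] by simp

lemma ind_test_fun: "filtered_space E \<Longrightarrow> i \<in> idx E \<Longrightarrow> ind (fil E i) \<in> test_fun E"
  using tf_ind tf_test_fun leq_refl by metis

lemma test_fun_translate:
  assumes fs: "filtered_space E" and f: "f \<in> test_fun E" and u: "u \<in> spc E"
  shows "(\<lambda>x. f (x + u)) \<in> test_fun E"
proof -
  obtain i0 where i0: "i0 \<in> idx E" "u \<in> fil E i0" using spc_fil[OF fs u] by blast
  then obtain i j where ij: "tf E i j f" "(i0, j) \<in> leq E" using tf_below[OF fs f] by blast
  have idx: "i \<in> idx E" "j \<in> idx E" using leq_idx[OF fs tf_leq[OF ij(1)]] by auto
  have u: "u \<in> fil E j" using i0 fil_mono[OF fs ij(2)] by blast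
  have "f (x + u) = 0" if "x \<notin> fil E j" for x
    using fil_diff[OF fs idx(2), of "x + u" u] u that tf_supp[OF ij(1)] by auto
  moreover have "f (x + v + u) = f (x + u)" if "v \<in> fil E i" for x v
    using tf_per[OF ij(1) that, of "x + u"] by (simp add: algebra_simps)
  ultimately have "tf E i j (\<lambda>x. f (x + u))"
    using tf_leq[OF ij(1)] by (auto simp: tf_def)
  then show ?thesis by (rule tf_test_fun[OF fs])
qed

section \<open>Distributions and invariant measures\<close>

lemma
  assumes "G \<in> dists E"
  shows dist_add: "f \<in> test_fun E \<Longrightarrow> g \<in> test_fun E \<Longrightarrow> G (f + g) = G f + G g"
    and dist_scale: "f \<in> test_fun E \<Longrightarrow> G (fscale c f) = c * G f"
    and dist_out: "f \<notin> test_fun E \<Longrightarrow> G f = 0"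
  using assms by (auto simp: dists_def lin_on_def)

lemma distI:
  assumes "\<And>f g c. f \<in> test_fun E \<Longrightarrow> g \<in> test_fun E \<Longrightarrow> G (fscale c f + g) = c * G f + G g"
    and "\<And>f. f \<notin> test_fun E \<Longrightarrow> G f = 0" and fs: "filtered_space E"
  shows "G \<in> dists E"
proof -
  have 0: "0 \<in> test_fun E" by (rule test_fun_0[OF fs])
  have "G 0 = 0" using assms(1)[OF 0 0, of 1] by simp
  then have "G (fscale c f) = c * G f" if "f \<in> test_fun E" for c f
    using assms(1)[OF that 0, of c] by simp
  moreover have "G (f + g) = G f + G g" if "f \<in> test_fun E" "g \<in> test_fun E" for f g
    using assms(1)[OF that, of 1] by simp
  ultimately show ?thesis using assms(2) by (simp add: dists_def lin_on_def)
qed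

lemma dist_0: "filtered_space E \<Longrightarrow> G \<in> dists E \<Longrightarrow> G 0 = 0"
  using dist_scale[of G E 0 0] test_fun_0[of E] by simp

lemma dist_lin:
  "filtered_space E \<Longrightarrow> G \<in> dists E \<Longrightarrow> f \<in> test_fun E \<Longrightarrow> g \<in> test_fun E \<Longrightarrow>
    G (fscale c f + g) = c * G f + G g"
  by (simp add: dist_add dist_scale test_fun_scale)

lemma dist_sum:
  assumes "filtered_space E" "G \<in> dists E" "\<And>i. i \<in> I \<Longrightarrow> f i \<in> test_fun E"
  shows "G (\<Sum>i\<in>I. f i) = (\<Sum>i\<in>I. G (f i))"
  using assms(3)
  by (induction I rule: infinite_finite_induct)
    (auto simp: dist_0[OF assms(1,2)] dist_add[OF assms(2)] test_fun_sum[OF assms(1)])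

lemma dists_scale: "filtered_space E \<Longrightarrow> G \<in> dists E \<Longrightarrow> fscale c G \<in> dists E"
  by (rule distI) (simp_all add: dist_lin dist_out distrib_left mult.left_commute)

section \<open>Invariant measures: exact Riemann sums, uniqueness, existence\<close>

lemma meas_dist: "m \<in> meas E \<Longrightarrow> m \<in> dists E"
  by (simp add: meas_def)

lemma meas_translate: "m \<in> meas E \<Longrightarrow> f \<in> test_fun E \<Longrightarrow> u \<in> spc E \<Longrightarrow> m (\<lambda>x. f (x + u)) = m f"
  by (simp add: meas_def)

lemma meas_scale: "filtered_space E \<Longrightarrow> m \<in> meas E \<Longrightarrow> fscale c m \<in> meas E"
  by (simp add: meas_def dists_scale)

lemma meas_coset:
  assumes fs: "filtered_space E" and m: "m \<in> meas E" and i: "i \<in> idx E" and r: "r \<in> spc E"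
  shows "ind (coset (fil E i) r) \<in> test_fun E" "m (ind (coset (fil E i) r)) = m (ind (fil E i))"
proof -
  obtain k where "k \<in> idx E" "r \<in> fil E k" using spc_fil[OF fs r] by blast
  moreover from this obtain j where j: "(k, j) \<in> leq E" "(i, j) \<in> leq E"
    using fil_above[OF fs _ i] by blast
  ultimately have "r \<in> fil E j" using fil_mono[OF fs] by blast
  then show t: "ind (coset (fil E i) r) \<in> test_fun E"
    using tf_coset[OF fs j(2)] tf_test_fun[OF fs] by blast
  have "(\<lambda>x. ind (coset (fil E i) r) (x + r)) = ind (fil E i)"
    by (auto simp: ind_def coset_def fun_eq_iff image_iff add.commute)
  then show "m (ind (coset (fil E i) r)) = m (ind (fil E i))"
    using meas_translate[OF m t r] by simp
qed

text \<open>\<open>f\<close> is a finite combination of indicators of cosets of F(i), and by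
  invariance each of them has the mass of F(i): the Riemann sum is exact.\<close>

lemma meas_riemann:
  fixes E :: "('k::field, 'i, 'v::ab_group_add) filt"
  assumes fs: "filtered_space E" and m: "m \<in> meas E" and f: "tf E i j f"
    and R: "transv R (fil E j) (fil E i)"
  shows "m f = (\<Sum>r\<in>R. f r) * m (ind (fil E i))"
proof -
  have idx: "i \<in> idx E" "j \<in> idx E" using leq_idx[OF fs tf_leq[OF f]] by auto
  let ?g = "\<lambda>r. ind (coset (fil E i) r) :: 'v \<Rightarrow> complex"
  have co: "x \<in> coset (fil E i) r \<longleftrightarrow> x - r \<in> fil E i" for x r
    by (auto simp: coset_def image_iff intro: bexI[of _ "x - r"])
  have "f = (\<Sum>r\<in>R. fscale (f r) (?g r))"
  proof
    fix x
    have S: "(\<Sum>r\<in>R. fscale (f r) (?g r)) x = (\<Sum>r\<in>R. f r * ?g r x)"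
      by (induction R rule: infinite_finite_induct) auto
    show "f x = (\<Sum>r\<in>R. fscale (f r) (?g r)) x"
    proof (cases "x \<in> fil E j")
      case True
      then obtain r where r: "r \<in> R" "x - r \<in> fil E i" using transv_ex[OF R] by blast
      have uniq: "s = r" if "s \<in> R" "x - s \<in> fil E i" for s
        using transv_unique[OF R True that(1) r(1) that(2) r(2)] .
      have "f s * ?g s x = (if s = r then f r else 0)" if "s \<in> R" for s
        using uniq[OF that] r(2) by (cases "s = r") (auto simp: ind_def co)
      then have "(\<Sum>s\<in>R. f s * ?g s x) = (\<Sum>s\<in>R. if s = r then f r else 0)"
        by (intro sum.cong) simp_all
      also have "\<dots> = f r" using r transv_finite[OF R] by simp
      also have "f r = f x" using tf_per[OF f r(2), of r] by simp
      finally show ?thesis using S by simp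
    next
      case False
      have "x - s \<notin> fil E i" if "s \<in> R" for s
        using transv_in[OF R that] fil_add[OF fs idx(2), of "x - s" s] fil_mono[OF fs tf_leq[OF f]] False
        by auto
      then have "(\<Sum>s\<in>R. f s * ?g s x) = 0"
        by (intro sum.neutral) (auto simp: ind_def co)
      then show ?thesis using S tf_supp[OF f False] by simp
    qed
  qed
  then have "m f = m (\<Sum>r\<in>R. fscale (f r) (?g r))" by simp
  also have "\<dots> = (\<Sum>r\<in>R. f r * m (ind (fil E i)))"
    using meas_coset[OF fs m idx(1)] fil_spc[OF fs idx(2)] transv_in[OF R]
    by (subst dist_sum[OF fs meas_dist[OF m]])
      (auto simp: test_fun_scale[OF fs] dist_scale[OF meas_dist[OF m]])
  finally show ?thesis by (simp add: sum_distrib_right)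
qed

lemma meas_index:
  assumes fs: "filtered_space E" and m: "m \<in> meas E" and ij: "(i, j) \<in> leq E"
    and R: "transv R (fil E j) (fil E i)"
  shows "m (ind (fil E j)) = of_nat (card R) * m (ind (fil E i))"
proof -
  have j: "j \<in> idx E" using leq_idx[OF fs ij] by auto
  have "tf E i j (ind (fil E j))"
    using tf_refine[OF fs tf_ind[OF fs leq_refl[OF fs j]] ij leq_refl[OF fs j]] .
  from meas_riemann[OF fs m this R] show ?thesis
    using transv_in[OF R] by (simp add: ind_def)
qed

text \<open>An inclusion of subspaces does not imply a relation between their indices. Both are
  therefore compared with F(k) for a common lower bound \<open>k\<close>. One transversal serves all
  measures.\<close>

lemma meas_index_subset:
  fixes E :: "('k::{field,finite}, 'i, 'v::ab_group_add) filt"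
  assumes c: "c1_space E" and ij: "i \<in> idx E" "j \<in> idx E" "fil E i \<subseteq> fil E j"
  shows "\<exists>R. transv R (fil E j) (fil E i) \<and>
    (\<forall>m\<in>meas E. m (ind (fil E j)) = of_nat (card R) * m (ind (fil E i)))"
proof -
  note fs = c1_fs[OF c]
  note sg = fil_subgroup[OF fs]
  obtain k where k: "(k, i) \<in> leq E" "(k, j) \<in> leq E" using fil_below[OF fs ij(1,2)] by blast
  have kx: "k \<in> idx E" using leq_idx[OF fs k(1)] by auto
  obtain S where S: "transv S (fil E j) (fil E k)" using transv_exists[OF c k(2)] by blast
  obtain Q where Q: "transv Q (fil E i) (fil E k)" using transv_exists[OF c k(1)] by blast
  have "\<exists>R. transv R (fil E j) (fil E i)"
    by (rule transv_from_cover[OF transv_finite[OF S] _ sg[OF ij(2)] sg[OF ij(1)] ij(3)])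
      (use transv_ex[OF S] fil_mono[OF fs k(1)] in blast)
  then obtain R where R: "transv R (fil E j) (fil E i)" by blast
  note T = transv_mult[OF R Q sg[OF ij(2)] sg[OF ij(1)] sg[OF kx] fil_mono[OF fs k(1)] ij(3)]
  have "m (ind (fil E j)) = of_nat (card R) * m (ind (fil E i))" if m: "m \<in> meas E" for m
    using meas_index[OF fs m k(2) T(2)] meas_index[OF fs m k(1) Q]
    by (simp add: card_image[OF T(1)] card_cartesian_product)
  then show ?thesis using R by blast
qed

text \<open>The coefficient \<open>a\<close> is fixed before \<open>m\<close>, which makes this a
  uniqueness statement: an invariant measure is determined by its mass on a single F(i0).\<close>

lemma meas_formula:
  fixes E :: "('k::{field,finite}, 'i, 'v::ab_group_add) filt"
  assumes c: "c1_space E" and f: "f \<in> test_fun E" and i0: "i0 \<in> idx E"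
  shows "\<exists>a. \<forall>m\<in>meas E. m f = a * m (ind (fil E i0))"
proof -
  note fs = c1_fs[OF c]
  obtain i j where ij: "tf E i j f" "(i, i0) \<in> leq E" using tf_below[OF fs f i0] by blast
  obtain R where R: "transv R (fil E j) (fil E i)" using transv_exists[OF c tf_leq[OF ij(1)]] by blast
  obtain Q where Q: "transv Q (fil E i0) (fil E i)" using transv_exists[OF c ij(2)] by blast
  have "card Q > 0" using transv_card_pos[OF Q fil_subgroup[OF fs i0]] .
  then have "m f = (\<Sum>r\<in>R. f r) / of_nat (card Q) * m (ind (fil E i0))" if "m \<in> meas E" for m
    using meas_riemann[OF fs that ij(1) R] meas_index[OF fs that ij(2) Q] by simp
  then show ?thesis by blast
qed

lemma meas_eqI:
  fixes E :: "('k::{field,finite}, 'i, 'v::ab_group_add) filt"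
  assumes "c1_space E" "m \<in> meas E" "n \<in> meas E" "i \<in> idx E" "m (ind (fil E i)) = n (ind (fil E i))"
  shows "m = n"
proof
  fix f
  show "m f = n f"
  proof (cases "f \<in> test_fun E")
    case True
    then show ?thesis using meas_formula[OF assms(1) True assms(4)] assms(2,3,5) by metis
  next
    case False
    then show ?thesis using dist_out meas_dist assms(2,3) by metis
  qed
qed

lemma meas_0: "filtered_space E \<Longrightarrow> 0 \<in> meas E"
  by (auto simp: meas_def intro!: distI)

lemma meas_nz:
  fixes E :: "('k::{field,finite}, 'i, 'v::ab_group_add) filt"
  assumes "c1_space E" "m \<in> meas E" "m \<noteq> 0" "i \<in> idx E"
  shows "m (ind (fil E i)) \<noteq> 0"
  using meas_eqI[OF assms(1,2) meas_0[OF c1_fs[OF assms(1)]] assms(4)] assms(3) by auto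

lemma meas_multiple:
  fixes E :: "('k::{field,finite}, 'i, 'v::ab_group_add) filt"
  assumes "c1_space E" "e \<in> meas E" "e \<noteq> 0" "m \<in> meas E"
  shows "\<exists>t. m = fscale t e"
proof -
  note fs = c1_fs[OF assms(1)]
  obtain i where i: "i \<in> idx E" using idx_nonempty[OF fs] by blast
  have "m = fscale (m (ind (fil E i)) / e (ind (fil E i))) e"
    using meas_nz[OF assms(1-3) i]
    by (intro meas_eqI[OF assms(1,4) meas_scale[OF fs assms(2)] i]) simp
  then show ?thesis by blast
qed

text \<open>Normalised Riemann sums do not change under refinement: a smaller period multiplies
  numerator and denominator of \<open>S\<close> by the same index.\<close>

lemma meas_exists:
  fixes E :: "('k::{field,finite}, 'i, 'v::ab_group_add) filt"
  assumes c: "c1_space E" and i0: "i0 \<in> idx E"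
  shows "\<exists>m\<in>meas E. m (ind (fil E i0)) = a"
proof -
  note fs = c1_fs[OF c]
  note sg = fil_subgroup[OF fs]
  define R where "R i j = (SOME R. transv R (fil E j) (fil E i))" for i j
  have R: "transv (R i j) (fil E j) (fil E i)" if "(i, j) \<in> leq E" for i j
    unfolding R_def by (rule someI_ex[OF transv_exists[OF c that]])
  \<comment> \<open>The divisor is the index of F(i) in F(i0), so that F(i0) has mass 1 before the
    factor \<open>a\<close>.\<close>
  define S where "S i j f = (\<Sum>r\<in>R i j. f r) / of_nat (card (R i i0))" for i j and f :: "'v \<Rightarrow> complex"
  have S_refine: "S i' j' f = S i j f"
    if f: "tf E i j f" and i: "(i, i0) \<in> leq E" "(i', i) \<in> leq E" and j: "(j, j') \<in> leq E"
    for i j i' j' f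
  proof -
    have idx: "i \<in> idx E" "i' \<in> idx E" "j \<in> idx E" "j' \<in> idx E"
      using leq_idx[OF fs i(2)] leq_idx[OF fs j] by auto
    note lij = tf_leq[OF f]
    note l = leq_trans[OF fs i(2) lij] leq_trans[OF fs i(2,1)]
    note l' = leq_trans[OF fs l(1) j]
    have sub: "fil E i' \<subseteq> fil E i" "fil E i \<subseteq> fil E j" "fil E i \<subseteq> fil E i0" "fil E j \<subseteq> fil E j'"
      using fil_mono[OF fs] i lij j by auto
    have per: "f (x + u) = f x" if "u \<in> fil E i" for x u using tf_per[OF f that] .
    have 1: "(\<Sum>r\<in>R i' j'. f r) = (\<Sum>r\<in>R i' j. f r)"
      by (rule transv_sum[OF R[OF l'] R[OF l(1)] sg[OF idx(2)]])
        (use per tf_supp[OF f] sub in blast)+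
    have 2: "(\<Sum>r\<in>R i' j. f r) = of_nat (card (R i' i)) * (\<Sum>r\<in>R i j. f r)"
      by (rule transv_sum_refine[OF R[OF lij] R[OF i(2)] R[OF l(1)] sg[OF idx(3)] sg[OF idx(1)] sg[OF idx(2)]])
        (use per tf_supp[OF f] sub in blast)+
    have per0: "ind (fil E i0) (x + u) = ind (fil E i0) x" if "u \<in> fil E i" for x u
      using tf_per[OF tf_refine[OF fs tf_ind[OF fs leq_refl[OF fs i0]] i(1) leq_refl[OF fs i0]] that] .
    have ones: "(\<Sum>r\<in>R k i0. ind (fil E i0) r) = of_nat (card (R k i0))" if "(k, i0) \<in> leq E" for k
      using transv_in[OF R[OF that]] by (simp add: ind_def)
    have "(\<Sum>r\<in>R i' i0. ind (fil E i0) r) = of_nat (card (R i' i)) * (\<Sum>r\<in>R i i0. ind (fil E i0) r)"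
      by (rule transv_sum_refine[OF R[OF i(1)] R[OF i(2)] R[OF l(2)] sg[OF i0] sg[OF idx(1)] sg[OF idx(2)]])
        (use per0 sub in \<open>auto simp: ind_def\<close>)
    then have 3: "(of_nat (card (R i' i0)) :: complex) = of_nat (card (R i' i)) * of_nat (card (R i i0))"
      using ones l(2) i(1) by simp
    have "card (R i' i) > 0" "card (R i i0) > 0"
      using transv_card_pos[OF R[OF i(2)] sg[OF idx(1)]] transv_card_pos[OF R[OF i(1)] sg[OF i0]] by auto
    then show ?thesis unfolding S_def 1 2 3 by simp
  qed
  define P where "P f = (SOME p. tf E (fst p) (snd p) f \<and> (fst p, i0) \<in> leq E)" for f
  define m where "m = cut (test_fun E) (\<lambda>f. a * S (fst (P f)) (snd (P f)) f)"
  \<comment> \<open>The level picked by \<open>P\<close> is immaterial, because any other admissible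
    level has a common refinement with it.\<close>
  have m: "m f = a * S i j f" if ij: "tf E i j f" "(i, i0) \<in> leq E" for i j f
  proof -
    have "\<exists>p. tf E (fst p) (snd p) f \<and> (fst p, i0) \<in> leq E"
      using ij by (intro exI[of _ "(i, j)"]) simp
    then have p: "tf E (fst (P f)) (snd (P f)) f" "(fst (P f), i0) \<in> leq E"
      unfolding P_def by (metis (mono_tags, lifting) someI_ex)+
    have idx: "i \<in> idx E" "j \<in> idx E" "fst (P f) \<in> idx E" "snd (P f) \<in> idx E"
      using leq_idx[OF fs tf_leq[OF ij(1)]] leq_idx[OF fs tf_leq[OF p(1)]] by auto
    obtain i' where i': "(i', i) \<in> leq E" "(i', fst (P f)) \<in> leq E" using fil_below[OF fs idx(1,3)] by blast
    obtain j' where j': "(j, j') \<in> leq E" "(snd (P f), j') \<in> leq E" using fil_above[OF fs idx(2,4)] by blast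
    show ?thesis
      using S_refine[OF ij i'(1) j'(1)] S_refine[OF p i'(2) j'(2)] tf_test_fun[OF fs ij(1)]
      by (simp add: m_def)
  qed
  have "m \<in> dists E"
  proof (rule distI)
    fix f g c assume f: "f \<in> test_fun E" and g: "g \<in> test_fun E"
    obtain i j where ij: "tf E i j f" "tf E i j g" "(i, i0) \<in> leq E" using tf_common[OF fs f g i0] by blast
    then have "tf E i j (fscale c f + g)" by (auto simp: tf_def)
    moreover have "S i j (fscale c f + g) = c * S i j f + S i j g"
      by (simp add: S_def sum.distrib sum_distrib_left add_divide_distrib)
    ultimately show "m (fscale c f + g) = c * m f + m g"
      using m ij by (simp add: algebra_simps)
  qed (use fs in \<open>simp_all add: m_def\<close>)
  moreover have "m (\<lambda>x. f (x + u)) = m f" if f: "f \<in> test_fun E" and u: "u \<in> spc E" for f u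
  proof -
    note fu = test_fun_translate[OF fs f u]
    obtain i1 where i1: "i1 \<in> idx E" "u \<in> fil E i1" using spc_fil[OF fs u] by blast
    obtain i j where ij: "tf E i j f" "tf E i j (\<lambda>x. f (x + u))" "(i, i0) \<in> leq E"
      using tf_common[OF fs f fu i0] by blast
    have idx: "i \<in> idx E" "j \<in> idx E" using leq_idx[OF fs tf_leq[OF ij(1)]] by auto
    obtain j' where j': "(j, j') \<in> leq E" "(i1, j') \<in> leq E" using fil_above[OF fs idx(2) i1(1)] by blast
    have uj: "u \<in> fil E j'" using i1 fil_mono[OF fs j'(2)] by blast
    have j'i: "j' \<in> idx E" using leq_idx[OF fs j'(1)] by auto
    note t = tf_refine[OF fs ij(1) leq_refl[OF fs idx(1)] j'(1)]
    note t' = tf_refine[OF fs ij(2) leq_refl[OF fs idx(1)] j'(1)]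
    note R' = R[OF tf_leq[OF t]]
    \<comment> \<open>Translation by \<open>u\<close>, an element of F(j'), permutes the cosets; the
      translated representatives compute the same sum.\<close>
    have T: "transv ((\<lambda>r. r + u) ` R i j') (fil E j') (fil E i)"
    proof (rule transvI)
      show "finite ((\<lambda>r. r + u) ` R i j')" using transv_finite[OF R'] by simp
      show "(\<lambda>r. r + u) ` R i j' \<subseteq> fil E j'" using transv_in[OF R'] uj fil_add[OF fs j'i] by auto
      show "\<exists>r\<in>(\<lambda>r. r + u) ` R i j'. x - r \<in> fil E i" if "x \<in> fil E j'" for x
        using transv_ex[OF R', of "x - u"] fil_diff[OF fs j'i that uj] by (auto simp: algebra_simps)
      show "r = s" if "r \<in> (\<lambda>r. r + u) ` R i j'" "s \<in> (\<lambda>r. r + u) ` R i j'" "r - s \<in> fil E i" for r s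
        using that transv_eq[OF R' _ _ _ sg[OF idx(1)]] by auto
      show "additive_subgroup (fil E i)" using sg idx by blast
    qed
    have "(\<Sum>r\<in>R i j'. f (r + u)) = (\<Sum>r\<in>(\<lambda>r. r + u) ` R i j'. f r)"
      by (subst sum.reindex) (auto simp: inj_on_def)
    also have "\<dots> = (\<Sum>r\<in>R i j'. f r)"
      by (rule transv_sum[OF T R' sg[OF idx(1)]]) (use tf_per[OF t] tf_supp[OF t] in blast)+
    finally have "S i j' (\<lambda>x. f (x + u)) = S i j' f" by (simp add: S_def)
    then show ?thesis using m[OF t ij(3)] m[OF t' ij(3)] by simp
  qed
  moreover have "m (ind (fil E i0)) = a"
  proof -
    note r = leq_refl[OF fs i0]
    have "(\<Sum>r\<in>R i0 i0. ind (fil E i0) r) = of_nat (card (R i0 i0))"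
      using transv_in[OF R[OF r]] by (simp add: ind_def)
    then show ?thesis
      using m[OF tf_ind[OF fs r] r] transv_card_pos[OF R[OF r] sg[OF i0]] by (simp add: S_def)
  qed
  ultimately show ?thesis by (auto simp: meas_def)
qed

lemma meas_nonzero_exists:
  fixes E :: "('k::{field,finite}, 'i, 'v::ab_group_add) filt"
  assumes c: "c1_space E"
  shows "\<exists>m\<in>meas E. m \<noteq> 0"
proof -
  obtain i where "i \<in> idx E" using idx_nonempty[OF c1_fs[OF c]] by blast
  then obtain m where "m \<in> meas E" "m (ind (fil E i)) = 1" using meas_exists[OF c] by blast
  then show ?thesis by (intro bexI[of _ m]) auto
qed

section \<open>Admissible triples\<close>

context
  fixes E1 :: "('k::{field,finite}, 'i1, 'a::ab_group_add) filt" and \<alpha> :: "'a \<Rightarrow> 'b::ab_group_add"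
    and E2 :: "('k, 'i2, 'b) filt" and \<beta> :: "'b \<Rightarrow> 'c::ab_group_add" and E3 :: "('k, 'i3, 'c) filt"
  assumes adm: "c1_admissible E1 \<alpha> E2 \<beta> E3"
begin

lemma
  shows adm_c1: "c1_space E1" "c1_space E2" "c1_space E3"
    and adm_exact: "exact_seq E1 \<alpha> E2 \<beta> E3"
  using adm by (simp_all add: c1_admissible_def)

lemma adm_fs: "filtered_space E1" "filtered_space E2" "filtered_space E3"
  using adm_c1 by (simp_all add: c1_fs)

lemma
  shows adm_alpha_add: "x \<in> spc E1 \<Longrightarrow> y \<in> spc E1 \<Longrightarrow> \<alpha> (x + y) = \<alpha> x + \<alpha> y"
    and adm_alpha_scl: "x \<in> spc E1 \<Longrightarrow> \<alpha> (scl E1 c x) = scl E2 c (\<alpha> x)"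
    and adm_beta_add: "z \<in> spc E2 \<Longrightarrow> w \<in> spc E2 \<Longrightarrow> \<beta> (z + w) = \<beta> z + \<beta> w"
    and adm_beta_scl: "z \<in> spc E2 \<Longrightarrow> \<beta> (scl E2 c z) = scl E3 c (\<beta> z)"
    and adm_inj: "x \<in> spc E1 \<Longrightarrow> y \<in> spc E1 \<Longrightarrow> \<alpha> x = \<alpha> y \<Longrightarrow> x = y"
  using adm_exact by (auto simp: exact_seq_def lin_on_def inj_on_def)

lemma
  shows adm_alpha_spc: "x \<in> spc E1 \<Longrightarrow> \<alpha> x \<in> spc E2"
    and adm_comp: "x \<in> spc E1 \<Longrightarrow> \<beta> (\<alpha> x) = 0"
    and adm_ker: "z \<in> spc E2 \<Longrightarrow> \<beta> z = 0 \<Longrightarrow> \<exists>x\<in>spc E1. z = \<alpha> x"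
    and adm_beta_spc: "z \<in> spc E2 \<Longrightarrow> \<beta> z \<in> spc E3"
  using adm_exact unfolding exact_seq_def by blast+

lemma adm_surj: "y \<in> spc E3 \<Longrightarrow> \<exists>z\<in>spc E2. \<beta> z = y"
proof -
  assume "y \<in> spc E3"
  then have "y \<in> \<beta> ` spc E2" using adm_exact by (simp add: exact_seq_def)
  then show ?thesis by auto
qed

lemma adm_alpha_0: "\<alpha> 0 = 0" and adm_beta_0: "\<beta> 0 = 0"
  using adm_alpha_add[OF spc_0 spc_0] adm_beta_add[OF spc_0 spc_0] adm_fs by auto

lemma adm_alpha_diff: "x \<in> spc E1 \<Longrightarrow> y \<in> spc E1 \<Longrightarrow> \<alpha> (x - y) = \<alpha> x - \<alpha> y"
  using adm_alpha_add[of "x - y" y] spc_diff[OF adm_fs(1)] by (simp add: algebra_simps)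

lemma adm_beta_diff: "x \<in> spc E2 \<Longrightarrow> y \<in> spc E2 \<Longrightarrow> \<beta> (x - y) = \<beta> x - \<beta> y"
  using adm_beta_add[of "x - y" y] spc_diff[OF adm_fs(2)] by (simp add: algebra_simps)

lemma adm_beta_eq: "z \<in> spc E2 \<Longrightarrow> w \<in> spc E2 \<Longrightarrow> \<beta> z = \<beta> w \<Longrightarrow> \<exists>x\<in>spc E1. z = w + \<alpha> x"
  using adm_ker[of "z - w"] adm_beta_diff[of z w] spc_diff[OF adm_fs(2)] by (auto simp: algebra_simps)

lemma adm_dom1: "\<exists>\<phi>. dominates_via E1 (idx E2) (leq E2) (fil_sub E1 \<alpha> E2) \<phi>"
  and adm_dom3: "\<exists>\<phi>. dominates_via E3 (idx E2) (leq E2) (\<lambda>i. \<beta> ` fil E2 i) \<phi>"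
  using adm unfolding c1_admissible_def by blast+

lemma adm_sub_fil: "i \<in> idx E2 \<Longrightarrow> \<exists>j\<in>idx E1. fil E1 j = fil_sub E1 \<alpha> E2 i"
  and adm_img_fil: "i \<in> idx E2 \<Longrightarrow> \<exists>j\<in>idx E3. fil E3 j = \<beta> ` fil E2 i"
  using adm_dom1 adm_dom3 unfolding dominates_via_def by metis+

lemma adm_pull_test:
  assumes f: "f \<in> test_fun E2"
  shows "pull E1 \<alpha> f \<in> test_fun E1"
proof -
  obtain i j where ij: "tf E2 i j f" using test_fun_tf[OF adm_fs(2) f] by blast
  have idx: "i \<in> idx E2" "j \<in> idx E2" using leq_idx[OF adm_fs(2) tf_leq[OF ij]] by auto
  obtain \<phi> where \<phi>: "dominates_via E1 (idx E2) (leq E2) (fil_sub E1 \<alpha> E2) \<phi>" using adm_dom1 by blast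
  then have \<phi>i: "fil E1 (\<phi> i) = fil_sub E1 \<alpha> E2 i" "fil E1 (\<phi> j) = fil_sub E1 \<alpha> E2 j"
    "(\<phi> i, \<phi> j) \<in> leq E1"
    using idx tf_leq[OF ij] by (auto simp: dominates_via_def)
  have "pull E1 \<alpha> f x = 0" if "x \<notin> fil E1 (\<phi> j)" for x
    using that tf_supp[OF ij, of "\<alpha> x"] \<phi>i(2) by (auto simp: pull_def cut_def fil_sub_def)
  moreover have "pull E1 \<alpha> f (x + u) = pull E1 \<alpha> f x" if "u \<in> fil E1 (\<phi> i)" for x u
  proof -
    have u: "u \<in> spc E1" "\<alpha> u \<in> fil E2 i" using that \<phi>i(1) by (auto simp: fil_sub_def)
    show ?thesis
      using tf_per[OF ij u(2)] spc_add_iff[OF adm_fs(1) u(1)] u(1) by (simp add: pull_def cut_def adm_alpha_add)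
  qed
  ultimately have "tf E1 (\<phi> i) (\<phi> j) (pull E1 \<alpha> f)" using \<phi>i(3) by (auto simp: tf_def)
  then show ?thesis by (rule tf_test_fun[OF adm_fs(1)])
qed

abbreviation "slice w f \<equiv> cut (spc E1) (\<lambda>v. f (w + \<alpha> v))"

lemma slice_test:
  assumes "f \<in> test_fun E2" "w \<in> spc E2"
  shows "slice w f \<in> test_fun E1"
  using adm_pull_test[OF test_fun_translate[OF adm_fs(2) assms]] by (simp add: pull_def add.commute)

text \<open>Two lifts of a point differ by an element of V1, and the resulting shift of the slice is
  absorbed by the invariance of \<open>m\<close>. This makes the \<open>SOME\<close> in
  \<open>fibre_integral\<close> harmless.\<close>

lemma slice_indep:
  assumes f: "f \<in> test_fun E2" and m: "m \<in> meas E1"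
    and w: "w \<in> spc E2" "w' \<in> spc E2" "\<beta> w = \<beta> w'"
  shows "m (slice w f) = m (slice w' f)"
proof -
  obtain u where u: "u \<in> spc E1" "w = w' + \<alpha> u" using adm_beta_eq[OF w] by blast
  have "slice w f = (\<lambda>v. slice w' f (v + u))"
    using u spc_add_iff[OF adm_fs(1) u(1)] by (auto simp: fun_eq_iff cut_def adm_alpha_add algebra_simps)
  then show ?thesis using meas_translate[OF m slice_test[OF f w(2)] u(1)] by simp
qed

lemma fibre_at:
  assumes f: "f \<in> test_fun E2" and m: "m \<in> meas E1" and w: "w \<in> spc E2"
  shows "fibre_integral E1 \<alpha> E2 \<beta> E3 m f (\<beta> w) = m (slice w f)"
proof -
  let ?w = "SOME w'. w' \<in> spc E2 \<and> \<beta> w' = \<beta> w"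
  have "?w \<in> spc E2 \<and> \<beta> ?w = \<beta> w" by (rule someI[of _ w]) (use w in simp)
  then show ?thesis
    using slice_indep[OF f m _ w, of ?w] adm_beta_spc[OF w] by (simp add: fibre_integral_def)
qed

lemma fibre_out: "y \<notin> spc E3 \<Longrightarrow> fibre_integral E1 \<alpha> E2 \<beta> E3 m f y = 0"
  by (simp add: fibre_integral_def)

text \<open>Equality is tested on lifts in \<open>spc E2\<close>, where the integral is explicit and
  no chosen preimage occurs; the identities of fibre integrals below rest on this.\<close>

lemma fibre_eqI:
  assumes f: "f \<in> test_fun E2" and m: "m \<in> meas E1"
    and "\<And>w. w \<in> spc E2 \<Longrightarrow> m (slice w f) = g (\<beta> w)" "\<And>y. y \<notin> spc E3 \<Longrightarrow> g y = 0"
  shows "fibre_integral E1 \<alpha> E2 \<beta> E3 m f = g"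
proof
  fix y
  show "fibre_integral E1 \<alpha> E2 \<beta> E3 m f y = g y"
  proof (cases "y \<in> spc E3")
    case True
    then obtain w where "w \<in> spc E2" "\<beta> w = y" using adm_surj by blast
    then show ?thesis using fibre_at[OF f m] assms(3) by metis
  next
    case False
    then show ?thesis using fibre_out assms(4) by simp
  qed
qed

lemma fibre_test:
  assumes f: "f \<in> test_fun E2" and m: "m \<in> meas E1"
  shows "fibre_integral E1 \<alpha> E2 \<beta> E3 m f \<in> test_fun E3"
proof -
  let ?g = "fibre_integral E1 \<alpha> E2 \<beta> E3 m f"
  obtain i j where ij: "tf E2 i j f" using test_fun_tf[OF adm_fs(2) f] by blast
  have idx: "i \<in> idx E2" "j \<in> idx E2" using leq_idx[OF adm_fs(2) tf_leq[OF ij]] by auto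
  obtain \<phi> where \<phi>: "dominates_via E3 (idx E2) (leq E2) (\<lambda>i. \<beta> ` fil E2 i) \<phi>" using adm_dom3 by blast
  then have \<phi>i: "fil E3 (\<phi> i) = \<beta> ` fil E2 i" "fil E3 (\<phi> j) = \<beta> ` fil E2 j" "(\<phi> i, \<phi> j) \<in> leq E3"
    "\<phi> i \<in> idx E3"
    using idx tf_leq[OF ij] by (auto simp: dominates_via_def)
  have "?g y = 0" if "y \<notin> fil E3 (\<phi> j)" for y
  proof (cases "y \<in> spc E3")
    case True
    then obtain w where w: "w \<in> spc E2" "\<beta> w = y" using adm_surj by blast
    have "f (w + \<alpha> v) = 0" if v: "v \<in> spc E1" for v
    proof (rule tf_supp[OF ij])
      have "\<beta> (w + \<alpha> v) = y" using adm_beta_add[OF w(1) adm_alpha_spc[OF v]] adm_comp[OF v] w by simp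
      then show "w + \<alpha> v \<notin> fil E2 j" using \<open>y \<notin> fil E3 (\<phi> j)\<close> \<phi>i(2) by blast
    qed
    then have "slice w f = 0" by (auto simp: fun_eq_iff cut_def)
    then show ?thesis using fibre_at[OF f m w(1)] w(2) dist_0[OF adm_fs(1) meas_dist[OF m]] by simp
  qed (rule fibre_out)
  moreover have "?g (y + u) = ?g y" if u: "u \<in> fil E3 (\<phi> i)" for y u
  proof (cases "y \<in> spc E3")
    case True
    then obtain w where w: "w \<in> spc E2" "\<beta> w = y" using adm_surj by blast
    obtain z where z: "z \<in> fil E2 i" "u = \<beta> z" using u \<phi>i(1) by blast
    have zs: "z \<in> spc E2" using z fil_spc[OF adm_fs(2) idx(1)] by blast
    have "slice (w + z) f = slice w f"
      using tf_per[OF ij z(1)] by (auto simp: fun_eq_iff cut_def add.assoc add.commute[of z])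
        (metis add.assoc add.commute)
    moreover have "\<beta> (w + z) = y + u" using adm_beta_add[OF w(1) zs] w z by simp
    ultimately show ?thesis
      using fibre_at[OF f m w(1)] fibre_at[OF f m spc_add[OF adm_fs(2) w(1) zs]] w by simp
  next
    case False
    then show ?thesis
      using fibre_out spc_add_iff[OF adm_fs(3) fil_spc[OF adm_fs(3) \<phi>i(4) u]] by simp
  qed
  ultimately have "tf E3 (\<phi> i) (\<phi> j) ?g" using \<phi>i(3) by (auto simp: tf_def)
  then show ?thesis by (rule tf_test_fun[OF adm_fs(3)])
qed

lemma fibre_lin:
  assumes f: "f \<in> test_fun E2" and g: "g \<in> test_fun E2" and m: "m \<in> meas E1"
  shows "fibre_integral E1 \<alpha> E2 \<beta> E3 m (fscale c f + g) =
    fscale c (fibre_integral E1 \<alpha> E2 \<beta> E3 m f) + fibre_integral E1 \<alpha> E2 \<beta> E3 m g"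
proof (rule fibre_eqI[OF test_fun_lin[OF adm_fs(2) f g] m])
  fix w assume w: "w \<in> spc E2"
  have "slice w (fscale c f + g) = fscale c (slice w f) + slice w g"
    by (auto simp: fun_eq_iff cut_def)
  then show "m (slice w (fscale c f + g)) =
      (fscale c (fibre_integral E1 \<alpha> E2 \<beta> E3 m f) + fibre_integral E1 \<alpha> E2 \<beta> E3 m g) (\<beta> w)"
    using fibre_at[OF f m w] fibre_at[OF g m w]
      dist_lin[OF adm_fs(1) meas_dist[OF m] slice_test[OF f w] slice_test[OF g w]] by simp
qed (simp add: fibre_out)

lemma fibre_scale: "fibre_integral E1 \<alpha> E2 \<beta> E3 (fscale s m) f = fscale s (fibre_integral E1 \<alpha> E2 \<beta> E3 m f)"
  by (auto simp: fibre_integral_def cut_def fun_eq_iff)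

lemma pull_dist_apply:
  "f \<in> test_fun E2 \<Longrightarrow> pull_dist E1 \<alpha> E2 \<beta> E3 m G f = G (fibre_integral E1 \<alpha> E2 \<beta> E3 m f)"
  by (simp add: pull_dist_def)

lemma pull_dist_dists:
  assumes m: "m \<in> meas E1" and G: "G \<in> dists E3"
  shows "pull_dist E1 \<alpha> E2 \<beta> E3 m G \<in> dists E2"
proof (rule distI[OF _ _ adm_fs(2)])
  fix f g c assume f: "f \<in> test_fun E2" and g: "g \<in> test_fun E2"
  show "pull_dist E1 \<alpha> E2 \<beta> E3 m G (fscale c f + g) =
      c * pull_dist E1 \<alpha> E2 \<beta> E3 m G f + pull_dist E1 \<alpha> E2 \<beta> E3 m G g"
    using dist_lin[OF adm_fs(3) G fibre_test[OF f m] fibre_test[OF g m], of c]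
    by (simp add: pull_dist_apply f g test_fun_lin[OF adm_fs(2)] fibre_lin m)
qed (simp add: pull_dist_def)

lemma pull_dist_scale:
  assumes m: "m \<in> meas E1" and G: "G \<in> dists E3"
  shows "pull_dist E1 \<alpha> E2 \<beta> E3 (fscale s m) (fscale t G) = fscale (s * t) (pull_dist E1 \<alpha> E2 \<beta> E3 m G)"
  by (auto simp: pull_dist_def cut_def fun_eq_iff fibre_scale dist_scale[OF G fibre_test[OF _ m]])

lemma pull_dist_meas:
  assumes m: "m \<in> meas E1" and n: "n \<in> meas E3"
  shows "pull_dist E1 \<alpha> E2 \<beta> E3 m n \<in> meas E2"
  unfolding meas_def
proof (intro CollectI conjI ballI)
  show "pull_dist E1 \<alpha> E2 \<beta> E3 m n \<in> dists E2" by (rule pull_dist_dists[OF m meas_dist[OF n]])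
  fix f u assume f: "f \<in> test_fun E2" and u: "u \<in> spc E2"
  note fu = test_fun_translate[OF adm_fs(2) f u]
  have "fibre_integral E1 \<alpha> E2 \<beta> E3 m (\<lambda>x. f (x + u)) =
      (\<lambda>y. fibre_integral E1 \<alpha> E2 \<beta> E3 m f (y + \<beta> u))"
  proof (rule fibre_eqI[OF fu m])
    fix w assume w: "w \<in> spc E2"
    have "slice w (\<lambda>x. f (x + u)) = slice (w + u) f"
      by (auto simp: fun_eq_iff cut_def algebra_simps)
    then show "m (slice w (\<lambda>x. f (x + u))) = fibre_integral E1 \<alpha> E2 \<beta> E3 m f (\<beta> w + \<beta> u)"
      using fibre_at[OF f m spc_add[OF adm_fs(2) w u]] adm_beta_add[OF w u] by simp
  next
    fix y assume "y \<notin> spc E3"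
    then show "fibre_integral E1 \<alpha> E2 \<beta> E3 m f (y + \<beta> u) = 0"
      using fibre_out spc_add_iff[OF adm_fs(3) adm_beta_spc[OF u]] by simp
  qed
  then show "pull_dist E1 \<alpha> E2 \<beta> E3 m n (\<lambda>x. f (x + u)) = pull_dist E1 \<alpha> E2 \<beta> E3 m n f"
    using meas_translate[OF n fibre_test[OF f m] adm_beta_spc[OF u]]
    by (simp add: pull_dist_apply f fu)
qed

text \<open>The slice through a point of F2(j) is the indicator of V1 \<inter> F2(j), and a slice
  that misses F2(j) is 0. Integration over the fibres thus gives a multiple of the indicator of
  \<beta>(F2(j)).\<close>

lemma pull_dist_ind:
  assumes m: "m \<in> meas E1" and n: "n \<in> meas E3" and j: "j \<in> idx E2"
  shows "pull_dist E1 \<alpha> E2 \<beta> E3 m n (ind (fil E2 j)) =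
    m (ind (fil_sub E1 \<alpha> E2 j)) * n (ind (\<beta> ` fil E2 j))"
proof -
  note t = ind_test_fun[OF adm_fs(2) j]
  obtain j3 where j3: "j3 \<in> idx E3" "fil E3 j3 = \<beta> ` fil E2 j" using adm_img_fil[OF j] by blast
  have "fibre_integral E1 \<alpha> E2 \<beta> E3 m (ind (fil E2 j)) =
      fscale (m (ind (fil_sub E1 \<alpha> E2 j))) (ind (\<beta> ` fil E2 j))"
  proof (rule fibre_eqI[OF t m])
    fix w assume w: "w \<in> spc E2"
    show "m (slice w (ind (fil E2 j))) = fscale (m (ind (fil_sub E1 \<alpha> E2 j))) (ind (\<beta> ` fil E2 j)) (\<beta> w)"
    proof (cases "\<beta> w \<in> \<beta> ` fil E2 j")
      case True
      then obtain z where z: "z \<in> fil E2 j" "\<beta> w = \<beta> z" by blast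
      have zs: "z \<in> spc E2" using z fil_spc[OF adm_fs(2) j] by blast
      have "z + \<alpha> v \<in> fil E2 j \<longleftrightarrow> \<alpha> v \<in> fil E2 j" for v
        using fil_add[OF adm_fs(2) j z(1), of "\<alpha> v"] fil_diff[OF adm_fs(2) j, of "z + \<alpha> v" z] z by auto
      then have "slice z (ind (fil E2 j)) = ind (fil_sub E1 \<alpha> E2 j)"
        by (auto simp: fun_eq_iff cut_def ind_def fil_sub_def)
      then show ?thesis using slice_indep[OF t m w zs z(2)] True by (simp add: ind_def)
    next
      case False
      have "\<beta> (w + \<alpha> v) = \<beta> w" if "v \<in> spc E1" for v
        using adm_beta_add[OF w adm_alpha_spc[OF that]] adm_comp[OF that] by simp
      then have "w + \<alpha> v \<notin> fil E2 j" if "v \<in> spc E1" for v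
        using False that image_eqI by metis
      then have "slice w (ind (fil E2 j)) = 0" by (auto simp: fun_eq_iff cut_def ind_def)
      then show ?thesis using False dist_0[OF adm_fs(1) meas_dist[OF m]] by (simp add: ind_def)
    qed
  next
    fix y assume "y \<notin> spc E3"
    then have "y \<notin> \<beta> ` fil E2 j" using j3 fil_spc[OF adm_fs(3) j3(1)] by blast
    then show "fscale (m (ind (fil_sub E1 \<alpha> E2 j))) (ind (\<beta> ` fil E2 j)) y = 0" by (simp add: ind_def)
  qed
  then show ?thesis
    using dist_scale[OF meas_dist[OF n] ind_test_fun[OF adm_fs(3) j3(1)]] j3 by (simp add: pull_dist_apply t)
qed

text \<open>Fubini: the product measure integrates over the fibres first.\<close>

lemma meas_tensor_eq:
  assumes m: "m \<in> meas E1" and n: "n \<in> meas E3"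
  shows "meas_tensor E1 \<alpha> E2 \<beta> E3 m n = pull_dist E1 \<alpha> E2 \<beta> E3 m n"
  unfolding meas_tensor_def
proof (rule the_equality)
  show "pull_dist E1 \<alpha> E2 \<beta> E3 m n \<in> meas E2 \<and>
    (\<forall>j\<in>idx E2. pull_dist E1 \<alpha> E2 \<beta> E3 m n (ind (fil E2 j)) =
        m (ind (fil_sub E1 \<alpha> E2 j)) * n (ind (\<beta> ` fil E2 j)))"
    using pull_dist_meas[OF m n] pull_dist_ind[OF m n] by blast
  fix p assume p: "p \<in> meas E2 \<and>
    (\<forall>j\<in>idx E2. p (ind (fil E2 j)) = m (ind (fil_sub E1 \<alpha> E2 j)) * n (ind (\<beta> ` fil E2 j)))"
  obtain j where j: "j \<in> idx E2" using idx_nonempty[OF adm_fs(2)] by blast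
  show "p = pull_dist E1 \<alpha> E2 \<beta> E3 m n"
    using p j pull_dist_ind[OF m n j] by (intro meas_eqI[OF adm_c1(2) _ pull_dist_meas[OF m n] j]) auto
qed

lemma tensor_nz:
  assumes "m \<in> meas E1" "n \<in> meas E3" "m \<noteq> 0" "n \<noteq> 0"
  shows "pull_dist E1 \<alpha> E2 \<beta> E3 m n \<noteq> 0"
proof -
  obtain j where j: "j \<in> idx E2" using idx_nonempty[OF adm_fs(2)] by blast
  obtain j1 where j1: "j1 \<in> idx E1" "fil E1 j1 = fil_sub E1 \<alpha> E2 j" using adm_sub_fil[OF j] by blast
  obtain j3 where j3: "j3 \<in> idx E3" "fil E3 j3 = \<beta> ` fil E2 j" using adm_img_fil[OF j] by blast
  show ?thesis
    using pull_dist_ind[OF assms(1,2) j] meas_nz[OF adm_c1(1) assms(1,3) j1(1)]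
      meas_nz[OF adm_c1(3) assms(2,4) j3(1)] j1 j3 by auto
qed

lemma push_dist_dists:
  assumes G: "G \<in> dists E1"
  shows "push_dist E1 \<alpha> E2 G \<in> dists E2"
proof (rule distI[OF _ _ adm_fs(2)])
  fix f g c assume f: "f \<in> test_fun E2" and g: "g \<in> test_fun E2"
  have "pull E1 \<alpha> (fscale c f + g) = fscale c (pull E1 \<alpha> f) + pull E1 \<alpha> g"
    by (auto simp: fun_eq_iff pull_def cut_def)
  then show "push_dist E1 \<alpha> E2 G (fscale c f + g) = c * push_dist E1 \<alpha> E2 G f + push_dist E1 \<alpha> E2 G g"
    using dist_lin[OF adm_fs(1) G adm_pull_test[OF f] adm_pull_test[OF g], of c]
    by (simp add: push_dist_def f g test_fun_lin[OF adm_fs(2)])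
qed (simp add: push_dist_def)

end

section \<open>Base change and integration in stages\<close>

lemma push_dist_scale: "push_dist E1 \<alpha> E2 (fscale c G) = fscale c (push_dist E1 \<alpha> E2 G)"
  by (auto simp: push_dist_def cut_def fun_eq_iff)

text \<open>The map \<open>g\<close> carries the fibre through \<open>w\<close> to the fibre through
  \<open>g w\<close>, acting by \<open>k\<close> on fibres, and \<open>m'\<close> is the image of
  \<open>m\<close>; so both sides integrate the same function. It is applied with \<open>k\<close>
  the identity for transitions within one space, and with \<open>k\<close> induced by \<alpha> for
  direct images.\<close>

lemma fibre_base_change:
  fixes A :: "('k::{field,finite}, 'i, 'a::ab_group_add) filt"
  assumes T: "c1_admissible A \<alpha> B \<beta> C" and T': "c1_admissible A' \<alpha>' B' \<beta>' C'"
    and m: "m \<in> meas A" and m': "m' \<in> meas A'" "m' = push_dist A k A' m"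
    and k: "\<And>x. x \<in> spc A \<Longrightarrow> k x \<in> spc A' \<and> g (\<alpha> x) = \<alpha>' (k x)"
    and g: "\<And>x. x \<in> spc B \<Longrightarrow> g x \<in> spc B' \<and> h (\<beta> x) = \<beta>' (g x)"
    and add: "\<And>x y. x \<in> spc B \<Longrightarrow> y \<in> spc B \<Longrightarrow> g (x + y) = g x + g y"
    and f: "f \<in> test_fun B'" and gf: "pull B g f \<in> test_fun B"
  shows "pull C h (fibre_integral A' \<alpha>' B' \<beta>' C' m' f) = fibre_integral A \<alpha> B \<beta> C m (pull B g f)"
proof (rule fibre_eqI[OF T gf m, symmetric])
  fix w assume w: "w \<in> spc B"
  let ?s = "cut (spc A') (\<lambda>v. f (g w + \<alpha>' v))"
  have gw: "g w \<in> spc B'" using g w by blast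
  have "pull A k ?s = cut (spc A) (\<lambda>v. pull B g f (w + \<alpha> v))"
  proof
    fix v
    show "pull A k ?s v = cut (spc A) (\<lambda>v. pull B g f (w + \<alpha> v)) v"
    proof (cases "v \<in> spc A")
      case True
      then show ?thesis
        using k[OF True] add[OF w adm_alpha_spc[OF T True]]
          spc_add[OF adm_fs(2)[OF T] w adm_alpha_spc[OF T True]]
        by (simp add: pull_def)
    qed (simp add: pull_def)
  qed
  then have "m (cut (spc A) (\<lambda>v. pull B g f (w + \<alpha> v))) = m' ?s"
    using slice_test[OF T' f gw] by (simp add: m'(2) push_dist_def)
  also have "\<dots> = pull C h (fibre_integral A' \<alpha>' B' \<beta>' C' m' f) (\<beta> w)"
    using fibre_at[OF T' f m'(1) gw] g[OF w] adm_beta_spc[OF T w] by (simp add: pull_def)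
  finally show "m (cut (spc A) (\<lambda>v. pull B g f (w + \<alpha> v))) =
    pull C h (fibre_integral A' \<alpha>' B' \<beta>' C' m' f) (\<beta> w)" .
qed (simp add: pull_def)

lemma push_dist_id:
  assumes "G \<in> dists A" "\<And>x. x \<in> spc A \<Longrightarrow> k x = x"
  shows "push_dist A k A G = G"
proof
  fix f
  have "pull A k f = f" if "f \<in> test_fun A"
    using assms(2) test_fun_out[OF that] by (auto simp: fun_eq_iff pull_def cut_def)
  then show "push_dist A k A G f = G f"
    using dist_out[OF assms(1), of f] by (cases "f \<in> test_fun A") (auto simp: push_dist_def)
qed

text \<open>Think of A \<subseteq> B \<subseteq> X with Y = X/A, Z = X/B and C = B/A: integrating
  over A and then over B/A is integrating over B.\<close>

lemma fibre_comp:
  fixes A :: "('k::{field,finite}, 'i, 'a::ab_group_add) filt"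
  assumes AXY: "c1_admissible A i1 X p1 Y" and CYZ: "c1_admissible C i2 Y p2 Z"
    and BXZ: "c1_admissible B i3 X p3 Z" and ABC: "c1_admissible A a B b C"
    and i: "\<And>x. x \<in> spc A \<Longrightarrow> i3 (a x) = i1 x"
    and p: "\<And>x. x \<in> spc X \<Longrightarrow> p2 (p1 x) = p3 x"
    and ip: "\<And>x. x \<in> spc B \<Longrightarrow> p1 (i3 x) = i2 (b x)"
    and m: "m \<in> meas A" and n: "n \<in> meas C" and f: "f \<in> test_fun X"
  shows "fibre_integral C i2 Y p2 Z n (fibre_integral A i1 X p1 Y m f) =
    fibre_integral B i3 X p3 Z (pull_dist A a B b C m n) f"
proof (rule fibre_eqI[OF BXZ f pull_dist_meas[OF ABC m n], symmetric])
  fix x assume x: "x \<in> spc X"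
  let ?g = "cut (spc B) (\<lambda>v. f (x + i3 v))"
  note g = slice_test[OF BXZ f x]
  have px: "p1 x \<in> spc Y" using adm_beta_spc[OF AXY x] .
  have "fibre_integral A a B b C m ?g = cut (spc C) (\<lambda>v. fibre_integral A i1 X p1 Y m f (p1 x + i2 v))"
  proof (rule fibre_eqI[OF ABC g m])
    fix v assume v: "v \<in> spc B"
    have xv: "i3 v \<in> spc X" "x + i3 v \<in> spc X"
      using spc_add[OF adm_fs(2)[OF AXY] x] adm_alpha_spc[OF BXZ v] by auto
    have "cut (spc A) (\<lambda>u. ?g (v + a u)) = cut (spc A) (\<lambda>u. f (x + i3 v + i1 u))"
      using i v adm_alpha_add[OF BXZ v] adm_alpha_spc[OF ABC] spc_add[OF adm_fs(1)[OF BXZ] v]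
      by (auto simp: fun_eq_iff cut_def add.assoc)
    then have "m (cut (spc A) (\<lambda>u. ?g (v + a u))) = fibre_integral A i1 X p1 Y m f (p1 (x + i3 v))"
      using fibre_at[OF AXY f m xv(2)] by simp
    also have "p1 (x + i3 v) = p1 x + i2 (b v)"
      using adm_beta_add[OF AXY x xv(1)] ip[OF v] by simp
    finally show "m (cut (spc A) (\<lambda>u. ?g (v + a u))) =
      cut (spc C) (\<lambda>v. fibre_integral A i1 X p1 Y m f (p1 x + i2 v)) (b v)"
      using adm_beta_spc[OF ABC v] by simp
  qed simp
  then have "pull_dist A a B b C m n ?g = n (cut (spc C) (\<lambda>v. fibre_integral A i1 X p1 Y m f (p1 x + i2 v)))"
    using pull_dist_apply[OF ABC g] by simp
  also have "\<dots> = fibre_integral C i2 Y p2 Z n (fibre_integral A i1 X p1 Y m f) (p2 (p1 x))"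
    using fibre_at[OF CYZ fibre_test[OF AXY f m] n px] by simp
  finally show "pull_dist A a B b C m n ?g =
      fibre_integral C i2 Y p2 Z n (fibre_integral A i1 X p1 Y m f) (p3 x)"
    using p[OF x] by simp
qed (simp add: fibre_out[OF CYZ])

lemma pull_dist_comp:
  fixes A :: "('k::{field,finite}, 'i, 'a::ab_group_add) filt"
  assumes AXY: "c1_admissible A i1 X p1 Y" and CYZ: "c1_admissible C i2 Y p2 Z"
    and BXZ: "c1_admissible B i3 X p3 Z" and ABC: "c1_admissible A a B b C"
    and i: "\<And>x. x \<in> spc A \<Longrightarrow> i3 (a x) = i1 x"
    and p: "\<And>x. x \<in> spc X \<Longrightarrow> p2 (p1 x) = p3 x"
    and ip: "\<And>x. x \<in> spc B \<Longrightarrow> p1 (i3 x) = i2 (b x)"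
    and m: "m \<in> meas A" and n: "n \<in> meas C"
  shows "pull_dist A i1 X p1 Y m (pull_dist C i2 Y p2 Z n G) =
    pull_dist B i3 X p3 Z (pull_dist A a B b C m n) G"
proof
  fix f
  show "pull_dist A i1 X p1 Y m (pull_dist C i2 Y p2 Z n G) f =
    pull_dist B i3 X p3 Z (pull_dist A a B b C m n) G f"
  proof (cases "f \<in> test_fun X")
    case True
    then show ?thesis
      using fibre_comp[OF AXY CYZ BXZ ABC i p ip m n True] fibre_test[OF AXY True m]
      by (simp add: pull_dist_def)
  qed (simp add: pull_dist_def)
qed

section \<open>The three-by-three lemma for measures\<close>

text \<open>\<open>Z\<close> induces an isomorphism between the two quotients (Goursat), so that these have the same
  number of elements.\<close>

lemma meas_goursat:
  fixes P :: "('k::{field,finite}, 'i, 'v::ab_group_add) filt" and Q :: "('k, 'j, 'w::ab_group_add) filt"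
  assumes c: "c1_space P" "c1_space Q" and m: "m \<in> meas P" and n: "n \<in> meas Q"
    and i: "i \<in> idx P" "i' \<in> idx P" "fil P i \<subseteq> fil P i'"
    and j: "j \<in> idx Q" "j' \<in> idx Q" "fil Q j \<subseteq> fil Q j'"
    and Z: "\<And>x. x \<in> fil P i' \<Longrightarrow> \<exists>y\<in>fil Q j'. Z x y" "\<And>y. y \<in> fil Q j' \<Longrightarrow> \<exists>x\<in>fil P i'. Z x y"
    and diff: "\<And>x y x' y'. x \<in> fil P i' \<Longrightarrow> x' \<in> fil P i' \<Longrightarrow> y \<in> fil Q j' \<Longrightarrow> y' \<in> fil Q j' \<Longrightarrow>
      Z x y \<Longrightarrow> Z x' y' \<Longrightarrow> x - x' \<in> fil P i \<longleftrightarrow> y - y' \<in> fil Q j"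
  shows "m (ind (fil P i')) * n (ind (fil Q j)) = m (ind (fil P i)) * n (ind (fil Q j'))"
proof -
  obtain R where R: "transv R (fil P i') (fil P i)"
    and mR: "m (ind (fil P i')) = of_nat (card R) * m (ind (fil P i))"
    using meas_index_subset[OF c(1) i] m by blast
  obtain S where S: "transv S (fil Q j') (fil Q j)"
    and nS: "n (ind (fil Q j')) = of_nat (card S) * n (ind (fil Q j))"
    using meas_index_subset[OF c(2) j] n by blast
  note sg = fil_subgroup[OF c1_fs[OF c(1)]] fil_subgroup[OF c1_fs[OF c(2)]]
  define s where "s x = (SOME y. y \<in> fil Q j' \<and> Z x y)" for x
  have s: "s x \<in> fil Q j' \<and> Z x (s x)" if "x \<in> fil P i'" for x
    unfolding s_def by (rule someI_ex) (use Z(1)[OF that] in blast)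
  have inj: "x = y" if "x \<in> R" "y \<in> R" "s x - s y \<in> fil Q j" for x y
    using transv_eq[OF R that(1,2) _ sg(1)[OF i(1)]] diff s transv_in[OF R] that by blast
  have "transv (s ` R) (fil Q j') (fil Q j)"
  proof (rule transvI)
    show "finite (s ` R)" using transv_finite[OF R] by simp
    show "s ` R \<subseteq> fil Q j'" using s transv_in[OF R] by blast
    show "\<exists>r\<in>s ` R. y - r \<in> fil Q j" if y: "y \<in> fil Q j'" for y
    proof -
      obtain x where x: "x \<in> fil P i'" "Z x y" using Z(2)[OF y] by blast
      obtain r where r: "r \<in> R" "x - r \<in> fil P i" using transv_ex[OF R x(1)] by blast
      then show ?thesis using diff[of x r y "s r"] s[of r] x y transv_in[OF R r(1)] by blast
    qed
    show "r = t" if "r \<in> s ` R" "t \<in> s ` R" "r - t \<in> fil Q j" for r t using inj that by blast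
  qed (rule sg(2)[OF j(1)])
  then have "card S = card (s ` R)"
    using transv_card[OF S _ sg(2)[OF j(2)] sg(2)[OF j(1)] j(3)] by blast
  also have "\<dots> = card R"
    by (rule card_image) (use inj sg_0[OF sg(2)[OF j(1)]] in \<open>auto simp: inj_on_def\<close>)
  finally show ?thesis using mR nS by simp
qed


text \<open>Both sides are invariant measures, so their masses on one F = F(x) in B2 suffice. Each
  mass is a product of four factors, one for each corner of the square. The factors at A1 and C3
  agree because the induced subspaces do; those at A3 and C1 may differ separately, and only their
  product is the same.\<close>

lemma tensor_three_by_three:
  fixes A1 :: "('k::{field,finite}, 'ia1, 'a1::ab_group_add) filt"
    and B2 :: "('k, 'ib2, 'b2::ab_group_add) filt" and C1 :: "('k, 'ic1, 'c1::ab_group_add) filt"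
    and A3 :: "('k, 'ia3, 'a3::ab_group_add) filt"
  assumes A: "c1_admissible A1 ai A2 ap A3" and B: "c1_admissible B1 bi B2 bp B3"
    and C: "c1_admissible C1 ci C2 cp C3"
    and V1: "c1_admissible A1 f1 B1 g1 C1" and V2: "c1_admissible A2 f2 B2 g2 C2"
    and V3: "c1_admissible A3 f3 B3 g3 C3"
    and fi: "\<And>x. x \<in> spc A1 \<Longrightarrow> f2 (ai x) = bi (f1 x)" and fp: "\<And>x. x \<in> spc A2 \<Longrightarrow> f3 (ap x) = bp (f2 x)"
    and gi: "\<And>x. x \<in> spc B1 \<Longrightarrow> g2 (bi x) = ci (g1 x)" and gp: "\<And>x. x \<in> spc B2 \<Longrightarrow> g3 (bp x) = cp (g2 x)"
    and m: "a1 \<in> meas A1" "a3 \<in> meas A3" "c1 \<in> meas C1" "c3 \<in> meas C3"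
  shows "pull_dist B1 bi B2 bp B3 (pull_dist A1 f1 B1 g1 C1 a1 c1) (pull_dist A3 f3 B3 g3 C3 a3 c3) =
    pull_dist A2 f2 B2 g2 C2 (pull_dist A1 ai A2 ap A3 a1 a3) (pull_dist C1 ci C2 cp C3 c1 c3)"
    (is "?L = ?R")
proof -
  note fs = adm_fs[OF A] adm_fs[OF B] adm_fs[OF C]
  note mb = pull_dist_meas[OF V1 m(1,3)] pull_dist_meas[OF V3 m(2,4)]
  note mac = pull_dist_meas[OF A m(1,2)] pull_dist_meas[OF C m(3,4)]
  obtain x where x: "x \<in> idx B2" using idx_nonempty[OF fs(5)] by blast
  let ?F = "fil B2 x"
  have F: "u \<in> spc B2" if "u \<in> ?F" for u using fil_spc[OF fs(5) x that] .
  obtain p where p: "p \<in> idx B1" "fil B1 p = fil_sub B1 bi B2 x" using adm_sub_fil[OF B x] by blast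
  obtain q where q: "q \<in> idx B3" "fil B3 q = bp ` ?F" using adm_img_fil[OF B x] by blast
  obtain r where r: "r \<in> idx A2" "fil A2 r = fil_sub A2 f2 B2 x" using adm_sub_fil[OF V2 x] by blast
  obtain s where s: "s \<in> idx C2" "fil C2 s = g2 ` ?F" using adm_img_fil[OF V2 x] by blast
  obtain a0 where a0: "a0 \<in> idx A3" "fil A3 a0 = ap ` fil A2 r" using adm_img_fil[OF A r(1)] by blast
  obtain a' where a': "a' \<in> idx A3" "fil A3 a' = fil_sub A3 f3 B3 q" using adm_sub_fil[OF V3 q(1)] by blast
  obtain d0 where d0: "d0 \<in> idx C1" "fil C1 d0 = g1 ` fil B1 p" using adm_img_fil[OF V1 p(1)] by blast
  obtain d' where d': "d' \<in> idx C1" "fil C1 d' = fil_sub C1 ci C2 s" using adm_sub_fil[OF C s(1)] by blast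
  have L: "?L (ind ?F) = a1 (ind (fil_sub A1 f1 B1 p)) * c1 (ind (fil C1 d0)) *
      (a3 (ind (fil A3 a')) * c3 (ind (g3 ` fil B3 q)))"
    using pull_dist_ind[OF B mb x] pull_dist_ind[OF V1 m(1,3) p(1)] pull_dist_ind[OF V3 m(2,4) q(1)]
    by (simp add: p(2) q(2) a'(2) d0(2))
  have R: "?R (ind ?F) = a1 (ind (fil_sub A1 ai A2 r)) * a3 (ind (fil A3 a0)) *
      (c1 (ind (fil C1 d')) * c3 (ind (cp ` fil C2 s)))"
    using pull_dist_ind[OF V2 mac x] pull_dist_ind[OF A m(1,2) r(1)] pull_dist_ind[OF C m(3,4) s(1)]
    by (simp add: r(2) s(2) a0(2) d'(2))
  have "fil_sub A1 f1 B1 p = fil_sub A1 ai A2 r"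
    using fi adm_alpha_spc[OF V1] adm_alpha_spc[OF A] by (auto simp: p(2) r(2) fil_sub_def)
  moreover have "g3 ` fil B3 q = cp ` fil C2 s"
    using gp F by (force simp: q(2) s(2))
  \<comment> \<open>\<open>a0\<close> and \<open>d0\<close> arise by intersecting F first and
    projecting afterwards, \<open>a'\<close> and \<open>d'\<close> in the opposite order. Elements
    of A3 and C1 that come from a common \<open>y\<close> in F match the quotients
    \<open>a'\<close>/\<open>a0\<close> and \<open>d'\<close>/\<open>d0\<close>.\<close>
  moreover have "a3 (ind (fil A3 a')) * c1 (ind (fil C1 d0)) = a3 (ind (fil A3 a0)) * c1 (ind (fil C1 d'))"
  proof (rule meas_goursat[where Z = "\<lambda>u w. \<exists>y\<in>?F. bp y = f3 u \<and> g2 y = ci w"])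
    show "c1_space A3" "c1_space C1" using adm_c1[OF A] adm_c1[OF C] by auto
    show "a3 \<in> meas A3" "c1 \<in> meas C1" "a0 \<in> idx A3" "a' \<in> idx A3" "d0 \<in> idx C1" "d' \<in> idx C1"
      by fact+
    show "fil A3 a0 \<subseteq> fil A3 a'"
      using adm_beta_spc[OF A] fp by (force simp: a0(2) a'(2) r(2) q(2) fil_sub_def)
    show "fil C1 d0 \<subseteq> fil C1 d'"
      using adm_beta_spc[OF V1] gi by (force simp: d0(2) d'(2) p(2) s(2) fil_sub_def)
    show "\<exists>w\<in>fil C1 d'. \<exists>y\<in>?F. bp y = f3 u \<and> g2 y = ci w" if u: "u \<in> fil A3 a'" for u
    proof -
      obtain y where y: "y \<in> ?F" "bp y = f3 u" "u \<in> spc A3"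
        using u by (auto simp: a'(2) q(2) fil_sub_def)
      have "cp (g2 y) = 0" using gp[OF F[OF y(1)]] y(2) adm_comp[OF V3 y(3)] by simp
      then obtain w where w: "w \<in> spc C1" "g2 y = ci w"
        using adm_ker[OF C adm_beta_spc[OF V2 F[OF y(1)]]] by blast
      then have "w \<in> fil C1 d'" using y(1) by (auto simp: d'(2) s(2) fil_sub_def intro: rev_image_eqI)
      then show ?thesis using w y by blast
    qed
    show "\<exists>u\<in>fil A3 a'. \<exists>y\<in>?F. bp y = f3 u \<and> g2 y = ci w" if w: "w \<in> fil C1 d'" for w
    proof -
      obtain y where y: "y \<in> ?F" "g2 y = ci w" "w \<in> spc C1"
        using w by (auto simp: d'(2) s(2) fil_sub_def)
      have "g3 (bp y) = 0" using gp[OF F[OF y(1)]] y(2) adm_comp[OF C y(3)] by simp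
      then obtain u where u: "u \<in> spc A3" "bp y = f3 u"
        using adm_ker[OF V3 adm_beta_spc[OF B F[OF y(1)]]] by blast
      then have "u \<in> fil A3 a'" using y(1) by (auto simp: a'(2) q(2) fil_sub_def intro: rev_image_eqI)
      then show ?thesis using u y by blast
    qed
    fix u w u' w'
    assume u: "u \<in> fil A3 a'" "u' \<in> fil A3 a'" and w: "w \<in> fil C1 d'" "w' \<in> fil C1 d'"
      and "\<exists>y\<in>?F. bp y = f3 u \<and> g2 y = ci w" "\<exists>y\<in>?F. bp y = f3 u' \<and> g2 y = ci w'"
    then obtain z z' where z: "z \<in> ?F" "bp z = f3 u" "g2 z = ci w" "z' \<in> ?F" "bp z' = f3 u'" "g2 z' = ci w'"
      by blast
    have us: "u \<in> spc A3" "u' \<in> spc A3" and ws: "w \<in> spc C1" "w' \<in> spc C1"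
      using u w by (auto simp: a'(2) d'(2) fil_sub_def)
    define y where "y = z - z'"
    have y: "y \<in> ?F" "bp y = f3 (u - u')" "g2 y = ci (w - w')"
      using fil_diff[OF fs(5) x] z us ws F adm_beta_diff[OF B, of z z'] adm_beta_diff[OF V2, of z z']
        adm_alpha_diff[OF V3 us] adm_alpha_diff[OF C ws] by (auto simp: y_def)
    have ds: "u - u' \<in> spc A3" "w - w' \<in> spc C1"
      using spc_diff[OF fs(3)] spc_diff[OF fs(7)] us ws by auto
    show "u - u' \<in> fil A3 a0 \<longleftrightarrow> w - w' \<in> fil C1 d0"
    proof
      assume "u - u' \<in> fil A3 a0"
      then obtain t where t: "t \<in> spc A2" "f2 t \<in> ?F" "u - u' = ap t" by (auto simp: a0(2) r(2) fil_sub_def)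
      have ft: "f2 t \<in> spc B2" using F t by blast
      have "bp (y - f2 t) = 0"
        using adm_beta_diff[OF B F[OF y(1)] ft] y(2) t fp[OF t(1)] by simp
      then obtain v where v: "v \<in> spc B1" "y - f2 t = bi v"
        using adm_ker[OF B] spc_diff[OF fs(5) F[OF y(1)] ft] by blast
      have "ci (g1 v) = ci (w - w')"
        using gi[OF v(1)] v(2) adm_beta_diff[OF V2 F[OF y(1)] ft] adm_comp[OF V2 t(1)] y(3) by simp
      then have "g1 v = w - w'" using adm_inj[OF C adm_beta_spc[OF V1 v(1)] ds(2)] by simp
      moreover have "v \<in> fil B1 p" using v fil_diff[OF fs(5) x y(1) t(2)] by (simp add: p(2) fil_sub_def)
      ultimately show "w - w' \<in> fil C1 d0" unfolding d0(2) by (metis image_eqI)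
    next
      assume "w - w' \<in> fil C1 d0"
      then obtain v where v: "v \<in> spc B1" "bi v \<in> ?F" "w - w' = g1 v" by (auto simp: d0(2) p(2) fil_sub_def)
      have bv: "bi v \<in> spc B2" using F v by blast
      have "g2 (y - bi v) = 0"
        using adm_beta_diff[OF V2 F[OF y(1)] bv] y(3) v gi[OF v(1)] by simp
      then obtain t where t: "t \<in> spc A2" "y - bi v = f2 t"
        using adm_ker[OF V2] spc_diff[OF fs(5) F[OF y(1)] bv] by blast
      have "f3 (ap t) = f3 (u - u')"
        using fp[OF t(1)] t(2) adm_beta_diff[OF B F[OF y(1)] bv] adm_comp[OF B v(1)] y(2) by simp
      then have "ap t = u - u'" using adm_inj[OF V3 adm_beta_spc[OF A t(1)] ds(1)] by simp
      moreover have "t \<in> fil A2 r" using t fil_diff[OF fs(5) x y(1) v(2)] by (simp add: r(2) fil_sub_def)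
      ultimately show "u - u' \<in> fil A3 a0" unfolding a0(2) by (metis image_eqI)
    qed
  qed
  ultimately have "?L (ind ?F) = ?R (ind ?F)" using L R by (simp add: mult.commute)
  then show ?thesis
    by (rule meas_eqI[OF adm_c1(2)[OF B] pull_dist_meas[OF B mb] pull_dist_meas[OF V2 mac] x])
qed

section \<open>Duals of \<open>C\<^sub>1\<close>-spaces\<close>

lemma c1_dual_simps [simp]:
  "idx (c1_dual E) = idx E" "leq (c1_dual E) = (leq E)\<inverse>" "fil (c1_dual E) i = ann E (fil E i)"
  "spc (c1_dual E) = (\<Union>i\<in>idx E. ann E (fil E i))" "scl (c1_dual E) = fscale"
  by (simp_all add: c1_dual_def)

lemma vector_space_fscale: "vector_space (fscale :: 'k::field \<Rightarrow> ('v \<Rightarrow> 'k) \<Rightarrow> 'v \<Rightarrow> 'k)"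
  by unfold_locales (auto simp: fun_eq_iff algebra_simps)

lemma module_fscale: "module (fscale :: 'k::field \<Rightarrow> ('v \<Rightarrow> 'k) \<Rightarrow> 'v \<Rightarrow> 'k)"
  using vector_space_fscale by (simp add: module_iff_vector_space)

lemma
  assumes "w \<in> functionals E"
  shows functional_add: "x \<in> spc E \<Longrightarrow> y \<in> spc E \<Longrightarrow> w (x + y) = w x + w y"
    and functional_scl: "x \<in> spc E \<Longrightarrow> w (scl E c x) = c * w x"
    and functional_out: "x \<notin> spc E \<Longrightarrow> w x = 0"
  using assms by (auto simp: functionals_def lin_on_def)

lemma functional_0: "filtered_space E \<Longrightarrow> w \<in> functionals E \<Longrightarrow> w 0 = 0"
  using functional_add[of w E 0 0] spc_0[of E] by (metis add.right_neutral add_left_imp_eq)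

lemma functionals_subspace: "module.subspace fscale (functionals E)"
  unfolding module.subspace_def[OF module_fscale]
  by (auto simp: functionals_def lin_on_def algebra_simps)

lemma ann_subspace: "module.subspace fscale (ann E S)"
  using functionals_subspace[of E] unfolding module.subspace_def[OF module_fscale] ann_def by auto

lemma ann_functional: "w \<in> ann E S \<Longrightarrow> w \<in> functionals E"
  and ann_zero: "w \<in> ann E S \<Longrightarrow> x \<in> S \<Longrightarrow> w x = 0"
  and annI: "w \<in> functionals E \<Longrightarrow> (\<And>x. x \<in> S \<Longrightarrow> w x = 0) \<Longrightarrow> w \<in> ann E S"
  by (auto simp: ann_def)

lemma ann_mono: "S \<subseteq> S' \<Longrightarrow> ann E S' \<subseteq> ann E S"
  by (auto simp: ann_def)

lemma dual_functional: "w \<in> spc (c1_dual E) \<Longrightarrow> w \<in> functionals E"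
  using ann_functional by auto

lemma dualI: "i \<in> idx E \<Longrightarrow> w \<in> ann E (fil E i) \<Longrightarrow> w \<in> spc (c1_dual E)"
  by auto

lemma c1_dual_filtered:
  fixes E :: "('k::{field,finite}, 'i, 'v::ab_group_add) filt"
  assumes fs: "filtered_space E"
  shows "filtered_space (c1_dual E)"
proof -
  note ss = module.subspace_def[OF module_fscale]
  have sub: "\<exists>k\<in>idx E. ann E (fil E i) \<subseteq> ann E (fil E k) \<and> ann E (fil E j) \<subseteq> ann E (fil E k)"
    if "i \<in> idx E" "j \<in> idx E" for i j
    using fil_below[OF fs that] ann_mono fil_mono[OF fs] by blast
  have spc: "module.subspace fscale (spc (c1_dual E))"
    unfolding ss
  proof (intro conjI ballI allI)
    show "0 \<in> spc (c1_dual E)"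
      using idx_nonempty[OF fs] ann_subspace[of E] unfolding ss by auto
    show "x + y \<in> spc (c1_dual E)" if x: "x \<in> spc (c1_dual E)" and y: "y \<in> spc (c1_dual E)" for x y
    proof -
      obtain i j where ij: "i \<in> idx E" "x \<in> ann E (fil E i)" "j \<in> idx E" "y \<in> ann E (fil E j)"
        using x y by auto
      then obtain k where "k \<in> idx E" "x \<in> ann E (fil E k)" "y \<in> ann E (fil E k)" using sub by blast
      then show ?thesis using ann_subspace[of E "fil E k"] unfolding ss by auto
    qed
    show "fscale c x \<in> spc (c1_dual E)" if x: "x \<in> spc (c1_dual E)" for c x
    proof -
      obtain i where "i \<in> idx E" "x \<in> ann E (fil E i)" using x by auto
      then have "i \<in> idx E \<and> fscale c x \<in> ann E (fil E i)"
        using ann_subspace[of E "fil E i"] unfolding ss by auto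
      then show ?thesis by auto
    qed
  qed
  have int: "(\<Inter>i\<in>idx E. ann E (fil E i)) = {0}"
  proof
    show "(\<Inter>i\<in>idx E. ann E (fil E i)) \<subseteq> {0}"
    proof
      fix w assume w: "w \<in> (\<Inter>i\<in>idx E. ann E (fil E i))"
      then have wf: "w \<in> functionals E" using idx_nonempty[OF fs] ann_functional by blast
      have "w x = 0" for x
      proof (cases "x \<in> spc E")
        case True
        then obtain i where "i \<in> idx E" "x \<in> fil E i" using spc_fil[OF fs] by blast
        then show ?thesis using w ann_zero by blast
      qed (rule functional_out[OF wf])
      then show "w \<in> {0}" by (simp add: fun_eq_iff)
    qed
    show "{0} \<subseteq> (\<Inter>i\<in>idx E. ann E (fil E i))"
      using ann_subspace[of E] unfolding ss by auto
  qed
  have dir: "\<exists>k\<in>idx E. \<exists>l\<in>idx E. (i, k) \<in> leq E \<and> (l, i) \<in> leq E \<and> (j, k) \<in> leq E \<and> (l, j) \<in> leq E"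
    if "i \<in> idx E" "j \<in> idx E" for i j
    using fil_directed[OF fs that] by blast
  have mono: "ann E (fil E i) \<subseteq> ann E (fil E j)" if "(j, i) \<in> leq E" for i j
    using ann_mono fil_mono[OF fs that] by blast
  show ?thesis
    unfolding filtered_space_def
    using vector_space_fscale spc leq_order[OF fs] dir ann_subspace mono int by auto
qed

text \<open>Modulo functionals vanishing on F(i), a functional vanishing on F(j) is given by its
  values on representatives of F(i)/F(j). Over a finite field there are finitely many tables of
  values, and one functional for each table generates.\<close>

lemma c1_dual_c1:
  fixes E :: "('k::{field,finite}, 'i, 'v::ab_group_add) filt"
  assumes c: "c1_space E"
  shows "c1_space (c1_dual E)"
  unfolding c1_space_def
proof (intro conjI allI impI)
  note fs = c1_fs[OF c]
  show fs': "filtered_space (c1_dual E)" by (rule c1_dual_filtered[OF fs])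
  fix i j assume "(i, j) \<in> leq (c1_dual E)"
  then have ji: "(j, i) \<in> leq E" by simp
  have idx: "i \<in> idx E" "j \<in> idx E" using leq_idx[OF fs ji] by auto
  interpret module "fscale :: 'k \<Rightarrow> ('v \<Rightarrow> 'k) \<Rightarrow> 'v \<Rightarrow> 'k" by (rule module_fscale)
  obtain R where R: "transv R (fil E i) (fil E j)" using transv_exists[OF c ji] by blast
  define S where "S = (\<lambda>w. restrict w R) ` ann E (fil E j)"
  have "S \<subseteq> (\<Pi>\<^sub>E r\<in>R. UNIV)" by (auto simp: S_def)
  then have finS: "finite S"
    by (rule finite_subset) (simp add: finite_PiE transv_finite[OF R])
  define g where "g s = (SOME w. w \<in> ann E (fil E j) \<and> restrict w R = s)" for s
  have g: "g s \<in> ann E (fil E j) \<and> restrict (g s) R = s" if "s \<in> S" for s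
    using someI_ex[of "\<lambda>w. w \<in> ann E (fil E j) \<and> restrict w R = s"] that
    unfolding g_def S_def by blast
  have "ann E (fil E j) \<subseteq> span (ann E (fil E i) \<union> g ` S)"
  proof
    fix w assume w: "w \<in> ann E (fil E j)"
    define w' where "w' = g (restrict w R)"
    have sS: "restrict w R \<in> S" using w by (simp add: S_def)
    have w': "w' \<in> ann E (fil E j)" and "restrict w' R = restrict w R"
      using g[OF sS] by (auto simp: w'_def)
    then have eq: "w' r = w r" if "r \<in> R" for r using that by (metis restrict_apply')
    have d: "w - w' \<in> ann E (fil E j)" using subspace_diff[OF ann_subspace w w'] .
    have "(w - w') x = 0" if x: "x \<in> fil E i" for x
    proof -
      obtain r where r: "r \<in> R" "x - r \<in> fil E j" using transv_ex[OF R x] by blast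
      have rs: "r \<in> spc E" using transv_in[OF R r(1)] fil_spc[OF fs idx(1)] by blast
      have "(w - w') (x - r + r) = (w - w') (x - r) + (w - w') r"
        using functional_add[OF ann_functional[OF d] _ rs] fil_spc[OF fs idx(2) r(2)] by blast
      then show ?thesis using ann_zero[OF d r(2)] eq[OF r(1)] by simp
    qed
    then have "w - w' \<in> ann E (fil E i)" using annI ann_functional[OF d] by blast
    then have "(w - w') + w' \<in> span (ann E (fil E i) \<union> g ` S)"
      using sS by (intro span_add span_base) (auto simp: w'_def)
    then show "w \<in> span (ann E (fil E i) \<union> g ` S)" by simp
  qed
  moreover have "span (ann E (fil E i) \<union> g ` S) \<subseteq> ann E (fil E j)"
    using g ann_mono[OF fil_mono[OF fs ji]] by (intro span_minimal ann_subspace) auto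
  ultimately show "\<exists>B. finite B \<and> B \<subseteq> fil (c1_dual E) j \<and>
      fil (c1_dual E) j = module.span (scl (c1_dual E)) (fil (c1_dual E) i \<union> B)"
    using finS g by (intro exI[of _ "g ` S"]) auto
qed

section \<open>Extension of continuous functionals\<close>

lemma linear_extend:
  fixes s :: "'k::field \<Rightarrow> 'v::ab_group_add \<Rightarrow> 'v"
  assumes vs: "vector_space s" and S: "module.subspace s S" and f: "lin_on s (*) S f"
  shows "\<exists>g. lin_on s (*) UNIV g \<and> (\<forall>x\<in>S. g x = f x)"
proof -
  interpret vector_space s by fact
  interpret vector_space_pair s "(*) :: 'k \<Rightarrow> 'k \<Rightarrow> 'k"
    by unfold_locales (auto simp: algebra_simps)
  obtain B where B: "B \<subseteq> S" "independent B" "S \<subseteq> span B"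
    using maximal_independent_subset[of S] by blast
  obtain g where g: "Vector_Spaces.linear s (*) g" "\<And>x. x \<in> B \<Longrightarrow> g x = f x"
    using linear_independent_extend[OF B(2)] by blast
  have "span B \<subseteq> {x \<in> S. g x = f x}"
  proof (rule span_minimal)
    show "B \<subseteq> {x \<in> S. g x = f x}" using B g by auto
    have "f 0 = 0" using f subspace_0[OF S] unfolding lin_on_def by (metis add_cancel_right_right)
    then show "subspace {x \<in> S. g x = f x}"
      using S f by (auto simp: subspace_def lin_on_def linear_add[OF g(1)] linear_scale[OF g(1)] linear_0[OF g(1)])
  qed
  then show ?thesis
    using B(3) linear_add[OF g(1)] linear_scale[OF g(1)] by (intro exI[of _ g]) (auto simp: lin_on_def)
qed

text \<open>The functional is first extended by 0 to W = S + F(i), consistently because it vanishes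
  on S \<inter> F(i), and then arbitrarily to V. Vanishing on F(i) keeps the extension in the dual
  space. The choice of the component \<open>p x\<close> in S does not affect the value, by
  \<open>fp\<close>.\<close>

lemma ann_extend:
  fixes E :: "('k::field, 'i, 'v::ab_group_add) filt"
  assumes fs: "filtered_space E" and i: "i \<in> idx E" and S: "module.subspace (scl E) S" "S \<subseteq> spc E"
    and f: "lin_on (scl E) (*) S f" and van: "\<And>x. x \<in> S \<Longrightarrow> x \<in> fil E i \<Longrightarrow> f x = 0"
  shows "\<exists>u\<in>ann E (fil E i). \<forall>x\<in>S. u x = f x"
proof -
  interpret vector_space "scl E" by (rule filtered_vs[OF fs])
  note U = fil_subspace[OF fs i]
  define W where "W = {x. \<exists>y\<in>S. x - y \<in> fil E i}"
  define p where "p x = (SOME y. y \<in> S \<and> x - y \<in> fil E i)" for x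
  have p: "p x \<in> S \<and> x - p x \<in> fil E i" if "x \<in> W" for x
    unfolding p_def by (rule someI_ex) (use that W_def in blast)
  have fdiff: "f (x - y) = f x - f y" if "x \<in> S" "y \<in> S" for x y
  proof -
    have "f (x - y + y) = f (x - y) + f y"
      using f that subspace_diff[OF S(1) that] unfolding lin_on_def by blast
    then show ?thesis by simp
  qed
  have fp: "f (p x) = f y" if "x \<in> W" "y \<in> S" "x - y \<in> fil E i" for x y
  proof -
    have "(x - y) - (x - p x) \<in> fil E i" using subspace_diff[OF U that(3)] p[OF that(1)] by blast
    then have "p x - y \<in> fil E i" by simp
    then show ?thesis using van[of "p x - y"] subspace_diff[OF S(1)] p[OF that(1)] that(2) fdiff by auto
  qed
  have add: "x + x' \<in> W \<and> f (p (x + x')) = f (p x) + f (p x')" if x: "x \<in> W" "x' \<in> W" for x x'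
  proof -
    have s: "p x + p x' \<in> S" using p x subspace_add[OF S(1)] by blast
    have "(x - p x) + (x' - p x') \<in> fil E i" using p x subspace_add[OF U] by blast
    then have d: "x + x' - (p x + p x') \<in> fil E i" by (simp add: algebra_simps)
    then have "x + x' \<in> W" using s W_def by blast
    then show ?thesis using fp[OF _ s d] f p x unfolding lin_on_def by metis
  qed
  have scl: "scl E c x \<in> W \<and> f (p (scl E c x)) = c * f (p x)" if x: "x \<in> W" for c x
  proof -
    have s: "scl E c (p x) \<in> S" using p x subspace_scale[OF S(1)] by blast
    have "scl E c (x - p x) \<in> fil E i" using p x subspace_scale[OF U] by blast
    then have d: "scl E c x - scl E c (p x) \<in> fil E i" by (simp add: scale_right_diff_distrib)
    then have "scl E c x \<in> W" using s W_def by blast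
    then show ?thesis using fp[OF _ s d] f p x unfolding lin_on_def by metis
  qed
  have SW: "x \<in> W \<and> f (p x) = f x" if "x \<in> S" for x
  proof -
    have "x - x \<in> fil E i" using subspace_0[OF U] by simp
    then show ?thesis using that fp[of x x] W_def by blast
  qed
  have UW: "x \<in> W \<and> f (p x) = 0" if "x \<in> fil E i" for x
  proof -
    have d: "x - 0 \<in> fil E i" using that by simp
    have z: "0 \<in> S" using subspace_0[OF S(1)] .
    have "x \<in> W" unfolding W_def using d z by blast
    then show ?thesis using fp[OF _ z d] van[OF z subspace_0[OF U]] by simp
  qed
  have "subspace W" using add scl UW[OF subspace_0[OF U]] by (auto simp: subspace_def)
  moreover have "lin_on (scl E) (*) W (\<lambda>x. f (p x))" using add scl by (simp add: lin_on_def)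
  ultimately obtain g where g: "lin_on (scl E) (*) UNIV g" "\<And>x. x \<in> W \<Longrightarrow> g x = f (p x)"
    using linear_extend[OF filtered_vs[OF fs]] by blast
  have "cut (spc E) g \<in> functionals E"
    using g(1) by (auto simp: functionals_def lin_on_def spc_add[OF fs] spc_scl[OF fs])
  then have "cut (spc E) g \<in> ann E (fil E i)"
    by (rule annI) (simp add: cut_def g(2) UW)
  moreover have "\<forall>x\<in>S. cut (spc E) g x = f x" using g(2) SW S(2) by auto
  ultimately show ?thesis by blast
qed

text \<open>Extension from the line through \<open>v\<close>, which meets F(i) only in 0. The value
  \<open>c\<close> is left free so that a character can be made nontrivial on it.\<close>

lemma ann_separates:
  fixes E :: "('k::field, 'i, 'v::ab_group_add) filt"
  assumes fs: "filtered_space E" and i: "i \<in> idx E" and v: "v \<in> spc E" "v \<notin> fil E i"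
  shows "\<exists>u\<in>ann E (fil E i). u v = c"
proof -
  interpret vector_space "scl E" by (rule filtered_vs[OF fs])
  let ?S = "range (\<lambda>a. scl E a v)"
  have v0: "v \<noteq> 0" using v fil_0[OF fs i] by blast
  define f where "f x = c * (THE a. x = scl E a v)" for x
  have f: "f (scl E a v) = c * a" for a
    using v0 by (simp add: f_def)
  have S: "subspace ?S"
    unfolding subspace_def
  proof (intro conjI ballI allI)
    show "0 \<in> ?S" by (rule range_eqI[of _ _ 0]) simp
    show "x + y \<in> ?S" if xy: "x \<in> ?S" "y \<in> ?S" for x y
    proof -
      obtain a b where "x = scl E a v" "y = scl E b v" using xy by blast
      then show ?thesis by (intro range_eqI[of _ _ "a + b"]) (simp add: scale_left_distrib)
    qed
    show "scl E a x \<in> ?S" if x: "x \<in> ?S" for a x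
    proof -
      obtain b where "x = scl E b v" using x by blast
      then show ?thesis by (intro range_eqI[of _ _ "a * b"]) simp
    qed
  qed
  have "lin_on (scl E) (*) ?S f"
    unfolding lin_on_def
  proof (intro conjI ballI allI)
    show "f (x + y) = f x + f y" if xy: "x \<in> ?S" "y \<in> ?S" for x y
    proof -
      obtain a b where ab: "x = scl E a v" "y = scl E b v" using xy by blast
      show ?thesis unfolding ab scale_left_distrib[symmetric] f by (simp add: distrib_left)
    qed
    show "f (scl E a x) = a * f x" if x: "x \<in> ?S" for a x
    proof -
      obtain b where b: "x = scl E b v" using x by blast
      show ?thesis unfolding b scale_scale f by simp
    qed
  qed
  moreover have "f x = 0" if x: "x \<in> ?S" "x \<in> fil E i" for x
  proof -
    obtain a where a: "x = scl E a v" using x(1) by blast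
    have "a = 0"
    proof (rule ccontr)
      assume "a \<noteq> 0"
      then have "v = scl E (inverse a) x" by (simp add: a)
      then show False using v(2) fil_scl[OF fs i x(2)] by metis
    qed
    then show ?thesis using f[of a] a by simp
  qed
  moreover have "?S \<subseteq> spc E" using v(1) spc_scl[OF fs] by auto
  ultimately obtain u where u: "u \<in> ann E (fil E i)" "\<forall>x\<in>?S. u x = f x"
    using ann_extend[OF fs i S] by blast
  have "v \<in> ?S" by (rule range_eqI[of _ _ 1]) simp
  then have "u v = f v" using u(2) by blast
  moreover have "f v = c" using f[of 1] by simp
  ultimately show ?thesis using u(1) by metis
qed

section \<open>The dual of an admissible triple\<close>

lemma pull_lin:
  "pull E \<alpha> (f + g) = pull E \<alpha> f + pull E \<alpha> (g :: 'b \<Rightarrow> 'c::monoid_add)"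
  "pull E \<alpha> (fscale c h) = fscale c (pull E \<alpha> (h :: 'b \<Rightarrow> 'd::mult_zero))"
  by (auto simp: pull_def cut_def fun_eq_iff)

lemma pull_diff: "pull E \<alpha> (f - g) = pull E \<alpha> f - pull E \<alpha> (g :: 'b \<Rightarrow> 'c::group_add)"
  by (auto simp: pull_def cut_def fun_eq_iff)

context
  fixes E1 :: "('k::{field,finite}, 'i1, 'a::ab_group_add) filt" and \<alpha> :: "'a \<Rightarrow> 'b::ab_group_add"
    and E2 :: "('k, 'i2, 'b) filt" and \<beta> :: "'b \<Rightarrow> 'c::ab_group_add" and E3 :: "('k, 'i3, 'c) filt"
  assumes adm: "c1_admissible E1 \<alpha> E2 \<beta> E3"
begin

lemma pull_alpha_functional: "w \<in> functionals E2 \<Longrightarrow> pull E1 \<alpha> w \<in> functionals E1"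
  using adm_alpha_spc[OF adm] adm_alpha_add[OF adm] adm_alpha_scl[OF adm]
    spc_add[OF adm_fs(1)[OF adm]] spc_scl[OF adm_fs(1)[OF adm]]
  by (auto simp: functionals_def lin_on_def pull_def)

lemma pull_beta_functional: "w \<in> functionals E3 \<Longrightarrow> pull E2 \<beta> w \<in> functionals E2"
  using adm_beta_spc[OF adm] adm_beta_add[OF adm] adm_beta_scl[OF adm]
    spc_add[OF adm_fs(2)[OF adm]] spc_scl[OF adm_fs(2)[OF adm]]
  by (auto simp: functionals_def lin_on_def pull_def)

text \<open>The inclusion from right to left extends a functional from \<alpha>(V1) to V2 while
  keeping it zero on F2(i).\<close>

lemma pull_alpha_ann:
  assumes i: "i \<in> idx E2"
  shows "pull E1 \<alpha> ` ann E2 (fil E2 i) = ann E1 (fil_sub E1 \<alpha> E2 i)"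
proof
  show "pull E1 \<alpha> ` ann E2 (fil E2 i) \<subseteq> ann E1 (fil_sub E1 \<alpha> E2 i)"
  proof
    fix u assume "u \<in> pull E1 \<alpha> ` ann E2 (fil E2 i)"
    then obtain w where w: "w \<in> ann E2 (fil E2 i)" "u = pull E1 \<alpha> w" by blast
    show "u \<in> ann E1 (fil_sub E1 \<alpha> E2 i)"
      unfolding w(2) using pull_alpha_functional[OF ann_functional[OF w(1)]] ann_zero[OF w(1)]
      by (intro annI) (auto simp: fil_sub_def pull_def)
  qed
  show "ann E1 (fil_sub E1 \<alpha> E2 i) \<subseteq> pull E1 \<alpha> ` ann E2 (fil E2 i)"
  proof
    fix u assume u: "u \<in> ann E1 (fil_sub E1 \<alpha> E2 i)"
    note uf = ann_functional[OF u]
    define f where "f y = u (THE x. x \<in> spc E1 \<and> \<alpha> x = y)" for y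
    have f: "f (\<alpha> x) = u x" if "x \<in> spc E1" for x
    proof -
      have "(THE x'. x' \<in> spc E1 \<and> \<alpha> x' = \<alpha> x) = x"
        by (rule the_equality) (use that adm_inj[OF adm] in auto)
      then show ?thesis by (simp add: f_def)
    qed
    interpret module "scl E2" by (rule filtered_module[OF adm_fs(2)[OF adm]])
    let ?S = "\<alpha> ` spc E1"
    have S: "subspace ?S"
      unfolding subspace_def
    proof (intro conjI ballI allI)
      show "0 \<in> ?S" using adm_alpha_0[OF adm] spc_0[OF adm_fs(1)[OF adm]] by (metis image_eqI)
      show "x + y \<in> ?S" if "x \<in> ?S" "y \<in> ?S" for x y
        using that adm_alpha_add[OF adm] spc_add[OF adm_fs(1)[OF adm]] by (metis (no_types, lifting) image_iff)
      show "scl E2 c x \<in> ?S" if "x \<in> ?S" for c x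
        using that adm_alpha_scl[OF adm] spc_scl[OF adm_fs(1)[OF adm]] by (metis (no_types, lifting) image_iff)
    qed
    have "f (x + y) = f x + f y" if "x \<in> ?S" "y \<in> ?S" for x y
      using that functional_add[OF uf] spc_add[OF adm_fs(1)[OF adm]]
      by (auto simp: adm_alpha_add[OF adm, symmetric] f)
    moreover have "f (scl E2 c x) = c * f x" if "x \<in> ?S" for c x
      using that functional_scl[OF uf] spc_scl[OF adm_fs(1)[OF adm]]
      by (auto simp: adm_alpha_scl[OF adm, symmetric] f)
    ultimately have lin: "lin_on (scl E2) (*) ?S f" by (simp add: lin_on_def)
    have sub: "?S \<subseteq> spc E2" using adm_alpha_spc[OF adm] by blast
    have "f x = 0" if "x \<in> ?S" "x \<in> fil E2 i" for x
      using that ann_zero[OF u] f by (auto simp: fil_sub_def)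
    then obtain w where w: "w \<in> ann E2 (fil E2 i)" "\<And>x. x \<in> spc E1 \<Longrightarrow> w (\<alpha> x) = f (\<alpha> x)"
      using ann_extend[OF adm_fs(2)[OF adm] i S sub lin] by blast
    have "pull E1 \<alpha> w = u"
      using w(2) f functional_out[OF uf] by (auto simp: pull_def cut_def fun_eq_iff)
    then show "u \<in> pull E1 \<alpha> ` ann E2 (fil E2 i)" using w(1) by blast
  qed
qed

lemma pull_beta_ann:
  assumes w: "w \<in> functionals E3" and i: "i \<in> idx E2"
  shows "pull E2 \<beta> w \<in> ann E2 (fil E2 i) \<longleftrightarrow> w \<in> ann E3 (\<beta> ` fil E2 i)"
  using pull_beta_functional[OF w] w fil_spc[OF adm_fs(2)[OF adm] i]
  by (auto simp: ann_def pull_def)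

lemma dual_fil_sub:
  assumes "i \<in> idx E2"
  shows "fil_sub (c1_dual E3) (pull E2 \<beta>) (c1_dual E2) i = ann E3 (\<beta> ` fil E2 i)"
proof -
  obtain j where "j \<in> idx E3" "fil E3 j = \<beta> ` fil E2 i" using adm_img_fil[OF adm assms] by blast
  then have "ann E3 (\<beta> ` fil E2 i) \<subseteq> spc (c1_dual E3)" using dualI[of j E3] by auto
  then show ?thesis
    using pull_beta_ann[OF _ assms] dual_functional ann_functional unfolding fil_sub_def c1_dual_simps(3) by blast
qed


text \<open>All orders are reversed together, so the index maps \<open>\<phi>3\<close> and
  \<open>\<phi>1\<close> of the given triple serve again, in exchanged roles. Surjectivity is the
  extension of functionals; exactness in the middle is descent along \<beta>.\<close>

lemma dual_admissible:
  "c1_admissible (c1_dual E3) (pull E2 \<beta>) (c1_dual E2) (pull E1 \<alpha>) (c1_dual E1)"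
proof -
  note fs = adm_fs[OF adm]
  obtain \<phi>1 where \<phi>1: "dominates_via E1 (idx E2) (leq E2) (fil_sub E1 \<alpha> E2) \<phi>1"
    using adm_dom1[OF adm] by blast
  obtain \<phi>3 where \<phi>3: "dominates_via E3 (idx E2) (leq E2) (\<lambda>i. \<beta> ` fil E2 i) \<phi>3"
    using adm_dom3[OF adm] by blast
  have spc2: "pull E2 \<beta> w \<in> spc (c1_dual E2)" if w: "w \<in> spc (c1_dual E3)" for w
  proof -
    obtain k where k: "k \<in> idx E3" "w \<in> ann E3 (fil E3 k)" using w by auto
    obtain i where i: "i \<in> idx E2" "(\<phi>3 i, k) \<in> leq E3" using \<phi>3 k(1) unfolding dominates_via_def by blast
    have "\<beta> ` fil E2 i \<subseteq> fil E3 k" using \<phi>3 i fil_mono[OF fs(3) i(2)] unfolding dominates_via_def by auto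
    then have "w \<in> ann E3 (\<beta> ` fil E2 i)" using k(2) ann_mono by blast
    then show ?thesis using dualI[OF i(1)] pull_beta_ann[OF dual_functional[OF w] i(1)] by blast
  qed
  have spc1: "pull E1 \<alpha> w \<in> spc (c1_dual E1)" if w: "w \<in> spc (c1_dual E2)" for w
  proof -
    obtain i where i: "i \<in> idx E2" "w \<in> ann E2 (fil E2 i)" using w by auto
    then have "pull E1 \<alpha> w \<in> ann E1 (fil E1 (\<phi>1 i))" "\<phi>1 i \<in> idx E1"
      using pull_alpha_ann[OF i(1)] \<phi>1 unfolding dominates_via_def by auto
    then show ?thesis using dualI[of "\<phi>1 i" E1] by simp
  qed
  have surj: "pull E1 \<alpha> ` spc (c1_dual E2) = spc (c1_dual E1)"
  proof
    show "pull E1 \<alpha> ` spc (c1_dual E2) \<subseteq> spc (c1_dual E1)" using spc1 by blast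
    show "spc (c1_dual E1) \<subseteq> pull E1 \<alpha> ` spc (c1_dual E2)"
    proof
      fix u assume "u \<in> spc (c1_dual E1)"
      then obtain k where k: "k \<in> idx E1" "u \<in> ann E1 (fil E1 k)" by auto
      obtain i where i: "i \<in> idx E2" "(\<phi>1 i, k) \<in> leq E1" using \<phi>1 k(1) unfolding dominates_via_def by blast
      have "fil_sub E1 \<alpha> E2 i \<subseteq> fil E1 k" using \<phi>1 i fil_mono[OF fs(1) i(2)] unfolding dominates_via_def by auto
      then have "u \<in> ann E1 (fil_sub E1 \<alpha> E2 i)" using k(2) ann_mono by blast
      then obtain w where "w \<in> ann E2 (fil E2 i)" "u = pull E1 \<alpha> w" using pull_alpha_ann[OF i(1)] by blast
      then show "u \<in> pull E1 \<alpha> ` spc (c1_dual E2)" using dualI[OF i(1)] by blast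
    qed
  qed
  have inj: "w = w'" if "w \<in> spc (c1_dual E3)" "w' \<in> spc (c1_dual E3)" "pull E2 \<beta> w = pull E2 \<beta> w'" for w w'
  proof
    fix y
    note wf = dual_functional[OF that(1)] dual_functional[OF that(2)]
    show "w y = w' y"
    proof (cases "y \<in> spc E3")
      case True
      then obtain x where "x \<in> spc E2" "\<beta> x = y" using adm_surj[OF adm] by blast
      then show ?thesis using fun_cong[OF that(3), of x] by (simp add: pull_def)
    qed (simp add: functional_out[OF wf(1)] functional_out[OF wf(2)])
  qed
  have comp: "pull E1 \<alpha> (pull E2 \<beta> w) = 0" if "w \<in> spc (c1_dual E3)" for w
    using adm_alpha_spc[OF adm] adm_comp[OF adm] functional_0[OF fs(3) dual_functional[OF that]]
    by (auto simp: pull_def cut_def fun_eq_iff)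
  have ker: "\<exists>w\<in>spc (c1_dual E3). u = pull E2 \<beta> w"
    if u: "u \<in> spc (c1_dual E2)" and 0: "pull E1 \<alpha> u = 0" for u
  proof -
    note uf = dual_functional[OF u]
    have u0: "u (\<alpha> x) = 0" if "x \<in> spc E1" for x
      using fun_cong[OF 0, of x] that by (simp add: pull_def)
    \<comment> \<open>A functional that vanishes on \<alpha>(V1) is constant on the fibres of
      \<beta>, hence descends to V3; it annihilates \<beta>(F2(i)) whenever \<open>u\<close>
      annihilates F2(i).\<close>
    define w where "w = cut (spc E3) (\<lambda>y. u (SOME x. x \<in> spc E2 \<and> \<beta> x = y))"
    have w: "w (\<beta> x) = u x" if x: "x \<in> spc E2" for x
    proof -
      let ?x = "SOME x'. x' \<in> spc E2 \<and> \<beta> x' = \<beta> x"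
      have "?x \<in> spc E2 \<and> \<beta> ?x = \<beta> x" by (rule someI[of _ x]) (use x in simp)
      then obtain z where z: "z \<in> spc E1" "?x = x + \<alpha> z" using adm_beta_eq[OF adm _ x] by blast
      then have "u ?x = u x" using functional_add[OF uf x adm_alpha_spc[OF adm z(1)]] u0 by simp
      then show ?thesis using adm_beta_spc[OF adm x] by (simp add: w_def)
    qed
    have wf: "w \<in> functionals E3"
    proof -
      have "w (x + y) = w x + w y" if xy: "x \<in> spc E3" "y \<in> spc E3" for x y
      proof -
        obtain x' y' where xy': "x' \<in> spc E2" "x = \<beta> x'" "y' \<in> spc E2" "y = \<beta> y'"
          using adm_surj[OF adm] xy by metis
        then show ?thesis
          using w functional_add[OF uf xy'(1,3)] adm_beta_add[OF adm xy'(1,3)] spc_add[OF fs(2) xy'(1,3)] by metis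
      qed
      moreover have "w (scl E3 c x) = c * w x" if x: "x \<in> spc E3" for c x
      proof -
        obtain x' where x': "x' \<in> spc E2" "x = \<beta> x'" using adm_surj[OF adm] x by metis
        then show ?thesis
          using w functional_scl[OF uf x'(1)] adm_beta_scl[OF adm x'(1)] spc_scl[OF fs(2) x'(1)] by metis
      qed
      ultimately show ?thesis by (auto simp: functionals_def lin_on_def w_def)
    qed
    have eq: "u = pull E2 \<beta> w"
      using w functional_out[OF uf] by (auto simp: pull_def cut_def fun_eq_iff)
    obtain i where i: "i \<in> idx E2" "u \<in> ann E2 (fil E2 i)" using u by auto
    then have *: "w \<in> ann E3 (fil E3 (\<phi>3 i))" "\<phi>3 i \<in> idx E3"
      using pull_beta_ann[OF wf i(1)] eq \<phi>3 unfolding dominates_via_def by auto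
    show ?thesis using eq dualI[OF *(2,1)] by (rule bexI)
  qed
  have dom1: "dominates_via (c1_dual E3) (idx E2) ((leq E2)\<inverse>) (fil_sub (c1_dual E3) (pull E2 \<beta>) (c1_dual E2)) \<phi>3"
    using \<phi>3 dual_fil_sub unfolding dominates_via_def c1_dual_simps by simp
  have dom3: "dominates_via (c1_dual E1) (idx E2) ((leq E2)\<inverse>) (\<lambda>i. pull E1 \<alpha> ` fil (c1_dual E2) i) \<phi>1"
    using \<phi>1 pull_alpha_ann unfolding dominates_via_def c1_dual_simps by simp
  have ex: "exact_seq (c1_dual E3) (pull E2 \<beta>) (c1_dual E2) (pull E1 \<alpha>) (c1_dual E1)"
    unfolding exact_seq_def
  proof (intro conjI)
    show "lin_on (scl (c1_dual E3)) (scl (c1_dual E2)) (spc (c1_dual E3)) (pull E2 \<beta>)"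
      "lin_on (scl (c1_dual E2)) (scl (c1_dual E1)) (spc (c1_dual E2)) (pull E1 \<alpha>)"
      by (simp_all add: lin_on_def pull_lin)
    show "inj_on (pull E2 \<beta>) (spc (c1_dual E3))" using inj by (meson inj_onI)
    show "pull E2 \<beta> ` spc (c1_dual E3) = {v \<in> spc (c1_dual E2). pull E1 \<alpha> v = 0}"
      using spc2 comp ker by blast
  qed (rule surj)
  note c = adm_c1[OF adm]
  show ?thesis
    unfolding c1_admissible_def
  proof (intro conjI allI impI ballI)
    show "\<exists>\<phi>. dominates_via (c1_dual E3) (idx (c1_dual E2)) (leq (c1_dual E2))
        (fil_sub (c1_dual E3) (pull E2 \<beta>) (c1_dual E2)) \<phi>"
      "\<exists>\<phi>. dominates_via (c1_dual E1) (idx (c1_dual E2)) (leq (c1_dual E2))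
        (\<lambda>i. pull E1 \<alpha> ` fil (c1_dual E2) i) \<phi>"
      using dom1 dom3 by (simp_all del: c1_dual_simps(3)) blast+
    fix i j assume "(i, j) \<in> leq (c1_dual E2)"
    then have ji: "(j, i) \<in> leq E2" by simp
    have idx: "i \<in> idx E2" "j \<in> idx E2" using leq_idx[OF fs(2) ji] by auto
    show "v \<in> fil_sub (c1_dual E3) (pull E2 \<beta>) (c1_dual E2) i"
      if "v \<in> fil_sub (c1_dual E3) (pull E2 \<beta>) (c1_dual E2) j" "pull E2 \<beta> v \<in> fil (c1_dual E2) i" for v
      using that by (simp add: fil_sub_def)
    fix v assume v: "v \<in> fil (c1_dual E2) j"
    have vs: "v \<in> spc (c1_dual E2)" using v idx(2) by auto
    note dsub = module.subspace_diff[OF module_fscale ann_subspace]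
    show "pull E1 \<alpha> v \<in> pull E1 \<alpha> ` fil (c1_dual E2) i \<longleftrightarrow>
      (\<exists>u\<in>fil_sub (c1_dual E3) (pull E2 \<beta>) (c1_dual E2) j. v - pull E2 \<beta> u \<in> fil (c1_dual E2) i)"
    proof
      assume "pull E1 \<alpha> v \<in> pull E1 \<alpha> ` fil (c1_dual E2) i"
      then obtain v' where v': "v' \<in> ann E2 (fil E2 i)" "pull E1 \<alpha> v = pull E1 \<alpha> v'" by auto
      have v'j: "v' \<in> ann E2 (fil E2 j)" using v'(1) ann_mono[OF fil_mono[OF fs(2) ji]] by blast
      have d: "v - v' \<in> ann E2 (fil E2 j)" using dsub v v'j by simp
      moreover have "pull E1 \<alpha> (v - v') = 0" using v'(2) by (simp add: pull_diff)
      ultimately obtain u where u: "u \<in> spc (c1_dual E3)" "v - v' = pull E2 \<beta> u"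
        using ker[OF dualI[OF idx(2)]] by blast
      have "u \<in> fil_sub (c1_dual E3) (pull E2 \<beta>) (c1_dual E2) j" using u d by (simp add: fil_sub_def)
      moreover have "v - pull E2 \<beta> u \<in> fil (c1_dual E2) i" using u(2) v'(1) by (simp add: algebra_simps flip: u(2))
      ultimately show "\<exists>u\<in>fil_sub (c1_dual E3) (pull E2 \<beta>) (c1_dual E2) j. v - pull E2 \<beta> u \<in> fil (c1_dual E2) i"
        by blast
    next
      assume "\<exists>u\<in>fil_sub (c1_dual E3) (pull E2 \<beta>) (c1_dual E2) j. v - pull E2 \<beta> u \<in> fil (c1_dual E2) i"
      then obtain u where u: "u \<in> spc (c1_dual E3)" "v - pull E2 \<beta> u \<in> fil (c1_dual E2) i"
        by (auto simp: fil_sub_def)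
      have "pull E1 \<alpha> v = pull E1 \<alpha> (v - pull E2 \<beta> u)" using comp[OF u(1)] by (simp add: pull_diff)
      then show "pull E1 \<alpha> v \<in> pull E1 \<alpha> ` fil (c1_dual E2) i" using u(2) by blast
    qed
  qed (intro c1_dual_c1 c ex)+
qed

end

section \<open>Fourier transform\<close>

text \<open>Translating the transversal by \<open>a\<close> leaves the sum unchanged, but multiplies
  it by \<open>f a\<close>, which is not 1.\<close>

lemma char_sum_zero:
  fixes f :: "'v::ab_group_add \<Rightarrow> complex"
  assumes R: "transv R A B" and sg: "additive_subgroup A" "additive_subgroup B" and sub: "B \<subseteq> A"
    and mult: "\<And>x y. x \<in> A \<Longrightarrow> y \<in> A \<Longrightarrow> f (x + y) = f x * f y" and triv: "\<And>u. u \<in> B \<Longrightarrow> f u = 1"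
    and a: "a \<in> A" "f a \<noteq> 1"
  shows "(\<Sum>r\<in>R. f r) = 0"
proof -
  let ?f = "cut A f"
  have per: "?f (x + u) = ?f x" if "u \<in> B" for x u
  proof -
    have "x + u \<in> A \<longleftrightarrow> x \<in> A"
      using sg_add[OF sg(1), of x u] sg_diff[OF sg(1), of "x + u" u] that sub by auto
    then show ?thesis using mult[of x u] triv[OF that] that sub by (auto simp: cut_def)
  qed
  have T: "transv ((\<lambda>r. r + a) ` R) A B"
  proof (rule transvI)
    show "finite ((\<lambda>r. r + a) ` R)" using transv_finite[OF R] by simp
    show "(\<lambda>r. r + a) ` R \<subseteq> A" using transv_in[OF R] a(1) sg_add[OF sg(1)] by auto
    show "\<exists>r\<in>(\<lambda>r. r + a) ` R. x - r \<in> B" if "x \<in> A" for x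
      using transv_ex[OF R, of "x - a"] sg_diff[OF sg(1) that a(1)] by (auto simp: algebra_simps)
    show "r = s" if "r \<in> (\<lambda>r. r + a) ` R" "s \<in> (\<lambda>r. r + a) ` R" "r - s \<in> B" for r s
      using that transv_eq[OF R _ _ _ sg(2)] by auto
  qed (rule sg(2))
  have "(\<Sum>r\<in>R. ?f r) = (\<Sum>r\<in>(\<lambda>r. r + a) ` R. ?f r)"
    by (rule transv_sum[OF R T sg(2)]) (use per in auto)
  also have "\<dots> = (\<Sum>r\<in>R. ?f (r + a))" by (subst sum.reindex) (auto simp: inj_on_def)
  also have "\<dots> = (\<Sum>r\<in>R. ?f r * f a)"
    by (rule sum.cong) (use mult a transv_in[OF R] sg_add[OF sg(1)] in auto)
  finally have "(\<Sum>r\<in>R. ?f r) * (1 - f a) = 0"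
    by (simp add: sum_distrib_right[symmetric] right_diff_distrib)
  then have "(\<Sum>r\<in>R. ?f r) = 0" using a(2) by simp
  moreover have "(\<Sum>r\<in>R. ?f r) = (\<Sum>r\<in>R. f r)" by (rule sum.cong) (use transv_in[OF R] in auto)
  ultimately show ?thesis by simp
qed

text \<open>The Fourier transform of a function on the dual space, read on \<open>E\<close> itself
  instead of on the double dual; \<open>fhat_eq\<close> identifies it with the function occurring in
  \<open>fourier_dist\<close>.\<close>

definition fhat ::
  "('k::field \<Rightarrow> complex) \<Rightarrow> ('k, 'i, 'v::ab_group_add) filt \<Rightarrow> ('v \<Rightarrow> 'k) dist \<Rightarrow>
   (('v \<Rightarrow> 'k) \<Rightarrow> complex) \<Rightarrow> 'v \<Rightarrow> complex" where
  "fhat \<psi> E n h = cut (spc E) (\<lambda>v. n (cut (spc (c1_dual E)) (\<lambda>w. h w * cnj (\<psi> (w v)))))"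

lemma fhat_eq:
  fixes E :: "('k::{field,finite}, 'i, 'v::ab_group_add) filt"
  assumes fs: "filtered_space E"
  shows "pull E (bidual E) (fourier_fun \<psi> (c1_dual E) n h) = fhat \<psi> E n h"
proof
  fix v
  note fs' = c1_dual_filtered[OF fs]
  show "pull E (bidual E) (fourier_fun \<psi> (c1_dual E) n h) v = fhat \<psi> E n h v"
  proof (cases "v \<in> spc E")
    case True
    then obtain i where i: "i \<in> idx E" "v \<in> fil E i" using spc_fil[OF fs] by blast
    have "bidual E v \<in> functionals (c1_dual E)"
      using spc_add[OF fs'] spc_scl[OF fs']
      unfolding functionals_def lin_on_def bidual_def by (auto simp del: c1_dual_simps(4))
    then have "bidual E v \<in> ann (c1_dual E) (fil (c1_dual E) i)"
      by (rule annI) (use i dualI[OF i(1)] ann_zero in \<open>auto simp: bidual_def simp del: c1_dual_simps(4)\<close>)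
    then have "bidual E v \<in> spc (c1_dual (c1_dual E))" using dualI[of i "c1_dual E"] i(1) by simp
    moreover have "cut (spc (c1_dual E)) (\<lambda>w. h w * cnj (\<psi> (bidual E v w))) =
        cut (spc (c1_dual E)) (\<lambda>w. h w * cnj (\<psi> (w v)))"
      by (auto simp: cut_def bidual_def fun_eq_iff)
    ultimately show ?thesis
      using True unfolding pull_def fourier_fun_def fhat_def by (simp del: c1_dual_simps(4))
  qed (simp add: pull_def fhat_def)
qed

section \<open>Orthogonality of characters and inverse measures\<close>

context
  fixes \<psi> :: "'k::{field,finite} \<Rightarrow> complex"
  assumes \<psi>: "nontrivial_character \<psi>"
begin

lemma
  shows psi_nz: "\<psi> x \<noteq> 0" and psi_add: "\<psi> (x + y) = \<psi> x * \<psi> y" and psi_nontrivial: "\<exists>x. \<psi> x \<noteq> 1"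
  using \<psi> unfolding nontrivial_character_def by blast+

lemma psi_0 [simp]: "\<psi> 0 = 1"
  using psi_add[of 0 0] psi_nz[of 0] by simp

lemma functional_sum_zero:
  fixes E :: "('k, 'i, 'v::ab_group_add) filt"
  assumes fs: "filtered_space E" and R: "transv R (fil E j) (fil E i)" and ij: "(i, j) \<in> leq E"
    and w: "w \<in> ann E (fil E i)" "w \<notin> ann E (fil E j)"
  shows "(\<Sum>r\<in>R. cnj (\<psi> (w r))) = 0"
proof -
  have idx: "i \<in> idx E" "j \<in> idx E" using leq_idx[OF fs ij] by auto
  note wf = ann_functional[OF w(1)]
  obtain a where a: "a \<in> fil E j" "w a \<noteq> 0" using w(2) annI[OF wf] by blast
  obtain c where c: "\<psi> c \<noteq> 1" using psi_nontrivial by blast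
  have "w (scl E (c / w a) a) = c" using functional_scl[OF wf fil_spc[OF fs idx(2) a(1)]] a(2) by simp
  then have "cnj (\<psi> (w (scl E (c / w a) a))) \<noteq> 1" using c by simp
  then show ?thesis
    by (rule char_sum_zero[OF R fil_subgroup[OF fs idx(2)] fil_subgroup[OF fs idx(1)] fil_mono[OF fs ij]
          _ _ fil_scl[OF fs idx(2) a(1)], rotated 2])
      (simp_all add: functional_add[OF wf] fil_spc[OF fs idx(2)] psi_add ann_zero[OF w(1)])
qed

text \<open>Orthogonality in the other variable needs enough functionals;
  \<open>ann_separates\<close> supplies one at which the character is nontrivial.\<close>

lemma vector_sum_zero:
  fixes E :: "('k, 'i, 'v::ab_group_add) filt"
  assumes fs: "filtered_space E" and Q: "transv Q (ann E (fil E i)) (ann E (fil E j))" and ij: "(i, j) \<in> leq E"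
    and v: "v \<in> fil E j" "v \<notin> fil E i"
  shows "(\<Sum>w\<in>Q. cnj (\<psi> (w v))) = 0"
proof -
  have idx: "i \<in> idx E" "j \<in> idx E" using leq_idx[OF fs ij] by auto
  note fs' = c1_dual_filtered[OF fs]
  have sg: "additive_subgroup (ann E (fil E k))" if "k \<in> idx E" for k
    using fil_subgroup[OF fs', of k] that by simp
  obtain c where c: "\<psi> c \<noteq> 1" using psi_nontrivial by blast
  obtain u where u: "u \<in> ann E (fil E i)" "u v = c"
    using ann_separates[OF fs idx(1) fil_spc[OF fs idx(2) v(1)] v(2)] by blast
  have "cnj (\<psi> (u v)) \<noteq> 1" using c u by simp
  then show ?thesis
    by (rule char_sum_zero[OF Q sg[OF idx(1)] sg[OF idx(2)] ann_mono[OF fil_mono[OF fs ij]] _ _ u(1), rotated 2])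
      (use v(1) in \<open>simp_all add: psi_add ann_zero\<close>)
qed

text \<open>The double sum of the conjugates of \<open>\<psi> (w r)\<close> is computed in both
  orders. In one order only the representative \<open>w0\<close> of the zero coset survives and
  leaves the cardinality of \<open>R\<close>; in the other only \<open>r0\<close> survives and
  leaves that of \<open>Q\<close>.\<close>

lemma index_dual:
  fixes E :: "('k, 'i, 'v::ab_group_add) filt"
  assumes fs: "filtered_space E" and ij: "(i, j) \<in> leq E" and R: "transv R (fil E j) (fil E i)"
    and Q: "transv Q (ann E (fil E i)) (ann E (fil E j))"
  shows "card R = card Q"
proof -
  have idx: "i \<in> idx E" "j \<in> idx E" using leq_idx[OF fs ij] by auto
  have idx': "i \<in> idx (c1_dual E)" "j \<in> idx (c1_dual E)" using idx by auto
  note fs' = c1_dual_filtered[OF fs]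
  note sg = fil_subgroup[OF fs idx(1)] fil_subgroup[OF fs' idx'(2)]
  have A0: "0 \<in> ann E (fil E i)" using fil_0[OF fs' idx'(1)] by simp
  obtain w0 where w0: "w0 \<in> Q" "0 - w0 \<in> ann E (fil E j)" using transv_ex[OF Q A0] by blast
  have w0j: "w0 \<in> ann E (fil E j)" using fil_neg[OF fs' idx'(2), of "0 - w0"] w0(2) by simp
  obtain r0 where r0: "r0 \<in> R" "0 - r0 \<in> fil E i" using transv_ex[OF R fil_0[OF fs idx(2)]] by blast
  have r0i: "r0 \<in> fil E i" using fil_neg[OF fs idx(1), of "0 - r0"] r0(2) by simp
  have uw: "w \<notin> ann E (fil E j)" if "w \<in> Q" "w \<noteq> w0" for w
    using transv_eq[OF Q that(1) w0(1)] that fil_diff[OF fs' idx'(2) _, of w w0] w0j sg(2) by auto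
  have ur: "r \<notin> fil E i" if "r \<in> R" "r \<noteq> r0" for r
    using transv_eq[OF R that(1) r0(1)] that fil_diff[OF fs idx(1) _ r0i] sg(1) by auto
  have "(\<Sum>w\<in>Q. \<Sum>r\<in>R. cnj (\<psi> (w r))) = (\<Sum>w\<in>Q. if w = w0 then of_nat (card R) else 0)"
  proof (rule sum.cong[OF refl])
    fix w assume w: "w \<in> Q"
    show "(\<Sum>r\<in>R. cnj (\<psi> (w r))) = (if w = w0 then of_nat (card R) else 0)"
      using functional_sum_zero[OF fs R ij transv_in[OF Q w] uw[OF w]] ann_zero[OF w0j transv_in[OF R]] by simp
  qed
  also have "\<dots> = of_nat (card R)" using w0(1) transv_finite[OF Q] by simp
  finally have 1: "(\<Sum>w\<in>Q. \<Sum>r\<in>R. cnj (\<psi> (w r))) = of_nat (card R)" .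
  have "(\<Sum>r\<in>R. \<Sum>w\<in>Q. cnj (\<psi> (w r))) = (\<Sum>r\<in>R. if r = r0 then of_nat (card Q) else 0)"
  proof (rule sum.cong[OF refl])
    fix r assume r: "r \<in> R"
    show "(\<Sum>w\<in>Q. cnj (\<psi> (w r))) = (if r = r0 then of_nat (card Q) else 0)"
    proof (cases "r = r0")
      case True
      have "(\<Sum>w\<in>Q. cnj (\<psi> (w r))) = (\<Sum>w\<in>Q. 1)"
        by (rule sum.cong) (simp_all add: True ann_zero[OF transv_in[OF Q] r0i])
      then show ?thesis using True by simp
    next
      case False
      then show ?thesis using vector_sum_zero[OF fs Q ij transv_in[OF R r] ur[OF r]] by simp
    qed
  qed
  also have "\<dots> = of_nat (card Q)" using r0(1) transv_finite[OF R] by simp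
  finally have 2: "(\<Sum>r\<in>R. \<Sum>w\<in>Q. cnj (\<psi> (w r))) = of_nat (card Q)" .
  have "(of_nat (card R) :: complex) = of_nat (card Q)"
    unfolding 1[symmetric] 2[symmetric] by (rule sum.swap)
  then show ?thesis by simp
qed

text \<open>The product of the masses of F(i) and of its annihilator has to be independent of
  \<open>i\<close>. Along \<open>i\<close> below \<open>j\<close> the first factor grows by
  [F(j):F(i)] and the second shrinks by the dual index, which is the same number by
  \<open>index_dual\<close>.\<close>

lemma meas_inv:
  fixes E :: "('k, 'i, 'v::ab_group_add) filt"
  assumes c: "c1_space E" and m: "m \<in> meas E" "m \<noteq> 0"
  shows "meas_inv E m \<in> meas (c1_dual E)"
    and "i \<in> idx E \<Longrightarrow> meas_inv E m (ind (ann E (fil E i))) = inverse (m (ind (fil E i)))"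
proof -
  note fs = c1_fs[OF c]
  note c' = c1_dual_c1[OF c]
  note fs' = c1_fs[OF c']
  obtain i0 where i0: "i0 \<in> idx E" using idx_nonempty[OF fs] by blast
  obtain n where n: "n \<in> meas (c1_dual E)" "n (ind (ann E (fil E i0))) = inverse (m (ind (fil E i0)))"
    using meas_exists[OF c', of i0] i0 by auto
  have step: "m (ind (fil E j)) * n (ind (ann E (fil E j))) = m (ind (fil E i)) * n (ind (ann E (fil E i)))"
    if ij: "(i, j) \<in> leq E" for i j
  proof -
    have ji: "(j, i) \<in> leq (c1_dual E)" using ij by simp
    obtain R where R: "transv R (fil E j) (fil E i)" using transv_exists[OF c ij] by blast
    obtain Q where Q: "transv Q (ann E (fil E i)) (ann E (fil E j))" using transv_exists[OF c' ji] by auto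
    show ?thesis
      using meas_index[OF fs m(1) ij R] meas_index[OF fs' n(1) ji, of Q] Q index_dual[OF fs ij R Q] by simp
  qed
  have all: "n (ind (ann E (fil E i))) = inverse (m (ind (fil E i)))" if i: "i \<in> idx E" for i
  proof -
    obtain k where k: "(k, i) \<in> leq E" "(k, i0) \<in> leq E" using fil_below[OF fs i i0] by blast
    have "m (ind (fil E i)) * n (ind (ann E (fil E i))) = 1"
      using step[OF k(1)] step[OF k(2)] n(2) meas_nz[OF c m i0] by simp
    then show ?thesis using meas_nz[OF c m i] by (simp add: field_simps)
  qed
  have "meas_inv E m = n"
    unfolding meas_inv_def
  proof (rule the_equality)
    show "n \<in> meas (c1_dual E) \<and> (\<forall>i\<in>idx E. n (ind (ann E (fil E i))) = inverse (m (ind (fil E i))))"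
      using n(1) all by blast
    show "p = n" if "p \<in> meas (c1_dual E) \<and> (\<forall>i\<in>idx E. p (ind (ann E (fil E i))) = inverse (m (ind (fil E i))))" for p
      using that i0 n by (intro meas_eqI[OF c' _ n(1), of _ i0]) auto
  qed
  then show "meas_inv E m \<in> meas (c1_dual E)"
    "i \<in> idx E \<Longrightarrow> meas_inv E m (ind (ann E (fil E i))) = inverse (m (ind (fil E i)))"
    using n(1) all by auto
qed

lemma meas_inv_unique:
  fixes E :: "('k, 'i, 'v::ab_group_add) filt"
  assumes c: "c1_space E" and m: "m \<in> meas E" "m \<noteq> 0"
    and n: "n \<in> meas (c1_dual E)" and i: "i \<in> idx E" "n (ind (ann E (fil E i))) = inverse (m (ind (fil E i)))"
  shows "meas_inv E m = n"
  using meas_inv[OF c m] n i by (intro meas_eqI[OF c1_dual_c1[OF c], of _ _ i]) auto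

lemma meas_inv_nz:
  fixes E :: "('k, 'i, 'v::ab_group_add) filt"
  assumes c: "c1_space E" and m: "m \<in> meas E" "m \<noteq> 0"
  shows "meas_inv E m \<noteq> 0"
proof -
  obtain i where i: "i \<in> idx E" using idx_nonempty[OF c1_fs[OF c]] by blast
  then show ?thesis using meas_inv(2)[OF c m i] meas_nz[OF c m i] by auto
qed

lemma meas_inv_scale:
  fixes E :: "('k, 'i, 'v::ab_group_add) filt"
  assumes c: "c1_space E" and m: "m \<in> meas E" "m \<noteq> 0" and t: "t \<noteq> 0"
  shows "meas_inv E (fscale t m) = fscale (inverse t) (meas_inv E m)"
proof -
  note fs = c1_fs[OF c]
  obtain i where i: "i \<in> idx E" using idx_nonempty[OF fs] by blast
  show ?thesis
    using meas_inv[OF c m] i t m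
    by (intro meas_inv_unique[OF c meas_scale[OF fs m(1)] _ meas_scale[OF c1_dual_filtered[OF fs]] i])
      (simp_all add: fscale_eq_0)
qed

lemma meas_pairing_inv:
  fixes E :: "('k, 'i, 'v::ab_group_add) filt"
  assumes c: "c1_space E" and m: "m \<in> meas E" "m \<noteq> 0"
  shows "meas_pairing E (fscale s m) (fscale t (meas_inv E m)) = s * t"
proof -
  obtain i where i: "i \<in> idx E" using idx_nonempty[OF c1_fs[OF c]] by blast
  have *: "fscale s m (ind (fil E i)) * fscale t (meas_inv E m) (ind (ann E (fil E i))) = s * t"
    if "i \<in> idx E" for i
    using meas_inv(2)[OF c m that] meas_nz[OF c m that] by simp
  show ?thesis
    unfolding meas_pairing_def by (rule the_equality) (use * i in auto)
qed

text \<open>It suffices to compare masses of one annihilator. Passing to annihilators turns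
  \<beta>(F2(i)) into the intersection with the subspace of the dual triple, and V1 \<inter> F2(i)
  into the image in its quotient.\<close>

lemma meas_inv_tensor:
  fixes E1 :: "('k, 'i1, 'a::ab_group_add) filt"
  assumes adm: "c1_admissible E1 \<alpha> E2 \<beta> E3" and m: "m \<in> meas E1" "m \<noteq> 0" and n: "n \<in> meas E3" "n \<noteq> 0"
  shows "meas_inv E2 (pull_dist E1 \<alpha> E2 \<beta> E3 m n) =
    pull_dist (c1_dual E3) (pull E2 \<beta>) (c1_dual E2) (pull E1 \<alpha>) (c1_dual E1) (meas_inv E3 n) (meas_inv E1 m)"
proof -
  note c = adm_c1[OF adm]
  note adm' = dual_admissible[OF adm]
  obtain i where i: "i \<in> idx E2" using idx_nonempty[OF adm_fs(2)[OF adm]] by blast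
  then have i': "i \<in> idx (c1_dual E2)" by simp
  obtain i1 where i1: "i1 \<in> idx E1" "fil E1 i1 = fil_sub E1 \<alpha> E2 i" using adm_sub_fil[OF adm i] by blast
  obtain i3 where i3: "i3 \<in> idx E3" "fil E3 i3 = \<beta> ` fil E2 i" using adm_img_fil[OF adm i] by blast
  note inv = meas_inv(1)[OF c(3) n] meas_inv(1)[OF c(1) m]
  show ?thesis
  proof (rule meas_inv_unique[OF c(2) pull_dist_meas[OF adm m(1) n(1)] tensor_nz[OF adm m(1) n(1) m(2) n(2)]
        pull_dist_meas[OF adm' inv] i])
    show "pull_dist (c1_dual E3) (pull E2 \<beta>) (c1_dual E2) (pull E1 \<alpha>) (c1_dual E1) (meas_inv E3 n) (meas_inv E1 m)
        (ind (ann E2 (fil E2 i))) = inverse (pull_dist E1 \<alpha> E2 \<beta> E3 m n (ind (fil E2 i)))"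
      using pull_dist_ind[OF adm' inv i'] pull_dist_ind[OF adm m(1) n(1) i] dual_fil_sub[OF adm i]
        pull_alpha_ann[OF adm i] meas_inv(2)[OF c(3) n i3(1)] meas_inv(2)[OF c(1) m i1(1)]
      by (simp add: i1 i3 mult.commute)
  qed
qed

section \<open>Fourier transforms of test functions\<close>

abbreviation "md h v \<equiv> (\<lambda>w. h w * cnj (\<psi> (w v)))"

lemma md_tf:
  fixes E :: "('k, 'i, 'v::ab_group_add) filt"
  assumes h: "tf (c1_dual E) i j h" and v: "v \<in> fil E i"
  shows "tf (c1_dual E) i j (md h v)"
  using h v unfolding tf_def by (auto simp: psi_add ann_zero)

lemma md_test:
  fixes E :: "('k, 'i, 'v::ab_group_add) filt"
  assumes fs: "filtered_space E" and h: "h \<in> test_fun (c1_dual E)" and v: "v \<in> spc E"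
  shows "md h v \<in> test_fun (c1_dual E)"
proof -
  note fs' = c1_dual_filtered[OF fs]
  obtain k where k: "k \<in> idx E" "v \<in> fil E k" using spc_fil[OF fs v] by blast
  then have k': "k \<in> idx (c1_dual E)" by simp
  obtain i j where ij: "tf (c1_dual E) i j h" "(i, k) \<in> leq (c1_dual E)" using tf_below[OF fs' h k'] by blast
  then have "v \<in> fil E i" using k(2) fil_mono[OF fs, of k i] by auto
  then show ?thesis using tf_test_fun[OF fs' md_tf[OF ij(1)]] by blast
qed

lemma fhat_at:
  fixes E :: "('k, 'i, 'v::ab_group_add) filt"
  assumes h: "h \<in> test_fun (c1_dual E)" and v: "v \<in> spc E"
  shows "fhat \<psi> E n h v = n (md h v)"
proof -
  have "cut (spc (c1_dual E)) (md h v) = md h v"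
    using test_fun_out[OF h] by (auto simp: cut_def fun_eq_iff simp del: c1_dual_simps(4))
  then show ?thesis using v by (simp add: fhat_def del: c1_dual_simps(4))
qed

text \<open>Period and support change places. For \<open>v\<close> outside F(i) some
  \<open>u\<close> annihilating F(i) has a nontrivial character value at \<open>v\<close>;
  translating by \<open>u\<close> fixes \<open>h\<close> but multiplies the integral by that value,
  so the integral is 0. Conversely all functionals in the support of \<open>h\<close> vanish on
  F(j), which gives the period.\<close>

lemma fhat_tf:
  fixes E :: "('k, 'i, 'v::ab_group_add) filt"
  assumes fs: "filtered_space E" and h: "tf (c1_dual E) i j h" and n: "n \<in> meas (c1_dual E)"
  shows "tf E j i (fhat \<psi> E n h)"
  unfolding tf_def
proof (intro conjI allI impI ballI)
  note fs' = c1_dual_filtered[OF fs]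
  note ht = tf_test_fun[OF fs' h]
  show ji: "(j, i) \<in> leq E" using tf_leq[OF h] by simp
  have idx: "i \<in> idx E" "j \<in> idx E" using leq_idx[OF fs ji] by auto
  show "fhat \<psi> E n h v = 0" if v: "v \<notin> fil E i" for v
  proof (cases "v \<in> spc E")
    case True
    obtain c where c: "\<psi> c \<noteq> 1" using psi_nontrivial by blast
    obtain u where u: "u \<in> ann E (fil E i)" "u v = c" using ann_separates[OF fs idx(1) True v] by blast
    have us: "u \<in> spc (c1_dual E)" by (rule dualI[OF idx(1) u(1)])
    have "(\<lambda>w. md h v (w + u)) = fscale (cnj (\<psi> c)) (md h v)"
      using tf_per[OF h, of u] u by (simp add: fun_eq_iff psi_add)
    then have "n (md h v) = cnj (\<psi> c) * n (md h v)"
      using meas_translate[OF n md_test[OF fs ht True] us] dist_scale[OF meas_dist[OF n] md_test[OF fs ht True]] by simp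
    then have "n (md h v) = 0" using c by auto
    then show ?thesis using fhat_at[OF ht True] by simp
  qed (simp add: fhat_def)
  show "fhat \<psi> E n h (v + u) = fhat \<psi> E n h v" if u: "u \<in> fil E j" for v u
  proof (cases "v \<in> spc E")
    case True
    have vu: "v + u \<in> spc E" using spc_add[OF fs True fil_spc[OF fs idx(2) u]] .
    have "md h (v + u) = md h v"
    proof
      fix w
      show "md h (v + u) w = md h v w"
      proof (cases "w \<in> ann E (fil E j)")
        case w: True
        then show ?thesis
          using functional_add[OF ann_functional[OF w] True fil_spc[OF fs idx(2) u]] ann_zero[OF w u] by simp
      next
        case False
        then show ?thesis using tf_supp[OF h, of w] by simp
      qed
    qed
    then show ?thesis using fhat_at[OF ht] True vu by simp
  next
    case False
    then show ?thesis using spc_add_iff[OF fs fil_spc[OF fs idx(2) u], of v] by (simp add: fhat_def)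
  qed
qed

lemma fhat_test:
  fixes E :: "('k, 'i, 'v::ab_group_add) filt"
  assumes fs: "filtered_space E" and h: "h \<in> test_fun (c1_dual E)" and n: "n \<in> meas (c1_dual E)"
  shows "fhat \<psi> E n h \<in> test_fun E"
  using test_fun_tf[OF c1_dual_filtered[OF fs] h] fhat_tf[OF fs _ n] tf_test_fun[OF fs] by blast

text \<open>At a finite level this is a double sum over \<open>R\<close> and \<open>Q\<close>.
  Orthogonality keeps only the representative of the zero coset, and the mass of F(j), the index
  [F(i):F(j)] and the dual mass of the annihilator of F(i) multiply to 1. Inversion at 0 suffices,
  because moving the argument amounts to modulating \<open>h\<close>.\<close>

lemma fourier_inversion_0:
  fixes E :: "('k, 'i, 'v::ab_group_add) filt"
  assumes c: "c1_space E" and m: "m \<in> meas E" "m \<noteq> 0" and h: "h \<in> test_fun (c1_dual E)"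
  shows "m (fhat \<psi> E (meas_inv E m) h) = h 0"
proof -
  note fs = c1_fs[OF c]
  note c' = c1_dual_c1[OF c]
  note fs' = c1_fs[OF c']
  let ?n = "meas_inv E m"
  note n = meas_inv[OF c m]
  obtain i j where ij: "tf (c1_dual E) i j h" using test_fun_tf[OF fs' h] by blast
  have ji: "(j, i) \<in> leq E" using tf_leq[OF ij] by simp
  have idx: "i \<in> idx E" "j \<in> idx E" using leq_idx[OF fs ji] by auto
  have idx': "i \<in> idx (c1_dual E)" using idx by simp
  obtain R where R: "transv R (fil E i) (fil E j)" using transv_exists[OF c ji] by blast
  obtain Q where Q: "transv Q (fil (c1_dual E) j) (fil (c1_dual E) i)"
    using transv_exists[OF c' tf_leq[OF ij]] by blast
  obtain w0 where w0: "w0 \<in> Q" "0 - w0 \<in> fil (c1_dual E) i"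
    using transv_ex[OF Q fil_0[OF fs']] idx by auto
  have w0i: "w0 \<in> fil (c1_dual E) i" using fil_neg[OF fs' idx', of "0 - w0"] w0(2) by simp
  have uw: "w \<notin> ann E (fil E i)" if "w \<in> Q" "w \<noteq> w0" for w
    using transv_eq[OF Q that(1) w0(1)] that fil_diff[OF fs' idx' _ w0i, of w] fil_subgroup[OF fs' idx'] by auto
  have h0: "h w0 = h 0" using tf_per[OF ij w0i, of 0] by simp
  have "m (fhat \<psi> E ?n h) = (\<Sum>r\<in>R. fhat \<psi> E ?n h r) * m (ind (fil E j))"
    by (rule meas_riemann[OF fs m(1) fhat_tf[OF fs ij n(1)] R])
  also have "(\<Sum>r\<in>R. fhat \<psi> E ?n h r) = (\<Sum>r\<in>R. (\<Sum>w\<in>Q. md h r w) * ?n (ind (ann E (fil E i))))"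
  proof (rule sum.cong[OF refl])
    fix r assume r: "r \<in> R"
    note ri = transv_in[OF R r]
    show "fhat \<psi> E ?n h r = (\<Sum>w\<in>Q. md h r w) * ?n (ind (ann E (fil E i)))"
      using meas_riemann[OF fs' n(1) md_tf[OF ij ri] Q] fhat_at[OF h fil_spc[OF fs idx(1) ri]] by simp
  qed
  also have "\<dots> = (\<Sum>w\<in>Q. h w * (\<Sum>r\<in>R. cnj (\<psi> (w r)))) * ?n (ind (ann E (fil E i)))"
    unfolding sum_distrib_right[symmetric] sum_distrib_left by (subst sum.swap) simp
  also have "(\<Sum>w\<in>Q. h w * (\<Sum>r\<in>R. cnj (\<psi> (w r)))) = (\<Sum>w\<in>Q. if w = w0 then h 0 * of_nat (card R) else 0)"
  proof (rule sum.cong[OF refl])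
    fix w assume w: "w \<in> Q"
    have wa: "w \<in> ann E (fil E j)" using transv_in[OF Q w] by simp
    have w0a: "w0 r = 0" if "r \<in> R" for r using ann_zero[of w0 E "fil E i"] w0i transv_in[OF R that] by simp
    show "h w * (\<Sum>r\<in>R. cnj (\<psi> (w r))) = (if w = w0 then h 0 * of_nat (card R) else 0)"
      using functional_sum_zero[OF fs R ji wa uw[OF w]] w0a by (simp add: h0)
  qed
  also have "\<dots> = h 0 * of_nat (card R)" using w0(1) transv_finite[OF Q] by simp
  finally show ?thesis
    using meas_index[OF fs m(1) ji R] n(2)[OF idx(1)] meas_nz[OF c m idx(1)] meas_nz[OF c m idx(2)]
    by (simp add: field_simps)
qed

text \<open>For \<open>v\<close> in V1 the character of \<alpha>(v) is constant along the dual of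
  V3, since \<beta> \<circ> \<alpha> = 0. It can be taken out of the fibre integral, and Fubini
  gives the claim.\<close>

lemma pull_fhat:
  fixes E1 :: "('k, 'i1, 'a::ab_group_add) filt"
  assumes adm: "c1_admissible E1 \<alpha> E2 \<beta> E3"
    and n: "n3 \<in> meas (c1_dual E3)" "n1 \<in> meas (c1_dual E1)" and f: "f \<in> test_fun (c1_dual E2)"
  shows "pull E1 \<alpha> (fhat \<psi> E2 (pull_dist (c1_dual E3) (pull E2 \<beta>) (c1_dual E2) (pull E1 \<alpha>) (c1_dual E1) n3 n1) f) =
    fhat \<psi> E1 n1 (fibre_integral (c1_dual E3) (pull E2 \<beta>) (c1_dual E2) (pull E1 \<alpha>) (c1_dual E1) n3 f)"
    (is "?L = fhat \<psi> E1 n1 ?g")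
proof
  fix v
  note adm' = dual_admissible[OF adm]
  note gt = fibre_test[OF adm' f n(1)]
  show "?L v = fhat \<psi> E1 n1 ?g v"
  proof (cases "v \<in> spc E1")
    case True
    note av = adm_alpha_spc[OF adm True]
    note ft = md_test[OF adm_fs(2)[OF adm] f av]
    have "fibre_integral (c1_dual E3) (pull E2 \<beta>) (c1_dual E2) (pull E1 \<alpha>) (c1_dual E1) n3 (md f (\<alpha> v)) = md ?g v"
    proof (rule fibre_eqI[OF adm' ft n(1)])
      fix w assume w: "w \<in> spc (c1_dual E2)"
      have *: "pull E2 \<beta> x (\<alpha> v) = 0" if "x \<in> spc (c1_dual E3)" for x
        using av adm_comp[OF adm True] functional_0[OF adm_fs(3)[OF adm] dual_functional[OF that]]
        by (simp add: pull_def)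
      have "cut (spc (c1_dual E3)) (\<lambda>x. md f (\<alpha> v) (w + pull E2 \<beta> x)) =
          fscale (cnj (\<psi> (w (\<alpha> v)))) (cut (spc (c1_dual E3)) (\<lambda>x. f (w + pull E2 \<beta> x)))"
        using * by (auto simp: fun_eq_iff cut_def simp del: c1_dual_simps(4))
      then have "n3 (cut (spc (c1_dual E3)) (\<lambda>x. md f (\<alpha> v) (w + pull E2 \<beta> x))) =
          cnj (\<psi> (w (\<alpha> v))) * ?g (pull E1 \<alpha> w)"
        using dist_scale[OF meas_dist[OF n(1)] slice_test[OF adm' f w]] fibre_at[OF adm' f n(1) w] by simp
      then show "n3 (cut (spc (c1_dual E3)) (\<lambda>x. md f (\<alpha> v) (w + pull E2 \<beta> x))) = md ?g v (pull E1 \<alpha> w)"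
        using True by (simp add: pull_def)
    qed (simp add: test_fun_out[OF gt] del: c1_dual_simps(4))
    then show ?thesis
      using True fhat_at[OF f av] fhat_at[OF gt True] pull_dist_apply[OF adm' ft] by (simp add: pull_def)
  qed (simp add: pull_def fhat_def)
qed

lemma fhat_scale:
  fixes E :: "('k, 'i, 'v::ab_group_add) filt"
  shows "fhat \<psi> E (fscale t n) h = fscale t (fhat \<psi> E n h)"
  by (auto simp: fhat_def cut_def fun_eq_iff)

text \<open>Poisson summation over the fibre through \<open>x\<close>. Replacing \<open>f\<close> by
  its modulation at \<open>x\<close> moves the fibre to V1; there the transform is restricted by
  \<open>pull_fhat\<close>, and its integral is a value at 0 by inversion. What remains is an
  integral over the dual of V3 against the character of \<beta>(x).\<close>

lemma fibre_poisson:
  fixes E1 :: "('k, 'i1, 'a::ab_group_add) filt"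
  assumes adm: "c1_admissible E1 \<alpha> E2 \<beta> E3" and m: "m1 \<in> meas E1" "m1 \<noteq> 0"
    and n: "n3 \<in> meas (c1_dual E3)" and f: "f \<in> test_fun (c1_dual E2)"
  shows "fibre_integral E1 \<alpha> E2 \<beta> E3 m1 (fhat \<psi> E2 (pull_dist (c1_dual E3) (pull E2 \<beta>) (c1_dual E2)
      (pull E1 \<alpha>) (c1_dual E1) n3 (meas_inv E1 m1)) f) = fhat \<psi> E3 n3 (pull (c1_dual E3) (pull E2 \<beta>) f)"
    (is "fibre_integral _ _ _ _ _ _ (fhat \<psi> E2 ?n f) = _")
proof -
  note adm' = dual_admissible[OF adm]
  note n1 = meas_inv(1)[OF adm_c1(1)[OF adm] m]
  note n2 = pull_dist_meas[OF adm' n n1]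
  note ft = fhat_test[OF adm_fs(2)[OF adm] f n2]
  note pt = adm_pull_test[OF adm' f]
  show ?thesis
  proof (rule fibre_eqI[OF adm ft m(1)])
    fix x assume x: "x \<in> spc E2"
    note gt = md_test[OF adm_fs(2)[OF adm] f x]
    have eq: "md f (x + \<alpha> v) w = md (md f x) (\<alpha> v) w" if "v \<in> spc E1" for v w
    proof (cases "w \<in> spc (c1_dual E2)")
      case True
      then show ?thesis
        using functional_add[OF dual_functional[OF True] x adm_alpha_spc[OF adm that]] by (simp add: psi_add)
    qed (use test_fun_out[OF f] in simp)
    have "cut (spc E1) (\<lambda>v. fhat \<psi> E2 ?n f (x + \<alpha> v)) = pull E1 \<alpha> (fhat \<psi> E2 ?n (md f x))"
    proof
      fix v
      show "cut (spc E1) (\<lambda>v. fhat \<psi> E2 ?n f (x + \<alpha> v)) v = pull E1 \<alpha> (fhat \<psi> E2 ?n (md f x)) v"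
      proof (cases "v \<in> spc E1")
        case True
        note av = adm_alpha_spc[OF adm True]
        show ?thesis
          using fhat_at[OF f spc_add[OF adm_fs(2)[OF adm] x av]] fhat_at[OF gt av] eq[OF True] True
          by (simp add: pull_def)
      qed (simp add: pull_def)
    qed
    also have "\<dots> = fhat \<psi> E1 (meas_inv E1 m1) (fibre_integral (c1_dual E3) (pull E2 \<beta>) (c1_dual E2)
        (pull E1 \<alpha>) (c1_dual E1) n3 (md f x))"
      by (rule pull_fhat[OF adm n n1 gt])
    finally have "m1 (cut (spc E1) (\<lambda>v. fhat \<psi> E2 ?n f (x + \<alpha> v))) =
        fibre_integral (c1_dual E3) (pull E2 \<beta>) (c1_dual E2) (pull E1 \<alpha>) (c1_dual E1) n3 (md f x) 0"
      using fourier_inversion_0[OF adm_c1(1)[OF adm] m fibre_test[OF adm' gt n]] by simp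
    also have "\<dots> = n3 (cut (spc (c1_dual E3)) (\<lambda>w. md f x (0 + pull E2 \<beta> w)))"
      using fibre_at[OF adm' gt n spc_0[OF adm_fs(2)[OF adm']]] adm_beta_0[OF adm'] by simp
    also have "cut (spc (c1_dual E3)) (\<lambda>w. md f x (0 + pull E2 \<beta> w)) =
        md (pull (c1_dual E3) (pull E2 \<beta>) f) (\<beta> x)"
      using x by (auto simp: pull_def cut_def fun_eq_iff simp del: c1_dual_simps(4))
    also have "n3 \<dots> = fhat \<psi> E3 n3 (pull (c1_dual E3) (pull E2 \<beta>) f) (\<beta> x)"
      using fhat_at[OF pt adm_beta_spc[OF adm x]] by simp
    finally show "m1 (cut (spc E1) (\<lambda>v. fhat \<psi> E2 ?n f (x + \<alpha> v))) =
        fhat \<psi> E3 n3 (pull (c1_dual E3) (pull E2 \<beta>) f) (\<beta> x)" .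
  qed (simp add: fhat_def)
qed

section \<open>Fourier transforms of distributions\<close>

lemma fourier_dist_apply:
  fixes E :: "('k, 'i, 'v::ab_group_add) filt"
  assumes "filtered_space E"
  shows "fourier_dist \<psi> E m G = cut (test_fun (c1_dual E)) (\<lambda>f. G (fhat \<psi> E (meas_inv E m) f))"
  by (simp add: fourier_dist_def fhat_eq[OF assms])

lemma fourier_dist_dists:
  fixes E :: "('k, 'i, 'v::ab_group_add) filt"
  assumes c: "c1_space E" and m: "m \<in> meas E" "m \<noteq> 0" and G: "G \<in> dists E"
  shows "fourier_dist \<psi> E m G \<in> dists (c1_dual E)"
proof (rule distI)
  note fs = c1_fs[OF c]
  note n = meas_inv(1)[OF c m]
  show fs': "filtered_space (c1_dual E)" by (rule c1_dual_filtered[OF fs])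
  fix f g t assume f: "f \<in> test_fun (c1_dual E)" and g: "g \<in> test_fun (c1_dual E)"
  note fg = test_fun_lin[OF fs' f g, of t]
  have "fhat \<psi> E (meas_inv E m) (fscale t f + g) = fscale t (fhat \<psi> E (meas_inv E m) f) + fhat \<psi> E (meas_inv E m) g"
  proof
    fix v
    show "fhat \<psi> E (meas_inv E m) (fscale t f + g) v =
        (fscale t (fhat \<psi> E (meas_inv E m) f) + fhat \<psi> E (meas_inv E m) g) v"
    proof (cases "v \<in> spc E")
      case True
      have "md (fscale t f + g) v = fscale t (md f v) + md g v" by (auto simp: fun_eq_iff algebra_simps)
      then show ?thesis
        using fhat_at[OF _ True] f g fg
          dist_lin[OF fs' meas_dist[OF n] md_test[OF fs f True] md_test[OF fs g True]] by simp
    qed (simp add: fhat_def)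
  qed
  then show "fourier_dist \<psi> E m G (fscale t f + g) = t * fourier_dist \<psi> E m G f + fourier_dist \<psi> E m G g"
    using f g fg dist_lin[OF fs G fhat_test[OF fs f n] fhat_test[OF fs g n]]
    by (simp add: fourier_dist_apply[OF fs])
qed (simp add: fourier_dist_def)

lemma fourier_dist_scale:
  fixes E :: "('k, 'i, 'v::ab_group_add) filt"
  assumes c: "c1_space E" and m: "m \<in> meas E" "m \<noteq> 0" and t: "t \<noteq> 0" and G: "G \<in> dists E"
  shows "fourier_dist \<psi> E (fscale t m) (fscale s G) = fscale (s / t) (fourier_dist \<psi> E m G)"
proof -
  note fs = c1_fs[OF c]
  note n = meas_inv(1)[OF c m]
  show ?thesis
    by (auto simp: fourier_dist_apply[OF fs] cut_def fun_eq_iff meas_inv_scale[OF c m t] fhat_scale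
        dist_scale[OF G fhat_test[OF fs _ n]] divide_inverse)
qed

context
  fixes E1 :: "('k, 'i1, 'a::ab_group_add) filt" and \<alpha> :: "'a \<Rightarrow> 'b::ab_group_add"
    and E2 :: "('k, 'i2, 'b) filt" and \<beta> :: "'b \<Rightarrow> 'c::ab_group_add" and E3 :: "('k, 'i3, 'c) filt"
  assumes adm: "c1_admissible E1 \<alpha> E2 \<beta> E3"
begin

text \<open>Conjugate to \<open>pull_fhat\<close>, the inverse of the product measure being split by
  \<open>meas_inv_tensor\<close>.\<close>

lemma fourier_push:
  assumes m: "m1 \<in> meas E1" "m1 \<noteq> 0" and m': "m3 \<in> meas E3" "m3 \<noteq> 0"
  shows "fourier_dist \<psi> E2 (pull_dist E1 \<alpha> E2 \<beta> E3 m1 m3) (push_dist E1 \<alpha> E2 G) =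
    pull_dist (c1_dual E3) (pull E2 \<beta>) (c1_dual E2) (pull E1 \<alpha>) (c1_dual E1) (meas_inv E3 m3)
      (fourier_dist \<psi> E1 m1 G)"
proof
  fix f
  note c = adm_c1[OF adm] and fs = adm_fs[OF adm] and adm' = dual_admissible[OF adm]
  note n = meas_inv(1)[OF c(3) m'] meas_inv(1)[OF c(1) m]
  note inv = meas_inv_tensor[OF adm m m']
  note n2 = pull_dist_meas[OF adm' n]
  show "fourier_dist \<psi> E2 (pull_dist E1 \<alpha> E2 \<beta> E3 m1 m3) (push_dist E1 \<alpha> E2 G) f =
    pull_dist (c1_dual E3) (pull E2 \<beta>) (c1_dual E2) (pull E1 \<alpha>) (c1_dual E1) (meas_inv E3 m3)
      (fourier_dist \<psi> E1 m1 G) f"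
  proof (cases "f \<in> test_fun (c1_dual E2)")
    case True
    then show ?thesis
      using fhat_test[OF fs(2) True n2] fibre_test[OF adm' True n(1)] pull_fhat[OF adm n True]
      by (simp add: fourier_dist_apply[OF fs(2)] fourier_dist_apply[OF fs(1)] inv push_dist_def
          pull_dist_apply[OF adm'])
  qed (simp add: fourier_dist_def pull_dist_def)
qed

text \<open>Conjugate to \<open>fibre_poisson\<close>.\<close>

lemma fourier_pull:
  assumes m: "m1 \<in> meas E1" "m1 \<noteq> 0" and m': "m3 \<in> meas E3" "m3 \<noteq> 0"
  shows "fourier_dist \<psi> E2 (pull_dist E1 \<alpha> E2 \<beta> E3 m1 m3) (pull_dist E1 \<alpha> E2 \<beta> E3 m1 G) =
    push_dist (c1_dual E3) (pull E2 \<beta>) (c1_dual E2) (fourier_dist \<psi> E3 m3 G)"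
proof
  fix f
  note c = adm_c1[OF adm] and fs = adm_fs[OF adm] and adm' = dual_admissible[OF adm]
  note n = meas_inv(1)[OF c(3) m'] meas_inv(1)[OF c(1) m]
  note inv = meas_inv_tensor[OF adm m m']
  note n2 = pull_dist_meas[OF adm' n]
  show "fourier_dist \<psi> E2 (pull_dist E1 \<alpha> E2 \<beta> E3 m1 m3) (pull_dist E1 \<alpha> E2 \<beta> E3 m1 G) f =
    push_dist (c1_dual E3) (pull E2 \<beta>) (c1_dual E2) (fourier_dist \<psi> E3 m3 G) f"
  proof (cases "f \<in> test_fun (c1_dual E2)")
    case True
    then show ?thesis
      using fhat_test[OF fs(2) True n2] adm_pull_test[OF adm' True] fibre_poisson[OF adm m n(1) True]
      by (simp add: fourier_dist_apply[OF fs(2)] fourier_dist_apply[OF fs(3)] inv push_dist_def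
          pull_dist_apply[OF adm])
  qed (simp add: fourier_dist_def push_dist_def)
qed

text \<open>By inversion the transform of \<open>m1\<close> with respect to \<open>m1\<close> itself
  is evaluation at 0. Its inverse image under the transpose of \<alpha> integrates over the fibre
  above 0, which is the dual of V3.\<close>

lemma fourier_push_meas:
  assumes m: "m1 \<in> meas E1" "m1 \<noteq> 0" and m': "m3 \<in> meas E3" "m3 \<noteq> 0"
  shows "fourier_dist \<psi> E2 (pull_dist E1 \<alpha> E2 \<beta> E3 m1 m3) (push_dist E1 \<alpha> E2 m1) =
    push_dist (c1_dual E3) (pull E2 \<beta>) (c1_dual E2) (meas_inv E3 m3)"
proof
  fix f
  note c = adm_c1[OF adm] and fs = adm_fs[OF adm] and adm' = dual_admissible[OF adm]
  note n = meas_inv(1)[OF c(3) m'] meas_inv(1)[OF c(1) m]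
  show "fourier_dist \<psi> E2 (pull_dist E1 \<alpha> E2 \<beta> E3 m1 m3) (push_dist E1 \<alpha> E2 m1) f =
    push_dist (c1_dual E3) (pull E2 \<beta>) (c1_dual E2) (meas_inv E3 m3) f"
  proof (cases "f \<in> test_fun (c1_dual E2)")
    case True
    note gt = fibre_test[OF adm' True n(1)]
    have "pull_dist (c1_dual E3) (pull E2 \<beta>) (c1_dual E2) (pull E1 \<alpha>) (c1_dual E1) (meas_inv E3 m3)
        (fourier_dist \<psi> E1 m1 m1) f =
        fibre_integral (c1_dual E3) (pull E2 \<beta>) (c1_dual E2) (pull E1 \<alpha>) (c1_dual E1) (meas_inv E3 m3) f 0"
      using True gt fourier_inversion_0[OF c(1) m gt]
      by (simp add: pull_dist_def fourier_dist_apply[OF fs(1)])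
    also have "\<dots> = meas_inv E3 m3 (cut (spc (c1_dual E3)) (\<lambda>w. f (0 + pull E2 \<beta> w)))"
      using fibre_at[OF adm' True n(1) spc_0[OF adm_fs(2)[OF adm']]] adm_beta_0[OF adm'] by simp
    finally show ?thesis using True fourier_push[OF m m'] by (simp add: push_dist_def pull_def[of _ "pull E2 \<beta>"])
  qed (simp add: fourier_dist_def push_dist_def)
qed

end

end

section \<open>Zero spaces\<close>

lemma zero_space_test:
  fixes E :: "('k::field, 'i, 'v::ab_group_add) filt"
  assumes fs: "filtered_space E" and z: "spc E = {0}"
  shows "f \<in> test_fun E \<longleftrightarrow> (\<forall>x. x \<noteq> 0 \<longrightarrow> f x = 0)"
proof
  assume "f \<in> test_fun E"
  then show "\<forall>x. x \<noteq> 0 \<longrightarrow> f x = 0" using test_fun_out z by blast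
next
  assume f: "\<forall>x. x \<noteq> 0 \<longrightarrow> f x = 0"
  obtain i where i: "i \<in> idx E" using idx_nonempty[OF fs] by blast
  then have "fil E i = {0}" using fil_0[OF fs i] fil_spc[OF fs i] z by blast
  then have "tf E i i f" using f leq_refl[OF fs i] by (simp add: tf_def)
  then show "f \<in> test_fun E" by (rule tf_test_fun[OF fs])
qed

lemma unit_meas_meas:
  fixes E :: "('k::field, 'i, 'v::ab_group_add) filt"
  assumes fs: "filtered_space E" and z: "spc E = {0}"
  shows "unit_meas E \<in> meas E" "unit_meas E (ind {0}) = 1" "unit_meas E \<noteq> 0"
proof -
  show "unit_meas E \<in> meas E"
    unfolding meas_def
  proof (intro CollectI conjI ballI)
    show "unit_meas E \<in> dists E"
      by (rule distI[OF _ _ fs]) (simp_all add: unit_meas_def test_fun_lin[OF fs])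
  qed (simp add: z)
  show *: "unit_meas E (ind {0}) = 1"
    using zero_space_test[OF fs z, of "ind {0}"] by (simp add: unit_meas_def ind_def)
  then show "unit_meas E \<noteq> 0" by auto
qed

lemma zero_space_meas:
  fixes E :: "('k::{field,finite}, 'i, 'v::ab_group_add) filt"
  assumes c: "c1_space E" and z: "spc E = {0}" and m: "m \<in> meas E"
  shows "m = fscale (m (ind {0})) (unit_meas E)"
proof -
  note u = unit_meas_meas[OF c1_fs[OF c] z]
  obtain t where "m = fscale t (unit_meas E)" using meas_multiple[OF c u(1,3) m] by blast
  then show ?thesis using u(2) by simp
qed

lemma pull_dist_unit_right:
  fixes E1 :: "('k::{field,finite}, 'i1, 'a::ab_group_add) filt"
  assumes adm: "c1_admissible E1 \<alpha> E2 \<beta> E3" and z: "spc E3 = {0}" and m: "m \<in> meas E1"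
  shows "pull_dist E1 \<alpha> E2 \<beta> E3 m (unit_meas E3) = push_dist E1 \<alpha> E2 m"
proof
  fix f
  show "pull_dist E1 \<alpha> E2 \<beta> E3 m (unit_meas E3) f = push_dist E1 \<alpha> E2 m f"
  proof (cases "f \<in> test_fun E2")
    case True
    then show ?thesis
      using fibre_at[OF adm True m spc_0[OF adm_fs(2)[OF adm]]] adm_beta_0[OF adm] fibre_test[OF adm True m]
      by (simp add: pull_dist_def push_dist_def unit_meas_def pull_def)
  qed (simp add: pull_dist_def push_dist_def)
qed

lemma pull_dist_unit_left:
  fixes E1 :: "('k::{field,finite}, 'i1, 'a::ab_group_add) filt"
  assumes adm: "c1_admissible E1 \<alpha> E2 \<beta> E2" and z: "spc E1 = {0}" and G: "G \<in> dists E2"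
    and id: "\<And>x. x \<in> spc E2 \<Longrightarrow> \<beta> x = x"
  shows "pull_dist E1 \<alpha> E2 \<beta> E2 (unit_meas E1) G = G"
proof
  fix f
  note u = unit_meas_meas(1)[OF adm_fs(1)[OF adm] z]
  show "pull_dist E1 \<alpha> E2 \<beta> E2 (unit_meas E1) G f = G f"
  proof (cases "f \<in> test_fun E2")
    case True
    have "fibre_integral E1 \<alpha> E2 \<beta> E2 (unit_meas E1) f = f"
    proof (rule fibre_eqI[OF adm True u])
      fix w assume w: "w \<in> spc E2"
      then show "unit_meas E1 (cut (spc E1) (\<lambda>v. f (w + \<alpha> v))) = f (\<beta> w)"
        using slice_test[OF adm True w] adm_alpha_0[OF adm] id[OF w] by (simp add: unit_meas_def z)
    qed (rule test_fun_out[OF True])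
    then show ?thesis using True by (simp add: pull_dist_def)
  qed (simp add: pull_dist_def dist_out[OF G])
qed

lemma push_dist_unit:
  fixes E1 :: "('k::{field,finite}, 'i1, 'a::ab_group_add) filt"
  assumes adm: "c1_admissible E1 \<alpha> E2 \<beta> E3" and z: "spc E1 = {0}" "spc E2 = {0}"
  shows "push_dist E1 \<alpha> E2 (unit_meas E1) = unit_meas E2"
  using adm_pull_test[OF adm] adm_alpha_0[OF adm] z
  by (auto simp: push_dist_def unit_meas_def cut_def fun_eq_iff pull_def)

section \<open>Systems of quotients\<close>

text \<open>What is used of a \<open>C\<^sub>2\<close>-space are the quotients \<open>F(j)/F(i)\<close> and the maps between them. In
  contrast to \<open>c2_space\<close>, this notion is stable under duality.\<close>

locale c2sys =
  fixes E :: "('k::{field,finite}, 'i, 'v::ab_group_add, 'x, 'w::ab_group_add) c2"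
  assumes order: "partial_order_on (idx E) (leq E)"
    and below: "i \<in> idx E \<Longrightarrow> j \<in> idx E \<Longrightarrow> \<exists>k. (k, i) \<in> leq E \<and> (k, j) \<in> leq E"
    and above: "i \<in> idx E \<Longrightarrow> j \<in> idx E \<Longrightarrow> \<exists>k. (i, k) \<in> leq E \<and> (j, k) \<in> leq E"
    and adm: "(i, j) \<in> leq E \<Longrightarrow> (j, k) \<in> leq E \<Longrightarrow>
      c1_admissible (quo E i j) (inc E i j k) (quo E i k) (prj E i j k) (quo E j k)"
    and quo_refl: "i \<in> idx E \<Longrightarrow> spc (quo E i i) = {0}"
    and inc_id: "(i, j) \<in> leq E \<Longrightarrow> x \<in> spc (quo E i j) \<Longrightarrow> inc E i j j x = x"
    and prj_id: "(i, j) \<in> leq E \<Longrightarrow> x \<in> spc (quo E i j) \<Longrightarrow> prj E i i j x = x"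
    and inc_inc: "(i, j) \<in> leq E \<Longrightarrow> (j, k) \<in> leq E \<Longrightarrow> (k, l) \<in> leq E \<Longrightarrow> x \<in> spc (quo E i j) \<Longrightarrow>
      inc E i k l (inc E i j k x) = inc E i j l x"
    and prj_prj: "(i, j) \<in> leq E \<Longrightarrow> (j, k) \<in> leq E \<Longrightarrow> (k, l) \<in> leq E \<Longrightarrow> x \<in> spc (quo E i l) \<Longrightarrow>
      prj E j k l (prj E i j l x) = prj E i k l x"
    and prj_inc: "(i, j) \<in> leq E \<Longrightarrow> (j, k) \<in> leq E \<Longrightarrow> (k, l) \<in> leq E \<Longrightarrow> x \<in> spc (quo E i k) \<Longrightarrow>
      prj E i j l (inc E i k l x) = inc E j k l (prj E i j k x)"
begin

lemma le_idx: "(i, j) \<in> leq E \<Longrightarrow> i \<in> idx E" "(i, j) \<in> leq E \<Longrightarrow> j \<in> idx E"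
  using order unfolding partial_order_on_def preorder_on_def by blast+

lemma le_refl: "i \<in> idx E \<Longrightarrow> (i, i) \<in> leq E"
  using order unfolding partial_order_on_def preorder_on_def refl_on_def by blast

lemma le_trans: "(i, j) \<in> leq E \<Longrightarrow> (j, k) \<in> leq E \<Longrightarrow> (i, k) \<in> leq E"
  using order unfolding partial_order_on_def preorder_on_def by (auto elim: transD)

lemma le_refl1: "(i, j) \<in> leq E \<Longrightarrow> (i, i) \<in> leq E" and le_refl2: "(i, j) \<in> leq E \<Longrightarrow> (j, j) \<in> leq E"
  using le_refl le_idx by blast+

lemma below3: "i \<in> idx E \<Longrightarrow> j \<in> idx E \<Longrightarrow> k \<in> idx E \<Longrightarrow>
    \<exists>l. (l, i) \<in> leq E \<and> (l, j) \<in> leq E \<and> (l, k) \<in> leq E"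
  using below le_trans le_idx by meson

lemma quo_c1: "(i, j) \<in> leq E \<Longrightarrow> c1_space (quo E i j)"
  using adm_c1(1)[OF adm] le_refl2 by blast

lemma quo_fs: "(i, j) \<in> leq E \<Longrightarrow> filtered_space (quo E i j)"
  using quo_c1 c1_fs by blast

abbreviation tens :: "'i \<Rightarrow> 'i \<Rightarrow> 'i \<Rightarrow> 'w dist \<Rightarrow> 'w dist \<Rightarrow> 'w dist" where
  "tens i j k \<equiv> pull_dist (quo E i j) (inc E i j k) (quo E i k) (prj E i j k) (quo E j k)"

lemma quo_tensor_eq:
  "(i, j) \<in> leq E \<Longrightarrow> (j, k) \<in> leq E \<Longrightarrow> m \<in> meas (quo E i j) \<Longrightarrow> n \<in> meas (quo E j k) \<Longrightarrow>
    quo_tensor E i j k m n = tens i j k m n"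
  unfolding quo_tensor_def by (rule meas_tensor_eq[OF adm])

text \<open>Associativity of the product of measures, as integration in stages along l \<le> i \<le>
  j \<le> k; \<open>G\<close> may be any distribution.\<close>

lemma tens_tens:
  assumes "(l, i) \<in> leq E" "(i, j) \<in> leq E" "(j, k) \<in> leq E"
    and "m \<in> meas (quo E l i)" "n \<in> meas (quo E i j)"
  shows "tens l i k m (tens i j k n G) = tens l j k (tens l i j m n) G"
  by (rule pull_dist_comp[OF adm[OF assms(1) le_trans[OF assms(2,3)]] adm[OF assms(2,3)]
        adm[OF le_trans[OF assms(1,2)] assms(3)] adm[OF assms(1,2)] _ _ _ assms(4,5)])
    (use inc_inc prj_prj prj_inc assms in blast)+

lemma tens_scale:
  "(i, j) \<in> leq E \<Longrightarrow> (j, k) \<in> leq E \<Longrightarrow> m \<in> meas (quo E i j) \<Longrightarrow> G \<in> dists (quo E j k) \<Longrightarrow>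
    tens i j k (fscale s m) (fscale t G) = fscale (s * t) (tens i j k m G)"
  by (rule pull_dist_scale[OF adm])

lemma tens_meas:
  "(i, j) \<in> leq E \<Longrightarrow> (j, k) \<in> leq E \<Longrightarrow> m \<in> meas (quo E i j) \<Longrightarrow> n \<in> meas (quo E j k) \<Longrightarrow>
    tens i j k m n \<in> meas (quo E i k)"
  by (rule pull_dist_meas[OF adm])

end

text \<open>A coherent choice of bases of the lines of measures \<open>\<mu>(F(j)/F(i))\<close>. It identifies all spaces of
  virtual measures with \<open>\<complex>\<close>.\<close>

locale c2triv = c2sys E for E :: "('k::{field,finite}, 'i, 'v::ab_group_add, 'x, 'w::ab_group_add) c2" +
  fixes e :: "'i \<Rightarrow> 'i \<Rightarrow> 'w dist"
  assumes e_meas: "(i, j) \<in> leq E \<Longrightarrow> e i j \<in> meas (quo E i j)"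
    and e_nz: "(i, j) \<in> leq E \<Longrightarrow> e i j \<noteq> 0"
    and e_tens: "(i, j) \<in> leq E \<Longrightarrow> (j, k) \<in> leq E \<Longrightarrow> tens i j k (e i j) (e j k) = e i k"

section \<open>Coherent bases: field identities and the splitting of the cocycle\<close>

lemma cocycle_ratio:
  fixes A :: "'a::field"
  assumes "P * A = T * D" "P * B = T' * F" "P \<noteq> 0"
  shows "A / B = T / T' * D / F"
proof -
  have "A = T * D / P" "B = T' * F / P" using assms by (simp_all add: eq_divide_eq mult.commute)
  then show ?thesis using assms(3) by simp
qed

lemma cocycle_shift:
  fixes D :: "'a::field"
  assumes "D * X' = X * D'" "D' \<noteq> 0" "F \<noteq> 0"
  shows "(y' * D' / F) / (y * D / F * X') = y' / (y * X)"
proof -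
  have "(y' * D' / F) / (y * D / F * X') = (y' * D') / (y * (D * X'))" using assms(3) by simp
  also have "\<dots> = y' / (y * X)" unfolding assms(1) using assms(2) by simp
  finally show ?thesis .
qed

lemma cocycle_cancel:
  fixes p :: "'a::field"
  assumes "p * q = t * r" "t \<noteq> 0" "y \<noteq> 0"
  shows "y / (x * p) * (w / (y * q)) * t = w / (x * r)"
proof -
  have "y / (x * p) * (w / (y * q)) * t = w * t / (x * (p * q))" using assms(3) by simp
  then show ?thesis unfolding assms(1) using assms(2) by simp
qed

text \<open>Arbitrary bases \<open>a\<close> satisfy the condition up to a 2-cocycle \<open>\<tau>\<close>. It is a coboundary because a
  directed order is contractible: the correction \<open>\<phi>\<close> compares the two orders in which one
  can pass from a small \<open>p\<close> to \<open>i\<close> and to the base point \<open>b\<close>.\<close>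

lemma (in c2sys) triv_exists: "\<exists>e. c2triv E e"
proof (cases "idx E = {}")
  case True
  then have "leq E = {}" using le_idx by auto
  then show ?thesis by (intro exI[of _ "\<lambda>_ _. 0"] c2triv.intro c2sys_axioms c2triv_axioms.intro) auto
next
  case False
  then obtain b where b: "b \<in> idx E" by blast
  define a where "a i j = (SOME m. m \<in> meas (quo E i j) \<and> m \<noteq> 0)" for i j
  have a: "a i j \<in> meas (quo E i j) \<and> a i j \<noteq> 0" if "(i, j) \<in> leq E" for i j
    using someI_ex[of "\<lambda>m. m \<in> meas (quo E i j) \<and> m \<noteq> 0"] meas_nonzero_exists[OF quo_c1[OF that]]
    unfolding a_def by blast
  define \<tau> where "\<tau> i j k = (SOME t. tens i j k (a i j) (a j k) = fscale t (a i k))" for i j k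
  have \<tau>: "tens i j k (a i j) (a j k) = fscale (\<tau> i j k) (a i k)"
    and \<tau>0: "\<tau> i j k \<noteq> 0" if ij: "(i, j) \<in> leq E" and jk: "(j, k) \<in> leq E" for i j k
  proof -
    note ik = le_trans[OF ij jk]
    show t: "tens i j k (a i j) (a j k) = fscale (\<tau> i j k) (a i k)"
      unfolding \<tau>_def
      by (rule someI_ex[OF meas_multiple[OF quo_c1[OF ik]]]) (use a ij jk ik tens_meas in blast)+
    show "\<tau> i j k \<noteq> 0"
      using t tensor_nz[OF adm[OF ij jk]] a[OF ij] a[OF jk] by auto
  qed
  have cocycle: "\<tau> l i j * \<tau> l j k = \<tau> i j k * \<tau> l i k"
    if li: "(l, i) \<in> leq E" and ij: "(i, j) \<in> leq E" and jk: "(j, k) \<in> leq E" for l i j k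
  proof -
    note ik = le_trans[OF ij jk] and lj = le_trans[OF li ij]
    note lk = le_trans[OF lj jk]
    have "fscale (\<tau> i j k * \<tau> l i k) (a l k) = tens l i k (fscale 1 (a l i)) (fscale (\<tau> i j k) (a i k))"
      using tens_scale[OF li ik _ meas_dist, of "a l i" "a i k" 1 "\<tau> i j k"] a[OF li] a[OF ik] \<tau>[OF li ik] by simp
    also have "\<dots> = tens l j k (tens l i j (a l i) (a i j)) (a j k)"
      using tens_tens[OF li ij jk, of "a l i" "a i j" "a j k"] a[OF li] a[OF ij] \<tau>[OF ij jk] by simp
    also have "\<dots> = tens l j k (fscale (\<tau> l i j) (a l j)) (fscale 1 (a j k))"
      using \<tau>[OF li ij] by simp
    also have "\<dots> = fscale (\<tau> l i j * \<tau> l j k) (a l k)"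
      using tens_scale[OF lj jk _ meas_dist, of "a l j" "a j k" "\<tau> l i j" 1] a[OF lj] a[OF jk] \<tau>[OF lj jk] by simp
    finally show ?thesis using fscale_cancel a[OF lk] by metis
  qed
  \<comment> \<open>A fixed common lower bound of \<open>i\<close> and the base point
    \<open>b\<close>, through which \<open>i\<close> is compared with \<open>b\<close>.\<close>
  define c where "c i = (SOME k. (k, i) \<in> leq E \<and> (k, b) \<in> leq E)" for i
  have c: "(c i, i) \<in> leq E \<and> (c i, b) \<in> leq E" if "i \<in> idx E" for i
    unfolding c_def by (rule someI_ex[OF below[OF that b]])
  \<comment> \<open>Going down from \<open>p\<close> to \<open>p'\<close> multiplies this by
    \<open>\<tau> p' p i / \<tau> p' p b\<close>, as \<open>yy\<close> below shows. The denominator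
    does not involve \<open>i\<close> and cancels in quotients.\<close>
  define y where "y i p = \<tau> p (c i) i / \<tau> p (c i) b" for i p
  have y0: "y i p \<noteq> 0" if "i \<in> idx E" "(p, c i) \<in> leq E" for i p
    using \<tau>0 c that by (simp add: y_def)
  \<comment> \<open>The remaining dependence on \<open>p\<close> is removed by the cocycle identity
    for p', p, i, j. Any \<open>p\<close> below \<open>c i\<close> and \<open>c j\<close> therefore
    gives the same number, which becomes \<open>\<phi> i j\<close>.\<close>
  define z where "z i j p = y j p / (y i p * \<tau> p i j)" for i j p
  have z_step: "z i j p' = z i j p"
    if ij: "(i, j) \<in> leq E" and p: "(p, c i) \<in> leq E" "(p, c j) \<in> leq E" "(p', p) \<in> leq E" for i j p p'
  proof -
    note idx = le_idx[OF ij]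
    note ci = c[OF idx(1)] and cj = c[OF idx(2)]
    note pi = le_trans[OF p(1) conjunct1[OF ci]] le_trans[OF p(1) conjunct2[OF ci]]
    note pj = le_trans[OF p(2) conjunct1[OF cj]]
    have yy: "y k p' = y k p * \<tau> p' p k / \<tau> p' p b" if k: "k \<in> idx E" "(p, c k) \<in> leq E" for k
    proof -
      note ck = c[OF k(1)]
      have kb: "(p, k) \<in> leq E" "(p, b) \<in> leq E" using le_trans[OF k(2)] ck by blast+
      show ?thesis
        unfolding y_def
        by (rule cocycle_ratio[OF cocycle[OF p(3) k(2) conjunct1[OF ck]] cocycle[OF p(3) k(2) conjunct2[OF ck]]
              \<tau>0[OF p(3) k(2)]])
    qed
    show ?thesis
      unfolding z_def yy[OF idx(1) p(1)] yy[OF idx(2) p(2)]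
      by (rule cocycle_shift[OF cocycle[OF p(3) pi(1) ij] \<tau>0[OF p(3) pj(1)] \<tau>0[OF p(3) pi(2)]])
  qed
  have z_indep: "z i j p' = z i j p"
    if p: "(i, j) \<in> leq E" "(p, c i) \<in> leq E" "(p, c j) \<in> leq E" "(p', c i) \<in> leq E" "(p', c j) \<in> leq E" for i j p p'
  proof -
    obtain q where "(q, p) \<in> leq E" "(q, p') \<in> leq E" using below[OF le_idx(1)[OF p(2)] le_idx(1)[OF p(4)]] by blast
    then show ?thesis using z_step p by metis
  qed
  define \<phi> where "\<phi> i j = z i j (SOME p. (p, c i) \<in> leq E \<and> (p, c j) \<in> leq E)" for i j
  have \<phi>: "\<phi> i j = z i j p" if "(i, j) \<in> leq E" "(p, c i) \<in> leq E" "(p, c j) \<in> leq E" for i j p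
  proof -
    have "\<exists>p. (p, c i) \<in> leq E \<and> (p, c j) \<in> leq E" using that by blast
    then show ?thesis unfolding \<phi>_def using someI_ex[of "\<lambda>p. (p, c i) \<in> leq E \<and> (p, c j) \<in> leq E"] z_indep that by blast
  qed
  have cp: "\<exists>p. (p, c i) \<in> leq E \<and> (p, c j) \<in> leq E \<and> (p, c k) \<in> leq E"
    if "i \<in> idx E" "j \<in> idx E" "k \<in> idx E" for i j k
    using below3 c le_idx that by meson
  have \<phi>0: "\<phi> i j \<noteq> 0" if ij: "(i, j) \<in> leq E" for i j
  proof -
    obtain p where p: "(p, c i) \<in> leq E" "(p, c j) \<in> leq E" using cp le_idx[OF ij] by blast
    have "(p, i) \<in> leq E" using le_trans p(1) c le_idx[OF ij] by blast
    then show ?thesis using \<phi>[OF ij p] y0 p \<tau>0[OF _ ij] le_idx[OF ij] by (simp add: z_def)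
  qed
  have mult: "\<phi> i j * \<phi> j k * \<tau> i j k = \<phi> i k" if ij: "(i, j) \<in> leq E" and jk: "(j, k) \<in> leq E" for i j k
  proof -
    note ik = le_trans[OF ij jk]
    note idx = le_idx[OF ij] le_idx[OF jk]
    obtain p where p: "(p, c i) \<in> leq E" "(p, c j) \<in> leq E" "(p, c k) \<in> leq E" using cp idx by blast
    have pi: "(p, i) \<in> leq E" and pj: "(p, j) \<in> leq E" using le_trans p c idx by blast+
    show ?thesis
      unfolding \<phi>[OF ij p(1,2)] \<phi>[OF jk p(2,3)] \<phi>[OF ik p(1,3)] z_def
      by (rule cocycle_cancel[OF cocycle[OF pi ij jk] \<tau>0[OF ij jk] y0[OF idx(2) p(2)]])
  qed
  have "c2triv E (\<lambda>i j. fscale (\<phi> i j) (a i j))"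
  proof (intro c2triv.intro c2sys_axioms c2triv_axioms.intro)
    fix i j assume ij: "(i, j) \<in> leq E"
    show "fscale (\<phi> i j) (a i j) \<in> meas (quo E i j)" using meas_scale[OF quo_fs[OF ij]] a[OF ij] by blast
    show "fscale (\<phi> i j) (a i j) \<noteq> 0" using \<phi>0[OF ij] a[OF ij] by (simp add: fscale_eq_0)
    fix k assume jk: "(j, k) \<in> leq E"
    show "tens i j k (fscale (\<phi> i j) (a i j)) (fscale (\<phi> j k) (a j k)) = fscale (\<phi> i k) (a i k)"
      using tens_scale[OF ij jk _ meas_dist] a[OF ij] a[OF jk] \<tau>[OF ij jk] mult[OF ij jk] by simp
  qed
  then show ?thesis by blast
qed

section \<open>Virtual measures in coordinates\<close>

lemma cls_eq: "equivclp r x y \<Longrightarrow> cls r x = cls r y"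
  unfolding cls_def by (rule Collect_cong) (meson equivclp_trans equivclp_sym)

lemma cls_self: "x \<in> cls r x"
  by (simp add: cls_def)

lemma fscale_zero_right [simp]: "fscale c (0 :: 'a \<Rightarrow> 'b::mult_zero) = 0"
  by (simp add: fscale_def zero_fun_def)

context c2triv
begin

definition cf :: "'i \<Rightarrow> 'i \<Rightarrow> 'w dist \<Rightarrow> complex" where
  "cf l i m = (THE t. m = fscale t (e l i))"

lemma cf_scale: "(l, i) \<in> leq E \<Longrightarrow> cf l i (fscale t (e l i)) = t"
  unfolding cf_def by (rule the_equality) (use fscale_cancel[OF _ e_nz] in auto)

lemma e_scale_meas: "(l, i) \<in> leq E \<Longrightarrow> fscale t (e l i) \<in> meas (quo E l i)"
  using meas_scale[OF quo_fs e_meas] by blast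

lemma measE:
  assumes "m \<in> meas (quo E l i)" "(l, i) \<in> leq E"
  obtains t where "m = fscale t (e l i)"
proof -
  have "\<exists>t. m = fscale t (e l i)"
    by (rule meas_multiple[OF quo_c1[OF assms(2)] e_meas[OF assms(2)] e_nz[OF assms(2)] assms(1)])
  then show thesis by (elim exE) (rule that)
qed

text \<open>The diagonal is normalised by \<open>e_tens\<close> alone: \<open>e i i\<close> is a
  nonzero idempotent in a one-dimensional algebra whose unit is \<open>unit_meas\<close>.\<close>

lemma e_refl:
  assumes i: "i \<in> idx E"
  shows "e i i = unit_meas (quo E i i)"
proof -
  note r = le_refl[OF i]
  note u = unit_meas_meas[OF quo_fs[OF r] quo_refl[OF i]]
  define s where "s = e i i (ind {0})"
  have s: "e i i = fscale s (unit_meas (quo E i i))"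
    using zero_space_meas[OF quo_c1[OF r] quo_refl[OF i] e_meas[OF r]] by (simp add: s_def)
  have "e i i = tens i i i (fscale 1 (e i i)) (fscale s (unit_meas (quo E i i)))"
    using e_tens[OF r r] s by simp
  also have "\<dots> = fscale s (tens i i i (e i i) (unit_meas (quo E i i)))"
    using tens_scale[OF r r e_meas[OF r] meas_dist[OF u(1)], of 1 s] by simp
  also have "tens i i i (e i i) (unit_meas (quo E i i)) = e i i"
    using pull_dist_unit_right[OF adm[OF r r] quo_refl[OF i] e_meas[OF r]]
      push_dist_id[OF meas_dist[OF e_meas[OF r]] inc_id[OF r]] by simp
  finally have "fscale s (e i i) = fscale 1 (e i i)" unfolding fscale_one by (rule sym)
  then have "s = 1" using fscale_cancel e_nz[OF r] by blast
  then show ?thesis using s by simp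
qed

definition hm :: "'i \<Rightarrow> 'i \<Rightarrow> 'i \<Rightarrow> complex \<Rightarrow> 'w dist \<Rightarrow> 'w dist" where
  "hm l i j z = cut (meas (quo E l i)) (\<lambda>m. fscale (cf l i m * z) (e l j))"

text \<open>The class of the maps \<open>e(l,i) \<mapsto> z e(l,j)\<close>: coherence of \<open>e\<close> makes them compatible for varying \<open>l\<close>.\<close>

definition V :: "'i \<Rightarrow> 'i \<Rightarrow> complex \<Rightarrow> ('i, 'w) vmeas" where
  "V i j z = {(l, hm l i j z) | l. (l, i) \<in> leq E \<and> (l, j) \<in> leq E}"

lemma hm_scale: "(l, i) \<in> leq E \<Longrightarrow> hm l i j z (fscale t (e l i)) = fscale (t * z) (e l j)"
  by (simp add: hm_def e_scale_meas cf_scale)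

lemma hm_e: "(l, i) \<in> leq E \<Longrightarrow> hm l i j z (e l i) = fscale z (e l j)"
  using hm_scale[of l i j z 1] by simp

lemma hm_level:
  assumes li: "(l, i) \<in> leq E" and lj: "(l, j) \<in> leq E"
  shows "hm l i j z \<in> vlevel E i j l"
proof -
  note m = meas_scale[OF quo_fs[OF li]]
  have "hm l i j z (x + y) = hm l i j z x + hm l i j z y"
    if x: "x \<in> meas (quo E l i)" and y: "y \<in> meas (quo E l i)" for x y
  proof -
    obtain s where s: "x = fscale s (e l i)" by (rule measE[OF x li])
    obtain t where t: "y = fscale t (e l i)" by (rule measE[OF y li])
    have "x + y = fscale (s + t) (e l i)" by (auto simp: s t fun_eq_iff algebra_simps)
    then have "hm l i j z (x + y) = fscale ((s + t) * z) (e l j)" by (simp only: hm_scale[OF li])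
    then show ?thesis by (auto simp: s t hm_scale[OF li] fun_eq_iff algebra_simps)
  qed
  moreover have "hm l i j z (fscale c x) = fscale c (hm l i j z x)" if x: "x \<in> meas (quo E l i)" for c x
  proof -
    obtain s where s: "x = fscale s (e l i)" by (rule measE[OF x li])
    show ?thesis by (simp add: s hm_scale[OF li] mult.assoc)
  qed
  moreover have "hm l i j z x \<in> meas (quo E l j)" if x: "x \<in> meas (quo E l i)" for x
    using that e_scale_meas[OF lj] by (simp add: hm_def)
  ultimately show ?thesis by (simp add: vlevel_def chom_def lin_on_def hm_def)
qed

lemma level_hm:
  assumes li: "(l, i) \<in> leq E" and lj: "(l, j) \<in> leq E" and f: "f \<in> vlevel E i j l"
    and fe: "f (fscale t (e l i)) = fscale (t * z) (e l j)" "t \<noteq> 0"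
  shows "f = hm l i j z"
proof
  fix x
  have lin: "f (fscale c y) = fscale c (f y)" if "y \<in> meas (quo E l i)" for c y
    using f that by (simp add: vlevel_def chom_def lin_on_def)
  show "f x = hm l i j z x"
  proof (cases "x \<in> meas (quo E l i)")
    case True
    then obtain s where s: "x = fscale s (e l i)" using measE li by blast
    have "f x = fscale (s / t) (f (fscale t (e l i)))"
      using lin[OF e_scale_meas[OF li, of t], of "s / t"] fe(2) by (simp add: s)
    then show ?thesis using fe by (simp add: s hm_scale[OF li])
  next
    case False
    then show ?thesis using f by (simp add: vlevel_def chom_def hm_def)
  qed
qed

lemma levelE:
  assumes li: "(l, i) \<in> leq E" and lj: "(l, j) \<in> leq E" and f: "f \<in> vlevel E i j l"
  obtains z where "f = hm l i j z"
proof -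
  have "f (e l i) \<in> meas (quo E l j)" using f e_meas[OF li] by (simp add: vlevel_def chom_def)
  then obtain z where "f (e l i) = fscale z (e l j)" using measE lj by blast
  then have "f = hm l i j z" by (intro level_hm[OF li lj f, of 1]) auto
  then show thesis using that by blast
qed

lemma hm_cancel:
  assumes "(l, i) \<in> leq E" "(l, j) \<in> leq E" "hm l i j z = hm l i j z'"
  shows "z = z'"
  using hm_e[OF assms(1), of j z] hm_e[OF assms(1), of j z'] assms(3) fscale_cancel[OF _ e_nz[OF assms(2)]] by metis

text \<open>Tensoring with e(l',l) sends e(l,i) to e(l',i) and e(l,j) to e(l',j), so the transition
  maps of the direct limit preserve the coordinate.\<close>

lemma hm_transition:
  assumes l: "(l', l) \<in> leq E" "(l, i) \<in> leq E" "(l, j) \<in> leq E"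
  shows "(\<forall>c\<in>meas (quo E l' l). \<forall>a\<in>meas (quo E l i).
     hm l' i j z' (quo_tensor E l' l i c a) = quo_tensor E l' l j c (hm l i j z a)) \<longleftrightarrow> z' = z"
proof -
  note l' = le_trans[OF l(1,2)] le_trans[OF l(1,3)]
  have 1: "quo_tensor E l' l k (fscale s (e l' l)) (fscale t (e l k)) = fscale (s * t) (e l' k)"
    if "(l, k) \<in> leq E" for k s t
    using quo_tensor_eq[OF l(1) that e_scale_meas[OF l(1)] e_scale_meas[OF that]]
      tens_scale[OF l(1) that e_meas[OF l(1)] meas_dist[OF e_meas[OF that]]] e_tens[OF l(1) that] by simp
  have 2: "hm l' i j z' (quo_tensor E l' l i (fscale s (e l' l)) (fscale t (e l i))) = fscale (s * t * z') (e l' j)"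
    and 3: "quo_tensor E l' l j (fscale s (e l' l)) (hm l i j z (fscale t (e l i))) = fscale (s * t * z) (e l' j)"
    for s t
    using 1[OF l(2)] 1[OF l(3)] hm_scale[OF l'(1)] hm_scale[OF l(2)] by (simp_all add: mult.assoc)
  show ?thesis
  proof
    assume *: "\<forall>c\<in>meas (quo E l' l). \<forall>a\<in>meas (quo E l i).
      hm l' i j z' (quo_tensor E l' l i c a) = quo_tensor E l' l j c (hm l i j z a)"
    have "fscale (1 * 1 * z') (e l' j) = fscale (1 * 1 * z) (e l' j)"
      unfolding 2[symmetric] 3[symmetric] using * e_scale_meas l by blast
    then show "z' = z" using fscale_cancel[OF _ e_nz[OF l'(2)]] by simp
  next
    assume z: "z' = z"
    show "\<forall>c\<in>meas (quo E l' l). \<forall>a\<in>meas (quo E l i).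
      hm l' i j z' (quo_tensor E l' l i c a) = quo_tensor E l' l j c (hm l i j z a)"
    proof (intro ballI)
      fix c a assume "c \<in> meas (quo E l' l)" "a \<in> meas (quo E l i)"
      then obtain s t where "c = fscale s (e l' l)" "a = fscale t (e l i)" using measE l by meson
      then show "hm l' i j z' (quo_tensor E l' l i c a) = quo_tensor E l' l j c (hm l i j z a)"
        using 2[of s t] 3[of s t] z by simp
    qed
  qed
qed

text \<open>\<open>V i j z\<close> is closed under the generating relation by
  \<open>hm_transition\<close>, and any two of its elements are related through a common lower
  level.\<close>

lemma cls_V:
  assumes l: "(l, i) \<in> leq E" "(l, j) \<in> leq E"
  shows "cls (vrel E i j) (l, hm l i j z) = V i j z"
proof
  have inv: "x \<in> V i j z \<longleftrightarrow> y \<in> V i j z" if "vrel E i j x y" for x y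
    using that
  proof cases
    case (1 l' l f f')
    note l' = le_trans[OF 1(3,4)] le_trans[OF 1(3,5)]
    obtain w where w: "f = hm l i j w" using levelE[OF 1(4,5,6)] .
    obtain w' where w': "f' = hm l' i j w'" using levelE[OF l' 1(7)] .
    have "w' = w" using hm_transition[OF 1(3,4,5)] 1(8) w w' by blast
    then show ?thesis
      using 1(1,2,4,5) l' w w' hm_cancel[OF 1(4,5)] hm_cancel[OF l'] by (auto simp: V_def)
  qed
  have "x \<in> V i j z" if "equivclp (vrel E i j) (l, hm l i j z) x" for x
    using that
  proof (induction rule: equivclp_induct)
    case base
    show ?case using l by (auto simp: V_def)
  next
    case (step x y)
    then show ?case using inv by blast
  qed
  then show "cls (vrel E i j) (l, hm l i j z) \<subseteq> V i j z" by (auto simp: cls_def)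
  have step: "vrel E i j (m, hm m i j z) (k, hm k i j z)"
    if "(k, m) \<in> leq E" "(m, i) \<in> leq E" "(m, j) \<in> leq E" for k m
    using that le_trans hm_transition[of k m i j z z] by (intro vrel.intros hm_level) blast+
  show "V i j z \<subseteq> cls (vrel E i j) (l, hm l i j z)"
  proof
    fix x assume "x \<in> V i j z"
    then obtain m where m: "x = (m, hm m i j z)" "(m, i) \<in> leq E" "(m, j) \<in> leq E" by (auto simp: V_def)
    obtain k where k: "(k, l) \<in> leq E" "(k, m) \<in> leq E" using below le_idx l m by meson
    have "equivclp (vrel E i j) (l, hm l i j z) (k, hm k i j z)" using step[OF k(1) l] by blast
    moreover have "equivclp (vrel E i j) (k, hm k i j z) x"
      using step[OF k(2) m(2,3)] m(1) by (auto intro: equivclp_sym)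
    ultimately show "x \<in> cls (vrel E i j) (l, hm l i j z)" unfolding cls_def using equivclp_trans by fastforce
  qed
qed

lemma V_vmeas:
  assumes "i \<in> idx E" "j \<in> idx E"
  shows "V i j z \<in> vmeas E i j"
proof -
  obtain l where l: "(l, i) \<in> leq E" "(l, j) \<in> leq E" using below assms by blast
  then show ?thesis unfolding vmeas_def cls_V[OF l, symmetric] using hm_level[OF l] by blast
qed

lemma vmeasE:
  assumes "A \<in> vmeas E i j"
  obtains z where "A = V i j z"
proof -
  obtain l f where l: "A = cls (vrel E i j) (l, f)" "(l, i) \<in> leq E" "(l, j) \<in> leq E" "f \<in> vlevel E i j l"
    using assms unfolding vmeas_def by blast
  then show thesis using that levelE cls_V by metis
qed

lemma V_inject:
  assumes "i \<in> idx E" "j \<in> idx E" "V i j z = V i j z'"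
  shows "z = z'"
proof -
  obtain l where l: "(l, i) \<in> leq E" "(l, j) \<in> leq E" using below assms by blast
  then have "(l, hm l i j z) \<in> V i j z'" using assms(3) by (auto simp: V_def)
  then show ?thesis using hm_cancel[OF l] by (auto simp: V_def)
qed

lemma V_scale:
  assumes "i \<in> idx E" "j \<in> idx E"
  shows "vscale E i j c (V i j z) = V i j (c * z)"
proof -
  have *: "(\<lambda>a. fscale c (hm l i j z a)) = hm l i j (c * z)" for l
    by (auto simp: hm_def cut_def fun_eq_iff mult.left_commute mult.assoc)
  obtain l where "(l, i) \<in> leq E" "(l, j) \<in> leq E" using below assms by blast
  then show ?thesis unfolding vscale_def V_def[of i j z] by (auto simp: * cls_V)
qed

lemma hm_comp:
  assumes "(l, i) \<in> leq E" "(l, j) \<in> leq E" "(l, k) \<in> leq E"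
  shows "hm l j k z' \<circ> hm l i j z = hm l i k (z * z')"
proof
  fix x
  show "(hm l j k z' \<circ> hm l i j z) x = hm l i k (z * z') x"
  proof (cases "x \<in> meas (quo E l i)")
    case True
    then obtain s where "x = fscale s (e l i)" using measE assms by blast
    then show ?thesis by (simp add: hm_scale assms mult.assoc)
  next
    case False
    have "cf l j 0 = 0" using cf_scale[OF assms(2), of 0] by simp
    then have "hm l j k z' 0 = 0" by (simp add: hm_def cut_def)
    then show ?thesis using False by (simp add: hm_def[of l i])
  qed
qed

text \<open>The union in \<open>vcomp\<close> runs over pairs of representatives at the same level.
  All give one class, and directedness provides at least one pair, so the union is not
  empty.\<close>

lemma V_comp:
  assumes "i \<in> idx E" "j \<in> idx E" "k \<in> idx E"
  shows "vcomp E i j k (V i j z) (V j k z') = V i k (z * z')"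
proof -
  obtain l where l: "(l, i) \<in> leq E" "(l, j) \<in> leq E" "(l, k) \<in> leq E" using below3 assms by blast
  have "cls (vrel E i k) (m, g \<circ> f) = V i k (z * z')" if "(m, f) \<in> V i j z" "(m, g) \<in> V j k z'" for m f g
    using that by (auto simp: V_def hm_comp cls_V[unfolded V_def])
  moreover have "(l, hm l i j z) \<in> V i j z" "(l, hm l j k z') \<in> V j k z'" using l by (auto simp: V_def)
  ultimately show ?thesis unfolding vcomp_def by blast
qed

lemma V_one:
  assumes "i \<in> idx E"
  shows "vone E i = V i i 1"
proof -
  note r = le_refl[OF assms]
  have "cut (meas (quo E i i)) id = hm i i i 1"
  proof
    fix x
    show "cut (meas (quo E i i)) id x = hm i i i 1 x"
      by (cases "x \<in> meas (quo E i i)") (auto simp: hm_def cf_scale[OF r] e_scale_meas[OF r] elim!: measE[OF _ r])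
  qed
  then show ?thesis unfolding vone_def using cls_V[OF r r] by simp
qed

lemma V_inv:
  assumes ij: "(i, j) \<in> leq E" and t: "t \<noteq> 0"
  shows "vinv E i j (fscale t (e i j)) = V j i (1 / t)"
proof -
  note i = le_idx(1)[OF ij]
  note r = le_refl[OF i]
  have "(THE f. f \<in> vlevel E j i i \<and> f (fscale t (e i j)) = unit_meas (quo E i i)) = hm i j i (1 / t)"
  proof (rule the_equality)
    show "hm i j i (1 / t) \<in> vlevel E j i i \<and> hm i j i (1 / t) (fscale t (e i j)) = unit_meas (quo E i i)"
      using hm_level[OF ij r] hm_scale[OF ij] t e_refl[OF i] by simp
    fix f assume f: "f \<in> vlevel E j i i \<and> f (fscale t (e i j)) = unit_meas (quo E i i)"
    show "f = hm i j i (1 / t)"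
      by (rule level_hm[OF ij r conjunct1[OF f] _ t]) (use f e_refl[OF i] t in simp)
  qed
  then show ?thesis unfolding vinv_def using cls_V[OF ij r] by simp
qed

lemma V_of:
  assumes ij: "(i, j) \<in> leq E"
  shows "vof E i j (fscale t (e i j)) = V i j t"
proof -
  note i = le_idx(1)[OF ij]
  note r = le_refl[OF i]
  have "(THE f. f \<in> vlevel E i j i \<and> f (unit_meas (quo E i i)) = fscale t (e i j)) = hm i i j t"
  proof (rule the_equality)
    show "hm i i j t \<in> vlevel E i j i \<and> hm i i j t (unit_meas (quo E i i)) = fscale t (e i j)"
      using hm_level[OF r ij] hm_e[OF r] e_refl[OF i] by simp
    fix f assume f: "f \<in> vlevel E i j i \<and> f (unit_meas (quo E i i)) = fscale t (e i j)"
    show "f = hm i i j t"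
      by (rule level_hm[OF r ij conjunct1[OF f], of 1]) (use f e_refl[OF i] in simp_all)
  qed
  then show ?thesis unfolding vof_def using cls_V[OF r ij] by simp
qed

lemma V_functional:
  assumes ij: "(i, j) \<in> leq E" and p: "\<And>t. p (fscale t (e i j)) = t * z"
  shows "vfunctional E i j p = V j i z"
proof -
  note i = le_idx(1)[OF ij]
  note r = le_refl[OF i]
  have "cut (meas (quo E i j)) (\<lambda>n. fscale (p n) (unit_meas (quo E i i))) = hm i j i z"
  proof
    fix x
    show "cut (meas (quo E i j)) (\<lambda>n. fscale (p n) (unit_meas (quo E i i))) x = hm i j i z x"
      by (cases "x \<in> meas (quo E i j)")
        (auto simp: hm_def cf_scale[OF ij] e_scale_meas[OF ij] p e_refl[OF i] elim!: measE[OF _ ij])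
  qed
  then show ?thesis unfolding vfunctional_def using cls_V[OF ij r] by simp
qed

section \<open>Distributions in coordinates\<close>

abbreviation PU :: "'i \<Rightarrow> 'i \<Rightarrow> 'i \<Rightarrow> 'w dist \<Rightarrow> 'w dist" where
  "PU l j i \<equiv> push_dist (quo E l j) (inc E l j i) (quo E l i)"

text \<open>With the basis measure as \<rho>, the element \<open>vinv\<close> has coordinate 1. The
  transition then acts on the distribution only, as it does for \<open>PU\<close>.\<close>

abbreviation PL :: "'i \<Rightarrow> 'i \<Rightarrow> 'i \<Rightarrow> 'w dist \<Rightarrow> 'w dist" where
  "PL l j i \<equiv> tens l j i (e l j)"

lemma PU_dists: "(l, j) \<in> leq E \<Longrightarrow> (j, i) \<in> leq E \<Longrightarrow> G \<in> dists (quo E l j) \<Longrightarrow> PU l j i G \<in> dists (quo E l i)"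
  by (rule push_dist_dists[OF adm])

lemma PL_dists: "(l, j) \<in> leq E \<Longrightarrow> (j, i) \<in> leq E \<Longrightarrow> G \<in> dists (quo E j i) \<Longrightarrow> PL l j i G \<in> dists (quo E l i)"
  by (rule pull_dist_dists[OF adm e_meas])

lemma PL_scale:
  "(l, j) \<in> leq E \<Longrightarrow> (j, i) \<in> leq E \<Longrightarrow> G \<in> dists (quo E j i) \<Longrightarrow> PL l j i (fscale c G) = fscale c (PL l j i G)"
  using tens_scale[of l j i "e l j" G 1 c] e_meas by simp

lemma PU_id: "(l, j) \<in> leq E \<Longrightarrow> G \<in> dists (quo E l j) \<Longrightarrow> PU l j j G = G"
  by (rule push_dist_id) (use inc_id in auto)

lemma PL_id:
  assumes lj: "(l, j) \<in> leq E" and G: "G \<in> dists (quo E l j)"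
  shows "PL l l j G = G"
  unfolding e_refl[OF le_idx(1)[OF lj]]
  by (rule pull_dist_unit_left[OF adm[OF le_refl1[OF lj] lj] quo_refl[OF le_idx(1)[OF lj]] G prj_id[OF lj]])

lemma PU_PU:
  assumes "(l, i) \<in> leq E" "(i, j) \<in> leq E" "(j, k) \<in> leq E"
  shows "PU l j k (PU l i j G) = PU l i k G"
proof
  fix f
  show "PU l j k (PU l i j G) f = PU l i k G f"
  proof (cases "f \<in> test_fun (quo E l k)")
    case True
    have "pull (quo E l i) (inc E l i j) (pull (quo E l j) (inc E l j k) f) = pull (quo E l i) (inc E l i k) f"
      using inc_inc[OF assms] adm_alpha_spc[OF adm[OF assms(1,2)]] by (auto simp: pull_def cut_def fun_eq_iff)
    then show ?thesis
      using True adm_pull_test[OF adm[OF le_trans[OF assms(1,2)] assms(3)] True] by (simp add: push_dist_def)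
  qed (simp add: push_dist_def)
qed

lemma PL_PL:
  assumes "(l', l) \<in> leq E" "(l, j) \<in> leq E" "(j, i) \<in> leq E"
  shows "PL l' l i (PL l j i G) = PL l' j i G"
  using tens_tens[OF assms e_meas[OF assms(1)] e_meas[OF assms(2)]] e_tens[OF assms(1,2)] by simp

text \<open>Lowering \<open>l\<close> and raising \<open>j\<close> are independent: the fibre
  F(l)/F(l') is the same for both upper ends, so this is base change with the identity on
  fibres.\<close>

lemma PL_PU:
  assumes l: "(l', l) \<in> leq E" "(l, j) \<in> leq E" "(j, i) \<in> leq E"
  shows "PL l' l i (PU l j i G) = PU l' j i (PL l' l j G)"
proof
  fix f
  note T = adm[OF l(1,2)] and T' = adm[OF l(1) le_trans[OF l(2,3)]]
  note J = adm[OF le_trans[OF l(1,2)] l(3)] and J' = adm[OF l(2,3)]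
  note m = e_meas[OF l(1)]
  show "PL l' l i (PU l j i G) f = PU l' j i (PL l' l j G) f"
  proof (cases "f \<in> test_fun (quo E l' i)")
    case True
    note pt = adm_pull_test[OF J True]
    have "pull (quo E l j) (inc E l j i) (fibre_integral (quo E l' l) (inc E l' l i) (quo E l' i) (prj E l' l i) (quo E l i) (e l' l) f)
        = fibre_integral (quo E l' l) (inc E l' l j) (quo E l' j) (prj E l' l j) (quo E l j) (e l' l)
            (pull (quo E l' j) (inc E l' j i) f)"
      by (rule fibre_base_change[OF T T' m m, where k = "\<lambda>x. x"])
        (use push_dist_id[OF meas_dist[OF m], of "\<lambda>x. x"] inc_inc[OF l] prj_inc[OF l]
          adm_alpha_spc[OF J] adm_alpha_add[OF J] pt True in auto)
    then show ?thesis
      using True pt fibre_test[OF T' True m] by (simp add: pull_dist_def push_dist_def)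
  qed (simp add: pull_dist_def push_dist_def)
qed

text \<open>The transition from the level F(i)/F(l) to F(p)/F(q) in the chosen bases; the order of
  the two steps is immaterial by \<open>PL_PU\<close>.\<close>

definition tr :: "'i \<Rightarrow> 'i \<Rightarrow> 'i \<Rightarrow> 'i \<Rightarrow> 'w dist \<Rightarrow> 'w dist" where
  "tr i l p q G = PU q i p (PL q l i G)"

lemma tr_dists:
  assumes "(l, i) \<in> leq E" "(i, p) \<in> leq E" "(q, l) \<in> leq E" "G \<in> dists (quo E l i)"
  shows "tr i l p q G \<in> dists (quo E q p)"
  unfolding tr_def using PU_dists PL_dists le_trans assms by blast

lemma tr_scale:
  assumes "(l, i) \<in> leq E" "(i, p) \<in> leq E" "(q, l) \<in> leq E" "G \<in> dists (quo E l i)"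
  shows "tr i l p q (fscale c G) = fscale c (tr i l p q G)"
  unfolding tr_def using PL_scale[OF assms(3,1,4)] push_dist_scale by metis

lemma tr_id: "(l, i) \<in> leq E \<Longrightarrow> G \<in> dists (quo E l i) \<Longrightarrow> tr i l i l G = G"
  by (simp add: tr_def PL_id PU_id)

lemma tr_tr:
  assumes "(l, i) \<in> leq E" "(i, p) \<in> leq E" "(q, l) \<in> leq E" "(p, p') \<in> leq E" "(q', q) \<in> leq E"
  shows "tr p q p' q' (tr i l p q G) = tr i l p' q' G"
proof -
  note qi = le_trans[OF assms(3,1)]
  note q'i = le_trans[OF assms(5) qi]
  have "PL q' q p (PU q i p (PL q l i G)) = PU q' i p (PL q' l i G)"
    using PL_PU[OF assms(5) qi assms(2)] PL_PL[OF assms(5,3,1)] by simp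
  then show ?thesis unfolding tr_def using PU_PU[OF q'i assms(2,4)] by simp
qed

text \<open>By directedness, the equivalence relation generated by \<open>drel\<close> amounts to equality at a common
  further level.\<close>

definition deq :: "'i \<Rightarrow> ('i, 'w) dlevel \<Rightarrow> ('i, 'w) dlevel \<Rightarrow> bool" where
  "deq b x y \<longleftrightarrow> (\<exists>i l G z i' l' G' z' p q. x = (i, l, G, V b l z) \<and> y = (i', l', G', V b l' z') \<and>
     (l, i) \<in> leq E \<and> (l', i') \<in> leq E \<and> G \<in> dists (quo E l i) \<and> G' \<in> dists (quo E l' i') \<and>
     (i, p) \<in> leq E \<and> (i', p) \<in> leq E \<and> (q, l) \<in> leq E \<and> (q, l') \<in> leq E \<and>
     tr i l p q (fscale z G) = tr i' l' p q (fscale z' G'))"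

lemma deqI:
  assumes "(l, i) \<in> leq E" "(l', i') \<in> leq E" "G \<in> dists (quo E l i)" "G' \<in> dists (quo E l' i')"
    and "(i, p) \<in> leq E" "(i', p) \<in> leq E" "(q, l) \<in> leq E" "(q, l') \<in> leq E"
    and "tr i l p q (fscale z G) = tr i' l' p q (fscale z' G')"
  shows "deq b (i, l, G, V b l z) (i', l', G', V b l' z')"
  unfolding deq_def using assms by blast

lemma deqE:
  assumes b: "b \<in> idx E" and d: "deq b (i, l, G, V b l z) (i', l', G', \<theta>)"
  obtains z' p q where "\<theta> = V b l' z'" "(l, i) \<in> leq E" "(l', i') \<in> leq E"
    "G \<in> dists (quo E l i)" "G' \<in> dists (quo E l' i')"
    "(i, p) \<in> leq E" "(i', p) \<in> leq E" "(q, l) \<in> leq E" "(q, l') \<in> leq E"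
    "tr i l p q (fscale z G) = tr i' l' p q (fscale z' G')"
proof -
  obtain w z' p q where *: "V b l z = V b l w" "\<theta> = V b l' z'" "(l, i) \<in> leq E" "(l', i') \<in> leq E"
    "G \<in> dists (quo E l i)" "G' \<in> dists (quo E l' i')"
    "(i, p) \<in> leq E" "(i', p) \<in> leq E" "(q, l) \<in> leq E" "(q, l') \<in> leq E"
    "tr i l p q (fscale w G) = tr i' l' p q (fscale z' G')"
    using d unfolding deq_def by auto
  moreover have "z = w" using V_inject[OF b _ *(1)] le_idx *(3) by blast
  ultimately show thesis using that by blast
qed

lemma deq_sym: "deq b x y \<Longrightarrow> deq b y x"
  unfolding deq_def by metis

lemma deq_refl: "(l, i) \<in> leq E \<Longrightarrow> G \<in> dists (quo E l i) \<Longrightarrow> deq b (i, l, G, V b l z) (i, l, G, V b l z)"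
  using le_refl1 le_refl2 by (intro deqI) auto

text \<open>The two comparisons happen at different levels, but by \<open>tr_tr\<close> both persist
  at a common further one.\<close>

lemma deq_trans:
  assumes b: "b \<in> idx E" and xy: "deq b x y" and yw: "deq b y w"
  shows "deq b x w"
proof -
  obtain i l G z j k H y' where x: "x = (i, l, G, V b l z)" and y: "y = (j, k, H, V b k y')"
    using xy unfolding deq_def by metis
  obtain r s K \<theta> where w: "w = (r, s, K, \<theta>)" by (cases w) auto
  have 1: "deq b (j, k, H, V b k y') (i, l, G, V b l z)" using deq_sym[OF xy] x y by simp
  have 2: "deq b (j, k, H, V b k y') (r, s, K, \<theta>)" using yw y w by simp
  obtain u p q where p: "V b l z = V b l u" "(k, j) \<in> leq E" "(l, i) \<in> leq E"
    "H \<in> dists (quo E k j)" "G \<in> dists (quo E l i)"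
    "(j, p) \<in> leq E" "(i, p) \<in> leq E" "(q, k) \<in> leq E" "(q, l) \<in> leq E"
    "tr j k p q (fscale y' H) = tr i l p q (fscale u G)"
    by (rule deqE[OF b 1])
  obtain v p' q' where p': "\<theta> = V b s v" "(s, r) \<in> leq E" "K \<in> dists (quo E s r)"
    "(j, p') \<in> leq E" "(r, p') \<in> leq E" "(q', k) \<in> leq E" "(q', s) \<in> leq E"
    "tr j k p' q' (fscale y' H) = tr r s p' q' (fscale v K)"
    by (rule deqE[OF b 2])
  obtain P where P: "(p, P) \<in> leq E" "(p', P) \<in> leq E" using above le_idx p(6) p'(4) by meson
  obtain Q where Q: "(Q, q) \<in> leq E" "(Q, q') \<in> leq E" using below le_idx p(8) p'(6) by meson
  have "tr i l P Q (fscale u G) = tr j k P Q (fscale y' H)"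
    using tr_tr[OF p(3,7,9) P(1) Q(1)] tr_tr[OF p(2,6,8) P(1) Q(1)] p(10) by metis
  also have "\<dots> = tr r s P Q (fscale v K)"
    using tr_tr[OF p'(2,5,7) P(2) Q(2)] tr_tr[OF p(2) p'(4,6) P(2) Q(2)] p'(8) by metis
  finally show ?thesis
    unfolding x w p(1) p'(1) using p p' P Q le_trans by (intro deqI[of _ _ _ _ _ _ P Q]) blast+
qed

text \<open>In the rule \<open>pull\<close> with \<rho> = t e(l,j), the distribution gains the
  factor t and the virtual measure the factor 1/t, so the arbitrary \<rho> leaves no trace.\<close>

lemma drel_deq:
  assumes b: "b \<in> idx E" and "drel E b x y"
  shows "deq b x y"
  using assms(2)
proof cases
  case (scale l i G \<theta> c)
  obtain z where z: "\<theta> = V b l z" using vmeasE[OF scale(5)] .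
  have "vscale E b l c \<theta> = V b l (c * z)" using V_scale[OF b] le_idx scale(3) z by blast
  then show ?thesis
    unfolding scale(1,2) z using scale le_refl1 le_refl2 dists_scale[OF quo_fs[OF scale(3)]]
    by (auto intro!: deqI[of _ _ _ _ _ _ i l] simp: mult.commute)
next
  case (push l j i G \<theta>)
  obtain z where z: "\<theta> = V b l z" using vmeasE[OF push(6)] .
  note li = le_trans[OF push(3,4)]
  have "tr j l i l (fscale z G) = tr i l i l (fscale z (PU l j i G))"
    using tr_id[OF li] dists_scale[OF quo_fs] PU_dists[OF push(3,4,5)] PL_id[OF push(3)] push(3,5) li
    by (simp add: tr_def[of j] push_dist_scale)
  then show ?thesis
    unfolding push(1,2) z using push li le_refl1 le_refl2 PU_dists[OF push(3,4,5)]
    by (intro deqI[of _ _ _ _ _ _ i l]) blast+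
next
  case (pull l j i G \<theta> \<rho>)
  obtain z where z: "\<theta> = V b j z" using vmeasE[OF pull(6)] .
  note li = le_trans[OF pull(3,4)]
  obtain t where t: "\<rho> = fscale t (e l j)" using measE[OF pull(7,3)] .
  have t0: "t \<noteq> 0" using pull(8) t by auto
  have v: "vcomp E b j l \<theta> (vinv E l j \<rho>) = V b l (z / t)"
    using V_comp[OF b le_idx(2)[OF pull(3)] le_idx(1)[OF pull(3)]] V_inv[OF pull(3) t0] z t by simp
  have T: "tens l j i \<rho> G = fscale t (PL l j i G)"
    using tens_scale[OF pull(3,4) e_meas[OF pull(3)] pull(5), of t 1] t by simp
  note D = PL_dists[OF pull(3,4,5)]
  have D': "fscale t (PL l j i G) \<in> dists (quo E l i)" using dists_scale[OF quo_fs[OF li] D] .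
  have "tr i j i l (fscale z G) = tr i l i l (fscale (z / t) (fscale t (PL l j i G)))"
    using tr_id[OF li dists_scale[OF quo_fs[OF li] D'], of "z / t"] PU_id[OF li dists_scale[OF quo_fs[OF li] D], of z]
      PL_scale[OF pull(3,4,5)] t0 by (simp add: tr_def[of i j])
  then show ?thesis
    unfolding pull(1,2) v T unfolding z using pull li le_refl1 le_refl2 D'
    by (intro deqI[of _ _ _ _ _ _ i l]) blast+
qed

text \<open>One use of each generating rule: lower \<open>l\<close> to \<open>q\<close>, raise
  \<open>i\<close> to \<open>p\<close>, then move the scalar into the distribution. Every class thus
  has a representative with coordinate 1 at any further level.\<close>

lemma drel_normal:
  assumes b: "b \<in> idx E" and li: "(l, i) \<in> leq E" and G: "G \<in> dists (quo E l i)"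
    and p: "(i, p) \<in> leq E" and q: "(q, l) \<in> leq E"
  shows "equivclp (drel E b) (i, l, G, V b l z) (p, q, tr i l p q (fscale z G), V b q 1)"
proof -
  note qi = le_trans[OF q li] and l = le_idx(1)[OF li] and qx = le_idx(1)[OF q]
  have V: "V b k w \<in> vmeas E b k" if "k \<in> idx E" for k w using V_vmeas b that by blast
  have inv: "vinv E q l (e q l) = V l q 1" using V_inv[OF q, of 1] by simp
  have "vcomp E b l q (V b l z) (vinv E q l (e q l)) = V b q z" using V_comp[OF b l qx] inv by simp
  then have 1: "drel E b (i, l, G, V b l z) (i, q, PL q l i G, V b q z)"
    using drel.pull[OF q li G V[OF l, of z] e_meas[OF q] e_nz[OF q]] by simp
  have D: "PL q l i G \<in> dists (quo E q i)" by (rule PL_dists[OF q li G])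
  have 2: "drel E b (i, q, PL q l i G, V b q z) (p, q, tr i l p q G, V b q z)"
    using drel.push[OF qi p D V[OF qx, of z]] by (simp add: tr_def)
  have "vscale E b q z (V b q 1) = V b q z" using V_scale[OF b qx] by simp
  then have 3: "drel E b (p, q, tr i l p q (fscale z G), V b q 1) (p, q, tr i l p q G, V b q z)"
    using drel.scale[where c = z, OF le_trans[OF qi p] tr_dists[OF li p q G] V[OF qx, of 1]] tr_scale[OF li p q G] by simp
  from 1 2 3 show ?thesis
    by (meson equivclp_trans equivclp_sym r_into_equivclp)
qed

lemma deq_drel:
  assumes b: "b \<in> idx E" and "deq b x y"
  shows "equivclp (drel E b) x y"
proof -
  obtain i l G z i' l' G' z' p q where *: "x = (i, l, G, V b l z)" "y = (i', l', G', V b l' z')"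
     "(l, i) \<in> leq E" "(l', i') \<in> leq E" "G \<in> dists (quo E l i)" "G' \<in> dists (quo E l' i')"
     "(i, p) \<in> leq E" "(i', p) \<in> leq E" "(q, l) \<in> leq E" "(q, l') \<in> leq E"
     "tr i l p q (fscale z G) = tr i' l' p q (fscale z' G')"
    using assms(2) unfolding deq_def by blast
  have "equivclp (drel E b) x (p, q, tr i l p q (fscale z G), V b q 1)"
    unfolding *(1) by (rule drel_normal[OF b *(3,5,7,9)])
  moreover have "equivclp (drel E b) y (p, q, tr i l p q (fscale z G), V b q 1)"
    unfolding *(2,11) by (rule drel_normal[OF b *(4,6,8,10)])
  ultimately show ?thesis by (rule equivclp_trans[OF _ equivclp_sym])
qed

abbreviation dc :: "'i \<Rightarrow> 'i \<Rightarrow> 'i \<Rightarrow> 'w dist \<Rightarrow> complex \<Rightarrow> ('i, 'w) dlevel set" where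
  "dc b i l G z \<equiv> cls (drel E b) (i, l, G, V b l z)"

lemma dc_mem:
  assumes b: "b \<in> idx E" and li: "(l, i) \<in> leq E" and G: "G \<in> dists (quo E l i)"
  shows "y \<in> dc b i l G z \<longleftrightarrow> deq b (i, l, G, V b l z) y"
proof
  assume "y \<in> dc b i l G z"
  then have "equivclp (drel E b) (i, l, G, V b l z) y" by (simp add: cls_def)
  then show "deq b (i, l, G, V b l z) y"
  proof (induction rule: equivclp_induct)
    case base
    show ?case by (rule deq_refl[OF li G])
  next
    case (step y w)
    then show ?case using drel_deq[OF b] deq_sym deq_trans[OF b] by blast
  qed
qed (use deq_drel[OF b] in \<open>simp add: cls_def\<close>)

lemma dc_eq:
  assumes b: "b \<in> idx E" and li: "(l, i) \<in> leq E" "(l', i') \<in> leq E"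
    and G: "G \<in> dists (quo E l i)" "G' \<in> dists (quo E l' i')"
    and p: "(i, p) \<in> leq E" "(i', p) \<in> leq E" and q: "(q, l) \<in> leq E" "(q, l') \<in> leq E"
    and eq: "tr i l p q (fscale z G) = tr i' l' p q (fscale z' G')"
  shows "dc b i l G z = dc b i' l' G' z'"
  by (rule cls_eq[OF deq_drel[OF b deqI[OF li G p q eq]]])

lemma dc_repE:
  assumes b: "b \<in> idx E" and li: "(l, i) \<in> leq E" and G: "G \<in> dists (quo E l i)"
    and y: "(i', l', G', \<theta>) \<in> dc b i l G z"
  obtains z' p q where "\<theta> = V b l' z'" "(l', i') \<in> leq E" "G' \<in> dists (quo E l' i')"
    "(i, p) \<in> leq E" "(i', p) \<in> leq E" "(q, l) \<in> leq E" "(q, l') \<in> leq E"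
    "tr i l p q (fscale z G) = tr i' l' p q (fscale z' G')"
  by (rule deqE[OF b]) (use y dc_mem[OF b li G] in blast)+

lemma dc_tr:
  assumes "b \<in> idx E" "(l, i) \<in> leq E" "G \<in> dists (quo E l i)" "(i, p) \<in> leq E" "(q, l) \<in> leq E"
  shows "dc b i l G z = dc b p q (tr i l p q (fscale z G)) 1"
  by (rule cls_eq[OF drel_normal[OF assms]])

end

section \<open>Trivial quotients\<close>

text \<open>Stated through quotients rather than by F(d) = {0}: in a dual space \<open>quo\<close>
  is given directly by duals, and in this form the conditions \<open>zero_at\<close> and
  \<open>top_at\<close> correspond under duality.\<close>

definition zero_at :: "('k, 'i, 'v, 'x, 'w::ab_group_add) c2 \<Rightarrow> 'i \<Rightarrow> bool" where
  "zero_at E d \<longleftrightarrow> (\<forall>l. (l, d) \<in> leq E \<longrightarrow> spc (quo E l d) = {0})"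

definition top_at :: "('k, 'i, 'v, 'x, 'w::ab_group_add) c2 \<Rightarrow> 'i \<Rightarrow> bool" where
  "top_at E c \<longleftrightarrow> (\<forall>l. (c, l) \<in> leq E \<longrightarrow> spc (quo E c l) = {0})"

lemma adm_zero_left:
  assumes "c1_admissible E1 \<alpha> E2 \<beta> (E3 :: ('k::{field,finite}, 'i, 'v::ab_group_add) filt)" "spc E2 = {0}"
  shows "spc E1 = {0}"
proof -
  have "x = 0" if "x \<in> spc E1" for x
    using adm_inj[OF assms(1) that spc_0[OF adm_fs(1)[OF assms(1)]]] adm_alpha_spc[OF assms(1) that]
      adm_alpha_0[OF assms(1)] assms(2) by simp
  then show ?thesis using spc_0[OF adm_fs(1)[OF assms(1)]] by blast
qed

lemma (in c2sys) zero_at_mono: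
  assumes "(d', d) \<in> leq E" "zero_at E d"
  shows "zero_at E d'"
  using adm_zero_left[OF adm[OF _ assms(1)]] le_trans[OF _ assms(1)] assms(2) unfolding zero_at_def by blast

context c2triv
begin

text \<open>The line of measures of a zero quotient has two bases, \<open>e i j\<close> and
  \<open>unit_meas\<close>; this is their ratio.\<close>

definition zu :: "'i \<Rightarrow> 'i \<Rightarrow> complex" where
  "zu i j = e i j (ind {0})"

lemma e_zero:
  assumes "(i, j) \<in> leq E" "spc (quo E i j) = {0}"
  shows "e i j = fscale (zu i j) (unit_meas (quo E i j))" "zu i j \<noteq> 0"
proof -
  show "e i j = fscale (zu i j) (unit_meas (quo E i j))"
    unfolding zu_def by (rule zero_space_meas[OF quo_c1[OF assms(1)] assms(2) e_meas[OF assms(1)]])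
  then show "zu i j \<noteq> 0" using e_nz[OF assms(1)] by auto
qed

text \<open>Unit measures multiply to unit measures just as the bases multiply to bases.\<close>

lemma zu_mult:
  assumes l: "(l', l) \<in> leq E" "(l, d) \<in> leq E" and d: "zero_at E d"
  shows "zu l' d = zu l' l * zu l d"
proof -
  note l'd = le_trans[OF l]
  have z: "spc (quo E l' d) = {0}" "spc (quo E l d) = {0}" using d l l'd by (auto simp: zero_at_def)
  have z': "spc (quo E l' l) = {0}" using adm_zero_left[OF adm[OF l] z(1)] .
  note u = unit_meas_meas(1)[OF quo_fs[OF l(1)] z'] unit_meas_meas(1)[OF quo_fs[OF l(2)] z(2)]
  have "e l' d = fscale (zu l' l * zu l d) (tens l' l d (unit_meas (quo E l' l)) (unit_meas (quo E l d)))"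
    using e_tens[OF l] e_zero(1)[OF l(1) z'] e_zero(1)[OF l(2) z(2)] tens_scale[OF l u(1) meas_dist[OF u(2)]] by metis
  also have "tens l' l d (unit_meas (quo E l' l)) (unit_meas (quo E l d)) = unit_meas (quo E l' d)"
    using pull_dist_unit_right[OF adm[OF l] z(2) u(1)] push_dist_unit[OF adm[OF l] z' z(1)] by simp
  finally have "fscale (zu l' d) (unit_meas (quo E l' d)) = fscale (zu l' l * zu l d) (unit_meas (quo E l' d))"
    unfolding e_zero(1)[OF l'd z(1), symmetric] .
  then show ?thesis using fscale_cancel unit_meas_meas(3)[OF quo_fs[OF l'd] z(1)] by blast
qed

text \<open>The coordinate of the canonical generator of \<open>\<mu>(F(d) | F(d'))\<close> for \<open>F(d) = F(d') = {0}\<close>.\<close>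

definition zr :: "'i \<Rightarrow> 'i \<Rightarrow> complex" where
  "zr d d' = (let l = SOME l. (l, d) \<in> leq E \<and> (l, d') \<in> leq E in zu l d / zu l d')"

lemma zr_eq:
  assumes l: "(l, d) \<in> leq E" "(l, d') \<in> leq E" and d: "zero_at E d" "zero_at E d'"
  shows "zr d d' = zu l d / zu l d'"
proof -
  let ?m = "SOME l. (l, d) \<in> leq E \<and> (l, d') \<in> leq E"
  have m: "(?m, d) \<in> leq E" "(?m, d') \<in> leq E"
    using someI[of "\<lambda>l. (l, d) \<in> leq E \<and> (l, d') \<in> leq E" l] l by blast+
  obtain k where k: "(k, ?m) \<in> leq E" "(k, l) \<in> leq E" using below[OF le_idx(1)[OF m(1)] le_idx(1)[OF l(1)]] by blast
  have "zu k x \<noteq> 0" if "(k, x) \<in> leq E" "zero_at E x" for x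
    using e_zero(2) that by (simp add: zero_at_def)
  moreover have "zero_at E ?m" "zero_at E l" using zero_at_mono m l d by blast+
  ultimately have "zu k ?m \<noteq> 0" "zu k l \<noteq> 0" using k by blast+
  then have "zu ?m d / zu ?m d' = zu k d / zu k d'"
    unfolding zu_mult[OF k(1) m(1) d(1)] zu_mult[OF k(1) m(2) d(2)] by simp
  moreover have "zu l d / zu l d' = zu k d / zu k d'"
    unfolding zu_mult[OF k(2) l(1) d(1)] zu_mult[OF k(2) l(2) d(2)] using \<open>zu k l \<noteq> 0\<close> by simp
  ultimately show ?thesis unfolding zr_def Let_def by simp
qed

lemma vzero_V:
  assumes d: "d \<in> idx E" "d' \<in> idx E" "zero_at E d" "zero_at E d'"
  shows "vzero E d d' = V d d' (zr d d')"
proof -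
  have unit: "unit_meas (quo E l x) = fscale (1 / zu l x) (e l x)" if "(l, x) \<in> leq E" "zero_at E x" for l x
    using e_zero[OF that(1)] that by (simp add: zero_at_def)
  have *: "f = hm l d d' (zr d d')"
    if l: "(l, d) \<in> leq E" "(l, d') \<in> leq E" and f: "f \<in> vlevel E d d' l"
      "f (unit_meas (quo E l d)) = unit_meas (quo E l d')" for l f
  proof (rule level_hm[OF l f(1), of "1 / zu l d"])
    have "zu l d \<noteq> 0" using e_zero(2)[OF l(1)] l d by (simp add: zero_at_def)
    then show "f (fscale (1 / zu l d) (e l d)) = fscale (1 / zu l d * zr d d') (e l d')" "1 / zu l d \<noteq> 0"
      using f(2) unit[OF l(1) d(3)] unit[OF l(2) d(4)] zr_eq[OF l d(3,4)] by simp_all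
  qed
  obtain l where l: "(l, d) \<in> leq E" "(l, d') \<in> leq E" using below d by blast
  have "zu l d \<noteq> 0" using e_zero(2)[OF l(1)] l d by (simp add: zero_at_def)
  then have "hm l d d' (zr d d') (unit_meas (quo E l d)) = unit_meas (quo E l d')"
    using unit[OF l(1) d(3)] unit[OF l(2) d(4)] zr_eq[OF l d(3,4)] by (simp add: hm_scale[OF l(1)])
  then have "\<exists>f. f \<in> vlevel E d d' l \<and> f (unit_meas (quo E l d)) = unit_meas (quo E l d')"
    using hm_level[OF l] by blast
  moreover have "cls (vrel E d d') (l, f) = V d d' (zr d d')"
    if "(l, d) \<in> leq E" "(l, d') \<in> leq E" "f \<in> vlevel E d d' l"
      "f (unit_meas (quo E l d)) = unit_meas (quo E l d')" for l f
    using *[OF that] cls_V[OF that(1,2)] by simp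
  ultimately show ?thesis unfolding vzero_def using l by blast
qed

lemma char_dist_dc:
  assumes bc: "(b, c) \<in> leq E"
  shows "char_dist E b c (V b c x) = dc b c b (fscale x (e b c)) 1"
proof -
  note b = le_idx(1)[OF bc]
  note r = le_refl[OF b]
  have "(b, f) \<in> V b c x \<longleftrightarrow> f = hm b b c x" for f
    using r bc by (auto simp: V_def)
  moreover have "hm b b c x (unit_meas (quo E b b)) = fscale x (e b c)"
    using hm_e[OF r] e_refl[OF b] by simp
  ultimately show ?thesis unfolding char_dist_def V_one[OF b] by simp
qed

text \<open>Lowering \<open>b\<close> to \<open>j\<close> turns e(b,c) into e(j,c). Raising
  \<open>c\<close> to \<open>i\<close> crosses the zero quotient F(i)/F(c), where e(c,i) is
  \<open>zu c i\<close> times the unit measure; e(j,i) is therefore \<open>zu c i\<close> times the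
  direct image of e(j,c), which explains the divisor.\<close>

lemma char_dist_level:
  assumes bc: "(b, c) \<in> leq E" and ci: "(c, i) \<in> leq E" and jb: "(j, b) \<in> leq E" and c: "top_at E c"
  shows "char_dist E b c (V b c x) = dc b i j (fscale (x / zu c i) (e j i)) 1"
proof -
  note b = le_idx(1)[OF bc] and jc = le_trans[OF jb bc]
  have z: "spc (quo E c i) = {0}" using c ci by (simp add: top_at_def)
  note u = unit_meas_meas(1)[OF quo_fs[OF ci] z]
  have D: "fscale x (e b c) \<in> dists (quo E b c)" by (rule meas_dist[OF e_scale_meas[OF bc]])
  have "e j i = tens j c i (fscale 1 (e j c)) (fscale (zu c i) (unit_meas (quo E c i)))"
    using e_tens[OF jc ci] e_zero(1)[OF ci z] by simp
  also have "\<dots> = fscale (zu c i) (PU j c i (e j c))"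
    using tens_scale[OF jc ci e_meas[OF jc] meas_dist[OF u], of 1 "zu c i"]
      pull_dist_unit_right[OF adm[OF jc ci] z e_meas[OF jc]] by simp
  finally have eji: "e j i = fscale (zu c i) (PU j c i (e j c))" .
  have "tr c b i j (fscale 1 (fscale x (e b c))) = fscale x (PU j c i (e j c))"
    using PL_scale[OF jb bc meas_dist[OF e_meas[OF bc]], of x] e_tens[OF jb bc]
    by (simp add: tr_def push_dist_scale)
  also have "\<dots> = fscale (x / zu c i) (e j i)" unfolding eji using e_zero(2)[OF ci z] by simp
  finally show ?thesis
    unfolding char_dist_dc[OF bc] using dc_tr[OF b bc D ci jb, of 1] by simp
qed

end

section \<open>Duality of systems\<close>

lemma c2_dual_simps [simp]:
  "idx (c2_dual E) = idx E" "leq (c2_dual E) = (leq E)\<inverse>" "fil (c2_dual E) = fil_dual E"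
  "quo (c2_dual E) i j = c1_dual (quo E j i)"
  "inc (c2_dual E) i j k = pull (quo E k i) (prj E k j i)"
  "prj (c2_dual E) i j k = pull (quo E k j) (inc E k j i)"
  by (simp_all add: c2_dual_def)

lemma zero_functionals:
  fixes E :: "('k::field, 'i, 'v::ab_group_add) filt"
  assumes fs: "filtered_space E" and z: "spc E = {0}"
  shows "functionals E = {0}"
proof -
  have "w = 0" if w: "w \<in> functionals E" for w
  proof
    fix x
    show "w x = 0 x" using functional_0[OF fs w] functional_out[OF w, of x] z by (cases "x = 0") auto
  qed
  moreover have "0 \<in> functionals E" by (simp add: functionals_def lin_on_def)
  ultimately show ?thesis by blast
qed

lemma zero_dual:
  fixes E :: "('k::{field,finite}, 'i, 'v::ab_group_add) filt"
  assumes fs: "filtered_space E" and z: "spc E = {0}"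
  shows "spc (c1_dual E) = {0}"
  using zero_functionals[OF assms] dual_functional[of _ E] spc_0[OF c1_dual_filtered[OF fs]] by blast

text \<open>Transposition exchanges \<open>inc\<close> and \<open>prj\<close>, so
  \<open>inc_id\<close> and \<open>prj_id\<close>, as well as \<open>inc_inc\<close> and
  \<open>prj_prj\<close>, prove each other's duals, and \<open>prj_inc\<close> proves its
  own.\<close>

lemma (in c2sys) c2sys_dual: "c2sys (c2_dual E)"
proof
  note ext = functional_out[OF dual_functional]
  show "partial_order_on (idx (c2_dual E)) (leq (c2_dual E))" using order by simp
  show "\<exists>k. (k, i) \<in> leq (c2_dual E) \<and> (k, j) \<in> leq (c2_dual E)"
    "\<exists>k. (i, k) \<in> leq (c2_dual E) \<and> (j, k) \<in> leq (c2_dual E)"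
    if "i \<in> idx (c2_dual E)" "j \<in> idx (c2_dual E)" for i j
    using above below that by simp_all
  show "c1_admissible (quo (c2_dual E) i j) (inc (c2_dual E) i j k) (quo (c2_dual E) i k)
      (prj (c2_dual E) i j k) (quo (c2_dual E) j k)"
    if "(i, j) \<in> leq (c2_dual E)" "(j, k) \<in> leq (c2_dual E)" for i j k
    using dual_admissible[OF adm[of k j i]] that by simp
  show "spc (quo (c2_dual E) i i) = {0}" if "i \<in> idx (c2_dual E)" for i
    using zero_dual[OF quo_fs[OF le_refl] quo_refl, of i] that by (simp del: c1_dual_simps(4))
  show "inc (c2_dual E) i j j x = x" if "(i, j) \<in> leq (c2_dual E)" "x \<in> spc (quo (c2_dual E) i j)" for i j x
    using prj_id[of j i] ext[of x "quo E j i"] that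
    by (auto simp: pull_def cut_def fun_eq_iff simp del: c1_dual_simps(4))
  show "prj (c2_dual E) i i j x = x" if "(i, j) \<in> leq (c2_dual E)" "x \<in> spc (quo (c2_dual E) i j)" for i j x
    using inc_id[of j i] ext[of x "quo E j i"] that
    by (auto simp: pull_def cut_def fun_eq_iff simp del: c1_dual_simps(4))
  fix i j k l x
  assume "(i, j) \<in> leq (c2_dual E)" "(j, k) \<in> leq (c2_dual E)" "(k, l) \<in> leq (c2_dual E)"
  then have l: "(l, k) \<in> leq E" "(k, j) \<in> leq E" "(j, i) \<in> leq E" by simp_all
  note a1 = adm[OF l(1) le_trans[OF l(2,3)]] and a2 = adm[OF le_trans[OF l(1,2)] l(3)]
    and a3 = adm[OF l(1,2)] and a4 = adm[OF l(2,3)]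
  show "inc (c2_dual E) i k l (inc (c2_dual E) i j k x) = inc (c2_dual E) i j l x"
    using prj_prj[OF l] adm_beta_spc[OF a1] by (auto simp: pull_def cut_def fun_eq_iff)
  show "prj (c2_dual E) j k l (prj (c2_dual E) i j l x) = prj (c2_dual E) i k l x"
    using inc_inc[OF l] adm_alpha_spc[OF a3] by (auto simp: pull_def cut_def fun_eq_iff)
  show "prj (c2_dual E) i j l (inc (c2_dual E) i k l x) = inc (c2_dual E) j k l (prj (c2_dual E) i j k x)"
    using prj_inc[OF l] adm_alpha_spc[OF a2] adm_beta_spc[OF a3] by (auto simp: pull_def cut_def fun_eq_iff)
qed

context c2triv
begin

abbreviation (input) e_dual :: "'i \<Rightarrow> 'i \<Rightarrow> ('w \<Rightarrow> 'k) dist" where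
  "e_dual \<equiv> \<lambda>i j. meas_inv (quo E j i) (e j i)"

context
  fixes \<psi> :: "'k \<Rightarrow> complex"
  assumes \<psi>: "nontrivial_character \<psi>"
begin

lemma c2triv_dual: "c2triv (c2_dual E) e_dual"
proof (intro c2triv.intro c2sys_dual c2triv_axioms.intro)
  fix i j assume "(i, j) \<in> leq (c2_dual E)"
  then have ji: "(j, i) \<in> leq E" by simp
  show "meas_inv (quo E j i) (e j i) \<in> meas (quo (c2_dual E) i j)"
    using meas_inv(1)[OF \<psi> quo_c1[OF ji] e_meas[OF ji] e_nz[OF ji]] by simp
  show "meas_inv (quo E j i) (e j i) \<noteq> 0"
    by (rule meas_inv_nz[OF \<psi> quo_c1[OF ji] e_meas[OF ji] e_nz[OF ji]])
  fix k assume "(j, k) \<in> leq (c2_dual E)"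
  then have kj: "(k, j) \<in> leq E" by simp
  show "pull_dist (quo (c2_dual E) i j) (inc (c2_dual E) i j k) (quo (c2_dual E) i k) (prj (c2_dual E) i j k)
      (quo (c2_dual E) j k) (meas_inv (quo E j i) (e j i)) (meas_inv (quo E k j) (e k j)) =
      meas_inv (quo E k i) (e k i)"
    using meas_inv_tensor[OF \<psi> adm[OF kj ji] e_meas[OF kj] e_nz[OF kj] e_meas[OF ji] e_nz[OF ji]]
      e_tens[OF kj ji] by simp
qed

interpretation D: c2triv "c2_dual E" e_dual
  by (rule c2triv_dual)

text \<open>A measure a = t e(l,i) contributes 1/t through its inverse and t z through the pairing.
  The result does not depend on \<open>a\<close>, and with respect to the inverse bases the
  coordinate is unchanged.\<close>

lemma vdual_V:
  assumes ij: "i \<in> idx E" "j \<in> idx E"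
  shows "vdual E i j (V i j z) = D.V i j z"
proof -
  have *: "vcomp (c2_dual E) i l j (vof (c2_dual E) i l (meas_inv (quo E l i) a))
      (vfunctional (c2_dual E) j l (meas_pairing (quo E l j) (f a))) = D.V i j z"
    if f: "(l, f) \<in> V i j z" and a: "a \<in> meas (quo E l i)" "a \<noteq> 0" for l f a
  proof -
    have l: "(l, i) \<in> leq E" "(l, j) \<in> leq E" and fh: "f = hm l i j z" using f by (auto simp: V_def)
    obtain t where t: "a = fscale t (e l i)" using measE[OF a(1) l(1)] .
    have t0: "t \<noteq> 0" using a(2) t by auto
    have fa: "f a = fscale (t * z) (e l j)" by (simp add: fh t hm_scale[OF l(1)])
    have inv: "meas_inv (quo E l i) a = fscale (1 / t) (e_dual i l)"
      using meas_inv_scale[OF \<psi> quo_c1[OF l(1)] e_meas[OF l(1)] e_nz[OF l(1)] t0] by (simp add: t divide_inverse)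
    have 1: "vof (c2_dual E) i l (meas_inv (quo E l i) a) = D.V i l (1 / t)"
      using D.V_of[of i l "1 / t"] l by (simp add: inv)
    have 2: "vfunctional (c2_dual E) j l (meas_pairing (quo E l j) (f a)) = D.V l j (t * z)"
      using meas_pairing_inv[OF \<psi> quo_c1[OF l(2)] e_meas[OF l(2)] e_nz[OF l(2)]] l
      by (intro D.V_functional) (simp_all add: fa mult.commute)
    show ?thesis
      unfolding 1 2 using D.V_comp[of i l j "1 / t" "t * z"] ij le_idx(1)[OF l(1)] t0 by simp
  qed
  obtain l where l: "(l, i) \<in> leq E" "(l, j) \<in> leq E" using below ij by blast
  have "(l, hm l i j z) \<in> V i j z" using l by (auto simp: V_def)
  then show ?thesis unfolding vdual_def using * e_meas[OF l(1)] e_nz[OF l(1)] by blast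
qed

text \<open>In a zero space the subspace F(k) and its annihilator are both {0}, so the inverse
  masses prescribed by \<open>meas_inv\<close> are exactly these two ratios.\<close>

lemma zu_dual:
  assumes l: "(l, d) \<in> leq E" and z: "spc (quo E l d) = {0}"
  shows "D.zu d l = 1 / zu l d"
proof -
  note fs = quo_fs[OF l]
  obtain k where k: "k \<in> idx (quo E l d)" using idx_nonempty[OF fs] by blast
  have F: "fil (quo E l d) k = {0}" using fil_0[OF fs k] fil_spc[OF fs k] z by blast
  have "ann (quo E l d) {0} \<subseteq> functionals (quo E l d)" using ann_functional by blast
  then have "ann (quo E l d) {0} = {0}"
    using zero_functionals[OF fs z] module.subspace_0[OF module_fscale ann_subspace] by blast
  then show ?thesis
    using meas_inv(2)[OF \<psi> quo_c1[OF l] e_meas[OF l] e_nz[OF l] k] F by (simp add: D.zu_def zu_def divide_inverse)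
qed

abbreviation FT :: "'i \<Rightarrow> 'i \<Rightarrow> 'w dist \<Rightarrow> ('w \<Rightarrow> 'k) dist" where
  "FT l i \<equiv> fourier_dist \<psi> (quo E l i) (e l i)"

lemma FT_dists: "(l, i) \<in> leq E \<Longrightarrow> G \<in> dists (quo E l i) \<Longrightarrow> FT l i G \<in> dists (c1_dual (quo E l i))"
  by (rule fourier_dist_dists[OF \<psi> quo_c1 e_meas e_nz])

lemma FT_scale: "(l, i) \<in> leq E \<Longrightarrow> G \<in> dists (quo E l i) \<Longrightarrow> FT l i (fscale s G) = fscale s (FT l i G)"
  using fourier_dist_scale[OF \<psi> quo_c1 e_meas e_nz, of l i 1 G s] by simp

text \<open>The Fourier transform exchanges \<open>PU\<close> and \<open>PL\<close>;
  \<open>PL_PU\<close> in the dual system restores the order used in \<open>tr\<close>.\<close>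

lemma FT_tr:
  assumes l: "(l, i) \<in> leq E" "(i, p) \<in> leq E" "(q, l) \<in> leq E" and G: "G \<in> dists (quo E l i)"
  shows "FT q p (tr i l p q G) = D.tr l i q p (FT l i G)"
proof -
  note qi = le_trans[OF l(3,1)]
  have 1: "FT q p (PU q i p H) = D.PL p i q (FT q i H)" for H
    using fourier_push[OF \<psi> adm[OF qi l(2)] e_meas[OF qi] e_nz[OF qi] e_meas[OF l(2)] e_nz[OF l(2)]]
      e_tens[OF qi l(2)] by simp
  have 2: "FT q i (PL q l i G) = D.PU i l q (FT l i G)"
    using fourier_pull[OF \<psi> adm[OF l(3,1)] e_meas[OF l(3)] e_nz[OF l(3)] e_meas[OF l(1)] e_nz[OF l(1)]]
      e_tens[OF l(3,1)] by simp
  have "FT q p (tr i l p q G) = D.PL p i q (D.PU i l q (FT l i G))" by (simp only: tr_def 1 2)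
  also have "\<dots> = D.tr l i q p (FT l i G)"
    unfolding D.tr_def by (rule D.PL_PU) (use l in simp_all)
  finally show ?thesis .
qed

text \<open>The union in \<open>fourier\<close> ranges over all representatives and all \<rho>.
  Replacing the basis measure by its t-fold divides the transform by t and multiplies the coordinate
  of \<theta> by t; a change of level is absorbed by \<open>FT_tr\<close>. The representative at
  hand with the basis measure shows that the union is not empty.\<close>

lemma fourier_dc:
  assumes b: "b \<in> idx E" and ji: "(j, i) \<in> leq E" and G: "G \<in> dists (quo E j i)"
  shows "fourier \<psi> E b (dc b i j G z) = D.dc b j i (FT j i G) z"
proof -
  have b': "b \<in> idx (c2_dual E)" using b by simp
  have *: "cls (drel (c2_dual E) b) (j', i', fourier_dist \<psi> (quo E j' i') \<rho> G', vdual E b i' \<theta>) =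
      D.dc b j i (FT j i G) z"
    if y: "(i', j', G', \<kappa>) \<in> dc b i j G z" and \<rho>: "\<rho> \<in> meas (quo E j' i')" "\<rho> \<noteq> 0"
      and \<theta>: "\<theta> \<in> vmeas E b i'" and \<kappa>: "\<kappa> = vcomp E b i' j' \<theta> (vinv E j' i' \<rho>)" for i' j' G' \<kappa> \<rho> \<theta>
  proof -
    obtain z' p q where z': "\<kappa> = V b j' z'" and ji': "(j', i') \<in> leq E" and G': "G' \<in> dists (quo E j' i')"
      and p: "(i, p) \<in> leq E" "(i', p) \<in> leq E" and q: "(q, j) \<in> leq E" "(q, j') \<in> leq E"
      and eq: "tr i j p q (fscale z G) = tr i' j' p q (fscale z' G')"
      using dc_repE[OF b ji G y] .
    obtain t where t: "\<rho> = fscale t (e j' i')" using measE[OF \<rho>(1) ji'] .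
    have t0: "t \<noteq> 0" using \<rho>(2) t by auto
    obtain w where w: "\<theta> = V b i' w" using vmeasE[OF \<theta>] .
    note idx = le_idx[OF ji']
    have "V b j' z' = V b j' (w / t)"
      using \<kappa> V_comp[OF b idx(2,1), of w "1 / t"] V_inv[OF ji' t0] by (simp add: z' w t)
    then have zw: "z' = w / t" using V_inject[OF b idx(1)] by blast
    have F: "fourier_dist \<psi> (quo E j' i') \<rho> G' = fscale (1 / t) (FT j' i' G')"
      using fourier_dist_scale[OF \<psi> quo_c1[OF ji'] e_meas[OF ji'] e_nz[OF ji'] t0 G', of 1] by (simp add: t)
    note FD = FT_dists[OF ji' G']
    have fsd: "filtered_space (c1_dual (quo E j' i'))" by (rule c1_dual_filtered[OF quo_fs[OF ji']])
    have "D.tr j' i' q p (fscale w (fscale (1 / t) (FT j' i' G'))) = D.tr j' i' q p (FT j' i' (fscale z' G'))"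
      using FT_scale[OF ji' G'] by (simp add: zw)
    also have "\<dots> = D.tr j i q p (FT j i (fscale z G))"
      using FT_tr[OF ji' p(2) q(2) dists_scale[OF quo_fs[OF ji'] G'], of z']
        FT_tr[OF ji p(1) q(1) dists_scale[OF quo_fs[OF ji] G], of z] eq by simp
    also have "\<dots> = D.tr j i q p (fscale z (FT j i G))" using FT_scale[OF ji G] by simp
    finally have "D.dc b j' i' (fscale (1 / t) (FT j' i' G')) w = D.dc b j i (FT j i G) z"
      using p q ji ji' FT_dists[OF ji G] dists_scale[OF fsd FD] by (intro D.dc_eq[OF b', where p = q and q = p]) simp_all
    then show ?thesis unfolding F w vdual_V[OF b idx(2)] .
  qed
  note idx = le_idx[OF ji]
  have 1: "(i, j, G, V b j z) \<in> dc b i j G z" by (rule cls_self)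
  have 2: "V b j z = vcomp E b i j (V b i z) (vinv E j i (e j i))"
    using V_comp[OF b idx(2,1), of z 1] V_inv[OF ji, of 1] by simp
  let ?S = "{cls (drel (c2_dual E) b) (j', i', fourier_dist \<psi> (quo E j' i') \<rho> G', vdual E b i' \<theta>)
    | i' j' G' \<kappa> \<rho> \<theta>. (i', j', G', \<kappa>) \<in> dc b i j G z \<and> \<rho> \<in> meas (quo E j' i') \<and> \<rho> \<noteq> 0 \<and>
      \<theta> \<in> vmeas E b i' \<and> \<kappa> = vcomp E b i' j' \<theta> (vinv E j' i' \<rho>)}"
  have "Y = D.dc b j i (FT j i G) z" if "Y \<in> ?S" for Y
    using that by (elim CollectE exE conjE) (rule trans, assumption, rule *)
  moreover have "D.dc b j i (FT j i G) z \<in> ?S"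
    unfolding *[OF 1 e_meas[OF ji] e_nz[OF ji] V_vmeas[OF b idx(2)] 2, symmetric]
    using 1 e_meas[OF ji] e_nz[OF ji] V_vmeas[OF b idx(2)] 2
    by (intro CollectI exI conjI) (rule refl, assumption+)
  ultimately have "?S = {D.dc b j i (FT j i G) z}" by blast
  then show ?thesis unfolding fourier_def by simp
qed

end

end

section \<open>Triples of systems\<close>

text \<open>The part of an admissible triple that survives duality: the maps between quotients,
  their naturality and the cofinality of both index maps. The latter allows an arbitrary level of
  the outer spaces to be replaced by one coming from I2.\<close>

locale tsys =
  fixes T :: "('k::{field,finite}, 'i1, 'a::ab_group_add, 'x1, 'r::ab_group_add,
    'i2, 'b::ab_group_add, 'x2, 's::ab_group_add, 'i3, 'c::ab_group_add, 'x3, 't::ab_group_add) triple"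
  assumes sys1: "c2sys (tri1 T)" and sys2: "c2sys (tri2 T)" and sys3: "c2sys (tri3 T)"
    and eps_mono: "(i, j) \<in> leq (tri2 T) \<Longrightarrow> (eps T i, eps T j) \<in> leq (tri1 T)"
    and gam_mono: "(i, j) \<in> leq (tri2 T) \<Longrightarrow> (gam T i, gam T j) \<in> leq (tri3 T)"
    and eps_cofinal: "k \<in> idx (tri1 T) \<Longrightarrow>
      \<exists>i\<in>idx (tri2 T). \<exists>j\<in>idx (tri2 T). (eps T i, k) \<in> leq (tri1 T) \<and> (k, eps T j) \<in> leq (tri1 T)"
    and gam_cofinal: "m \<in> idx (tri3 T) \<Longrightarrow>
      \<exists>i\<in>idx (tri2 T). \<exists>j\<in>idx (tri2 T). (gam T i, m) \<in> leq (tri3 T) \<and> (m, gam T j) \<in> leq (tri3 T)"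
    and tadm: "(i, j) \<in> leq (tri2 T) \<Longrightarrow> c1_admissible (quo (tri1 T) (eps T i) (eps T j)) (tri_aq T i j)
      (quo (tri2 T) i j) (tri_bq T i j) (quo (tri3 T) (gam T i) (gam T j))"
    and aq_inc: "(i, j) \<in> leq (tri2 T) \<Longrightarrow> (j, l) \<in> leq (tri2 T) \<Longrightarrow> x \<in> spc (quo (tri1 T) (eps T i) (eps T j)) \<Longrightarrow>
      tri_aq T i l (inc (tri1 T) (eps T i) (eps T j) (eps T l) x) = inc (tri2 T) i j l (tri_aq T i j x)"
    and aq_prj: "(i, j) \<in> leq (tri2 T) \<Longrightarrow> (j, l) \<in> leq (tri2 T) \<Longrightarrow> x \<in> spc (quo (tri1 T) (eps T i) (eps T l)) \<Longrightarrow>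
      tri_aq T j l (prj (tri1 T) (eps T i) (eps T j) (eps T l) x) = prj (tri2 T) i j l (tri_aq T i l x)"
    and bq_inc: "(i, j) \<in> leq (tri2 T) \<Longrightarrow> (j, l) \<in> leq (tri2 T) \<Longrightarrow> y \<in> spc (quo (tri2 T) i j) \<Longrightarrow>
      tri_bq T i l (inc (tri2 T) i j l y) = inc (tri3 T) (gam T i) (gam T j) (gam T l) (tri_bq T i j y)"
    and bq_prj: "(i, j) \<in> leq (tri2 T) \<Longrightarrow> (j, l) \<in> leq (tri2 T) \<Longrightarrow> y \<in> spc (quo (tri2 T) i l) \<Longrightarrow>
      tri_bq T j l (prj (tri2 T) i j l y) = prj (tri3 T) (gam T i) (gam T j) (gam T l) (tri_bq T i l y)"

lemma dual_triple_simps [simp]: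
  "tri1 (dual_triple T) = c2_dual (tri3 T)" "tri2 (dual_triple T) = c2_dual (tri2 T)"
  "tri3 (dual_triple T) = c2_dual (tri1 T)" "eps (dual_triple T) = gam T" "gam (dual_triple T) = eps T"
  "tri_aq (dual_triple T) i j = pull (quo (tri2 T) j i) (tri_bq T j i)"
  "tri_bq (dual_triple T) i j = pull (quo (tri1 T) (eps T j) (eps T i)) (tri_aq T j i)"
  by (simp_all add: dual_triple_def)

lemma (in tsys) tsys_dual: "tsys (dual_triple T)"
proof (rule tsys.intro)
  show "c2sys (tri1 (dual_triple T))" "c2sys (tri2 (dual_triple T))" "c2sys (tri3 (dual_triple T))"
    using c2sys.c2sys_dual sys1 sys2 sys3 by simp_all
  fix i j
  show "\<exists>i\<in>idx (tri2 (dual_triple T)). \<exists>j\<in>idx (tri2 (dual_triple T)).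
      (eps (dual_triple T) i, k) \<in> leq (tri1 (dual_triple T)) \<and> (k, eps (dual_triple T) j) \<in> leq (tri1 (dual_triple T))"
    if "k \<in> idx (tri1 (dual_triple T))" for k
    using gam_cofinal[of k] that by auto
  show "\<exists>i\<in>idx (tri2 (dual_triple T)). \<exists>j\<in>idx (tri2 (dual_triple T)).
      (gam (dual_triple T) i, k) \<in> leq (tri3 (dual_triple T)) \<and> (k, gam (dual_triple T) j) \<in> leq (tri3 (dual_triple T))"
    if "k \<in> idx (tri3 (dual_triple T))" for k
    using eps_cofinal[of k] that by auto
  assume "(i, j) \<in> leq (tri2 (dual_triple T))"
  then have ji: "(j, i) \<in> leq (tri2 T)" by simp
  show "(eps (dual_triple T) i, eps (dual_triple T) j) \<in> leq (tri1 (dual_triple T))"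
    "(gam (dual_triple T) i, gam (dual_triple T) j) \<in> leq (tri3 (dual_triple T))"
    using eps_mono[OF ji] gam_mono[OF ji] by simp_all
  show "c1_admissible (quo (tri1 (dual_triple T)) (eps (dual_triple T) i) (eps (dual_triple T) j))
      (tri_aq (dual_triple T) i j) (quo (tri2 (dual_triple T)) i j) (tri_bq (dual_triple T) i j)
      (quo (tri3 (dual_triple T)) (gam (dual_triple T) i) (gam (dual_triple T) j))"
    using dual_admissible[OF tadm[OF ji]] by simp
  fix l assume "(j, l) \<in> leq (tri2 (dual_triple T))"
  then have lj: "(l, j) \<in> leq (tri2 T)" by simp
  interpret S2: c2sys "tri2 T" by (rule sys2)
  interpret S1: c2sys "tri1 T" by (rule sys1)
  note li = S2.le_trans[OF lj ji]
  note a2 = S2.adm[OF lj ji] and a1 = S1.adm[OF eps_mono[OF lj] eps_mono[OF ji]]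
  show "tri_aq (dual_triple T) i l (inc (tri1 (dual_triple T)) (eps (dual_triple T) i) (eps (dual_triple T) j)
      (eps (dual_triple T) l) x) = inc (tri2 (dual_triple T)) i j l (tri_aq (dual_triple T) i j x)" for x
    using bq_prj[OF lj ji] adm_beta_spc[OF tadm[OF li]] adm_beta_spc[OF a2]
    by (auto simp: pull_def cut_def fun_eq_iff)
  show "tri_aq (dual_triple T) j l (prj (tri1 (dual_triple T)) (eps (dual_triple T) i) (eps (dual_triple T) j)
      (eps (dual_triple T) l) x) = prj (tri2 (dual_triple T)) i j l (tri_aq (dual_triple T) i l x)" for x
    using bq_inc[OF lj ji] adm_beta_spc[OF tadm[OF lj]] adm_alpha_spc[OF a2]
    by (auto simp: pull_def cut_def fun_eq_iff)
  show "tri_bq (dual_triple T) i l (inc (tri2 (dual_triple T)) i j l x) = inc (tri3 (dual_triple T))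
      (gam (dual_triple T) i) (gam (dual_triple T) j) (gam (dual_triple T) l) (tri_bq (dual_triple T) i j x)" for x
    using aq_prj[OF lj ji] adm_alpha_spc[OF tadm[OF li]] adm_beta_spc[OF a1]
    by (auto simp: pull_def cut_def fun_eq_iff)
  show "tri_bq (dual_triple T) j l (prj (tri2 (dual_triple T)) i j l x) = prj (tri3 (dual_triple T))
      (gam (dual_triple T) i) (gam (dual_triple T) j) (gam (dual_triple T) l) (tri_bq (dual_triple T) i l x)" for x
    using aq_inc[OF lj ji] adm_alpha_spc[OF tadm[OF lj]] adm_alpha_spc[OF a1]
    by (auto simp: pull_def cut_def fun_eq_iff)
qed

locale ttriv = tsys T + T1: c2triv "tri1 T" e1 + T3: c2triv "tri3 T" e3
  for T :: "('k::{field,finite}, 'i1, 'a::ab_group_add, 'x1, 'r::ab_group_add,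
    'i2, 'b::ab_group_add, 'x2, 's::ab_group_add, 'i3, 'c::ab_group_add, 'x3, 't::ab_group_add) triple"
    and e1 e3 +
  fixes e2 :: "'i2 \<Rightarrow> 'i2 \<Rightarrow> 's dist"
  assumes e2: "(i, j) \<in> leq (tri2 T) \<Longrightarrow> e2 i j = pull_dist (quo (tri1 T) (eps T i) (eps T j)) (tri_aq T i j)
      (quo (tri2 T) i j) (tri_bq T i j) (quo (tri3 T) (gam T i) (gam T j))
      (e1 (eps T i) (eps T j)) (e3 (gam T i) (gam T j))"
begin

sublocale S2: c2sys "tri2 T" by (rule sys2)

sublocale T2: c2triv "tri2 T" e2
proof
  fix i j assume ij: "(i, j) \<in> leq (tri2 T)"
  note m = T1.e_meas[OF eps_mono[OF ij]] T3.e_meas[OF gam_mono[OF ij]]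
  note n = T1.e_nz[OF eps_mono[OF ij]] T3.e_nz[OF gam_mono[OF ij]]
  show "e2 i j \<in> meas (quo (tri2 T) i j)" unfolding e2[OF ij] by (rule pull_dist_meas[OF tadm[OF ij] m])
  show "e2 i j \<noteq> 0" unfolding e2[OF ij] by (rule tensor_nz[OF tadm[OF ij] m n])
  fix l assume jl: "(j, l) \<in> leq (tri2 T)"
  note il = S2.le_trans[OF ij jl]
  note m' = T1.e_meas[OF eps_mono[OF jl]] T3.e_meas[OF gam_mono[OF jl]]
  show "S2.tens i j l (e2 i j) (e2 j l) = e2 i l"
    unfolding e2[OF ij] e2[OF jl] e2[OF il]
    using tensor_three_by_three[OF T1.adm[OF eps_mono[OF ij] eps_mono[OF jl]] S2.adm[OF ij jl]
        T3.adm[OF gam_mono[OF ij] gam_mono[OF jl]] tadm[OF ij] tadm[OF il] tadm[OF jl]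
        aq_inc[OF ij jl] aq_prj[OF ij jl] bq_inc[OF ij jl] bq_prj[OF ij jl] m(1) m'(1) m(2) m'(2)]
      T1.e_tens[OF eps_mono[OF ij] eps_mono[OF jl]] T3.e_tens[OF gam_mono[OF ij] gam_mono[OF jl]] by simp
qed

lemma eps_idx: "i \<in> idx (tri2 T) \<Longrightarrow> eps T i \<in> idx (tri1 T)"
  and gam_idx: "i \<in> idx (tri2 T) \<Longrightarrow> gam T i \<in> idx (tri3 T)"
  using eps_mono gam_mono S2.le_refl T1.le_idx T3.le_idx by meson+

lemma tri_tensor_e:
  assumes "(i, j) \<in> leq (tri2 T)"
  shows "tri_tensor T i j (fscale s (e1 (eps T i) (eps T j))) (fscale t (e3 (gam T i) (gam T j))) =
    fscale (s * t) (e2 i j)"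
  unfolding tri_tensor_def e2[OF assms]
  using meas_tensor_eq[OF tadm[OF assms] T1.e_scale_meas[OF eps_mono[OF assms]] T3.e_scale_meas[OF gam_mono[OF assms]]]
    pull_dist_scale[OF tadm[OF assms] T1.e_meas[OF eps_mono[OF assms]] meas_dist[OF T3.e_meas[OF gam_mono[OF assms]]]]
  by simp

text \<open>The classes \<open>T1.V\<close> and \<open>T3.V\<close> have representatives at every
  level below both indices, in particular at \<open>eps T l\<close> and \<open>gam T l\<close> for
  the same \<open>l\<close>. This makes the union in \<open>vtensor\<close> nonempty, and
  \<open>level_hm\<close> forces the value of each \<open>g\<close> in it.\<close>

lemma vtensor_V:
  assumes ij: "i \<in> idx (tri2 T)" "j \<in> idx (tri2 T)"
  shows "vtensor T i j (T1.V (eps T i) (eps T j) z) (T3.V (gam T i) (gam T j) w) = T2.V i j (z * w)"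
proof -
  have *: "cls (vrel (tri2 T) i j) (l, g) = T2.V i j (z * w)"
    if l: "(l, i) \<in> leq (tri2 T)" "(l, j) \<in> leq (tri2 T)" and g: "g \<in> vlevel (tri2 T) i j l"
      and f: "(eps T l, f) \<in> T1.V (eps T i) (eps T j) z" and h: "(gam T l, h) \<in> T3.V (gam T i) (gam T j) w"
      and eq: "\<forall>a\<in>meas (quo (tri1 T) (eps T l) (eps T i)). \<forall>c\<in>meas (quo (tri3 T) (gam T l) (gam T i)).
            g (tri_tensor T l i a c) = tri_tensor T l j (f a) (h c)" for l g f h
  proof -
    have fh: "f = T1.hm (eps T l) (eps T i) (eps T j) z" "h = T3.hm (gam T l) (gam T i) (gam T j) w"
      using f h by (auto simp: T1.V_def T3.V_def)
    have "g (tri_tensor T l i (e1 (eps T l) (eps T i)) (e3 (gam T l) (gam T i))) =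
      tri_tensor T l j (f (e1 (eps T l) (eps T i))) (h (e3 (gam T l) (gam T i)))"
      using eq T1.e_meas[OF eps_mono[OF l(1)]] T3.e_meas[OF gam_mono[OF l(1)]] by blast
    then have "g (fscale 1 (e2 l i)) = fscale (1 * (z * w)) (e2 l j)"
      using tri_tensor_e[OF l(1), of 1 1] tri_tensor_e[OF l(2), of z w]
        T1.hm_e[OF eps_mono[OF l(1)]] T3.hm_e[OF gam_mono[OF l(1)]] by (simp add: fh)
    then have "g = T2.hm l i j (z * w)" by (intro T2.level_hm[OF l g, of 1]) auto
    then show ?thesis using T2.cls_V[OF l] by simp
  qed
  obtain l where l: "(l, i) \<in> leq (tri2 T)" "(l, j) \<in> leq (tri2 T)" using S2.below ij by blast
  let ?f = "T1.hm (eps T l) (eps T i) (eps T j) z" and ?h = "T3.hm (gam T l) (gam T i) (gam T j) w"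
  have eq: "T2.hm l i j (z * w) (tri_tensor T l i a c) = tri_tensor T l j (?f a) (?h c)"
    if a: "a \<in> meas (quo (tri1 T) (eps T l) (eps T i))" and c: "c \<in> meas (quo (tri3 T) (gam T l) (gam T i))" for a c
  proof -
    obtain s where s: "a = fscale s (e1 (eps T l) (eps T i))" using T1.measE[OF a eps_mono[OF l(1)]] .
    obtain t where t: "c = fscale t (e3 (gam T l) (gam T i))" using T3.measE[OF c gam_mono[OF l(1)]] .
    show ?thesis
      unfolding s t T1.hm_scale[OF eps_mono[OF l(1)]] T3.hm_scale[OF gam_mono[OF l(1)]] tri_tensor_e[OF l(1)]
        tri_tensor_e[OF l(2)] T2.hm_scale[OF l(1)] by (simp add: mult.commute mult.left_commute)
  qed
  have f: "(eps T l, ?f) \<in> T1.V (eps T i) (eps T j) z" and h: "(gam T l, ?h) \<in> T3.V (gam T i) (gam T j) w"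
    using l eps_mono gam_mono by (auto simp: T1.V_def T3.V_def)
  let ?S = "{cls (vrel (tri2 T) i j) (l, g) | l g f h.
         (l, i) \<in> leq (tri2 T) \<and> (l, j) \<in> leq (tri2 T) \<and> g \<in> vlevel (tri2 T) i j l \<and>
         (eps T l, f) \<in> T1.V (eps T i) (eps T j) z \<and> (gam T l, h) \<in> T3.V (gam T i) (gam T j) w \<and>
         (\<forall>a\<in>meas (quo (tri1 T) (eps T l) (eps T i)). \<forall>c\<in>meas (quo (tri3 T) (gam T l) (gam T i)).
            g (tri_tensor T l i a c) = tri_tensor T l j (f a) (h c))}"
  have "Y = T2.V i j (z * w)" if "Y \<in> ?S" for Y
    using that by (elim CollectE exE conjE) (rule trans, assumption, rule *)
  moreover have "T2.V i j (z * w) \<in> ?S"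
    unfolding T2.cls_V[OF l, symmetric] using l T2.hm_level[OF l] f h eq
    by (intro CollectI exI conjI ballI) (rule refl, assumption+)
  ultimately have "?S = {T2.V i j (z * w)}" by blast
  then show ?thesis unfolding vtensor_def by simp
qed

section \<open>Direct image along \<alpha> and the distribution delta\<close>

abbreviation AL :: "'i2 \<Rightarrow> 'i2 \<Rightarrow> 'r dist \<Rightarrow> 's dist" where
  "AL j i \<equiv> push_dist (quo (tri1 T) (eps T j) (eps T i)) (tri_aq T j i) (quo (tri2 T) j i)"

lemma AL_dists: "(j, i) \<in> leq (tri2 T) \<Longrightarrow> G \<in> dists (quo (tri1 T) (eps T j) (eps T i)) \<Longrightarrow>
    AL j i G \<in> dists (quo (tri2 T) j i)"
  by (rule push_dist_dists[OF tadm])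

lemma AL_PU:
  assumes l: "(j, i) \<in> leq (tri2 T)" "(i, i') \<in> leq (tri2 T)"
  shows "T2.PU j i i' (AL j i G) = AL j i' (T1.PU (eps T j) (eps T i) (eps T i') G)"
proof
  fix f
  note a1 = T1.adm[OF eps_mono[OF l(1)] eps_mono[OF l(2)]]
  show "T2.PU j i i' (AL j i G) f = AL j i' (T1.PU (eps T j) (eps T i) (eps T i') G) f"
  proof (cases "f \<in> test_fun (quo (tri2 T) j i')")
    case True
    have "pull (quo (tri1 T) (eps T j) (eps T i)) (tri_aq T j i) (pull (quo (tri2 T) j i) (inc (tri2 T) j i i') f) =
      pull (quo (tri1 T) (eps T j) (eps T i)) (inc (tri1 T) (eps T j) (eps T i) (eps T i'))
        (pull (quo (tri1 T) (eps T j) (eps T i')) (tri_aq T j i') f)"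
      using aq_inc[OF l] adm_alpha_spc[OF tadm[OF l(1)]] adm_alpha_spc[OF a1]
      by (auto simp: pull_def cut_def fun_eq_iff)
    then show ?thesis
      using True adm_pull_test[OF S2.adm[OF l] True] adm_pull_test[OF tadm[OF S2.le_trans[OF l]] True]
      by (simp add: push_dist_def)
  qed (simp add: push_dist_def)
qed

text \<open>Since F3(\<gamma> j)/F3(\<gamma> j') is zero, e2(j',j) is the image of e1(\<epsilon>
  j',\<epsilon> j) up to the ratio \<open>zu\<close>. Apart from this factor the claim is base
  change along the map induced by \<alpha>.\<close>

lemma AL_PL:
  assumes l: "(j', j) \<in> leq (tri2 T)" "(j, i) \<in> leq (tri2 T)" and z: "zero_at (tri3 T) (gam T j)"
    and G: "G \<in> dists (quo (tri1 T) (eps T j) (eps T i))"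
  shows "T2.PL j' j i (AL j i G) =
    fscale (T3.zu (gam T j') (gam T j)) (AL j' i (T1.PL (eps T j') (eps T j) (eps T i) G))"
proof -
  note j'i = S2.le_trans[OF l]
  let ?m = "push_dist (quo (tri1 T) (eps T j') (eps T j)) (tri_aq T j' j) (quo (tri2 T) j' j) (e1 (eps T j') (eps T j))"
  note em = T1.e_meas[OF eps_mono[OF l(1)]]
  have z': "spc (quo (tri3 T) (gam T j') (gam T j)) = {0}" using z gam_mono[OF l(1)] by (simp add: zero_at_def)
  note u = unit_meas_meas(1)[OF T3.quo_fs[OF gam_mono[OF l(1)]] z']
  have m: "?m \<in> meas (quo (tri2 T) j' j)"
    using pull_dist_meas[OF tadm[OF l(1)] em u] pull_dist_unit_right[OF tadm[OF l(1)] z' em] by simp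
  have "e2 j' j = fscale (T3.zu (gam T j') (gam T j)) ?m"
    using e2[OF l(1)] T3.e_zero(1)[OF gam_mono[OF l(1)] z'] pull_dist_unit_right[OF tadm[OF l(1)] z' em]
      pull_dist_scale[OF tadm[OF l(1)] em meas_dist[OF u], of 1 "T3.zu (gam T j') (gam T j)"] by simp
  then have "T2.PL j' j i (AL j i G) = fscale (T3.zu (gam T j') (gam T j)) (S2.tens j' j i ?m (AL j i G))"
    using S2.tens_scale[OF l m AL_dists[OF l(2) G], of "T3.zu (gam T j') (gam T j)" 1] by simp
  moreover have "S2.tens j' j i ?m (AL j i G) = AL j' i (T1.PL (eps T j') (eps T j) (eps T i) G)"
  proof
    fix f
    note A1 = T1.adm[OF eps_mono[OF l(1)] eps_mono[OF l(2)]] and A2 = S2.adm[OF l]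
    show "S2.tens j' j i ?m (AL j i G) f = AL j' i (T1.PL (eps T j') (eps T j) (eps T i) G) f"
    proof (cases "f \<in> test_fun (quo (tri2 T) j' i)")
      case True
      note pt = adm_pull_test[OF tadm[OF j'i] True]
      have "pull (quo (tri1 T) (eps T j) (eps T i)) (tri_aq T j i)
          (fibre_integral (quo (tri2 T) j' j) (inc (tri2 T) j' j i) (quo (tri2 T) j' i) (prj (tri2 T) j' j i)
            (quo (tri2 T) j i) ?m f) =
          fibre_integral (quo (tri1 T) (eps T j') (eps T j)) (inc (tri1 T) (eps T j') (eps T j) (eps T i))
            (quo (tri1 T) (eps T j') (eps T i)) (prj (tri1 T) (eps T j') (eps T j) (eps T i))
            (quo (tri1 T) (eps T j) (eps T i)) (e1 (eps T j') (eps T j))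
            (pull (quo (tri1 T) (eps T j') (eps T i)) (tri_aq T j' i) f)"
      proof (rule fibre_base_change[OF A1 A2 em m refl _ _ _ True pt])
        show "tri_aq T j' j x \<in> spc (quo (tri2 T) j' j) \<and>
          tri_aq T j' i (inc (tri1 T) (eps T j') (eps T j) (eps T i) x) = inc (tri2 T) j' j i (tri_aq T j' j x)"
          if "x \<in> spc (quo (tri1 T) (eps T j') (eps T j))" for x
          using aq_inc[OF l that] adm_alpha_spc[OF tadm[OF l(1)] that] by blast
        show "tri_aq T j' i x \<in> spc (quo (tri2 T) j' i) \<and>
          tri_aq T j i (prj (tri1 T) (eps T j') (eps T j) (eps T i) x) = prj (tri2 T) j' j i (tri_aq T j' i x)"
          if "x \<in> spc (quo (tri1 T) (eps T j') (eps T i))" for x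
          using aq_prj[OF l that] adm_alpha_spc[OF tadm[OF j'i] that] by blast
      qed (rule adm_alpha_add[OF tadm[OF j'i]])
      then show ?thesis
        using True pt fibre_test[OF A2 True m]
        by (simp add: pull_dist_apply[OF A2] pull_dist_apply[OF A1] push_dist_def[of _ _ "quo (tri2 T) j i"]
            push_dist_def[of _ _ "quo (tri2 T) j' i"])
    qed (simp add: pull_dist_def push_dist_def)
  qed
  ultimately show ?thesis by simp
qed

lemma AL_tr:
  assumes l: "(j', j) \<in> leq (tri2 T)" "(j, i) \<in> leq (tri2 T)" "(i, i') \<in> leq (tri2 T)"
    and z: "zero_at (tri3 T) (gam T j)" and G: "G \<in> dists (quo (tri1 T) (eps T j) (eps T i))"
  shows "T2.tr i j i' j' (AL j i G) =
    fscale (T3.zu (gam T j') (gam T j)) (AL j' i' (T1.tr (eps T i) (eps T j) (eps T i') (eps T j') G))"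
  unfolding T2.tr_def T1.tr_def AL_PL[OF l(1,2) z G] push_dist_scale AL_PU[OF S2.le_trans[OF l(1,2)] l(3)] ..

text \<open>Lowering \<open>j\<close> multiplies the direct image by a ratio \<open>zu\<close>, and
  the factor \<open>zr d (gam T j)\<close> coming from \<open>vzero\<close> changes by exactly this
  ratio. The class is thus independent of the level and of the representative chosen in
  \<open>image_map\<close>.\<close>

lemma image_map_dc:
  assumes b: "b \<in> idx (tri2 T)" and zero: "\<And>k. k \<in> idx (tri3 T) \<Longrightarrow> fil (tri3 T) k = {0} \<Longrightarrow> zero_at (tri3 T) k"
    and d: "d \<in> idx (tri3 T)" "fil (tri3 T) d = {0}"
    and k: "(j, k) \<in> leq (tri2 T)" "(k, i) \<in> leq (tri2 T)" "fil (tri3 T) (gam T k) = {0}"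
    and G: "G \<in> dists (quo (tri1 T) (eps T j) (eps T i))"
  shows "image_map T b d (T1.dc (eps T b) (eps T i) (eps T j) G z) (T3.V (gam T b) d y) =
    T2.dc b i j (AL j i G) (z * (y * T3.zr d (gam T j)))"
    (is "image_map T b d ?X ?\<nu> = ?Y")
proof -
  note b1 = eps_idx[OF b] and b3 = gam_idx[OF b]
  note zd = zero[OF d]
  have tensor: "vtensor T b j' (T1.V (eps T b) (eps T j') w)
      (vcomp (tri3 T) (gam T b) d (gam T j') ?\<nu> (vzero (tri3 T) d (gam T j'))) =
      T2.V b j' (w * (y * T3.zr d (gam T j')))" and zj: "zero_at (tri3 T) (gam T j')"
    if j': "(j', k') \<in> leq (tri2 T)" "fil (tri3 T) (gam T k') = {0}" for j' k' w
  proof -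
    have idx: "j' \<in> idx (tri2 T)" "k' \<in> idx (tri2 T)" using S2.le_idx[OF j'(1)] by auto
    show z: "zero_at (tri3 T) (gam T j')"
      using T3.zero_at_mono[OF gam_mono[OF j'(1)] zero[OF gam_idx[OF idx(2)] j'(2)]] .
    show "vtensor T b j' (T1.V (eps T b) (eps T j') w)
      (vcomp (tri3 T) (gam T b) d (gam T j') ?\<nu> (vzero (tri3 T) d (gam T j'))) =
      T2.V b j' (w * (y * T3.zr d (gam T j')))"
      unfolding T3.vzero_V[OF d(1) gam_idx[OF idx(1)] zd z] T3.V_comp[OF b3 d(1) gam_idx[OF idx(1)]]
        vtensor_V[OF b idx(1)] ..
  qed
  have ji: "(j, i) \<in> leq (tri2 T)" using S2.le_trans k by blast
  note ji1 = eps_mono[OF ji]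
  have *: "cls (drel (tri2 T) b) (i', j', AL j' i' G', vtensor T b j' \<theta>
      (vcomp (tri3 T) (gam T b) d (gam T j') ?\<nu> (vzero (tri3 T) d (gam T j')))) = ?Y"
    if k': "(j', k') \<in> leq (tri2 T)" "(k', i') \<in> leq (tri2 T)" "fil (tri3 T) (gam T k') = {0}"
      and y: "(eps T i', eps T j', G', \<theta>) \<in> ?X" for i' j' k' G' \<theta>
  proof -
    obtain w p q where w: "\<theta> = T1.V (eps T b) (eps T j') w" and ji1': "(eps T j', eps T i') \<in> leq (tri1 T)"
      and G': "G' \<in> dists (quo (tri1 T) (eps T j') (eps T i'))"
      and p: "(eps T i, p) \<in> leq (tri1 T)" "(eps T i', p) \<in> leq (tri1 T)"
      and q: "(q, eps T j) \<in> leq (tri1 T)" "(q, eps T j') \<in> leq (tri1 T)"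
      and eq: "T1.tr (eps T i) (eps T j) p q (fscale z G) = T1.tr (eps T i') (eps T j') p q (fscale w G')"
      using T1.dc_repE[OF b1 ji1 G y] .
    have ji': "(j', i') \<in> leq (tri2 T)" using S2.le_trans k' by blast
    note x = S2.le_idx[OF ji] and x' = S2.le_idx[OF ji']
    \<comment> \<open>Two representatives agree at a level of I1, while direct images exist only at
      levels of the form \<epsilon>(i). Cofinality moves the comparison there.\<close>
    obtain p2 where p2: "p2 \<in> idx (tri2 T)" "(p, eps T p2) \<in> leq (tri1 T)"
      using eps_cofinal T1.le_idx(2)[OF p(1)] by blast
    obtain q2 where q2: "q2 \<in> idx (tri2 T)" "(eps T q2, q) \<in> leq (tri1 T)"
      using eps_cofinal T1.le_idx(1)[OF q(1)] by blast
    obtain P0 where P0: "(i, P0) \<in> leq (tri2 T)" "(i', P0) \<in> leq (tri2 T)" using S2.above x x' by blast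
    obtain P where P: "(P0, P) \<in> leq (tri2 T)" "(p2, P) \<in> leq (tri2 T)"
      using S2.above[OF S2.le_idx(2)[OF P0(1)] p2(1)] by blast
    obtain Q where Q: "(Q, j) \<in> leq (tri2 T)" "(Q, j') \<in> leq (tri2 T)" "(Q, q2) \<in> leq (tri2 T)"
      using S2.below3 x x' q2 by blast
    have iP: "(i, P) \<in> leq (tri2 T)" "(i', P) \<in> leq (tri2 T)" using S2.le_trans P0 P by blast+
    have pP: "(p, eps T P) \<in> leq (tri1 T)" using T1.le_trans[OF p2(2) eps_mono[OF P(2)]] .
    have Qq: "(eps T Q, q) \<in> leq (tri1 T)" using T1.le_trans[OF eps_mono[OF Q(3)] q2(2)] .
    have eq': "T1.tr (eps T i) (eps T j) (eps T P) (eps T Q) (fscale z G) =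
        T1.tr (eps T i') (eps T j') (eps T P) (eps T Q) (fscale w G')"
      using T1.tr_tr[OF ji1 p(1) q(1) pP Qq] T1.tr_tr[OF ji1' p(2) q(2) pP Qq] eq by metis
    \<comment> \<open>The compensation: the ratio lost by the canonical generator when the level
      drops from \<open>l\<close> to \<open>Q\<close> is gained by the direct image.\<close>
    have zz: "T3.zr d (gam T l) * T3.zu (gam T Q) (gam T l) = T3.zr d (gam T Q)"
      if l: "(Q, l) \<in> leq (tri2 T)" and zl: "zero_at (tri3 T) (gam T l)" for l
    proof -
      obtain m where m: "(m, d) \<in> leq (tri3 T)" "(m, gam T Q) \<in> leq (tri3 T)"
        using T3.below[OF d(1) T3.le_idx(1)[OF gam_mono[OF l]]] by blast
      note ml = T3.le_trans[OF m(2) gam_mono[OF l]]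
      have "T3.zu (gam T Q) (gam T l) \<noteq> 0"
        using T3.e_zero(2)[OF gam_mono[OF l]] zl gam_mono[OF l] by (simp add: zero_at_def)
      then show ?thesis
        unfolding T3.zr_eq[OF m(1) ml zd zl] T3.zr_eq[OF m zd T3.zero_at_mono[OF gam_mono[OF l] zl]]
          T3.zu_mult[OF m(2) gam_mono[OF l] zl] by simp
    qed
    have tr: "T2.tr i l P Q (fscale (v * (y * T3.zr d (gam T l))) (AL l i H)) =
        fscale (y * T3.zr d (gam T Q)) (AL Q P (T1.tr (eps T i) (eps T l) (eps T P) (eps T Q) (fscale v H)))"
      if l: "(l, i) \<in> leq (tri2 T)" "(i, P) \<in> leq (tri2 T)" "(Q, l) \<in> leq (tri2 T)"
        and zl: "zero_at (tri3 T) (gam T l)" and H: "H \<in> dists (quo (tri1 T) (eps T l) (eps T i))" for i l v H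
    proof -
      have "T2.tr i l P Q (fscale (v * (y * T3.zr d (gam T l))) (AL l i H)) =
        fscale (v * (y * (T3.zr d (gam T l) * T3.zu (gam T Q) (gam T l))))
          (AL Q P (T1.tr (eps T i) (eps T l) (eps T P) (eps T Q) H))"
        using T2.tr_scale[OF l AL_dists[OF l(1) H]] AL_tr[OF l(3,1,2) zl H] by (simp add: mult.assoc)
      then show ?thesis
        unfolding zz[OF l(3) zl] T1.tr_scale[OF eps_mono[OF l(1)] eps_mono[OF l(2)] eps_mono[OF l(3)] H]
          push_dist_scale by (simp add: mult.commute mult.left_commute)
    qed
    have "T2.dc b i' j' (AL j' i' G') (w * (y * T3.zr d (gam T j'))) = ?Y"
      using tr[OF ji iP(1) Q(1) zj[OF k(1,3)] G] tr[OF ji' iP(2) Q(2) zj[OF k'(1,3)] G'] eq'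
      by (intro T2.dc_eq[OF b ji' ji AL_dists[OF ji' G'] AL_dists[OF ji G] iP(2,1) Q(2,1)]) simp
    then show ?thesis unfolding w tensor[OF k'(1,3)] .
  qed
  let ?S = "{cls (drel (tri2 T) b)
          (i, j, push_dist (quo (tri1 T) (eps T j) (eps T i)) (tri_aq T j i) (quo (tri2 T) j i) G,
           vtensor T b j \<theta> (vcomp (tri3 T) (gam T b) d (gam T j) ?\<nu> (vzero (tri3 T) d (gam T j))))
        | i j k G \<theta>. (j, k) \<in> leq (tri2 T) \<and> (k, i) \<in> leq (tri2 T) \<and>
            fil (tri3 T) (gam T k) = {0} \<and> (eps T i, eps T j, G, \<theta>) \<in> ?X}"
  have mem: "(eps T i, eps T j, G, T1.V (eps T b) (eps T j) z) \<in> ?X" by (rule cls_self)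
  have "Y = ?Y" if "Y \<in> ?S" for Y
    using that by (elim CollectE exE conjE) (rule trans, assumption, rule *)
  moreover have "?Y \<in> ?S"
    unfolding *[OF k mem, symmetric] using k mem by (intro CollectI exI conjI) (rule refl, assumption+)
  ultimately have "?S = {?Y}" by blast
  then show ?thesis unfolding image_map_def by simp
qed

text \<open>The divisor \<open>T1.zu c (eps T i)\<close> comes from carrying the characteristic
  function from \<open>c\<close> up to \<epsilon>(i). The factor \<open>T3.zu (gam T j) d\<close>
  identifies the two zero subspaces F3(d) and F3(\<gamma> j); it is \<open>zr\<close>, evaluated at
  the lower bound \<gamma>(j), where one of its two ratios is 1.\<close>

lemma delta_dc:
  assumes b: "b \<in> idx (tri2 T)" and zero: "\<And>k. k \<in> idx (tri3 T) \<Longrightarrow> fil (tri3 T) k = {0} \<Longrightarrow> zero_at (tri3 T) k"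
    and c: "(eps T b, c) \<in> leq (tri1 T)" "top_at (tri1 T) c" "(c, eps T i) \<in> leq (tri1 T)"
    and d: "fil (tri3 T) d = {0}" "(gam T j, d) \<in> leq (tri3 T)" "fil (tri3 T) (gam T j) = {0}"
    and ij: "(j, b) \<in> leq (tri2 T)" "(b, i) \<in> leq (tri2 T)"
  shows "delta T b c d (T1.V (eps T b) c x) (T3.V (gam T b) d y) =
    T2.dc b i j (AL j i (e1 (eps T j) (eps T i))) (x / T1.zu c (eps T i) * y * T3.zu (gam T j) d)"
proof -
  note ji = S2.le_trans[OF ij]
  note j = S2.le_idx(1)[OF ji]
  note em = meas_dist[OF T1.e_meas[OF eps_mono[OF ji]]]
  let ?s = "x / T1.zu c (eps T i)"
  have Ge: "fscale ?s (e1 (eps T j) (eps T i)) \<in> dists (quo (tri1 T) (eps T j) (eps T i))"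
    by (rule meas_dist[OF T1.e_scale_meas[OF eps_mono[OF ji]]])
  have dx: "d \<in> idx (tri3 T)" and gx: "gam T j \<in> idx (tri3 T)" using T3.le_idx d(2) by blast+
  have "T3.zu (gam T j) (gam T j) = 1"
    unfolding T3.zu_def T3.e_refl[OF gx]
    by (rule unit_meas_meas(2)[OF T3.quo_fs[OF T3.le_refl[OF gx]] T3.quo_refl[OF gx]])
  then have zr: "T3.zr d (gam T j) = T3.zu (gam T j) d"
    using T3.zr_eq[OF d(2) T3.le_refl[OF gx] zero[OF dx d(1)] zero[OF gx d(3)]] by simp
  have "delta T b c d (T1.V (eps T b) c x) (T3.V (gam T b) d y) =
      T2.dc b i j (AL j i (fscale ?s (e1 (eps T j) (eps T i)))) (1 * (y * T3.zr d (gam T j)))"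
    unfolding delta_def T1.char_dist_level[OF c(1,3) eps_mono[OF ij(1)] c(2)]
    by (rule image_map_dc[OF b zero dx d(1) S2.le_refl1[OF ji] ji d(3) Ge])
  also have "\<dots> = T2.dc b i j (AL j i (e1 (eps T j) (eps T i))) (?s * y * T3.zu (gam T j) d)"
    using AL_dists[OF ji Ge] AL_dists[OF ji em] S2.le_refl1[OF ji] S2.le_refl2[OF ji] ji
    by (intro T2.dc_eq[OF b, where p = i and q = j])
      (simp_all add: push_dist_scale zr ac_simps)
  finally show ?thesis .
qed

end

section \<open>\<open>C\<^sub>2\<close>-spaces\<close>

context
  fixes E :: "('k::{field,finite}, 'i, 'v::ab_group_add, 'x, 'w::ab_group_add) c2"
  assumes c2: "c2_space E"
begin

lemma c2_fs: "filtered_space E"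
  using c2 by (simp add: c2_space_def)

lemma c2_quo:
  assumes "(i, j) \<in> leq E"
  shows "lin_on (scl E) (scl (quo E i j)) (fil E j) (qmap E i j)" "qmap E i j ` fil E j = spc (quo E i j)"
    and "{v \<in> fil E j. qmap E i j v = 0} = fil E i"
  using c2 assms unfolding c2_space_def by blast+

lemma c2_maps:
  assumes "(i, j) \<in> leq E" "(j, k) \<in> leq E"
  shows "v \<in> fil E j \<Longrightarrow> inc E i j k (qmap E i j v) = qmap E i k v"
    and "v \<in> fil E k \<Longrightarrow> prj E i j k (qmap E i k v) = qmap E j k v"
    and "c1_admissible (quo E i j) (inc E i j k) (quo E i k) (prj E i j k) (quo E j k)"
  using c2 assms unfolding c2_space_def by blast+

lemma c2_quoE:
  assumes "(i, j) \<in> leq E" "x \<in> spc (quo E i j)"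
  obtains v where "v \<in> fil E j" "x = qmap E i j v"
  using c2_quo(2)[OF assms(1)] assms(2) by blast

lemma c2_quo_zero:
  assumes ij: "(i, j) \<in> leq E" and eq: "fil E j \<subseteq> fil E i"
  shows "spc (quo E i j) = {0}"
proof -
  have "qmap E i j v = 0" if "v \<in> fil E j" for v using c2_quo(3)[OF ij] eq that by blast
  moreover have "0 \<in> fil E j" using fil_0[OF c2_fs] leq_idx[OF c2_fs ij] by blast
  ultimately show ?thesis unfolding c2_quo(2)[OF ij, symmetric] by (auto intro: rev_image_eqI)
qed

lemma c2_space_c2sys: "c2sys E"
proof
  note fs = c2_fs
  show "partial_order_on (idx E) (leq E)" by (rule leq_order[OF fs])
  show "\<exists>k. (k, i) \<in> leq E \<and> (k, j) \<in> leq E" "\<exists>k. (i, k) \<in> leq E \<and> (j, k) \<in> leq E"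
    if "i \<in> idx E" "j \<in> idx E" for i j
    using fil_below[OF fs that] fil_above[OF fs that] by blast+
  show "c1_admissible (quo E i j) (inc E i j k) (quo E i k) (prj E i j k) (quo E j k)"
    if "(i, j) \<in> leq E" "(j, k) \<in> leq E" for i j k by (rule c2_maps(3)[OF that])
  show "spc (quo E i i) = {0}" if "i \<in> idx E" for i by (rule c2_quo_zero[OF leq_refl[OF fs that] order_refl])
  note tr = leq_trans[OF fs]
  have mono: "v \<in> fil E k" if "(j, k) \<in> leq E" "v \<in> fil E j" for j k v using fil_mono[OF fs] that by blast
  show "inc E i j j x = x" if "(i, j) \<in> leq E" "x \<in> spc (quo E i j)" for i j x
    by (rule c2_quoE[OF that]) (use that leq_idx[OF fs] leq_refl[OF fs] c2_maps(1) in metis)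
  show "prj E i i j x = x" if "(i, j) \<in> leq E" "x \<in> spc (quo E i j)" for i j x
    by (rule c2_quoE[OF that]) (use that leq_idx[OF fs] leq_refl[OF fs] c2_maps(2) in metis)
  fix i j k l x assume l: "(i, j) \<in> leq E" "(j, k) \<in> leq E" "(k, l) \<in> leq E"
  show "inc E i k l (inc E i j k x) = inc E i j l x" if "x \<in> spc (quo E i j)"
    by (rule c2_quoE[OF l(1) that])
      (simp add: c2_maps(1)[OF l(1,2)] c2_maps(1)[OF l(1) tr[OF l(2,3)]] c2_maps(1)[OF tr[OF l(1,2)] l(3)] mono[OF l(2)])
  show "prj E j k l (prj E i j l x) = prj E i k l x" if "x \<in> spc (quo E i l)"
    by (rule c2_quoE[OF tr[OF tr[OF l(1,2)] l(3)] that])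
      (simp add: c2_maps(2)[OF l(1) tr[OF l(2,3)]] c2_maps(2)[OF l(2,3)] c2_maps(2)[OF tr[OF l(1,2)] l(3)])
  show "prj E i j l (inc E i k l x) = inc E j k l (prj E i j k x)" if "x \<in> spc (quo E i k)"
    by (rule c2_quoE[OF tr[OF l(1,2)] that])
      (simp add: c2_maps(1)[OF tr[OF l(1,2)] l(3)] c2_maps(2)[OF l(1) tr[OF l(2,3)]] c2_maps(2)[OF l(1,2)]
        c2_maps(1)[OF l(2,3)] mono[OF l(3)])
qed

lemma c2_zero_at:
  assumes "fil E d = {0}"
  shows "zero_at E d"
  unfolding zero_at_def
proof (intro allI impI)
  fix l assume ld: "(l, d) \<in> leq E"
  have "0 \<in> fil E l" using fil_0[OF c2_fs] leq_idx[OF c2_fs ld] by blast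
  then show "spc (quo E l d) = {0}" using assms by (intro c2_quo_zero[OF ld]) simp
qed

lemma c2_top_at:
  assumes "fil E c = spc E"
  shows "top_at E c"
  unfolding top_at_def
proof (intro allI impI)
  fix l assume cl: "(c, l) \<in> leq E"
  have "fil E l \<subseteq> fil E c" using assms fil_spc[OF c2_fs] leq_idx[OF c2_fs cl] by blast
  then show "spc (quo E c l) = {0}" by (rule c2_quo_zero[OF cl])
qed

text \<open>An element of F0(i) factors through F(i)/F(i) = {0} on F(i) = V.\<close>

lemma fil_dual_top:
  assumes i: "i \<in> idx E" "fil E i = spc E"
  shows "fil_dual E i = {0}"
proof -
  have ii: "(i, i) \<in> leq E" by (rule leq_refl[OF c2_fs i(1)])
  have z: "spc (quo E i i) = {0}" by (rule c2_quo_zero[OF ii order_refl])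
  have fsq: "filtered_space (quo E i i)" using adm_fs(1)[OF c2_maps(3)[OF ii ii]] .
  have "w = 0" if w: "w \<in> fil_dual E i" for w
  proof
    fix v
    obtain u where u: "u \<in> spc (c1_dual (quo E i i))" "\<And>v. v \<in> fil E i \<Longrightarrow> w v = u (qmap E i i v)"
      using w ii unfolding fil_dual_def by blast
    have "u = 0" using u(1) zero_dual[OF fsq z] by blast
    moreover have "w \<in> functionals E" using w by (simp add: fil_dual_def)
    ultimately show "w v = 0 v"
      using u(2)[of v] functional_out[of w E v] i(2) by (cases "v \<in> spc E") auto
  qed
  moreover have "0 \<in> fil_dual E i"
    unfolding fil_dual_def
  proof (intro CollectI conjI allI impI)
    show "0 \<in> functionals E" by (simp add: functionals_def lin_on_def)
    fix j assume ij: "(i, j) \<in> leq E"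
    have "(j, j) \<in> leq E" using leq_refl[OF c2_fs] leq_idx[OF c2_fs ij] by blast
    then have "filtered_space (quo E i j)" using adm_fs(1)[OF c2_maps(3)[OF ij]] by blast
    then have "0 \<in> spc (c1_dual (quo E i j))" using spc_0[OF c1_dual_filtered] by blast
    then show "\<exists>u\<in>spc (c1_dual (quo E i j)). \<forall>v\<in>fil E j. 0 v = u (qmap E i j v)" by (rule bexI[rotated]) simp
  qed
  ultimately show ?thesis by blast
qed

text \<open>If \<open>V\<close> is a member of the filtration, every continuous functional on a quotient \<open>F(l)/F(k)\<close> comes
  from an element of \<open>F\<^sup>0(k)\<close>; in general a functional need not extend along all of \<open>I\<close>.\<close>

lemma fil_dual_zero_at:
  assumes k: "k \<in> idx E" "fil_dual E k = {0}" and c: "c \<in> idx E" "fil E c = spc E"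
  shows "zero_at (c2_dual E) k"
  unfolding zero_at_def
proof (intro allI impI)
  note fs = c2_fs and tr = leq_trans[OF c2_fs]
  fix l assume "(l, k) \<in> leq (c2_dual E)"
  then have kl: "(k, l) \<in> leq E" by simp
  have lx: "l \<in> idx E" using leq_idx[OF fs kl] by blast
  \<comment> \<open>Above \<open>c\<close> the filtration is constantly V, so a functional on
    F(t)/F(k) is a functional on all of V.\<close>
  obtain t where t: "(c, t) \<in> leq E" "(l, t) \<in> leq E" using fil_above[OF fs c(1) lx] by blast
  have tx: "t \<in> idx E" using leq_idx[OF fs t(1)] by blast
  have Ft: "fil E t' = spc E" if "(c, t') \<in> leq E" for t'
    using fil_mono[OF fs that] c(2) fil_spc[OF fs] leq_idx[OF fs that] by blast
  have kt: "(k, t) \<in> leq E" using tr[OF kl t(2)] .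
  have restrict: "\<exists>u'\<in>spc (c1_dual (quo E k j)). u = pull (quo E k i) (inc E k i j) u'"
    if "(k, i) \<in> leq E" "(i, j) \<in> leq E" "u \<in> spc (c1_dual (quo E k i))" for i j u
    using adm_surj[OF dual_admissible[OF c2_maps(3)[OF that(1,2)]] that(3)] by metis
  have "u = 0" if u: "u \<in> spc (c1_dual (quo E k l))" for u
  proof -
    obtain u1 where u1: "u1 \<in> spc (c1_dual (quo E k t))" "u = pull (quo E k l) (inc E k l t) u1"
      using restrict[OF kl t(2) u] by blast
    define w where "w = cut (spc E) (\<lambda>v. u1 (qmap E k t v))"
    note q = c2_quo[OF kt]
    have qs: "qmap E k t v \<in> spc (quo E k t)" if "v \<in> spc E" for v using q(2) that Ft[OF t(1)] by blast
    have wf: "w \<in> functionals E"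
      using q(1) functional_add[OF dual_functional[OF u1(1)] qs qs] functional_scl[OF dual_functional[OF u1(1)] qs]
      by (auto simp: functionals_def w_def lin_on_def Ft[OF t(1)] spc_add[OF fs] spc_scl[OF fs])
    have "w \<in> fil_dual E k"
      unfolding fil_dual_def
    proof (intro CollectI conjI allI impI)
      fix i assume ki: "(k, i) \<in> leq E"
      have ix: "i \<in> idx E" using leq_idx[OF fs ki] by blast
      \<comment> \<open>Membership in F0(k) must be verified on every quotient F(i)/F(k), with
        \<open>i\<close> possibly not comparable to \<open>t\<close>. The functional is extended to
        a common upper bound and restricted back; as F(t') = V as well, the extension still induces
        \<open>w\<close>.\<close>
      obtain t' where t': "(t, t') \<in> leq E" "(i, t') \<in> leq E" using fil_above[OF fs tx ix] by blast
      obtain u2 where u2: "u2 \<in> spc (c1_dual (quo E k t'))" "u1 = pull (quo E k t) (inc E k t t') u2"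
        using restrict[OF kt t'(1) u1(1)] by blast
      let ?u3 = "pull (quo E k i) (inc E k i t') u2"
      have "?u3 \<in> spc (c1_dual (quo E k i))"
        using adm_beta_spc[OF dual_admissible[OF c2_maps(3)[OF ki t'(2)]] u2(1)] .
      moreover have "w v = ?u3 (qmap E k i v)" if v: "v \<in> fil E i" for v
      proof -
        have vs: "v \<in> spc E" using fil_spc[OF fs ix v] .
        have "w v = u2 (qmap E k t' v)"
          using u2(2) vs qs[OF vs] c2_maps(1)[OF kt t'(1)] Ft[OF t(1)] by (simp add: w_def pull_def)
        moreover have "qmap E k i v \<in> spc (quo E k i)" using c2_quo(2)[OF ki] v by blast
        ultimately show ?thesis using c2_maps(1)[OF ki t'(2) v] by (simp add: pull_def)
      qed
      ultimately show "\<exists>u\<in>spc (c1_dual (quo E k i)). \<forall>v\<in>fil E i. w v = u (qmap E k i v)" by blast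
    qed (rule wf)
    then have w0: "w = 0" using k(2) by blast
    have "u1 x = 0" for x
    proof (cases "x \<in> spc (quo E k t)")
      case True
      then obtain v where v: "v \<in> fil E t" "x = qmap E k t v" using c2_quoE[OF kt] by blast
      then show ?thesis using fun_cong[OF w0, of v] Ft[OF t(1)] by (simp add: w_def)
    qed (rule functional_out[OF dual_functional[OF u1(1)]])
    then show ?thesis unfolding u1(2) by (auto simp: pull_def cut_def fun_eq_iff)
  qed
  moreover have "0 \<in> spc (c1_dual (quo E k l))"
    using spc_0[OF adm_fs(3)[OF dual_admissible[OF c2_maps(3)[OF kl t(2)]]]] .
  ultimately show "spc (quo (c2_dual E) l k) = {0}" unfolding c2_dual_simps by blast
qed

end

text \<open>In a \<open>c2_space\<close> every element of a quotient is \<open>qmap\<close> of some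
  vector, and on such elements all maps are induced by the identity, \<alpha> or \<beta>; the
  naturality squares follow.\<close>

lemma c2_admissible_tsys:
  fixes T :: "('k::{field,finite}, 'i1, 'a::ab_group_add, 'x1, 'r::ab_group_add,
    'i2, 'b::ab_group_add, 'x2, 's::ab_group_add, 'i3, 'c::ab_group_add, 'x3, 't::ab_group_add) triple"
  assumes "c2_admissible T"
  shows "tsys T"
proof (rule tsys.intro)
  have c2: "c2_space (tri1 T)" "c2_space (tri2 T)" "c2_space (tri3 T)"
    and ex: "exact_seq (tri1 T) (tri_a T) (tri2 T) (tri_b T) (tri3 T)"
    and d1: "dominates_via (tri1 T) (idx (tri2 T)) (leq (tri2 T)) (fil_sub (tri1 T) (tri_a T) (tri2 T)) (eps T)"
    and d3: "dominates_via (tri3 T) (idx (tri2 T)) (leq (tri2 T)) (\<lambda>i. tri_b T ` fil (tri2 T) i) (gam T)"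
    and q: "\<And>i j. (i, j) \<in> leq (tri2 T) \<Longrightarrow>
        (\<forall>v\<in>fil (tri1 T) (eps T j).
           tri_aq T i j (qmap (tri1 T) (eps T i) (eps T j) v) = qmap (tri2 T) i j (tri_a T v)) \<and>
        (\<forall>v\<in>fil (tri2 T) j.
           tri_bq T i j (qmap (tri2 T) i j v) = qmap (tri3 T) (gam T i) (gam T j) (tri_b T v)) \<and>
        c1_admissible (quo (tri1 T) (eps T i) (eps T j)) (tri_aq T i j) (quo (tri2 T) i j)
          (tri_bq T i j) (quo (tri3 T) (gam T i) (gam T j))"
    using assms unfolding c2_admissible_def by auto
  note aq = q[THEN conjunct1, rule_format] and bq = q[THEN conjunct2, THEN conjunct1, rule_format]
  show "c2sys (tri1 T)" "c2sys (tri2 T)" "c2sys (tri3 T)" using c2_space_c2sys c2 by blast+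
  show eps: "(eps T i, eps T j) \<in> leq (tri1 T)" if "(i, j) \<in> leq (tri2 T)" for i j
    using d1 that by (simp add: dominates_via_def)
  show gam: "(gam T i, gam T j) \<in> leq (tri3 T)" if "(i, j) \<in> leq (tri2 T)" for i j
    using d3 that by (simp add: dominates_via_def)
  show "\<exists>i\<in>idx (tri2 T). \<exists>j\<in>idx (tri2 T). (eps T i, k) \<in> leq (tri1 T) \<and> (k, eps T j) \<in> leq (tri1 T)"
    if "k \<in> idx (tri1 T)" for k using d1 that by (simp add: dominates_via_def)
  show "\<exists>i\<in>idx (tri2 T). \<exists>j\<in>idx (tri2 T). (gam T i, k) \<in> leq (tri3 T) \<and> (k, gam T j) \<in> leq (tri3 T)"
    if "k \<in> idx (tri3 T)" for k using d3 that by (simp add: dominates_via_def)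
  show "c1_admissible (quo (tri1 T) (eps T i) (eps T j)) (tri_aq T i j) (quo (tri2 T) i j)
      (tri_bq T i j) (quo (tri3 T) (gam T i) (gam T j))" if "(i, j) \<in> leq (tri2 T)" for i j
    using q[OF that] by blast
  note fs = c2_fs[OF c2(1)] c2_fs[OF c2(2)] c2_fs[OF c2(3)]
  have a: "tri_a T v \<in> fil (tri2 T) j" if "v \<in> fil (tri1 T) (eps T j)" "j \<in> idx (tri2 T)" for v j
    using d1 that unfolding dominates_via_def fil_sub_def by auto
  have b: "tri_b T v \<in> fil (tri3 T) (gam T j)" if "v \<in> fil (tri2 T) j" "j \<in> idx (tri2 T)" for v j
    using d3 that unfolding dominates_via_def by auto
  fix i j l assume ij: "(i, j) \<in> leq (tri2 T)" and jl: "(j, l) \<in> leq (tri2 T)"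
  note il = leq_trans[OF fs(2) ij jl]
  have idx: "i \<in> idx (tri2 T)" "j \<in> idx (tri2 T)" "l \<in> idx (tri2 T)"
    using leq_idx[OF fs(2) ij] leq_idx[OF fs(2) jl] by auto
  have up1: "v \<in> fil (tri1 T) (eps T l)" if "v \<in> fil (tri1 T) (eps T j)" for v
    using fil_mono[OF fs(1) eps[OF jl]] that by blast
  have up2: "v \<in> fil (tri2 T) l" if "v \<in> fil (tri2 T) j" for v using fil_mono[OF fs(2) jl] that by blast
  show "tri_aq T i l (inc (tri1 T) (eps T i) (eps T j) (eps T l) x) = inc (tri2 T) i j l (tri_aq T i j x)"
    if "x \<in> spc (quo (tri1 T) (eps T i) (eps T j))" for x
    by (rule c2_quoE[OF c2(1) eps[OF ij] that])
      (simp add: c2_maps(1)[OF c2(1) eps[OF ij] eps[OF jl]] aq[OF ij] aq[OF il] up1 c2_maps(1)[OF c2(2) ij jl] a idx)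
  show "tri_aq T j l (prj (tri1 T) (eps T i) (eps T j) (eps T l) x) = prj (tri2 T) i j l (tri_aq T i l x)"
    if "x \<in> spc (quo (tri1 T) (eps T i) (eps T l))" for x
    by (rule c2_quoE[OF c2(1) eps[OF il] that])
      (simp add: c2_maps(2)[OF c2(1) eps[OF ij] eps[OF jl]] aq[OF jl] aq[OF il] c2_maps(2)[OF c2(2) ij jl] a idx)
  show "tri_bq T i l (inc (tri2 T) i j l x) = inc (tri3 T) (gam T i) (gam T j) (gam T l) (tri_bq T i j x)"
    if "x \<in> spc (quo (tri2 T) i j)" for x
    by (rule c2_quoE[OF c2(2) ij that])
      (simp add: c2_maps(1)[OF c2(3) gam[OF ij] gam[OF jl]] bq[OF ij] bq[OF il] up2 c2_maps(1)[OF c2(2) ij jl] b idx)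
  show "tri_bq T j l (prj (tri2 T) i j l x) = prj (tri3 T) (gam T i) (gam T j) (gam T l) (tri_bq T i l x)"
    if "x \<in> spc (quo (tri2 T) i l)" for x
    by (rule c2_quoE[OF c2(2) il that])
      (simp add: c2_maps(2)[OF c2(3) gam[OF ij] gam[OF jl]] bq[OF jl] bq[OF il] c2_maps(2)[OF c2(2) ij jl] b idx)
qed

section \<open>The Fourier transform of a characteristic function\<close>

theorem theorem2:
  fixes \<psi> :: "'k::{field, finite} \<Rightarrow> complex"
    and T :: "('k, 'i1, 'v1::ab_group_add, 'x1, 'w1::ab_group_add,
               'i2, 'v2::ab_group_add, 'x2, 'w2::ab_group_add,
               'i3, 'v3::ab_group_add, 'x3, 'w3::ab_group_add) triple"
    and b :: 'i2 and c :: 'i1 and d :: 'i3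
    and \<mu> :: "('i1, 'w1) vmeas" and \<nu> :: "('i3, 'w3) vmeas"
  assumes "nontrivial_character \<psi>"
    and "c2_admissible T"
    and "c2_complete (tri1 T)" and "c2_complete (tri2 T)" and "c2_complete (tri3 T)"
    and "cC2_space (tri1 T)" and "dC2_space (tri3 T)"
    and "b \<in> idx (tri2 T)"
    and "(eps T b, c) \<in> leq (tri1 T)" and "fil (tri1 T) c = spc (tri1 T)"
    and "(d, gam T b) \<in> leq (tri3 T)" and "fil (tri3 T) d = {0}"
    and "\<mu> \<in> vmeas (tri1 T) (eps T b) c"
    and "\<nu> \<in> vmeas (tri3 T) (gam T b) d"
  shows "fourier \<psi> (tri2 T) b (delta T b c d \<mu> \<nu>) =
           delta (dual_triple T) b d c (vdual (tri3 T) (gam T b) d \<nu>) (vdual (tri1 T) (eps T b) c \<mu>)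
         \<and> delta (dual_triple T) b d c (vdual (tri3 T) (gam T b) d \<nu>) (vdual (tri1 T) (eps T b) c \<mu>)
           \<in> dist_space (c2_dual (tri2 T)) b"
proof -
  note \<psi> = assms(1) and b = assms(8) and bc = assms(9) and Fc = assms(10) and db = assms(11) and Fd = assms(12)
  have c2: "c2_space (tri1 T)" "c2_space (tri2 T)" "c2_space (tri3 T)"
    using assms(2) by (simp_all add: c2_admissible_def)
  interpret tsys T by (rule c2_admissible_tsys[OF assms(2)])
  obtain e1 where "c2triv (tri1 T) e1" using c2sys.triv_exists[OF sys1] by blast
  then interpret T1: c2triv "tri1 T" e1 .
  obtain e3 where "c2triv (tri3 T) e3" using c2sys.triv_exists[OF sys3] by blast
  then interpret T3: c2triv "tri3 T" e3 .
  \<comment> \<open>Bases of the middle space are not chosen freely: taking products makes the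
    coordinates of \<open>vtensor\<close> multiply.\<close>
  define e2 where "e2 i j = pull_dist (quo (tri1 T) (eps T i) (eps T j)) (tri_aq T i j)
      (quo (tri2 T) i j) (tri_bq T i j) (quo (tri3 T) (gam T i) (gam T j))
      (e1 (eps T i) (eps T j)) (e3 (gam T i) (gam T j))" for i j
  interpret X: ttriv T e1 e3 e2
    by (intro ttriv.intro ttriv_axioms.intro tsys_axioms T1.c2triv_axioms T3.c2triv_axioms) (simp add: e2_def)
  note D1 = T1.c2triv_dual[OF \<psi>] and D3 = T3.c2triv_dual[OF \<psi>]
  interpret D1: c2triv "c2_dual (tri1 T)" T1.e_dual by (rule D1)
  interpret D2: c2triv "c2_dual (tri2 T)" X.T2.e_dual by (rule X.T2.c2triv_dual[OF \<psi>])
  interpret D3: c2triv "c2_dual (tri3 T)" T3.e_dual by (rule D3)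
  interpret Y: ttriv "dual_triple T" T3.e_dual T1.e_dual X.T2.e_dual
  proof (intro ttriv.intro ttriv_axioms.intro tsys_dual)
    show "c2triv (tri1 (dual_triple T)) T3.e_dual" "c2triv (tri3 (dual_triple T)) T1.e_dual"
      using D1 D3 by simp_all
    fix i j assume "(i, j) \<in> leq (tri2 (dual_triple T))"
    then have ji: "(j, i) \<in> leq (tri2 T)" by simp
    show "meas_inv (quo (tri2 T) j i) (e2 j i) =
      pull_dist (quo (tri1 (dual_triple T)) (eps (dual_triple T) i) (eps (dual_triple T) j))
        (tri_aq (dual_triple T) i j) (quo (tri2 (dual_triple T)) i j) (tri_bq (dual_triple T) i j)
        (quo (tri3 (dual_triple T)) (gam (dual_triple T) i) (gam (dual_triple T) j))
        (meas_inv (quo (tri3 T) (eps (dual_triple T) j) (eps (dual_triple T) i)) (e3 (eps (dual_triple T) j) (eps (dual_triple T) i)))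
        (meas_inv (quo (tri1 T) (gam (dual_triple T) j) (gam (dual_triple T) i)) (e1 (gam (dual_triple T) j) (gam (dual_triple T) i)))"
      using meas_inv_tensor[OF \<psi> tadm[OF ji] T1.e_meas[OF eps_mono[OF ji]] T1.e_nz[OF eps_mono[OF ji]]
          T3.e_meas[OF gam_mono[OF ji]] T3.e_nz[OF gam_mono[OF ji]]]
      by (simp add: e2_def)
  qed
  have idx: "c \<in> idx (tri1 T)" "d \<in> idx (tri3 T)" "eps T b \<in> idx (tri1 T)" "gam T b \<in> idx (tri3 T)"
    using T1.le_idx[OF bc] T3.le_idx[OF db] by auto
  obtain x where x: "\<mu> = T1.V (eps T b) c x" using T1.vmeasE[OF assms(13)] .
  obtain y where y: "\<nu> = T3.V (gam T b) d y" using T3.vmeasE[OF assms(14)] .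
  \<comment> \<open>The common level has to satisfy c \<le> \<epsilon>(i) and \<gamma>(j) \<le> d,
    with \<open>b\<close> between \<open>j\<close> and \<open>i\<close>.\<close>
  obtain i0 where i0: "i0 \<in> idx (tri2 T)" "(c, eps T i0) \<in> leq (tri1 T)" using eps_cofinal[OF idx(1)] by blast
  obtain j0 where j0: "j0 \<in> idx (tri2 T)" "(gam T j0, d) \<in> leq (tri3 T)" using gam_cofinal[OF idx(2)] by blast
  obtain i where i: "(b, i) \<in> leq (tri2 T)" "(i0, i) \<in> leq (tri2 T)" using X.S2.above[OF b i0(1)] by blast
  obtain j where j: "(j, b) \<in> leq (tri2 T)" "(j, j0) \<in> leq (tri2 T)" using X.S2.below[OF b j0(1)] by blast
  note ji = X.S2.le_trans[OF j(1) i(1)]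
  have ci: "(c, eps T i) \<in> leq (tri1 T)" by (rule T1.le_trans[OF i0(2) eps_mono[OF i(2)]])
  have jd: "(gam T j, d) \<in> leq (tri3 T)" by (rule T3.le_trans[OF gam_mono[OF j(2)] j0(2)])
  have zd: "zero_at (tri3 T) d" by (rule c2_zero_at[OF c2(3) Fd])
  have tc: "top_at (tri1 T) c" by (rule c2_top_at[OF c2(1) Fc])
  have zjd: "spc (quo (tri3 T) (gam T j) d) = {0}" using zd jd by (simp add: zero_at_def)
  have zci: "spc (quo (tri1 T) c (eps T i)) = {0}" using tc ci by (simp add: top_at_def)
  have Fj: "fil (tri3 T) (gam T j) = {0}"
    using fil_mono[OF c2_fs[OF c2(3)] jd] Fd fil_0[OF c2_fs[OF c2(3)] T3.le_idx(1)[OF jd]] by blast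
  have Fi: "fil (tri1 T) (eps T i) = spc (tri1 T)"
    using fil_mono[OF c2_fs[OF c2(1)] ci] Fc fil_spc[OF c2_fs[OF c2(1)] T1.le_idx(2)[OF ci]] by blast
  \<comment> \<open>\<open>x\<close> and \<open>y\<close> are the coordinates of \<mu> and \<nu>;
    the two ratios account for replacing \<open>c\<close> by \<epsilon>(i) and \<open>d\<close> by
    \<gamma>(j).\<close>
  let ?z = "x / T1.zu c (eps T i) * y * T3.zu (gam T j) d"
  have lhs: "delta T b c d \<mu> \<nu> = X.T2.dc b i j (X.AL j i (e1 (eps T j) (eps T i))) ?z"
    unfolding x y by (rule X.delta_dc[OF b c2_zero_at[OF c2(3)] bc tc ci Fd jd Fj j(1) i(1)])
  have F: "X.T2.FT \<psi> j i (X.AL j i (e1 (eps T j) (eps T i))) = Y.AL i j (T3.e_dual (gam T i) (gam T j))"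
    using fourier_push_meas[OF \<psi> tadm[OF ji] T1.e_meas[OF eps_mono[OF ji]] T1.e_nz[OF eps_mono[OF ji]]
        T3.e_meas[OF gam_mono[OF ji]] T3.e_nz[OF gam_mono[OF ji]]] by (simp add: e2_def)
  have td: "top_at (c2_dual (tri3 T)) d"
    unfolding top_at_def using zd zero_dual[OF T3.quo_fs] by (simp add: zero_at_def del: c1_dual_simps(4))
  \<comment> \<open>In the dual triple the third space comes first, so \<open>d\<close> now marks
    the whole space and \<open>c\<close> the zero subspace. As V1 is a member of the filtration,
    \<open>fil_dual_zero_at\<close> supplies the condition on zero members of the dual of
    E1.\<close>
  have "delta (dual_triple T) b d c (Y.T1.V (eps (dual_triple T) b) d y) (Y.T3.V (gam (dual_triple T) b) c x) =
    Y.T2.dc b j i (Y.AL i j (T3.e_dual (eps (dual_triple T) i) (eps (dual_triple T) j)))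
      (y / Y.T1.zu d (eps (dual_triple T) j) * x * Y.T3.zu (gam (dual_triple T) i) c)"
    using b db bc td jd ci j(1) i(1) fil_dual_top[OF c2(1)] idx T1.le_idx(2)[OF ci] Fc Fi
      fil_dual_zero_at[OF c2(1) _ _ idx(1) Fc]
    by (intro Y.delta_dc) simp_all
  \<comment> \<open>By \<open>zu_dual\<close>, division by the dual ratio at \<open>d\<close> is
    multiplication by the original one, and multiplication by the dual ratio at \<open>c\<close> is
    division by the original one.\<close>
  then have rhs: "delta (dual_triple T) b d c (D3.V (gam T b) d y) (D1.V (eps T b) c x) =
      D2.dc b j i (Y.AL i j (T3.e_dual (gam T i) (gam T j))) ?z"
    using T3.zu_dual[OF \<psi> jd zjd] T1.zu_dual[OF \<psi> ci zci] by (simp add: ac_simps)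
  have G: "X.AL j i (e1 (eps T j) (eps T i)) \<in> dists (quo (tri2 T) j i)"
    by (rule X.AL_dists[OF ji meas_dist[OF T1.e_meas[OF eps_mono[OF ji]]]])
  have eq: "fourier \<psi> (tri2 T) b (delta T b c d \<mu> \<nu>) =
      delta (dual_triple T) b d c (vdual (tri3 T) (gam T b) d \<nu>) (vdual (tri1 T) (eps T b) c \<mu>)"
    unfolding lhs X.T2.fourier_dc[OF \<psi> b ji G] F
    unfolding x y T1.vdual_V[OF \<psi> idx(3,1)] T3.vdual_V[OF \<psi> idx(4,2)] rhs ..
  have "D2.dc b j i (X.T2.FT \<psi> j i (X.AL j i (e1 (eps T j) (eps T i)))) ?z \<in> dist_space (c2_dual (tri2 T)) b"
    unfolding dist_space_def
  proof (intro CollectI exI conjI)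
    show "(i, j) \<in> leq (c2_dual (tri2 T))" using ji by simp
    show "X.T2.FT \<psi> j i (X.AL j i (e1 (eps T j) (eps T i))) \<in> dists (quo (c2_dual (tri2 T)) i j)"
      using X.T2.FT_dists[OF \<psi> ji G] by simp
    show "D2.V b i ?z \<in> vmeas (c2_dual (tri2 T)) b i" using D2.V_vmeas b X.S2.le_idx(2)[OF ji] by simp
  qed (rule refl)
  then show ?thesis using eq unfolding eq[symmetric] lhs X.T2.fourier_dc[OF \<psi> b ji G] by blast
qed

end
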